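(* Let $\alpha\in(0,1)$. Assume that $A\in L_\infty(\mathbb{R}_+\times\mathbb{R}^N;\mathbb{R}^{N\times N})$ and that there exists $\nu>0$ such that $$(A(t,x)\xi|\xi)\ge\nu|\xi|^2\quad\text{for a.a. }(t,x)\in\mathbb{R}_+\times\mathbb{R}^N\text{ and all }\xi\in\mathbb{R}^N.$$ Suppose that $u$ is a global bounded weak solution of $$\partial_t^\alpha u-\mathrm{div}\,(A(t,x)Du)=0.$$ Then $u=0$ a.e. on $\mathbb{R}_+\times\mathbb{R}^N$.
   Context: $B(x,r)$ is the open ball in $\mathbb{R}^N$ with center $x$ and radius $r$; $(\cdot|\cdot)$ is the Euclidean inner product; $Du$ is the spatial gradient. For $\beta>0$, $g_\beta(t)=t^{\beta-1}/\Gamma(\beta)$, $t>0$. Convolution is in time on the positive half-line: $(f_1\ast f_2)(t)=\int_0^t f_1(t-\tau)f_2(\tau)\,d\tau$. The Riemann-Liouville fractional derivative is $\partial_t^\alpha v=\partial_t(g_{1-\alpha}\ast v)$. Weak solutions. For $T>0$ and a bounded domain $\Omega\subset\mathbb{R}^N$, let $Z_\alpha$ (for $(0,T)\times\Omega$) be the space of all $v\in L_{\frac{2}{1-\alpha},w}([0,T];L_2(\Omega))\cap L_2([0,T];H^1_2(\Omega))$ such that $g_{1-\alpha}\ast v\in C([0,T];L_2(\Omega))$ and $(g_{1-\alpha}\ast v)|_{t=0}=0$. Here $L_{p,w}$ denotes the weak $L_p$ space and $H^1_2$ the $L_2$-Sobolev space of order one. A function $u$ is a weak solution of $\partial_t^\alpha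 u-\mathrm{div}(A(t,x)Du)=0$ in $(0,T)\times\Omega$ if $u\in Z_\alpha$ and for every nonnegative test function $\zeta\in H^1_2([0,T];L_2(\Omega))\cap L_2([0,T];\mathring H^1_2(\Omega))$ with $\zeta|_{t=T}=0$, where $\mathring H^1_2(\Omega)$ is the closure of $C_0^\infty(\Omega)$ in $H^1_2(\Omega)$, $$\int_0^T\int_\Omega\Big(-\zeta_t\,(g_{1-\alpha}\ast u)+(ADu|D\zeta)\Big)\,dx\,dt=0.$$ A function $u$ on $\mathbb{R}_+\times\mathbb{R}^N$ is a global weak solution of this equation if it is a weak solution in $(0,T)\times B(0,r)$ for all $T>0$ and $r>0$; it is bounded if $u\in L_\infty(\mathbb{R}_+\times\mathbb{R}^N)$. *)

theory Defs
  imports "HOL-Analysis.Analysis"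
begin

text \<open>
  Functions of time and space are written in curried form \<open>v t x\<close>. Elements of Lebesgue and
  Sobolev spaces are represented by Lebesgue measurable functions; the notions of
  solution below do not depend on the choice of representatives. A (strongly measurable) function from \<open>[0,T]\<close> into \<open>L\<^sub>2(\<Omega>)\<close> is
  represented by a jointly measurable function on \<open>(0,T) \<times> \<Omega>\<close>.
\<close>

section \<open>Lebesgue spaces\<close>

definition Linf :: "'a::euclidean_space set \<Rightarrow> ('a \<Rightarrow> 'b::euclidean_space) set" where
  "Linf S = {f \<in> borel_measurable (lebesgue_on S). \<exists>M. AE x in lebesgue_on S. norm (f x) \<le> M}"

definition L2 :: "'a::euclidean_space set \<Rightarrow> ('a \<Rightarrow> 'b::euclidean_space) set" where
  "L2 S = {f \<in> borel_measurable (lebesgue_on S). integrable (lebesgue_on S) (\<lambda>x. (norm (f x))\<^sup>2)}"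

definition L2_norm :: "'a::euclidean_space set \<Rightarrow> ('a \<Rightarrow> 'b::euclidean_space) \<Rightarrow> real" where
  "L2_norm S f = sqrt (LINT x|lebesgue_on S. (norm (f x))\<^sup>2)"

section \<open>Test functions and weak derivatives in space\<close>

fun Ck :: "nat \<Rightarrow> ('a::euclidean_space \<Rightarrow> real) \<Rightarrow> bool" where
  "Ck 0 f \<longleftrightarrow> continuous_on UNIV f"
| "Ck (Suc k) f \<longleftrightarrow>
     (\<forall>x. f differentiable (at x)) \<and> (\<forall>b. Ck k (\<lambda>x. frechet_derivative f (at x) b))"

definition Cinf0 :: "'a::euclidean_space set \<Rightarrow> ('a \<Rightarrow> real) set" where
  "Cinf0 \<Omega> = {\<phi>. (\<forall>k. Ck k \<phi>) \<and> compact (closure {x. \<phi> x \<noteq> 0}) \<and> closure {x. \<phi> x \<noteq> 0} \<subseteq> \<Omega>}"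

definition grad :: "('a::euclidean_space \<Rightarrow> real) \<Rightarrow> 'a \<Rightarrow> 'a" where
  "grad \<phi> x = (\<Sum>b\<in>Basis. frechet_derivative \<phi> (at x) b *\<^sub>R b)"

text \<open>\<open>f\<close> belongs to \<open>H\<^sup>1\<^sub>2(\<Omega>)\<close> and has the weak gradient \<open>G\<close>.\<close>

definition H1_grad :: "'a::euclidean_space set \<Rightarrow> ('a \<Rightarrow> real) \<Rightarrow> ('a \<Rightarrow> 'a) \<Rightarrow> bool" where
  "H1_grad \<Omega> f G \<longleftrightarrow> f \<in> L2 \<Omega> \<and> G \<in> L2 \<Omega> \<and>
     (\<forall>\<phi>\<in>Cinf0 \<Omega>. (LINT x|lebesgue_on \<Omega>. f x *\<^sub>R grad \<phi> x) = - (LINT x|lebesgue_on \<Omega>. \<phi> x *\<^sub>R G x))"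

text \<open>\<open>f\<close> lies moreover in the closure of \<open>Cinf0 \<Omega>\<close> with respect to the norm of \<open>H\<^sup>1\<^sub>2(\<Omega>)\<close>.\<close>

definition H10_grad :: "'a::euclidean_space set \<Rightarrow> ('a \<Rightarrow> real) \<Rightarrow> ('a \<Rightarrow> 'a) \<Rightarrow> bool" where
  "H10_grad \<Omega> f G \<longleftrightarrow> H1_grad \<Omega> f G \<and>
     (\<forall>\<epsilon>>0. \<exists>\<phi>\<in>Cinf0 \<Omega>.
        sqrt ((L2_norm \<Omega> (\<lambda>x. f x - \<phi> x))\<^sup>2 + (L2_norm \<Omega> (\<lambda>x. G x - grad \<phi> x))\<^sup>2) < \<epsilon>)"

section \<open>Spaces of functions of time with values in a function space\<close>

text \<open>The space \<open>L\<^sub>2([0,T];L\<^sub>2(\<Omega>))\<close> is identified with \<open>L\<^sub>2((0,T) \<times> \<Omega>)\<close>.\<close>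

definition L2_L2 ::
  "real \<Rightarrow> 'a::euclidean_space set \<Rightarrow> (real \<Rightarrow> 'a \<Rightarrow> 'b::euclidean_space) \<Rightarrow> bool" where
  "L2_L2 T \<Omega> v \<longleftrightarrow> (\<lambda>(t, x). v t x) \<in> L2 ({0<..<T} \<times> \<Omega>)"

text \<open>\<open>v\<close> belongs to \<open>L\<^sub>2([0,T];H\<^sup>1\<^sub>2(\<Omega>))\<close> and has the spatial gradient \<open>G\<close>.\<close>

definition L2_H1 ::
  "real \<Rightarrow> 'a::euclidean_space set \<Rightarrow> (real \<Rightarrow> 'a \<Rightarrow> real) \<Rightarrow> (real \<Rightarrow> 'a \<Rightarrow> 'a) \<Rightarrow> bool" where
  "L2_H1 T \<Omega> v G \<longleftrightarrow> L2_L2 T \<Omega> v \<and> L2_L2 T \<Omega> G \<and>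
     (AE t in lebesgue_on {0<..<T}. H1_grad \<Omega> (v t) (G t))"

definition L2_H10 ::
  "real \<Rightarrow> 'a::euclidean_space set \<Rightarrow> (real \<Rightarrow> 'a \<Rightarrow> real) \<Rightarrow> (real \<Rightarrow> 'a \<Rightarrow> 'a) \<Rightarrow> bool" where
  "L2_H10 T \<Omega> v G \<longleftrightarrow> L2_L2 T \<Omega> v \<and> L2_L2 T \<Omega> G \<and>
     (AE t in lebesgue_on {0<..<T}. H10_grad \<Omega> (v t) (G t))"

text \<open>
  \<open>v\<close> belongs to \<open>H\<^sup>1\<^sub>2([0,T];L\<^sub>2(\<Omega>))\<close> and has the weak time derivative \<open>v'\<close>. The integrals over
  time are integrals with values in \<open>L\<^sub>2(\<Omega>)\<close>, hence the equality for almost all \<open>x\<close>.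
\<close>

definition H1_L2 ::
  "real \<Rightarrow> 'a::euclidean_space set \<Rightarrow> (real \<Rightarrow> 'a \<Rightarrow> real) \<Rightarrow> (real \<Rightarrow> 'a \<Rightarrow> real) \<Rightarrow> bool" where
  "H1_L2 T \<Omega> v v' \<longleftrightarrow> L2_L2 T \<Omega> v \<and> L2_L2 T \<Omega> v' \<and>
     (\<forall>\<phi>\<in>Cinf0 {0<..<T}. AE x in lebesgue_on \<Omega>.
        (LINT t|lebesgue_on {0<..<T}. deriv \<phi> t * v t x) =
        - (LINT t|lebesgue_on {0<..<T}. \<phi> t * v' t x))"

definition C_L2 :: "real \<Rightarrow> 'a::euclidean_space set \<Rightarrow> (real \<Rightarrow> 'a \<Rightarrow> real) \<Rightarrow> bool" where
  "C_L2 T \<Omega> w \<longleftrightarrow> (\<forall>t\<in>{0..T}. w t \<in> L2 \<Omega> \<and>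
     ((\<lambda>s. L2_norm \<Omega> (\<lambda>x. w s x - w t x)) \<longlongrightarrow> 0) (at t within {0..T}))"

text \<open>
  \<open>v\<close> belongs to \<open>C([0,T];L\<^sub>2(\<Omega>))\<close> (after modification on a null set of times), and its value at
  time \<open>t\<^sub>0\<close> is zero. The value has to be taken from the continuous representative \<open>w\<close>, since
  \<open>v t\<^sub>0\<close> itself is not determined by the equivalence class of \<open>v\<close>.
\<close>

definition C_L2_vanishing ::
  "real \<Rightarrow> 'a::euclidean_space set \<Rightarrow> real \<Rightarrow> (real \<Rightarrow> 'a \<Rightarrow> real) \<Rightarrow> bool" where
  "C_L2_vanishing T \<Omega> t\<^sub>0 v \<longleftrightarrow> (\<exists>w. C_L2 T \<Omega> w \<and>
     (AE t in lebesgue_on {0<..<T}. AE x in lebesgue_on \<Omega>. w t x = v t x) \<and>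
     (AE x in lebesgue_on \<Omega>. w t\<^sub>0 x = 0))"

text \<open>The space \<open>L\<^bsub>p,w\<^esub>([0,T];L\<^sub>2(\<Omega>))\<close>.\<close>

definition weak_Lp_L2 ::
  "real \<Rightarrow> real \<Rightarrow> 'a::euclidean_space set \<Rightarrow> (real \<Rightarrow> 'a \<Rightarrow> real) \<Rightarrow> bool" where
  "weak_Lp_L2 p T \<Omega> v \<longleftrightarrow>
     (\<lambda>(t, x). v t x) \<in> borel_measurable (lebesgue_on ({0<..<T} \<times> \<Omega>)) \<and>
     (AE t in lebesgue_on {0<..<T}. v t \<in> L2 \<Omega>) \<and>
     (\<exists>C. \<forall>s>0. s powr p * measure lebesgue {t \<in> {0<..<T}. L2_norm \<Omega> (v t) > s} \<le> C)"

section \<open>Weak solutions of the time-fractional diffusion equation\<close>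

definition gker :: "real \<Rightarrow> real \<Rightarrow> real" where
  "gker \<beta> t = t powr (\<beta> - 1) / Gamma \<beta>"

text \<open>Convolution in time; for \<open>f \<in> L\<^sub>1(0,T)\<close> and \<open>v \<in> L\<^sub>2((0,T) \<times> \<Omega>)\<close> the integral converges for almost all \<open>(t,x)\<close>.\<close>

definition tconv :: "(real \<Rightarrow> real) \<Rightarrow> (real \<Rightarrow> 'a \<Rightarrow> real) \<Rightarrow> real \<Rightarrow> 'a \<Rightarrow> real" where
  "tconv f v t x = (LINT \<tau>|lebesgue_on {0<..<t}. f (t - \<tau>) * v \<tau> x)"

definition Z_space :: "real \<Rightarrow> real \<Rightarrow> 'a::euclidean_space set \<Rightarrow> (real \<Rightarrow> 'a \<Rightarrow> real) set" where
  "Z_space \<alpha> T \<Omega> = {v. weak_Lp_L2 (2 / (1 - \<alpha>)) T \<Omega> v \<and> (\<exists>G. L2_H1 T \<Omega> v G) \<and>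
     C_L2_vanishing T \<Omega> 0 (tconv (gker (1 - \<alpha>)) v)}"

text \<open>
  The weak derivatives \<open>Du\<close>, \<open>\<zeta>'\<close> and \<open>D\<zeta>\<close> are unique up to null sets, so the way they are
  quantified is immaterial.
\<close>

definition weak_solution ::
  "real \<Rightarrow> (real \<Rightarrow> real^'n \<Rightarrow> real^'n^'n) \<Rightarrow> real \<Rightarrow> (real^'n) set \<Rightarrow> (real \<Rightarrow> real^'n \<Rightarrow> real) \<Rightarrow> bool"
where
  "weak_solution \<alpha> A T \<Omega> u \<longleftrightarrow> u \<in> Z_space \<alpha> T \<Omega> \<and>
     (\<exists>Du. L2_H1 T \<Omega> u Du \<and>
       (\<forall>\<zeta> \<zeta>' D\<zeta>.
          H1_L2 T \<Omega> \<zeta> \<zeta>' \<and> L2_H10 T \<Omega> \<zeta> D\<zeta> \<and> C_L2_vanishing T \<Omega> T \<zeta> \<and>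
          (AE (t, x) in lebesgue_on ({0<..<T} \<times> \<Omega>). \<zeta> t x \<ge> 0) \<longrightarrow>
          (LINT t|lebesgue_on {0<..<T}. LINT x|lebesgue_on \<Omega>.
             - \<zeta>' t x * tconv (gker (1 - \<alpha>)) u t x + (A t x *v Du t x) \<bullet> D\<zeta> t x) = 0))"

definition global_weak_solution ::
  "real \<Rightarrow> (real \<Rightarrow> real^'n \<Rightarrow> real^'n^'n) \<Rightarrow> (real \<Rightarrow> real^'n \<Rightarrow> real) \<Rightarrow> bool" where
  "global_weak_solution \<alpha> A u \<longleftrightarrow> (\<forall>T>0. \<forall>r>0. weak_solution \<alpha> A T (ball 0 r) u)"

end

theory Submission
  imports Defs
begin

text \<open>
  Energy estimate. Let \<open>\<phi>\<close> be a cutoff function of the ball of radius \<open>R\<close> and let \<open>S\<^sub>h = E\<^sub>h\<^sup>* E\<^sub>h\<close>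
  with the exponential average \<open>E\<^sub>h f(t) = \<integral>\<^sub>0\<^sup>t e\<^bsup>-(t-\<tau>)/h\<^esup> f(\<tau>) d\<tau> / h\<close>, so that \<open>S\<^sub>h f\<close> is Lipschitz in time
  and vanishes at \<open>T\<close>. Since test functions have to be nonnegative, the equation is tested with
  \<open>\<phi>\<^sup>2 S\<^sub>h(u + M)\<close> and with \<open>\<phi>\<^sup>2 S\<^sub>h M\<close>, where \<open>\<bar>u\<bar> \<le> M\<close>, and the results are subtracted.
  The kernel \<open>g\<^bsub>1-\<alpha>\<^esub>\<close> is a superposition of the exponentials \<open>e\<^bsup>-st\<^esup>\<close> with positive weights; treating each
  of them separately shows that the memory term is at least \<open>C \<integral>\<integral> \<phi>\<^sup>2 (E\<^sub>h u)\<^sup>2\<close> with \<open>C > 0\<close>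
  independent of \<open>h\<close> and \<open>R\<close>. As \<open>h\<close> tends to \<open>0\<close>, ellipticity and Young's inequality
  give \<open>E(R/2) \<le> c R\<^bsup>-2\<^esup> E(R)\<close> for \<open>E(R) = \<integral>\<^sub>0\<^sup>T \<integral>\<^bsub>B(0,R)\<^esub> u\<^sup>2\<close>. Since \<open>E(R)\<close> grows at most like \<open>R\<^sup>N\<close>,
  iteration yields \<open>E = 0\<close>.
\<close>

section \<open>Smooth functions\<close>

text \<open>The memory term controls \<open>u^2\<close> itself and not only a gradient, so a
  Caccioppoli estimate with the factor \<open>R^-2\<close> can be iterated directly, without Sobolev
  embedding or regularity theory. This control rests on continuing \<open>u\<close> by zero to
  negative times: functions starting from zero obey a Poincare inequality on \<open>(0,T)\<close>.
  Its constant depends on \<open>T\<close>, which stays fixed while the radius grows. The obstacle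
  is time regularity: \<open>u\<close> has no time derivative in \<open>L_2\<close> and cannot enter
  a test function directly. Composing an average with its adjoint yields a time derivative, the zero
  terminal value, and the exact identity \<open>\<integral> u S_h u = \<integral> (E_h u)^2\<close>.
  Exponential averages are chosen because they commute with convolution by the exponentials that
  make up the kernel, which reduces coercivity to scalar linear differential equations. Since
  \<open>A\<close> depends on time and need not be symmetric, \<open>S_h\<close> cannot be moved
  across the diffusion term; its sign appears only in the limit, through convergence of the pairings
  \<open>\<integral> f S_h g\<close>.\<close>

lemma CkI:
  assumes "\<And>x. (f has_derivative f' x) (at x)" "\<And>b. Ck k (\<lambda>x. f' x b)"
  shows "Ck (Suc k) f"
proof -
  have "frechet_derivative f (at x) = f' x" for x
    using assms(1) frechet_derivative_at by metis
  then show ?thesis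
    using assms by (auto intro: differentiableI)
qed

lemma Ck_Suc_has_derivative:
  assumes "Ck (Suc k) f"
  shows "(f has_derivative frechet_derivative f (at x)) (at x)"
  using assms by (simp flip: frechet_derivative_works)

lemma Ck_frechet_derivative: "Ck (Suc k) f \<Longrightarrow> Ck k (\<lambda>x. frechet_derivative f (at x) b)"
  by simp

lemma not_in_closure_support: "x \<notin> closure {x. f x \<noteq> 0} \<Longrightarrow> f x = 0"
  using closure_subset[of "{x. f x \<noteq> 0}"] by auto

lemma Ck_Suc_D: "Ck (Suc k) f \<Longrightarrow> Ck k f"
proof (induction k arbitrary: f)
  case 0
  then have "continuous (at x) f" for x
    using Ck_Suc_has_derivative has_derivative_continuous by blast
  then show ?case
    by (simp add: continuous_on_eq_continuous_at)
next
  case (Suc k)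
  then have "Ck k (\<lambda>x. frechet_derivative f (at x) b)" for b
    by (metis Ck.simps(2))
  then show ?case
    using Suc.prems by simp
qed

declare Ck.simps(2) [simp del]

lemma Ck_imp_continuous_on: "Ck k f \<Longrightarrow> continuous_on UNIV f"
  by (induction k) (auto dest: Ck_Suc_D)

lemma Ck_const: "Ck k (\<lambda>x. c)"
proof (induction k arbitrary: c)
  case (Suc k)
  show ?case
    by (rule CkI[where f' = "\<lambda>x b. 0"]) (use Suc in auto)
qed simp

lemma Ck_linear: "bounded_linear f \<Longrightarrow> Ck k f"
proof (cases k)
  case 0
  assume "bounded_linear f"
  then show ?thesis using 0 linear_continuous_on by auto
next
  case (Suc j)
  assume "bounded_linear f"
  then show ?thesis unfolding Suc
    by (intro CkI[where f' = "\<lambda>x. f"] bounded_linear_imp_has_derivative Ck_const)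
qed

lemma Ck_add: "Ck k f \<Longrightarrow> Ck k g \<Longrightarrow> Ck k (\<lambda>x. f x + g x)"
proof (induction k arbitrary: f g)
  case 0
  then show ?case by (auto intro: continuous_intros)
next
  case (Suc k)
  show ?case
    by (rule CkI[OF has_derivative_add[OF Suc.prems[THEN Ck_Suc_has_derivative]]])
       (auto intro!: Suc.IH Ck_frechet_derivative Suc.prems)
qed

lemma Ck_mult: "Ck k f \<Longrightarrow> Ck k g \<Longrightarrow> Ck k (\<lambda>x. f x * g x)"
proof (induction k arbitrary: f g)
  case 0
  then show ?case by (auto intro: continuous_intros)
next
  case (Suc k)
  show ?case
    by (rule CkI[OF has_derivative_mult[OF Suc.prems[THEN Ck_Suc_has_derivative]]])
       (auto intro!: Ck_add Suc.IH Ck_frechet_derivative Suc.prems[THEN Ck_Suc_D] Suc.prems)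
qed

lemma Ck_sum: "(\<And>i. i \<in> I \<Longrightarrow> Ck k (f i)) \<Longrightarrow> Ck k (\<lambda>x. \<Sum>i\<in>I. f i x)"
  by (induction I rule: infinite_finite_induct) (auto intro: Ck_add Ck_const)

text \<open>The chain rule produces a derivative in the direction \<open>c\<close> times
  \<open>b\<close>. By linearity the scalar leaves the derivative, so the induction hypothesis
  applies with the direction \<open>b\<close> unchanged. The case \<open>c = -1\<close> reflects a
  mollifier.\<close>

lemma Ck_affine: "Ck k f \<Longrightarrow> Ck k (\<lambda>x. f (a + c *\<^sub>R x))"
proof (induction k arbitrary: f)
  case 0
  then show ?case
    by (auto intro!: continuous_on_compose2[of UNIV f] continuous_intros)
next
  case (Suc k)
  have D: "((\<lambda>x. f (a + c *\<^sub>R x)) has_derivative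
      (\<lambda>b. frechet_derivative f (at (a + c *\<^sub>R x)) (c *\<^sub>R b))) (at x)" for x
    by (rule has_derivative_compose[OF _ Ck_Suc_has_derivative[OF Suc.prems]])
       (auto intro!: derivative_eq_intros)
  have "frechet_derivative f (at y) (c *\<^sub>R b) = c * frechet_derivative f (at y) b" for y b
    using linear_cmul[OF has_derivative_linear[OF Ck_Suc_has_derivative[OF Suc.prems]]] by auto
  then show ?case
    by (intro CkI[OF D]) (auto intro!: Ck_mult Ck_const Suc.IH Ck_frechet_derivative Suc.prems)
qed

lemma Cinf0_D:
  assumes "\<phi> \<in> Cinf0 \<Omega>"
  shows "Ck k \<phi>" "compact (closure {x. \<phi> x \<noteq> 0})" "closure {x. \<phi> x \<noteq> 0} \<subseteq> \<Omega>"
    "x \<notin> \<Omega> \<Longrightarrow> \<phi> x = 0" "continuous_on S \<phi>" "(\<phi> has_derivative frechet_derivative \<phi> (at x)) (at x)"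
    "Ck k (\<lambda>x. frechet_derivative \<phi> (at x) b)"
proof -
  show *: "Ck k \<phi>" for k
    using assms by (simp add: Cinf0_def)
  show "closure {x. \<phi> x \<noteq> 0} \<subseteq> \<Omega>" "compact (closure {x. \<phi> x \<noteq> 0})"
    using assms by (simp_all add: Cinf0_def)
  then show "\<phi> x = 0" if "x \<notin> \<Omega>" using that by (intro not_in_closure_support) auto
  show "continuous_on S \<phi>"
    by (rule continuous_on_subset[OF Ck_imp_continuous_on[OF *[of 0]]]) simp
  show "(\<phi> has_derivative frechet_derivative \<phi> (at x)) (at x)"
    by (rule Ck_Suc_has_derivative[OF *[of "Suc 0"]])
  show "Ck k (\<lambda>x. frechet_derivative \<phi> (at x) b)"
    using Ck_frechet_derivative[OF *[of "Suc k"]] .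
qed

lemma frechet_derivative_eq_0_outside:
  assumes "x \<notin> closure {x. \<phi> x \<noteq> 0}"
  shows "frechet_derivative \<phi> (at x) = (\<lambda>b. 0)"
proof -
  have "((\<lambda>x. 0) has_derivative (\<lambda>b. 0)) (at x)" by simp
  then have "(\<phi> has_derivative (\<lambda>b. 0)) (at x)"
  proof (rule has_derivative_transform_within_open[of _ _ _ _ "- closure {x. \<phi> x \<noteq> 0}"])
    fix y assume "y \<in> - closure {x. \<phi> x \<noteq> 0}"
    then show "0 = \<phi> y" using not_in_closure_support[of y \<phi>] by (metis ComplD)
  qed (use assms in \<open>auto simp: open_Compl\<close>)
  then show ?thesis using frechet_derivative_at by metis
qed

text \<open>Exhibiting any enclosing compact set suffices, so the exact support of a derivative,
  product or mollification is never computed.\<close>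

lemma Cinf0_subsetI:
  assumes "\<And>k. Ck k \<phi>" "compact K" "K \<subseteq> \<Omega>" "\<And>x. x \<notin> K \<Longrightarrow> \<phi> x = 0"
  shows "\<phi> \<in> Cinf0 \<Omega>"
proof -
  have *: "closure {x. \<phi> x \<noteq> 0} \<subseteq> K"
    using assms by (intro closure_minimal compact_imp_closed) auto
  then have "compact (closure {x. \<phi> x \<noteq> 0})"
    by (metis assms(2) bounded_subset closed_closure compact_eq_bounded_closed)
  then show ?thesis unfolding Cinf0_def using * assms by auto
qed

lemma Cinf0_derivative:
  assumes "\<phi> \<in> Cinf0 \<Omega>"
  shows "(\<lambda>x. frechet_derivative \<phi> (at x) b) \<in> Cinf0 \<Omega>"
  by (rule Cinf0_subsetI[OF Cinf0_D(7)[OF assms] Cinf0_D(2)[OF assms] Cinf0_D(3)[OF assms]])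
     (simp add: frechet_derivative_eq_0_outside[of _ \<phi>])

lemma Cinf0_mult:
  assumes "\<phi> \<in> Cinf0 \<Omega>" "\<And>k. Ck k \<theta>"
  shows "(\<lambda>x. \<phi> x * \<theta> x) \<in> Cinf0 \<Omega>"
proof (rule Cinf0_subsetI[OF _ Cinf0_D(2)[OF assms(1)] Cinf0_D(3)[OF assms(1)]])
  show "\<phi> x * \<theta> x = 0" if "x \<notin> closure {x. \<phi> x \<noteq> 0}" for x
    using not_in_closure_support[OF that] by (rule arg_cong[where f = "\<lambda>y. y * \<theta> x", THEN trans]) simp
qed (rule Ck_mult[OF Cinf0_D(1)[OF assms(1)] assms(2)])

lemma Cinf0_bounded:
  assumes "\<phi> \<in> Cinf0 \<Omega>"
  obtains B where "B > 0" "\<And>x. \<bar>\<phi> x\<bar> \<le> B"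
proof -
  let ?K = "closure {x. \<phi> x \<noteq> 0}"
  have "bounded (\<phi> ` ?K)"
    by (intro compact_imp_bounded compact_continuous_image Cinf0_D[OF assms])
  then obtain B where B: "\<forall>x\<in>?K. \<bar>\<phi> x\<bar> \<le> B" "B > 0"
    unfolding bounded_pos by auto
  have "\<bar>\<phi> x\<bar> \<le> B" for x
  proof (cases "x \<in> ?K")
    case False
    from not_in_closure_support[OF this] show ?thesis using B(2) by simp
  qed (use B in blast)
  then show ?thesis by (rule that[OF B(2)])
qed

section \<open>Gradients of scalar functions\<close>

lemma inner_grad:
  assumes "(\<phi> has_derivative D) (at x)"
  shows "grad \<phi> x \<bullet> v = D v"
proof -
  have D: "frechet_derivative \<phi> (at x) = D" using assms frechet_derivative_at by metis
  interpret bounded_linear D using assms has_derivative_bounded_linear by blast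
  have "D v = D (\<Sum>b\<in>Basis. (v \<bullet> b) *\<^sub>R b)" by (simp add: euclidean_representation)
  also have "\<dots> = (\<Sum>b\<in>Basis. (v \<bullet> b) * D b)" by (simp add: sum scaleR)
  finally show ?thesis by (simp add: grad_def inner_sum_left D inner_commute[of v] mult.commute)
qed

lemma grad_eqI:
  assumes "(\<phi> has_derivative (\<lambda>v. w \<bullet> v)) (at x)"
  shows "grad \<phi> x = w"
  using inner_grad[OF assms] vector_eq_rdot by blast

lemma grad_has_derivative:
  assumes "\<phi> differentiable (at x)"
  shows "(\<phi> has_derivative (\<lambda>v. grad \<phi> x \<bullet> v)) (at x)"
  using assms inner_grad[of \<phi> _ x] by (simp add: frechet_derivative_works)

lemma grad_mult:
  assumes "f differentiable (at x)" "g differentiable (at x)"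
  shows "grad (\<lambda>x. f x * g x) x = f x *\<^sub>R grad g x + g x *\<^sub>R grad f x"
  by (rule grad_eqI)
     (rule has_derivative_eq_rhs[OF has_derivative_mult[OF grad_has_derivative grad_has_derivative]],
       use assms in \<open>auto simp: inner_add_left algebra_simps\<close>)

lemma grad_eq_0_outside: "x \<notin> closure {x. \<phi> x \<noteq> 0} \<Longrightarrow> grad \<phi> x = 0"
  unfolding grad_def using frechet_derivative_eq_0_outside[of x \<phi>] by auto

lemma Cinf0_differentiable: "\<phi> \<in> Cinf0 \<Omega> \<Longrightarrow> \<phi> differentiable (at x)"
  by (rule differentiableI[OF Cinf0_D(6)])

lemma Cinf0_continuous_on_grad: "\<phi> \<in> Cinf0 \<Omega> \<Longrightarrow> continuous_on S (grad \<phi>)"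
  unfolding grad_def[abs_def]
  by (intro continuous_intros Cinf0_D(5)[OF Cinf0_derivative])

lemma Cinf0_grad_bounded:
  assumes "\<phi> \<in> Cinf0 \<Omega>"
  obtains B where "B > 0" "\<And>x. norm (grad \<phi> x) \<le> B"
proof -
  let ?K = "closure {x. \<phi> x \<noteq> 0}"
  have "bounded (grad \<phi> ` ?K)"
    by (intro compact_imp_bounded compact_continuous_image Cinf0_D[OF assms] Cinf0_continuous_on_grad[OF assms])
  then obtain B where B: "\<forall>x\<in>?K. norm (grad \<phi> x) \<le> B" "B > 0"
    unfolding bounded_pos by auto
  have "norm (grad \<phi> x) \<le> B" for x
  proof (cases "x \<in> ?K")
    case False
    from grad_eq_0_outside[OF this] show ?thesis using B(2) by simp
  qed (use B in blast)
  then show ?thesis by (rule that[OF B(2)])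
qed

subsection \<open>A smooth bump function\<close>

text \<open>The polynomial makes the family closed under differentiation: with
  \<open>y = 1 / t\<close>, the derivative of \<open>p(y) exp(-y)\<close> is
  \<open>y^2 (p - p')(y) exp(-y)\<close>. Smoothness of all members then follows by one induction
  that generalises over \<open>p\<close>.\<close>

definition flat_exp :: "real poly \<Rightarrow> real \<Rightarrow> real" where
  "flat_exp p t = (if t > 0 then poly p (1 / t) * exp (- 1 / t) else 0)"

lemma tendsto_flat_exp_0: "((\<lambda>t. poly p (1 / t) * exp (- 1 / t)) \<longlongrightarrow> 0) (at_right (0::real))"
proof -
  have "((\<lambda>x::real. \<Sum>i\<le>degree p. coeff p i * (x ^ i / exp x)) \<longlongrightarrow> (\<Sum>i\<le>degree p. coeff p i * 0)) at_top"
    by (intro tendsto_intros tendsto_power_div_exp_0)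
  then have "((\<lambda>x. poly p x * exp (- x)) \<longlongrightarrow> 0) at_top"
    by (simp add: exp_minus field_simps poly_altdef sum_distrib_left sum_distrib_right)
  from filterlim_compose[OF this filterlim_inverse_at_top_right] show ?thesis
    by (simp add: inverse_eq_divide)
qed

lemma flat_exp_has_derivative:
  "(flat_exp p has_real_derivative flat_exp ([:0, 0, 1:] * (p - pderiv p)) t) (at t)"
proof -
  consider "t < 0" | "t = 0" | "t > 0" by linarith
  then show ?thesis
  proof cases
    case 1
    have "((\<lambda>t. 0) has_real_derivative 0) (at t)" by simp
    then have "(flat_exp p has_real_derivative 0) (at t)"
      by (rule has_field_derivative_transform_within[of _ _ _ _ "-t"]) (use 1 in \<open>auto simp: flat_exp_def dist_real_def\<close>)
    then show ?thesis using 1 by (simp add: flat_exp_def)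
  next
    case 3
    have "((\<lambda>t. poly p (1 / t) * exp (- 1 / t)) has_real_derivative
        poly ([:0, 0, 1:] * (p - pderiv p)) (1 / t) * exp (- 1 / t)) (at t)"
      using 3 by (auto intro!: derivative_eq_intros poly_DERIV[THEN DERIV_chain2]
          simp: field_simps power2_eq_square)
    then have "(flat_exp p has_real_derivative
        poly ([:0, 0, 1:] * (p - pderiv p)) (1 / t) * exp (- 1 / t)) (at t)"
      by (rule has_field_derivative_transform_within[of _ _ _ _ t]) (use 3 in \<open>auto simp: flat_exp_def dist_real_def\<close>)
    then show ?thesis using 3 by (simp add: flat_exp_def)
  next
    case 2
    \<comment> \<open>For positive \<open>h\<close>, division by \<open>h\<close> multiplies the
      polynomial by its variable, so the difference quotient at 0 falls under the limit already
      computed.\<close>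
    have "((\<lambda>h. flat_exp p h / h) \<longlongrightarrow> 0) (at_right 0)"
    proof (rule Lim_transform_eventually[OF tendsto_flat_exp_0[of "[:0, 1:] * p"]])
      show "\<forall>\<^sub>F h in at_right 0. poly ([:0, 1:] * p) (1 / h) * exp (- 1 / h) = flat_exp p h / h"
        by (auto simp: eventually_at_right_field flat_exp_def intro!: exI[of _ 1])
    qed
    moreover have "((\<lambda>h. flat_exp p h / h) \<longlongrightarrow> 0) (at_left 0)"
      by (rule tendsto_eventually)
         (auto simp: eventually_at_left_field flat_exp_def intro!: exI[of _ "-1"])
    ultimately have "((\<lambda>h. flat_exp p h / h) \<longlongrightarrow> 0) (at 0)"
      using filterlim_split_at_real by blast
    then show ?thesis using 2 by (simp add: DERIV_def flat_exp_def)
  qed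
qed

lemma continuous_on_flat_exp: "continuous_on S (flat_exp p)"
  by (meson DERIV_isCont continuous_at_imp_continuous_on flat_exp_has_derivative)

lemma Ck_flat_exp_compose:
  assumes "\<And>k. Ck k g"
  shows "Ck k (\<lambda>x. flat_exp p (g x))"
proof (induction k arbitrary: p)
  case 0
  show ?case
    using assms[of 0] continuous_on_flat_exp[of UNIV p] by (auto intro: continuous_on_compose2)
next
  case (Suc k)
  have "((\<lambda>x. flat_exp p (g x)) has_derivative
      (\<lambda>b. flat_exp ([:0, 0, 1:] * (p - pderiv p)) (g x) * frechet_derivative g (at x) b)) (at x)" for x
    using has_derivative_compose[OF Ck_Suc_has_derivative[OF assms]
        flat_exp_has_derivative[unfolded has_field_derivative_def]] .
  then show ?case
    by (intro CkI) (auto intro!: Ck_mult Suc.IH Ck_frechet_derivative assms simp del: mult_pCons_left)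
qed

text \<open>The argument uses the squared norm, which is smooth at the origin. The function is not 1
  on a smaller ball; a lower bound on the half ball and a gradient bound that scales like
  \<open>1 / R\<close> are all that the iteration over radii requires.\<close>

definition bump :: "real \<Rightarrow> 'a::euclidean_space \<Rightarrow> real" where
  "bump R x = flat_exp 1 (1 - x \<bullet> x / R\<^sup>2)"

lemma bump_nonneg: "bump R x \<ge> 0"
  by (simp add: bump_def flat_exp_def)

lemma bump_le_1: "bump R x \<le> 1"
  by (simp add: bump_def flat_exp_def)

lemma bump_eq_0: "R > 0 \<Longrightarrow> norm x \<ge> R \<Longrightarrow> bump R x = 0"
proof -
  assume "R > 0" "norm x \<ge> R"
  then have "x \<bullet> x \<ge> R\<^sup>2" by (simp add: dot_square_norm)
  then show ?thesis using \<open>R > 0\<close> by (simp add: bump_def flat_exp_def field_simps)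
qed

text \<open>On the half ball the argument of the flat exponential is at least 3/4, whence the
  constant \<open>exp (-4/3)\<close>, independent of \<open>R\<close>.\<close>

lemma bump_ge: "R > 0 \<Longrightarrow> norm x \<le> R / 2 \<Longrightarrow> bump R x \<ge> exp (-4/3)"
proof -
  assume R: "R > 0" "norm x \<le> R / 2"
  then have "(norm x)\<^sup>2 \<le> (R/2)\<^sup>2" by (intro power_mono) auto
  define y where "y = 1 - x \<bullet> x / R\<^sup>2"
  have *: "y \<ge> 3/4"
    using R \<open>(norm x)\<^sup>2 \<le> (R/2)\<^sup>2\<close> by (simp add: y_def dot_square_norm field_simps)
  then have "1 / y \<le> 1 / (3/4)" by (intro divide_left_mono) auto
  then show ?thesis using * by (simp add: bump_def flat_exp_def flip: y_def)
qed

lemma bump_in_Cinf0: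
  assumes "R > 0" "cball 0 R \<subseteq> \<Omega>"
  shows "bump R \<in> Cinf0 \<Omega>"
proof (rule Cinf0_subsetI[of _ "cball 0 R"])
  have "Ck k (\<lambda>x. 1 + (-1/R\<^sup>2) * (\<Sum>b\<in>Basis. (x \<bullet> b) * (x \<bullet> b)))" for k
    by (intro Ck_add Ck_mult Ck_const Ck_sum Ck_linear bounded_linear_inner_left)
  then have "Ck k (\<lambda>x. 1 - x \<bullet> x / R\<^sup>2)" for k
    by (simp flip: euclidean_inner)
  then show "Ck k (bump R)" for k
    unfolding bump_def[abs_def] by (rule Ck_flat_exp_compose)
qed (use assms in \<open>auto intro: bump_eq_0\<close>)

text \<open>The chain rule leaves \<open>x / R^2\<close> times a fixed continuous profile evaluated
  in \<open>{0..1}\<close>. The profile is bounded there and \<open>norm x \<le> R\<close>, so a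
  single constant serves all radii.\<close>

lemma bump_grad_bound:
  obtains C where "C > 0" "\<And>R x. R > 0 \<Longrightarrow> norm (grad (bump R) (x::'a::euclidean_space)) \<le> C / R"
proof -
  obtain q where q: "\<And>t. (flat_exp 1 has_real_derivative flat_exp q t) (at t)"
    using flat_exp_has_derivative[of 1] by blast
  have "bounded (flat_exp q ` {0..1})"
    by (intro compact_imp_bounded compact_continuous_image continuous_on_flat_exp compact_Icc)
  then obtain C where C: "C > 0" "\<And>t. t \<in> {0..1} \<Longrightarrow> \<bar>flat_exp q t\<bar> \<le> C"
    unfolding bounded_pos by auto
  have "norm (grad (bump R) x) \<le> 2 * C / R" if "R > 0" for R and x :: 'a
  proof -
    have "((\<lambda>x::'a. 1 - x \<bullet> x / R\<^sup>2) has_derivative (\<lambda>b. - (2 * (x \<bullet> b)) / R\<^sup>2)) (at x)"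
      using that by (auto intro!: derivative_eq_intros simp: inner_commute power2_eq_square)
    from has_derivative_compose[OF this q[unfolded has_field_derivative_def]]
    have "(bump R has_derivative (\<lambda>b. flat_exp q (1 - x \<bullet> x / R\<^sup>2) * (- (2 * (x \<bullet> b)) / R\<^sup>2))) (at x)"
      unfolding bump_def[abs_def] .
    moreover have "(\<lambda>b. flat_exp q (1 - x \<bullet> x / R\<^sup>2) * (- (2 * (x \<bullet> b)) / R\<^sup>2)) =
        (\<lambda>b. ((-2 * flat_exp q (1 - x \<bullet> x / R\<^sup>2) / R\<^sup>2) *\<^sub>R x) \<bullet> b)"
      by (auto simp: field_simps)
    ultimately have grad: "grad (bump R) x = (-2 * flat_exp q (1 - x \<bullet> x / R\<^sup>2) / R\<^sup>2) *\<^sub>R x"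
      by (intro grad_eqI) (simp only:)
    show ?thesis
    proof (cases "norm x \<le> R")
      case True
      then have "(norm x)\<^sup>2 \<le> R\<^sup>2" by (intro power_mono) auto
      then have "1 - x \<bullet> x / R\<^sup>2 \<in> {0..1}" using that by (simp add: dot_square_norm)
      from C(2)[OF this] True that
      have "2 * \<bar>flat_exp q (1 - x \<bullet> x / R\<^sup>2)\<bar> / R\<^sup>2 * norm x \<le> 2 * C / R\<^sup>2 * R"
        by (intro mult_mono divide_right_mono) auto
      then show ?thesis using that unfolding grad norm_scaleR
        by (simp add: power2_eq_square)
    next
      case False
      then have "x \<notin> closure {x. bump R x \<noteq> 0}"
        using Cinf0_D(3)[OF bump_in_Cinf0[OF that order_refl]] by auto
      then have "grad (bump R) x = 0" by (rule grad_eq_0_outside)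
      then show ?thesis using C(1) that by simp
    qed
  qed
  then show ?thesis using that[of "2 * C"] C(1) by simp
qed

section \<open>Mollification\<close>

lemma integrable_continuous_bounded_support:
  fixes g :: "'a::euclidean_space \<Rightarrow> 'b::euclidean_space"
  assumes "continuous_on UNIV g" "\<And>x. norm x > R \<Longrightarrow> g x = 0"
  shows "integrable lborel g"
proof -
  have "integrable lborel (\<lambda>x. indicator (cball 0 R) x *\<^sub>R g x)"
    using borel_integrable_compact[of "cball 0 R" g] continuous_on_subset[OF assms(1)]
    by (auto simp: set_integrable_def)
  moreover have "(\<lambda>x. indicator (cball 0 R) x *\<^sub>R g x) = g"
    using assms(2) by (auto simp: indicator_def fun_eq_iff)
  ultimately show ?thesis by simp
qed

lemma integrable_square_continuous_bounded_support:
  fixes g :: "'a::euclidean_space \<Rightarrow> real"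
  assumes "continuous_on UNIV g" "\<And>x. norm x > R \<Longrightarrow> g x = 0"
  shows "integrable lborel (\<lambda>x. (g x)\<^sup>2)"
  by (rule integrable_continuous_bounded_support[of _ R])
     (use assms in \<open>auto intro: continuous_intros\<close>)

lemma integrable_square_integrable_product:
  fixes f g :: "'a \<Rightarrow> real"
  assumes [measurable]: "f \<in> borel_measurable M" "g \<in> borel_measurable M"
    and int: "integrable M (\<lambda>x. (f x)\<^sup>2)" "integrable M (\<lambda>x. (g x)\<^sup>2)"
  shows "integrable M (\<lambda>x. f x * g x)"
proof (rule Bochner_Integration.integrable_bound)
  show "integrable M (\<lambda>x. (f x)\<^sup>2 + (g x)\<^sup>2)" using int by simp
  have "\<bar>a * b\<bar> \<le> a\<^sup>2 + b\<^sup>2" for a b :: real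
    by (rule abs_leI) (use sum_squares_bound[of a b] sum_squares_bound[of a "-b"] in auto)
  then show "AE x in M. norm (f x * g x) \<le> norm ((f x)\<^sup>2 + (g x)\<^sup>2)" by simp
qed simp

lemma integrable_square_add:
  fixes f g :: "'a \<Rightarrow> real"
  assumes [measurable]: "f \<in> borel_measurable M" "g \<in> borel_measurable M"
    and int: "integrable M (\<lambda>x. (f x)\<^sup>2)" "integrable M (\<lambda>x. (g x)\<^sup>2)"
  shows "integrable M (\<lambda>x. (f x + g x)\<^sup>2)" "integrable M (\<lambda>x. (f x - g x)\<^sup>2)"
  using int integrable_square_integrable_product[OF assms]
  by (auto simp: power2_sum power2_diff mult.assoc)

lemma integrable_of_square_integrable:
  fixes f :: "'a::euclidean_space \<Rightarrow> real"
  assumes [measurable]: "f \<in> borel_measurable borel"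
    and "integrable lborel (\<lambda>x. (f x)\<^sup>2)" "\<And>x. norm x > R \<Longrightarrow> f x = 0"
  shows "integrable lborel f"
proof (rule Bochner_Integration.integrable_bound)
  have "integrable lborel (indicat_real (cball (0::'a) R))"
    by (intro integrable_real_indicator) (auto simp: emeasure_bounded_finite[OF bounded_cball, simplified])
  with assms(2) show "integrable lborel (\<lambda>x. (f x)\<^sup>2 + indicat_real (cball 0 R) x)" by simp
  have "\<bar>a\<bar> \<le> a\<^sup>2 + 1" for a :: real
    using sum_squares_bound[of a 1] sum_squares_bound[of "-a" 1] by (auto simp: abs_if)
  then show "AE x in lborel. norm (f x) \<le> norm ((f x)\<^sup>2 + indicat_real (cball 0 R) x)"
    using assms(3) by (auto simp: indicator_def)
qed simp

text \<open>Almost everywhere approximation by continuous functions is the definition of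
  \<open>measurable_on\<close>, which agrees with Borel measurability for the Lebesgue
  measure.\<close>

lemma borel_AE_limit_of_continuous:
  fixes f :: "'a::euclidean_space \<Rightarrow> real"
  assumes "f \<in> borel_measurable borel"
  obtains g where "\<And>j. continuous_on UNIV (g j :: 'a \<Rightarrow> real)" "AE x in lborel. (\<lambda>j. g j x) \<longlonglongrightarrow> f x"
proof -
  have "f \<in> borel_measurable (lebesgue_on UNIV)"
    using assms by (simp add: lebesgue_on_UNIV_eq measurable_completion)
  then have "f measurable_on UNIV"
    by (simp add: measurable_on_iff_borel_measurable)
  then obtain N g where g: "negligible N" "\<forall>n. continuous_on UNIV (g n)"
      "\<forall>x. x \<notin> N \<longrightarrow> (\<lambda>n. g n x) \<longlonglongrightarrow> f x"
    unfolding measurable_on_def by auto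
  have "AE x in lebesgue. x \<notin> N" using g(1) by (simp add: negligible_iff_null_sets AE_not_in)
  then have "AE x in lborel. (\<lambda>j. g j x) \<longlonglongrightarrow> f x"
    unfolding AE_completion_iff by eventually_elim (use g in auto)
  then show ?thesis using that g by blast
qed

text \<open>Truncate in height, then approximate the bounded function pointwise by continuous ones.
  Dominated convergence carries each of the two approximations over to the square integral.\<close>

lemma square_integrable_approx_continuous:
  fixes f :: "'a::euclidean_space \<Rightarrow> real"
  assumes f[measurable]: "f \<in> borel_measurable borel" and int: "integrable lborel (\<lambda>x. (f x)\<^sup>2)"
    and supp: "\<And>x. norm x > R \<Longrightarrow> f x = 0" and "\<epsilon> > 0"
  obtains g where "continuous_on UNIV g" "\<And>x. norm x > R + 1 \<Longrightarrow> g x = 0"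
    "(\<integral>x. (f x - g x)\<^sup>2 \<partial>lborel) < \<epsilon>"
proof -
  define clip where "clip n y = max (- real n) (min (real n) y)" for n and y :: real
  have clip_cont: "continuous_on UNIV (clip n)" for n
    unfolding clip_def by (intro continuous_intros)
  have clip_abs: "\<bar>clip n y\<bar> \<le> real n" for n y by (auto simp: clip_def)
  have [measurable]: "clip n \<in> borel_measurable borel" for n
    using clip_cont by (rule borel_measurable_continuous_onI)
  have "(\<lambda>n. \<integral>x. (f x - clip n (f x))\<^sup>2 \<partial>lborel) \<longlonglongrightarrow> (\<integral>x. 0 \<partial>(lborel :: 'a measure))"
  proof (rule integral_dominated_convergence[OF _ _ int])
    show "AE x in lborel. (\<lambda>n. (f x - clip n (f x))\<^sup>2) \<longlonglongrightarrow> 0"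
    proof (rule AE_I2, rule tendsto_eventually)
      fix x
      show "\<forall>\<^sub>F n in sequentially. (f x - clip n (f x))\<^sup>2 = 0"
        using eventually_ge_at_top[of "nat \<lceil>\<bar>f x\<bar>\<rceil>"]
        by eventually_elim (auto simp: clip_def max_def min_def; linarith)
    qed
    show "AE x in lborel. norm ((f x - clip n (f x))\<^sup>2) \<le> (f x)\<^sup>2" for n
    proof (rule AE_I2)
      fix x
      have "\<bar>f x - clip n (f x)\<bar> \<le> \<bar>f x\<bar>" by (auto simp: clip_def)
      then show "norm ((f x - clip n (f x))\<^sup>2) \<le> (f x)\<^sup>2" by (simp add: abs_le_square_iff)
    qed
  qed auto
  \<comment> \<open>The two errors will be joined by \<open>(a + b)^2 \<le> 2 a^2 + 2 b^2\<close>,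
    so each may cost a quarter of \<open>\<epsilon>\<close>.\<close>
  then have "\<forall>\<^sub>F n in sequentially. (\<integral>x. (f x - clip n (f x))\<^sup>2 \<partial>lborel) < \<epsilon> / 4"
    using \<open>\<epsilon> > 0\<close> by (intro order_tendstoD) auto
  then obtain n where n: "(\<integral>x. (f x - clip n (f x))\<^sup>2 \<partial>lborel) < \<epsilon> / 4"
    by (auto simp: eventually_sequentially)
  obtain g where g: "\<And>j. continuous_on UNIV (g j :: 'a \<Rightarrow> real)" "AE x in lborel. (\<lambda>j. g j x) \<longlonglongrightarrow> f x"
    using borel_AE_limit_of_continuous[OF f] by blast
  define cut where "cut x = max 0 (min 1 (R + 1 - norm x))" for x :: 'a
  have cut_cont: "continuous_on UNIV cut" unfolding cut_def by (intro continuous_intros)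
  have cut: "cut x \<ge> 0" "cut x \<le> 1" "norm x > R + 1 \<Longrightarrow> cut x = 0" "norm x \<le> R \<Longrightarrow> cut x = 1" for x
    by (auto simp: cut_def)
  \<comment> \<open>The continuous approximants \<open>g j\<close> may be unbounded and spread over
    the whole space. Clipping them once more and cutting them off supplies the dominating function;
    the limit is unaffected, since \<open>cut\<close> equals 1 wherever \<open>f\<close> can be
    nonzero.\<close>
  define h where "h j x = cut x * clip n (g j x)" for j x
  have h_cont: "continuous_on UNIV (h j)" for j
    unfolding h_def by (intro continuous_intros cut_cont continuous_on_compose2[OF clip_cont g(1)]) auto
  then have [measurable]: "h j \<in> borel_measurable borel" for j
    by (rule borel_measurable_continuous_onI)
  have h_supp: "norm x > R + 1 \<Longrightarrow> h j x = 0" for j x by (simp add: h_def cut)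
  have f_cut: "clip n (f x) = cut x * clip n (f x)" for x
    using cut(4)[of x] supp[of x] by (cases "norm x \<le> R") (auto simp: clip_def)
  have "(\<lambda>j. \<integral>x. (clip n (f x) - h j x)\<^sup>2 \<partial>lborel) \<longlonglongrightarrow> (\<integral>x. 0 \<partial>(lborel :: 'a measure))"
  proof (rule integral_dominated_convergence)
    show "integrable lborel (\<lambda>x::'a. (2 * real n)\<^sup>2 * indicat_real (cball 0 (R + 1)) x)"
      by (intro integrable_mult_right integrable_real_indicator) (auto simp: emeasure_bounded_finite[OF bounded_cball, simplified])
    show "AE x in lborel. (\<lambda>j. (clip n (f x) - h j x)\<^sup>2) \<longlonglongrightarrow> 0"
      using g(2)
    proof eventually_elim
      case (elim x)
      have "isCont (clip n) (f x)" using clip_cont by (simp add: continuous_on_eq_continuous_at)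
      then have "(\<lambda>j. h j x) \<longlonglongrightarrow> cut x * clip n (f x)"
        unfolding h_def using isCont_tendsto_compose[OF _ elim] by (intro tendsto_mult tendsto_const) auto
      then have "(\<lambda>j. (clip n (f x) - h j x)\<^sup>2) \<longlonglongrightarrow> (clip n (f x) - cut x * clip n (f x))\<^sup>2"
        by (intro tendsto_intros)
      then show ?case using f_cut[of x] by simp
    qed
    show "AE x in lborel. norm ((clip n (f x) - h j x)\<^sup>2) \<le> (2 * real n)\<^sup>2 * indicat_real (cball 0 (R + 1)) x" for j
    proof (rule AE_I2)
      fix x
      show "norm ((clip n (f x) - h j x)\<^sup>2) \<le> (2 * real n)\<^sup>2 * indicat_real (cball 0 (R + 1)) x"
      proof (cases "norm x \<le> R + 1")
        case True
        have "\<bar>h j x\<bar> \<le> 1 * real n"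
          unfolding h_def abs_mult using cut[of x] clip_abs by (intro mult_mono) auto
        then have "\<bar>clip n (f x) - h j x\<bar> \<le> \<bar>2 * real n\<bar>" using clip_abs[of n "f x"] by linarith
        then have "(clip n (f x) - h j x)\<^sup>2 \<le> (2 * real n)\<^sup>2" by (simp only: abs_le_square_iff)
        then show ?thesis using True by simp
      next
        case False
        then show ?thesis using supp[of x] h_supp[of x j] by (simp add: clip_def)
      qed
    qed
  qed auto
  then have "\<forall>\<^sub>F j in sequentially. (\<integral>x. (clip n (f x) - h j x)\<^sup>2 \<partial>lborel) < \<epsilon> / 4"
    using \<open>\<epsilon> > 0\<close> by (intro order_tendstoD) auto
  then obtain j where j: "(\<integral>x. (clip n (f x) - h j x)\<^sup>2 \<partial>lborel) < \<epsilon> / 4"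
    by (auto simp: eventually_sequentially)
  have int_clip: "integrable lborel (\<lambda>x. (clip n (f x))\<^sup>2)"
    by (rule Bochner_Integration.integrable_bound[OF int]) (auto simp: clip_def abs_le_square_iff[symmetric])
  have int_h: "integrable lborel (\<lambda>x. (h j x)\<^sup>2)"
    by (rule integrable_square_continuous_bounded_support[OF h_cont h_supp])
  have int1: "integrable lborel (\<lambda>x. (f x - clip n (f x))\<^sup>2)"
    and int2: "integrable lborel (\<lambda>x. (clip n (f x) - h j x)\<^sup>2)"
    and int3: "integrable lborel (\<lambda>x. (f x - h j x)\<^sup>2)"
    by (rule integrable_square_add(2); use int int_clip int_h in simp)+
  have "(\<integral>x. (f x - h j x)\<^sup>2 \<partial>lborel)
      \<le> (\<integral>x. 2 * (f x - clip n (f x))\<^sup>2 + 2 * (clip n (f x) - h j x)\<^sup>2 \<partial>lborel)"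
  proof (rule integral_mono)
    show "(f x - h j x)\<^sup>2 \<le> 2 * (f x - clip n (f x))\<^sup>2 + 2 * (clip n (f x) - h j x)\<^sup>2" for x
      using sum_squares_bound[of "f x - clip n (f x)" "clip n (f x) - h j x"]
      by (simp add: power2_eq_square algebra_simps)
  qed (use int1 int2 int3 in auto)
  also have "\<dots> = 2 * (\<integral>x. (f x - clip n (f x))\<^sup>2 \<partial>lborel) + 2 * (\<integral>x. (clip n (f x) - h j x)\<^sup>2 \<partial>lborel)"
    using int1 int2 by (subst Bochner_Integration.integral_add) auto
  also have "\<dots> < \<epsilon>" using n j by linarith
  finally show ?thesis using that[of "h j"] h_cont h_supp by blast
qed

section \<open>Convolution with a smooth kernel\<close>

lemma lborel_distr_minus: "distr lborel borel (\<lambda>y. x - y) = (lborel :: 'a::euclidean_space measure)"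
  using lborel_affine[of "-1" x] by (simp add: density_1)

lemma integral_shift_minus:
  fixes f :: "'a::euclidean_space \<Rightarrow> 'b::{banach, second_countable_topology}"
  assumes [measurable]: "f \<in> borel_measurable borel"
  shows "(\<integral>y. f (x - y) \<partial>lborel) = (\<integral>y. f y \<partial>lborel)"
proof -
  have "(\<integral>y. f y \<partial>(distr lborel borel (\<lambda>y. x - y))) = (\<integral>y. f (x - y) \<partial>lborel)"
    by (rule integral_distr) auto
  then show ?thesis by (simp add: lborel_distr_minus)
qed

lemma integrable_shift_minus:
  fixes f :: "'a::euclidean_space \<Rightarrow> 'b::{banach, second_countable_topology}"
  assumes [measurable]: "f \<in> borel_measurable borel"
  shows "integrable lborel (\<lambda>y. f (x - y)) \<longleftrightarrow> integrable lborel f"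
proof -
  have "integrable (distr lborel borel (\<lambda>y. x - y)) f \<longleftrightarrow> integrable lborel (\<lambda>y. f (x - y))"
    by (rule integrable_distr_eq) auto
  then show ?thesis by (simp add: lborel_distr_minus)
qed

definition mollify :: "('a::euclidean_space \<Rightarrow> real) \<Rightarrow> ('a \<Rightarrow> real) \<Rightarrow> 'a \<Rightarrow> real" where
  "mollify \<rho> f x = (\<integral>y. \<rho> (x - y) * f y \<partial>lborel)"

lemma Cinf0_borel_measurable [measurable_dest]: "\<phi> \<in> Cinf0 \<Omega> \<Longrightarrow> \<phi> \<in> borel_measurable borel"
  by (intro borel_measurable_continuous_onI Cinf0_D(5))

lemma Cinf0_grad_borel_measurable: "\<phi> \<in> Cinf0 \<Omega> \<Longrightarrow> grad \<phi> \<in> borel_measurable borel"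
  by (intro borel_measurable_continuous_onI Cinf0_continuous_on_grad)

lemma integrable_mollify:
  fixes f :: "'a::euclidean_space \<Rightarrow> real"
  assumes "\<rho> \<in> Cinf0 UNIV" "integrable lborel f"
  shows "integrable lborel (\<lambda>y. \<rho> (x - y) * f y)"
proof -
  note [measurable] = Cinf0_borel_measurable[OF assms(1)] borel_measurable_integrable[OF assms(2)]
  obtain B where B: "B > 0" "\<And>x. \<bar>\<rho> x\<bar> \<le> B" using Cinf0_bounded[OF assms(1)] by blast
  then show ?thesis using B(1)
    by (intro Bochner_Integration.integrable_bound[OF integrable_mult_right[OF integrable_abs[OF assms(2)], of B]] AE_I2)
       (auto simp: abs_mult intro: mult_right_mono)
qed

lemma integrable_mollify_grad:
  fixes f :: "'a::euclidean_space \<Rightarrow> real"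
  assumes "\<rho> \<in> Cinf0 UNIV" "integrable lborel f"
  shows "integrable lborel (\<lambda>y. f y *\<^sub>R grad \<rho> (x - y))"
proof -
  note [measurable] = Cinf0_grad_borel_measurable[OF assms(1)] borel_measurable_integrable[OF assms(2)]
  obtain B where B: "B > 0" "\<And>x. norm (grad \<rho> x) \<le> B" using Cinf0_grad_bounded[OF assms(1)] by blast
  then show ?thesis using B(1)
    by (intro Bochner_Integration.integrable_bound[OF integrable_mult_right[OF integrable_abs[OF assms(2)], of B]] AE_I2)
       (auto simp: abs_mult mult.commute[of _ "\<bar>f _\<bar>"] intro: mult_left_mono)
qed

text \<open>Differentiation under the integral sign. The remainder quotient \<open>q h y\<close>
  tends to 0 for each \<open>y\<close> and is bounded by \<open>2 * B\<close>, because
  \<open>\<rho>\<close> is Lipschitz with constant \<open>B\<close>. Dominated convergence is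
  applied along an arbitrary null sequence.\<close>

lemma mollify_has_derivative:
  fixes f :: "'a::euclidean_space \<Rightarrow> real"
  assumes \<rho>: "\<rho> \<in> Cinf0 UNIV" and f: "integrable lborel f"
  shows "(mollify \<rho> f has_derivative (\<lambda>b. (\<integral>y. f y *\<^sub>R grad \<rho> (x - y) \<partial>lborel) \<bullet> b)) (at x)"
proof -
  note [measurable] = Cinf0_grad_borel_measurable[OF \<rho>] Cinf0_borel_measurable[OF \<rho>] borel_measurable_integrable[OF f]
  let ?w = "\<integral>y. f y *\<^sub>R grad \<rho> (x - y) \<partial>lborel"
  obtain B where B: "B > 0" "\<And>x. norm (grad \<rho> x) \<le> B" using Cinf0_grad_bounded[OF \<rho>] by blast
  have D: "(\<rho> has_derivative (\<lambda>v. grad \<rho> z \<bullet> v)) (at z)" for z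
    by (intro grad_has_derivative Cinf0_differentiable[OF \<rho>])
  have lip: "\<bar>\<rho> a - \<rho> b\<bar> \<le> B * norm (a - b)" for a b
  proof -
    have "norm (\<rho> a - \<rho> b) \<le> B * norm (a - b)"
    proof (rule differentiable_bound[of UNIV \<rho> "\<lambda>z v. grad \<rho> z \<bullet> v"])
      fix z
      show "onorm (\<lambda>v. grad \<rho> z \<bullet> v) \<le> B"
        by (rule onorm_le) (use B(2)[of z] in \<open>auto intro!: order_trans[OF Cauchy_Schwarz_ineq2] mult_right_mono\<close>)
    qed (use D in auto)
    then show ?thesis by simp
  qed
  define q where "q h y = (\<rho> (x + h - y) - \<rho> (x - y) - grad \<rho> (x - y) \<bullet> h) / norm h" for h y
  have eq: "(mollify \<rho> f (x + h) - mollify \<rho> f x - ?w \<bullet> h) / norm h = (\<integral>y. q h y * f y \<partial>lborel)" for h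
  proof -
    have "?w \<bullet> h = (\<integral>y. (f y *\<^sub>R grad \<rho> (x - y)) \<bullet> h \<partial>lborel)"
      by (rule integral_inner_left[symmetric]) (rule integrable_mollify_grad[OF \<rho> f])
    then have "mollify \<rho> f (x + h) - mollify \<rho> f x - ?w \<bullet> h =
       (\<integral>y. \<rho> (x + h - y) * f y - \<rho> (x - y) * f y - (f y *\<^sub>R grad \<rho> (x - y)) \<bullet> h \<partial>lborel)"
      unfolding mollify_def using integrable_mollify[OF \<rho> f] integrable_mollify_grad[OF \<rho> f, of x]
      by (simp add: Bochner_Integration.integral_diff del: inner_scaleR_left)
    then have "(mollify \<rho> f (x + h) - mollify \<rho> f x - ?w \<bullet> h) / norm h =
       (\<integral>y. (\<rho> (x + h - y) * f y - \<rho> (x - y) * f y - (f y *\<^sub>R grad \<rho> (x - y)) \<bullet> h) / norm h \<partial>lborel)"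
      by simp
    also have "\<dots> = (\<integral>y. q h y * f y \<partial>lborel)"
      by (rule Bochner_Integration.integral_cong) (auto simp: q_def algebra_simps diff_divide_distrib)
    finally show ?thesis .
  qed
  have "(\<lambda>h. norm (mollify \<rho> f (x + h) - mollify \<rho> f x - ?w \<bullet> h) / norm h) \<midarrow>0\<rightarrow> 0"
    unfolding tendsto_at_iff_sequentially
  proof (intro allI impI)
    fix X :: "nat \<Rightarrow> 'a" assume X: "\<forall>i. X i \<in> UNIV - {0}" "X \<longlonglongrightarrow> 0"
    have "(\<lambda>i. \<integral>y. q (X i) y * f y \<partial>lborel) \<longlonglongrightarrow> (\<integral>y. 0 \<partial>(lborel :: 'a measure))"
    proof (rule integral_dominated_convergence)
      show "integrable lborel (\<lambda>y. 2 * B * \<bar>f y\<bar>)" using f by auto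
      show "AE y in lborel. (\<lambda>i. q (X i) y * f y) \<longlonglongrightarrow> 0"
      proof (rule AE_I2)
        fix y
        have "(\<lambda>h. norm (\<rho> (x - y + h) - \<rho> (x - y) - grad \<rho> (x - y) \<bullet> h) / norm h) \<midarrow>0\<rightarrow> 0"
          using D[of "x - y"] unfolding has_derivative_at by blast
        then have "((\<lambda>h. norm (\<rho> (x - y + h) - \<rho> (x - y) - grad \<rho> (x - y) \<bullet> h) / norm h) \<circ> X) \<longlonglongrightarrow> 0"
          using X unfolding tendsto_at_iff_sequentially by blast
        moreover have "((\<lambda>h. norm (\<rho> (x - y + h) - \<rho> (x - y) - grad \<rho> (x - y) \<bullet> h) / norm h) \<circ> X) = (\<lambda>i. norm (q (X i) y))"
          by (auto simp: q_def fun_eq_iff algebra_simps)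
        ultimately have "(\<lambda>i. q (X i) y) \<longlonglongrightarrow> 0" using tendsto_norm_zero_cancel by metis
        then show "(\<lambda>i. q (X i) y * f y) \<longlonglongrightarrow> 0" by (rule tendsto_mult_left_zero)
      qed
      show "AE y in lborel. norm (q (X i) y * f y) \<le> 2 * B * \<bar>f y\<bar>" for i
      proof (rule AE_I2)
        fix y
        have "\<bar>\<rho> (x + X i - y) - \<rho> (x - y)\<bar> \<le> B * norm (X i)"
          using lip[of "x + X i - y" "x - y"] by simp
        moreover have "\<bar>grad \<rho> (x - y) \<bullet> X i\<bar> \<le> B * norm (X i)"
          by (rule order_trans[OF Cauchy_Schwarz_ineq2]) (use B in \<open>auto intro: mult_right_mono\<close>)
        ultimately have "\<bar>\<rho> (x + X i - y) - \<rho> (x - y) - grad \<rho> (x - y) \<bullet> X i\<bar> \<le> 2 * B * norm (X i)"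
          by linarith
        then have "\<bar>q (X i) y\<bar> \<le> 2 * B" using X(1) by (simp add: q_def field_simps)
        then show "norm (q (X i) y * f y) \<le> 2 * B * \<bar>f y\<bar>"
          by (auto simp: abs_mult intro: mult_right_mono)
      qed
      show "(\<lambda>y. q (X i) y * f y) \<in> borel_measurable lborel" for i
        unfolding q_def by measurable
    qed simp
    then have "(\<lambda>i. norm (\<integral>y. q (X i) y * f y \<partial>lborel)) \<longlonglongrightarrow> 0"
      by (simp add: tendsto_rabs_zero)
    moreover have "((\<lambda>h. norm (mollify \<rho> f (x + h) - mollify \<rho> f x - ?w \<bullet> h) / norm h) \<circ> X)
       = (\<lambda>i. norm (\<integral>y. q (X i) y * f y \<partial>lborel))"
      unfolding eq[symmetric] by (auto simp: fun_eq_iff)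
    ultimately show "((\<lambda>h. norm (mollify \<rho> f (x + h) - mollify \<rho> f x - ?w \<bullet> h) / norm h) \<circ> X) \<longlonglongrightarrow> 0"
      by simp
  qed
  then show ?thesis unfolding has_derivative_at by (auto intro: bounded_linear_inner_right)
qed

lemma grad_mollify:
  assumes "\<rho> \<in> Cinf0 UNIV" "integrable lborel f"
  shows "grad (mollify \<rho> f) x = (\<integral>y. f y *\<^sub>R grad \<rho> (x - y) \<partial>lborel)"
  by (rule grad_eqI[OF mollify_has_derivative[OF assms]])

text \<open>A directional derivative of the mollification is the mollification with a derivative of
  the kernel, which is again a test function. Hence the induction generalises over
  \<open>\<rho>\<close>, and \<open>f\<close> only has to be integrable.\<close>

lemma Ck_mollify:
  assumes "\<rho> \<in> Cinf0 UNIV" "integrable lborel f"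
  shows "Ck k (mollify \<rho> f)"
  using assms(1)
proof (induction k arbitrary: \<rho>)
  case 0
  have "continuous (at x) (mollify \<rho> f)" for x
    using mollify_has_derivative[OF 0 assms(2)] has_derivative_continuous by blast
  then show ?case by (simp add: continuous_on_eq_continuous_at)
next
  case (Suc k)
  show ?case
  proof (rule CkI[OF mollify_has_derivative[OF Suc.prems assms(2)]])
    fix b
    have "(\<integral>y. f y *\<^sub>R grad \<rho> (x - y) \<partial>lborel) \<bullet> b = mollify (\<lambda>z. frechet_derivative \<rho> (at z) b) f x" for x
    proof -
      have "(\<integral>y. f y *\<^sub>R grad \<rho> (x - y) \<partial>lborel) \<bullet> b = (\<integral>y. (f y *\<^sub>R grad \<rho> (x - y)) \<bullet> b \<partial>lborel)"
        by (rule integral_inner_left[symmetric]) (rule integrable_mollify_grad[OF Suc.prems assms(2)])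
      then show ?thesis
        by (simp add: mollify_def inner_grad[OF Cinf0_D(6)[OF Suc.prems]] mult.commute)
    qed
    then show "Ck k (\<lambda>x. (\<integral>y. f y *\<^sub>R grad \<rho> (x - y) \<partial>lborel) \<bullet> b)"
      using Suc.IH[OF Cinf0_derivative[OF Suc.prems]] by simp
  qed
qed

lemma bump_integral_pos:
  assumes "R > 0"
  shows "(\<integral>x. bump R (x::'a::euclidean_space) \<partial>lborel) > 0"
proof -
  have b: "bump R \<in> Cinf0 (UNIV :: 'a set)" using bump_in_Cinf0[OF assms subset_UNIV] .
  have "integrable lborel (indicat_real (cball (0::'a) (R/2)))"
    by (intro integrable_real_indicator) (auto simp: emeasure_bounded_finite[OF bounded_cball, simplified])
  moreover have "integrable lborel (bump R :: 'a \<Rightarrow> real)"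
    by (rule integrable_continuous_bounded_support[OF Cinf0_D(5)[OF b], of R]) (simp add: bump_eq_0 assms)
  ultimately have le: "(\<integral>x. exp (-4/3) * indicat_real (cball (0::'a) (R/2)) x \<partial>lborel) \<le> (\<integral>x. bump R (x::'a) \<partial>lborel)"
    by (intro integral_mono integrable_mult_right)
       (use bump_ge[OF assms] bump_nonneg in \<open>auto split: split_indicator\<close>)
  have "measure lborel (cball (0::'a) (R/2)) > 0"
    by (rule content_cball_pos) (use assms in simp)
  then have "0 < exp (-4/3) * measure lborel (cball (0::'a) (R/2))" by (intro mult_pos_pos exp_gt_zero)
  also have "\<dots> = (\<integral>x. exp (-4/3) * indicat_real (cball (0::'a) (R/2)) x \<partial>lborel)" by simp
  finally show ?thesis using le by (rule less_le_trans)
qed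

definition mollifier :: "real \<Rightarrow> 'a::euclidean_space \<Rightarrow> real" where
  "mollifier e x = bump e x / (\<integral>y. bump e (y::'a) \<partial>lborel)"

lemma mollifier:
  fixes x :: "'a::euclidean_space"
  assumes "e > 0"
  shows "(mollifier e :: 'a \<Rightarrow> real) \<in> Cinf0 UNIV" "mollifier e x \<ge> 0" "norm x \<ge> e \<Longrightarrow> mollifier e x = 0"
    "(\<integral>x. mollifier e (x::'a) \<partial>lborel) = 1"
    "integrable lborel (mollifier e :: 'a \<Rightarrow> real)"
proof -
  note I = bump_integral_pos[OF assms, where 'a = 'a]
  have b: "bump e \<in> Cinf0 (UNIV :: 'a set)" using bump_in_Cinf0[OF assms subset_UNIV] .
  from Cinf0_mult[OF b Ck_const[of _ "1 / (\<integral>y. bump e (y::'a) \<partial>lborel)"]]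
  show m: "mollifier e \<in> Cinf0 (UNIV :: 'a set)" by (simp add: mollifier_def[abs_def])
  show "mollifier e x \<ge> 0" "(\<integral>x. mollifier e (x::'a) \<partial>lborel) = 1" "norm x \<ge> e \<Longrightarrow> mollifier e x = 0"
    using I bump_nonneg[of e x] assms bump_eq_0[of e x] by (auto simp: mollifier_def)
  show "integrable lborel (mollifier e :: 'a \<Rightarrow> real)"
    by (rule integrable_continuous_bounded_support[OF Cinf0_D(5)[OF m], of e])
       (use assms in \<open>auto simp: mollifier_def bump_eq_0\<close>)
qed

lemma continuous_on_mollify:
  assumes "\<rho> \<in> Cinf0 UNIV" "integrable lborel f"
  shows "continuous_on UNIV (mollify \<rho> f)"
  using Ck_mollify[OF assms] Ck_imp_continuous_on by blast

lemma mollify_support: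
  assumes "e > 0" "\<And>x. norm x > R \<Longrightarrow> f x = 0" "norm x > R + e"
  shows "mollify (mollifier e) f x = 0"
proof -
  have "mollifier e (x - y) * f y = 0" for y
  proof (cases "norm y > R")
    case False
    then have "norm (x - y) \<ge> e" using assms(3) norm_triangle_ineq2[of x y] by linarith
    then show ?thesis using mollifier(3)[OF assms(1)] by auto
  qed (use assms in auto)
  then show ?thesis unfolding mollify_def by (simp only: Bochner_Integration.integral_zero)
qed

text \<open>The kernel is a probability density: Jensen's inequality in \<open>y\<close>, followed
  by Fubini and integration of the kernel over \<open>x\<close>.\<close>

lemma mollify_contraction:
  fixes f :: "'a::euclidean_space \<Rightarrow> real"
  assumes e: "e > 0" and f[measurable]: "f \<in> borel_measurable borel"
    and int: "integrable lborel (\<lambda>x. (f x)\<^sup>2)" and supp: "\<And>x. norm x > R \<Longrightarrow> f x = 0"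
  shows "(\<integral>x. (mollify (mollifier e) f x)\<^sup>2 \<partial>lborel) \<le> (\<integral>x. (f x)\<^sup>2 \<partial>lborel)"
proof -
  let ?m = "mollifier e :: 'a \<Rightarrow> real"
  note m = mollifier[OF e, where 'a = 'a]
  note [measurable] = Cinf0_borel_measurable[OF m(1)]
  have fi: "integrable lborel f" by (rule integrable_of_square_integrable[OF f int supp])
  have mi: "integrable lborel (\<lambda>y. ?m (x - y))" "(\<integral>y. ?m (x - y) \<partial>lborel) = 1" for x
    using m(4,5) by (simp_all add: integrable_shift_minus integral_shift_minus)
  have sup_square: "integrable lborel (\<lambda>y. ?m (x - y) * (f y)\<^sup>2)" for x
    using integrable_mollify[OF m(1) int] .
  have jensen: "(mollify ?m f x)\<^sup>2 \<le> (\<integral>y. ?m (x - y) * (f y)\<^sup>2 \<partial>lborel)" for x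
  proof -
    \<comment> \<open>Jensen in the form that a variance is nonnegative: expanding the square around
      the mean \<open>c\<close> gives the claim.\<close>
    define c where "c = mollify ?m f x"
    have "0 \<le> (\<integral>y. ?m (x - y) * (f y - c)\<^sup>2 \<partial>lborel)"
      by (intro integral_nonneg_AE AE_I2) (use m(2) in auto)
    also have "\<dots> = (\<integral>y. ?m (x - y) * (f y)\<^sup>2 - 2 * c * (?m (x - y) * f y) + c\<^sup>2 * ?m (x - y) \<partial>lborel)"
      by (rule Bochner_Integration.integral_cong) (auto simp: power2_eq_square algebra_simps)
    also have "\<dots> = (\<integral>y. ?m (x - y) * (f y)\<^sup>2 \<partial>lborel) - 2 * c * c + c\<^sup>2 * 1"
      unfolding c_def mollify_def
      using sup_square mi integrable_mollify[OF m(1) fi]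
      by (simp add: Bochner_Integration.integral_add Bochner_Integration.integral_diff)
    finally show ?thesis by (simp add: c_def power2_eq_square)
  qed
  have pair: "integrable (lborel \<Otimes>\<^sub>M lborel) (\<lambda>(y, x). ?m (x - y) * (f y)\<^sup>2)"
  proof (rule lborel_pair.Fubini_integrable)
    have *: "(\<integral>x. ?m (x - y) * (f y)\<^sup>2 \<partial>lborel) = (f y)\<^sup>2" "integrable lborel (\<lambda>x. ?m (x - y) * (f y)\<^sup>2)" for y
    proof -
      have "(\<integral>x. ?m (x - y) \<partial>lborel) = (\<integral>x. ?m x \<partial>(distr lborel borel ((+) (-y))))"
        by (subst integral_distr) auto
      also have "\<dots> = 1" using m(4) by (simp only: lborel_distr_plus)
      finally have 1: "(\<integral>x. ?m (x - y) \<partial>lborel) = 1" .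
      \<comment> \<open>A function that is not integrable has integral 0, so the value 1 already
        proves integrability.\<close>
      then have 2: "integrable lborel (\<lambda>x. ?m (x - y))" using not_integrable_integral_eq by fastforce
      show "(\<integral>x. ?m (x - y) * (f y)\<^sup>2 \<partial>lborel) = (f y)\<^sup>2" using 1 by simp
      show "integrable lborel (\<lambda>x. ?m (x - y) * (f y)\<^sup>2)" using 2 by simp
    qed
    have "(\<lambda>y. \<integral>x. norm (case (y, x) of (y, x) \<Rightarrow> ?m (x - y) * (f y)\<^sup>2) \<partial>lborel) = (\<lambda>y. (f y)\<^sup>2)"
      using *(1) m(2) by (simp only: prod.case real_norm_def abs_mult abs_of_nonneg zero_le_power2)
    then show "integrable lborel (\<lambda>y. \<integral>x. norm (case (y, x) of (y, x) \<Rightarrow> ?m (x - y) * (f y)\<^sup>2) \<partial>lborel)"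
      using int by simp
    show "AE y in lborel. integrable lborel (\<lambda>x. case (y, x) of (y, x) \<Rightarrow> ?m (x - y) * (f y)\<^sup>2)"
      using *(2) by simp
  qed measurable
  have one: "(\<integral>x. ?m (x - y) \<partial>lborel) = 1" for y
  proof -
    have "(\<integral>x. ?m (x - y) \<partial>lborel) = (\<integral>x. ?m x \<partial>(distr lborel borel ((+) (-y))))"
      by (subst integral_distr) auto
    also have "\<dots> = 1" using m(4) by (simp only: lborel_distr_plus)
    finally show ?thesis .
  qed
  have "(\<integral>x. (mollify ?m f x)\<^sup>2 \<partial>lborel) \<le> (\<integral>x. (\<integral>y. ?m (x - y) * (f y)\<^sup>2 \<partial>lborel) \<partial>lborel)"
  proof (rule integral_mono)
    show "integrable lborel (\<lambda>x. (mollify ?m f x)\<^sup>2)"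
      by (rule integrable_square_continuous_bounded_support[OF continuous_on_mollify[OF m(1) fi], of "R + e"])
         (rule mollify_support[OF e, of R f], rule supp, auto)
    show "integrable lborel (\<lambda>x. \<integral>y. ?m (x - y) * (f y)\<^sup>2 \<partial>lborel)"
      using lborel_pair.integrable_snd[OF pair] .
  qed (rule jensen)
  also have "\<dots> = (\<integral>y. (\<integral>x. ?m (x - y) * (f y)\<^sup>2 \<partial>lborel) \<partial>lborel)"
    using lborel_pair.Fubini_integral[OF pair] .
  also have "\<dots> = (\<integral>y. (f y)\<^sup>2 \<partial>lborel)" using one by simp
  finally show ?thesis .
qed

text \<open>Two points at distance below 1 either both lie in the ball of radius
  \<open>R + 2\<close>, where uniform continuity applies, or both lie outside the support of
  \<open>g\<close>.\<close>

lemma mollify_continuous_uniform: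
  fixes g :: "'a::euclidean_space \<Rightarrow> real"
  assumes g: "continuous_on UNIV g" "\<And>x. norm x > R \<Longrightarrow> g x = 0" and "\<delta> > 0"
  obtains d where "d > 0" "\<And>e x. 0 < e \<Longrightarrow> e \<le> d \<Longrightarrow> \<bar>mollify (mollifier e) g x - g x\<bar> \<le> \<delta>"
proof -
  have "uniformly_continuous_on (cball 0 (R + 2)) g"
    by (intro compact_uniformly_continuous continuous_on_subset[OF g(1)]) auto
  then obtain d0 where d0: "d0 > 0"
    "\<And>x y. norm x \<le> R + 2 \<Longrightarrow> norm y \<le> R + 2 \<Longrightarrow> dist y x < d0 \<Longrightarrow> dist (g y) (g x) < \<delta>"
    unfolding uniformly_continuous_on_def using \<open>\<delta> > 0\<close> by auto
  have uc: "\<bar>g y - g x\<bar> \<le> \<delta>" if "norm (x - y) < min d0 1" for x y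
  proof (cases "norm x \<le> R + 2 \<and> norm y \<le> R + 2")
    case True
    then show ?thesis using d0(2)[of x y] that by (auto simp: dist_norm norm_minus_commute)
  next
    case False
    then have "norm x > R \<and> norm y > R"
      using that norm_triangle_ineq2[of x y] norm_triangle_ineq2[of y x] norm_minus_commute[of x y] by linarith
    then show ?thesis using g(2) \<open>\<delta> > 0\<close> by simp
  qed
  have gi: "integrable lborel g" by (rule integrable_continuous_bounded_support[OF g])
  have "\<bar>mollify (mollifier e) g x - g x\<bar> \<le> \<delta>" if e: "0 < e" "e \<le> min d0 1" for e x
  proof -
    let ?m = "mollifier e :: 'a \<Rightarrow> real"
    note m = mollifier[OF e(1), where 'a = 'a]
    note [measurable] = Cinf0_borel_measurable[OF m(1)]
    have mi: "integrable lborel (\<lambda>y. ?m (x - y))" "(\<integral>y. ?m (x - y) \<partial>lborel) = 1"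
      using m(4,5) by (simp_all add: integrable_shift_minus integral_shift_minus)
    have "mollify ?m g x - g x = (\<integral>y. ?m (x - y) * g y - g x * ?m (x - y) \<partial>lborel)"
      unfolding mollify_def using mi integrable_mollify[OF m(1) gi]
      by (simp add: Bochner_Integration.integral_diff)
    moreover have "norm (\<integral>y. ?m (x - y) * g y - g x * ?m (x - y) \<partial>lborel) \<le> (\<integral>y. \<delta> * ?m (x - y) \<partial>lborel)"
    proof (rule Bochner_Integration.integral_norm_bound_integral)
      fix y
      show "norm (?m (x - y) * g y - g x * ?m (x - y)) \<le> \<delta> * ?m (x - y)"
      proof (cases "norm (x - y) < e")
        case True
        then have "\<bar>g y - g x\<bar> * ?m (x - y) \<le> \<delta> * ?m (x - y)"
          using uc[of x y] e m(2)[of "x - y"] by (intro mult_right_mono) auto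
        moreover have "norm (?m (x - y) * g y - g x * ?m (x - y)) = \<bar>g y - g x\<bar> * ?m (x - y)"
        proof -
          have "?m (x - y) * g y - g x * ?m (x - y) = (g y - g x) * ?m (x - y)" by (simp add: algebra_simps)
          then show ?thesis using m(2)[of "x - y"] by (simp add: abs_mult)
        qed
        ultimately show ?thesis by simp
      qed (use m(3) in simp)
    qed (use mi integrable_mollify[OF m(1) gi] in auto)
    ultimately show ?thesis using mi by simp
  qed
  then show ?thesis using that[of "min d0 1"] d0(1) by auto
qed

text \<open>Density argument: replace \<open>f\<close> by a continuous \<open>g\<close>; the
  contraction property controls the mollified difference, and uniform convergence handles
  \<open>g\<close>. The three squared errors enter with factor 3 each, so
  \<open>\<epsilon> / 12\<close> for every one of them leaves room.\<close>

lemma mollify_tendsto_L2: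
  fixes f :: "'a::euclidean_space \<Rightarrow> real"
  assumes f[measurable]: "f \<in> borel_measurable borel" and int: "integrable lborel (\<lambda>x. (f x)\<^sup>2)"
    and supp: "\<And>x. norm x > R \<Longrightarrow> f x = 0" and "\<epsilon> > 0"
  obtains d where "d > 0"
    "\<And>e. 0 < e \<Longrightarrow> e \<le> d \<Longrightarrow> (\<integral>x. (f x - mollify (mollifier e) f x)\<^sup>2 \<partial>lborel) < \<epsilon>"
proof -
  obtain g where g: "continuous_on UNIV g" "\<And>x. norm x > R + 1 \<Longrightarrow> g x = 0"
    "(\<integral>x. (f x - g x)\<^sup>2 \<partial>lborel) < \<epsilon> / 12"
    using square_integrable_approx_continuous[OF f int supp divide_pos_pos[OF \<open>\<epsilon> > 0\<close>, of 12]] by auto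
  note [measurable] = borel_measurable_continuous_onI[OF g(1)]
  define V where "V = measure lborel (cball (0::'a) (R + 2))"
  have "V \<ge> 0" by (simp add: V_def)
  \<comment> \<open>The uniform error on the ball of volume \<open>V\<close> then contributes at
    most \<open>\<epsilon> / 12\<close> to the square integral; adding 1 keeps the denominator
    positive.\<close>
  define \<delta> where "\<delta> = sqrt (\<epsilon> / (12 * (V + 1)))"
  have \<delta>: "\<delta> > 0" "\<delta>\<^sup>2 * V \<le> \<epsilon> / 12"
    using \<open>\<epsilon> > 0\<close> \<open>V \<ge> 0\<close> by (auto simp: \<delta>_def field_simps)
  obtain d where d: "d > 0" "\<And>e x. 0 < e \<Longrightarrow> e \<le> d \<Longrightarrow> \<bar>mollify (mollifier e) g x - g x\<bar> \<le> \<delta>"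
    using mollify_continuous_uniform[OF g(1,2) \<delta>(1)] by blast
  have g2: "integrable lborel (\<lambda>x. (g x)\<^sup>2)" by (rule integrable_square_continuous_bounded_support[OF g(1,2)])
  have fg2: "integrable lborel (\<lambda>x. (f x - g x)\<^sup>2)" by (rule integrable_square_add) (use int g2 in auto)
  have fg_supp: "norm x > R + 1 \<Longrightarrow> f x - g x = 0" for x using supp[of x] g(2)[of x] by simp
  have fi: "integrable lborel f" by (rule integrable_of_square_integrable[OF f int supp])
  have gi: "integrable lborel g" by (rule integrable_continuous_bounded_support[OF g(1,2)])
  have "(\<integral>x. (f x - mollify (mollifier e) f x)\<^sup>2 \<partial>lborel) < \<epsilon>" if e: "0 < e" "e \<le> min d 1" for e
  proof -
    let ?m = "mollifier e :: 'a \<Rightarrow> real"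
    note m = mollifier[OF e(1), where 'a = 'a]
    have fgi: "integrable lborel (\<lambda>x. f x - g x)" using fi gi by simp
    have split: "mollify ?m f x = mollify ?m (\<lambda>x. f x - g x) x + mollify ?m g x" for x
      unfolding mollify_def using integrable_mollify[OF m(1) fgi] integrable_mollify[OF m(1) gi]
      by (subst Bochner_Integration.integral_add[symmetric]) (auto simp: algebra_simps)
    have c1: "continuous_on UNIV (mollify ?m (\<lambda>x. f x - g x))" and c2: "continuous_on UNIV (mollify ?m g)"
      using continuous_on_mollify[OF m(1)] fgi gi by auto
    note [measurable] = borel_measurable_continuous_onI[OF c1] borel_measurable_continuous_onI[OF c2]
    have s1: "mollify ?m (\<lambda>x. f x - g x) x = 0" if "norm x > R + 2" for x
      using mollify_support[OF e(1), of "R + 1" "\<lambda>x. f x - g x" x] fg_supp that e by auto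
    have s2: "mollify ?m g x = 0" if "norm x > R + 2" for x
      using mollify_support[OF e(1), of "R + 1" g x] g(2) that e by auto
    have i1: "integrable lborel (\<lambda>x. (mollify ?m (\<lambda>x. f x - g x) x)\<^sup>2)"
      and i2: "integrable lborel (\<lambda>x. (mollify ?m g x)\<^sup>2)"
      by (rule integrable_square_continuous_bounded_support[OF c1 s1]
          integrable_square_continuous_bounded_support[OF c2 s2]; assumption)+
    have i3: "integrable lborel (\<lambda>x. (mollify ?m g x - g x)\<^sup>2)"
      by (rule integrable_square_add) (use i2 g2 in auto)
    have mf: "mollify ?m f = (\<lambda>x. mollify ?m (\<lambda>x. f x - g x) x + mollify ?m g x)"
      using split by auto
    have i4: "integrable lborel (\<lambda>x. (mollify ?m f x)\<^sup>2)"
      unfolding mf by (rule integrable_square_add) (use i1 i2 in auto)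
    have [measurable]: "mollify ?m f \<in> borel_measurable borel" unfolding mf by measurable
    have sq3: "(a + b + c)\<^sup>2 \<le> 3 * a\<^sup>2 + 3 * b\<^sup>2 + 3 * c\<^sup>2" for a b c :: real
      using sum_squares_bound[of a b] sum_squares_bound[of b c] sum_squares_bound[of a c]
      by (simp add: power2_eq_square algebra_simps)
    have "(\<integral>x. (f x - mollify ?m f x)\<^sup>2 \<partial>lborel) \<le>
       (\<integral>x. 3 * (f x - g x)\<^sup>2 + 3 * (mollify ?m (\<lambda>x. f x - g x) x)\<^sup>2 + 3 * (mollify ?m g x - g x)\<^sup>2 \<partial>lborel)"
    proof (rule integral_mono)
      show "(f x - mollify ?m f x)\<^sup>2 \<le> 3 * (f x - g x)\<^sup>2 + 3 * (mollify ?m (\<lambda>x. f x - g x) x)\<^sup>2 + 3 * (mollify ?m g x - g x)\<^sup>2" for x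
      proof -
        have "f x - mollify ?m f x = (f x - g x) + (- mollify ?m (\<lambda>x. f x - g x) x) + (g x - mollify ?m g x)"
          using split[of x] by simp
        then show ?thesis
          using sq3[of "f x - g x" "- mollify ?m (\<lambda>x. f x - g x) x" "g x - mollify ?m g x"]
          by (simp only: power2_minus power2_commute[of "mollify ?m g x"])
      qed
      show "integrable lborel (\<lambda>x. (f x - mollify ?m f x)\<^sup>2)"
        by (rule integrable_square_add) (use int i4 in auto)
    qed (use fg2 i1 i3 in auto)
    also have "\<dots> = 3 * (\<integral>x. (f x - g x)\<^sup>2 \<partial>lborel) + 3 * (\<integral>x. (mollify ?m (\<lambda>x. f x - g x) x)\<^sup>2 \<partial>lborel)
        + 3 * (\<integral>x. (mollify ?m g x - g x)\<^sup>2 \<partial>lborel)"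
      using fg2 i1 i3 by (simp add: Bochner_Integration.integral_add)
    also have "(\<integral>x. (mollify ?m (\<lambda>x. f x - g x) x)\<^sup>2 \<partial>lborel) \<le> (\<integral>x. (f x - g x)\<^sup>2 \<partial>lborel)"
      by (rule mollify_contraction[OF e(1) _ fg2 fg_supp]) auto
    also have "(\<integral>x. (mollify ?m g x - g x)\<^sup>2 \<partial>lborel) \<le> (\<integral>x. \<delta>\<^sup>2 * indicat_real (cball 0 (R + 2)) x \<partial>(lborel :: 'a measure))"
    proof (rule integral_mono[OF i3])
      show "integrable lborel (\<lambda>x::'a. \<delta>\<^sup>2 * indicat_real (cball 0 (R + 2)) x)"
        by (intro integrable_mult_right integrable_real_indicator) (auto simp: emeasure_bounded_finite[OF bounded_cball, simplified])
      fix x :: 'a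
      show "(mollify ?m g x - g x)\<^sup>2 \<le> \<delta>\<^sup>2 * indicat_real (cball 0 (R + 2)) x"
      proof (cases "norm x \<le> R + 2")
        case True
        have "\<bar>mollify ?m g x - g x\<bar> \<le> \<bar>\<delta>\<bar>" using d(2)[of e x] e \<delta>(1) by auto
        then have "(mollify ?m g x - g x)\<^sup>2 \<le> \<delta>\<^sup>2" by (simp only: abs_le_square_iff)
        then show ?thesis using True by simp
      qed (use s2[of x] g(2)[of x] in auto)
    qed
    also have "(\<integral>x. \<delta>\<^sup>2 * indicat_real (cball 0 (R + 2)) x \<partial>(lborel :: 'a measure)) = \<delta>\<^sup>2 * V"
      by (simp add: V_def)
    finally show ?thesis using g(3) \<delta>(2) \<open>\<epsilon> > 0\<close> by linarith
  qed
  then show ?thesis using that[of "min d 1"] d(1) by auto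
qed

section \<open>Membership in the Sobolev spaces\<close>

text \<open>The notions of solution are phrased over \<open>lebesgue_on\<close>, whereas Fubini and
  changes of variables are carried out over \<open>lborel\<close>. Extension by zero lets one pass
  between them.\<close>

lemma integral_lebesgue_on_borel:
  fixes h :: "'a::euclidean_space \<Rightarrow> 'b::euclidean_space"
  assumes "S \<in> sets borel" "h \<in> borel_measurable borel" "\<And>x. x \<notin> S \<Longrightarrow> h x = 0"
  shows "(LINT x|lebesgue_on S. h x) = (\<integral>x. h x \<partial>lborel)"
    and "integrable (lebesgue_on S) h \<longleftrightarrow> integrable lborel h"
    and "h \<in> borel_measurable (lebesgue_on S)"
proof -
  have eq: "(\<lambda>x. indicat_real S x *\<^sub>R h x) = h" using assms(3) by (auto simp: indicator_def fun_eq_iff)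
  have S: "S \<inter> space lebesgue \<in> sets lebesgue" using assms(1) by auto
  show "(LINT x|lebesgue_on S. h x) = (\<integral>x. h x \<partial>lborel)"
    unfolding integral_restrict_space[OF S] eq using assms(2) by (simp add: integral_completion)
  show "integrable (lebesgue_on S) h \<longleftrightarrow> integrable lborel h"
    unfolding integrable_restrict_space[OF S] eq using assms(2) by (simp add: integrable_completion)
  show "h \<in> borel_measurable (lebesgue_on S)"
    using assms(2) by (intro measurable_restrict_space1 measurable_completion) auto
qed

lemma L2_borelI:
  fixes h :: "'a::euclidean_space \<Rightarrow> 'b::euclidean_space"
  assumes "S \<in> sets borel" "h \<in> borel_measurable borel" "\<And>x. x \<notin> S \<Longrightarrow> h x = 0"
    "integrable lborel (\<lambda>x. (norm (h x))\<^sup>2)"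
  shows "h \<in> L2 S" "(L2_norm S h)\<^sup>2 = (\<integral>x. (norm (h x))\<^sup>2 \<partial>lborel)"
proof -
  have n: "(\<lambda>x. (norm (h x))\<^sup>2) \<in> borel_measurable borel" using assms(2) by measurable
  show "h \<in> L2 S"
    using integral_lebesgue_on_borel(2)[OF assms(1) n] integral_lebesgue_on_borel(3)[OF assms(1-3)] assms(3,4)
    by (simp add: L2_def)
  show "(L2_norm S h)\<^sup>2 = (\<integral>x. (norm (h x))\<^sup>2 \<partial>lborel)"
    unfolding L2_norm_def using integral_lebesgue_on_borel(1)[OF assms(1) n] assms(3)
    by (simp add: integral_nonneg)
qed

lemma norm_square_eq_sum:
  "(norm (v::'a::euclidean_space))\<^sup>2 = (\<Sum>b\<in>Basis. (v \<bullet> b)\<^sup>2)"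
  using euclidean_inner[of v v] by (simp add: dot_square_norm power2_eq_square)

text \<open>A weak gradient on the whole space together with support strictly inside the ball gives
  zero boundary values: mollification stays in the ball, and its gradient is the mollification of
  \<open>G\<close>. Both then converge in \<open>L_2\<close>.\<close>

lemma H10_gradI:
  fixes f :: "'a::euclidean_space \<Rightarrow> real" and G :: "'a \<Rightarrow> 'a"
  assumes f[measurable]: "f \<in> borel_measurable borel" and fint: "integrable lborel (\<lambda>x. (f x)\<^sup>2)"
    and G[measurable]: "G \<in> borel_measurable borel" and Gint: "integrable lborel (\<lambda>x. (norm (G x))\<^sup>2)"
    and fsupp: "\<And>x. norm x > R \<Longrightarrow> f x = 0" and Gsupp: "\<And>x. norm x > R \<Longrightarrow> G x = 0"
    and weak: "\<And>\<theta>. \<theta> \<in> Cinf0 UNIV \<Longrightarrow>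
      (\<integral>x. f x *\<^sub>R grad \<theta> x \<partial>lborel) = - (\<integral>x. \<theta> x *\<^sub>R G x \<partial>lborel)"
    and "R < r"
  shows "H10_grad (ball 0 r) f G"
proof -
  let ?\<Omega> = "ball (0::'a) r"
  have \<Omega>: "?\<Omega> \<in> sets borel" by simp
  have out: "norm x > R" if "x \<notin> ?\<Omega>" for x using that \<open>R < r\<close> by auto
  have f0: "x \<notin> ?\<Omega> \<Longrightarrow> f x = 0" and G0: "x \<notin> ?\<Omega> \<Longrightarrow> G x = 0" for x
    using out fsupp Gsupp by blast+
  have H1: "H1_grad ?\<Omega> f G"
    unfolding H1_grad_def
  proof (intro conjI ballI)
    show "f \<in> L2 ?\<Omega>" by (rule L2_borelI[OF \<Omega> f f0]) (use fint in auto)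
    show "G \<in> L2 ?\<Omega>" by (rule L2_borelI[OF \<Omega> G G0 Gint])
    fix \<theta> :: "'a \<Rightarrow> real" assume "\<theta> \<in> Cinf0 ?\<Omega>"
    then have \<theta>: "\<theta> \<in> Cinf0 UNIV" by (auto simp: Cinf0_def)
    note [measurable] = Cinf0_borel_measurable[OF \<theta>] Cinf0_grad_borel_measurable[OF \<theta>]
    show "(LINT x|lebesgue_on ?\<Omega>. f x *\<^sub>R grad \<theta> x) = - (LINT x|lebesgue_on ?\<Omega>. \<theta> x *\<^sub>R G x)"
      using weak[OF \<theta>] f0 G0 by (subst (1 2) integral_lebesgue_on_borel(1)) auto
  qed
  moreover have "\<exists>\<phi>\<in>Cinf0 ?\<Omega>. sqrt ((L2_norm ?\<Omega> (\<lambda>x. f x - \<phi> x))\<^sup>2 + (L2_norm ?\<Omega> (\<lambda>x. G x - grad \<phi> x))\<^sup>2) < \<epsilon>"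
    if "\<epsilon> > 0" for \<epsilon>
  proof -
    \<comment> \<open>One share for \<open>f\<close> and one for each of the \<open>DIM('a)\<close>
      components of \<open>G\<close>; the shares add up to \<open>\<epsilon>^2\<close>.\<close>
    define \<delta> where "\<delta> = \<epsilon>\<^sup>2 / (real DIM('a) + 1)"
    have "\<delta> > 0" using that by (simp add: \<delta>_def)
    have [measurable]: "(\<lambda>x. G x \<bullet> b) \<in> borel_measurable borel" for b by measurable
    have Gb: "integrable lborel (\<lambda>x. (G x \<bullet> b)\<^sup>2)" if "b \<in> Basis" for b
      by (rule Bochner_Integration.integrable_bound[OF Gint])
         (use that in \<open>auto intro!: AE_I2 power_mono simp: abs_le_square_iff[symmetric] Basis_le_norm\<close>)
    have "\<exists>d>0. \<forall>e. 0 < e \<longrightarrow> e \<le> d \<longrightarrow> (\<integral>x. (G x \<bullet> b - mollify (mollifier e) (\<lambda>x. G x \<bullet> b) x)\<^sup>2 \<partial>lborel) < \<delta>"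
      if "b \<in> Basis" for b
      using mollify_tendsto_L2[of "\<lambda>x. G x \<bullet> b" R \<delta>] Gb[OF that] Gsupp \<open>\<delta> > 0\<close> by (auto; metis)
    then obtain d where d: "\<And>b. b \<in> Basis \<Longrightarrow> d b > 0"
      "\<And>b e. b \<in> Basis \<Longrightarrow> 0 < e \<Longrightarrow> e \<le> d b \<Longrightarrow> (\<integral>x. (G x \<bullet> b - mollify (mollifier e) (\<lambda>x. G x \<bullet> b) x)\<^sup>2 \<partial>lborel) < \<delta>"
      by metis
    obtain d' where d': "d' > 0" "\<And>e. 0 < e \<Longrightarrow> e \<le> d' \<Longrightarrow> (\<integral>x. (f x - mollify (mollifier e) f x)\<^sup>2 \<partial>lborel) < \<delta>"
      using mollify_tendsto_L2[OF f fint fsupp \<open>\<delta> > 0\<close>] by blast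
    \<comment> \<open>Half the gap between \<open>R\<close> and \<open>r\<close> keeps the support
      of the mollification compact in the open ball; the remaining bounds make all
      \<open>L_2\<close> errors small at once.\<close>
    define e where "e = min (min d' ((r - R) / 2)) (Min (d ` Basis))"
    have "Min (d ` Basis) > 0" by (subst Min_gr_iff) (use d(1) in auto)
    moreover have "e \<le> min d' ((r - R) / 2)" "e \<le> Min (d ` Basis)"
      unfolding e_def by (rule min.cobounded1, rule min.cobounded2)
    ultimately have e: "e > 0" "e \<le> d'" "e \<le> (r - R) / 2" "\<And>b. b \<in> Basis \<Longrightarrow> e \<le> d b"
      using d'(1) \<open>R < r\<close> by (simp_all add: e_def order_trans[OF min.cobounded2])
    let ?m = "mollifier e :: 'a \<Rightarrow> real"
    note m = mollifier[OF e(1), where 'a = 'a]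
    define \<phi> where "\<phi> = mollify ?m f"
    have fi: "integrable lborel f" by (rule integrable_of_square_integrable[OF f fint fsupp])
    have Gbi: "integrable lborel (\<lambda>x. G x \<bullet> b)" if "b \<in> Basis" for b
      by (rule integrable_of_square_integrable[of _ R]) (use Gb[OF that] Gsupp in auto)
    have Gi: "integrable lborel G"
    proof -
      have "integrable lborel (\<lambda>x. \<Sum>b\<in>Basis. (G x \<bullet> b) *\<^sub>R b)"
        by (intro Bochner_Integration.integrable_sum integrable_scaleR_left Gbi)
      then show ?thesis by (simp add: euclidean_representation)
    qed
    have \<phi>: "\<phi> \<in> Cinf0 ?\<Omega>"
    proof (rule Cinf0_subsetI[of _ "cball 0 (R + e)"])
      show "Ck k \<phi>" for k unfolding \<phi>_def by (rule Ck_mollify[OF m(1) fi])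
      show "cball 0 (R + e) \<subseteq> ?\<Omega>" using e(3) \<open>R < r\<close> by (auto simp: field_simps)
      show "\<phi> x = 0" if "x \<notin> cball 0 (R + e)" for x
        unfolding \<phi>_def by (rule mollify_support[OF e(1) fsupp]) (use that in auto)
    qed auto
    have grad_b: "grad \<phi> x \<bullet> b = mollify ?m (\<lambda>x. G x \<bullet> b) x" if "b \<in> Basis" for x b
    proof -
      \<comment> \<open>The weak identity is tested with the reflected and translated mollifier. Its
        gradient carries a minus sign, which cancels the one in the weak identity.\<close>
      define \<theta> where "\<theta> y = ?m (x + (-1) *\<^sub>R y)" for y
      have \<theta>: "\<theta> \<in> Cinf0 UNIV"
      proof (rule Cinf0_subsetI[of _ "cball x e"])
        show "Ck k \<theta>" for k unfolding \<theta>_def using Ck_affine[OF Cinf0_D(1)[OF m(1)]] .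
        show "\<theta> y = 0" if "y \<notin> cball x e" for y
          unfolding \<theta>_def using m(3)[of "x - y"] that by (simp add: dist_norm)
      qed auto
      have grad_\<theta>: "grad \<theta> y = - grad ?m (x - y)" for y
      proof (rule grad_eqI)
        have "((\<lambda>y. x + (-1) *\<^sub>R y) has_derivative (\<lambda>v. - v)) (at y)"
          by (auto intro!: derivative_eq_intros)
        from has_derivative_compose[OF this, of ?m "\<lambda>v. grad ?m (x - y) \<bullet> v"]
        show "(\<theta> has_derivative (\<lambda>v. - grad ?m (x - y) \<bullet> v)) (at y)"
          using grad_has_derivative[OF Cinf0_differentiable[OF m(1)], of "x - y"] by (simp add: \<theta>_def[abs_def])
      qed
      have "grad \<phi> x = - (\<integral>y. f y *\<^sub>R grad \<theta> y \<partial>lborel)"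
        unfolding \<phi>_def grad_mollify[OF m(1) fi] by (simp add: grad_\<theta>)
      also have "\<dots> = (\<integral>y. \<theta> y *\<^sub>R G y \<partial>lborel)" using weak[OF \<theta>] by simp
      finally have "grad \<phi> x \<bullet> b = (\<integral>y. \<theta> y *\<^sub>R G y \<partial>lborel) \<bullet> b" by simp
      also have "\<dots> = (\<integral>y. (\<theta> y *\<^sub>R G y) \<bullet> b \<partial>lborel)"
      proof (rule integral_inner_left[symmetric])
        note [measurable] = Cinf0_borel_measurable[OF \<theta>]
        obtain B where "\<And>x. \<bar>\<theta> x\<bar> \<le> B" using Cinf0_bounded[OF \<theta>] by blast
        then show "integrable lborel (\<lambda>y. \<theta> y *\<^sub>R G y)"
          by (intro Bochner_Integration.integrable_bound[OF integrable_scaleR_right[OF Gi, of B]])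
             (auto intro!: AE_I2 mult_right_mono order_trans[OF _ abs_ge_self])
      qed
      finally show ?thesis by (simp add: mollify_def \<theta>_def)
    qed
    have 1: "(L2_norm ?\<Omega> (\<lambda>x. f x - \<phi> x))\<^sup>2 < \<delta>"
    proof -
      note [measurable] = Cinf0_borel_measurable[OF \<phi>]
      have p0: "\<phi> x = 0" if "norm x > R + e" for x
        unfolding \<phi>_def by (rule mollify_support[OF e(1) fsupp that])
      have "integrable lborel (\<lambda>x. (\<phi> x)\<^sup>2)"
        by (rule integrable_square_continuous_bounded_support[OF Cinf0_D(5)[OF \<phi>] p0])
      then have "integrable lborel (\<lambda>x. (f x - \<phi> x)\<^sup>2)"
        by (intro integrable_square_add) (use fint in auto)
      then have "(L2_norm ?\<Omega> (\<lambda>x. f x - \<phi> x))\<^sup>2 = (\<integral>x. (norm (f x - \<phi> x))\<^sup>2 \<partial>lborel)"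
        by (intro L2_borelI[OF \<Omega>]) (use f0 Cinf0_D(4)[OF \<phi>] in auto)
      then show ?thesis using d'(2)[of e] e by (simp add: \<phi>_def)
    qed
    have 2: "(L2_norm ?\<Omega> (\<lambda>x. G x - grad \<phi> x))\<^sup>2 \<le> real DIM('a) * \<delta>"
    proof -
      note [measurable] = Cinf0_grad_borel_measurable[OF \<phi>]
      have sq: "(norm (G x - grad \<phi> x))\<^sup>2 = (\<Sum>b\<in>Basis. (G x \<bullet> b - mollify ?m (\<lambda>x. G x \<bullet> b) x)\<^sup>2)" for x
        unfolding norm_square_eq_sum by (rule sum.cong) (simp_all add: inner_diff_left grad_b)
      have int: "integrable lborel (\<lambda>x. (G x \<bullet> b - mollify ?m (\<lambda>x. G x \<bullet> b) x)\<^sup>2)" if "b \<in> Basis" for b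
      proof (rule integrable_square_add)
        have c: "continuous_on UNIV (mollify ?m (\<lambda>x. G x \<bullet> b))" by (rule continuous_on_mollify[OF m(1) Gbi[OF that]])
        then show "mollify ?m (\<lambda>x. G x \<bullet> b) \<in> borel_measurable lborel" by (simp add: borel_measurable_continuous_onI)
        show "integrable lborel (\<lambda>x. (mollify ?m (\<lambda>x. G x \<bullet> b) x)\<^sup>2)"
          by (rule integrable_square_continuous_bounded_support[OF c, of "R + e"])
             (use mollify_support[OF e(1), of R "\<lambda>x. G x \<bullet> b"] Gsupp in auto)
      qed (use Gb[OF that] in auto)
      have "(L2_norm ?\<Omega> (\<lambda>x. G x - grad \<phi> x))\<^sup>2 = (\<integral>x. (norm (G x - grad \<phi> x))\<^sup>2 \<partial>lborel)"
      proof (rule L2_borelI[OF \<Omega>])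
        show "G x - grad \<phi> x = 0" if "x \<notin> ?\<Omega>" for x
        proof -
          have "x \<notin> closure {x. \<phi> x \<noteq> 0}" using Cinf0_D(3)[OF \<phi>] that by blast
          from grad_eq_0_outside[OF this] show ?thesis using G0[OF that] by simp
        qed
        show "integrable lborel (\<lambda>x. (norm (G x - grad \<phi> x))\<^sup>2)" unfolding sq using int by auto
      qed measurable
      also have "\<dots> = (\<Sum>b\<in>Basis. \<integral>x. (G x \<bullet> b - mollify ?m (\<lambda>x. G x \<bullet> b) x)\<^sup>2 \<partial>lborel)"
        unfolding sq using int by (subst Bochner_Integration.integral_sum) auto
      also have "\<dots> \<le> (\<Sum>b\<in>(Basis::'a set). \<delta>)"
        by (intro sum_mono less_imp_le d(2) e) auto
      finally show ?thesis by simp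
    qed
    have "(L2_norm ?\<Omega> (\<lambda>x. f x - \<phi> x))\<^sup>2 + (L2_norm ?\<Omega> (\<lambda>x. G x - grad \<phi> x))\<^sup>2 < \<epsilon>\<^sup>2"
    proof -
      have "(real DIM('a) + 1) * \<delta> = \<epsilon>\<^sup>2" by (simp add: \<delta>_def add_nonneg_eq_0_iff)
      then have "\<delta> + real DIM('a) * \<delta> = \<epsilon>\<^sup>2" by (simp add: distrib_right)
      then show ?thesis using 1 2 by linarith
    qed
    then have "sqrt ((L2_norm ?\<Omega> (\<lambda>x. f x - \<phi> x))\<^sup>2 + (L2_norm ?\<Omega> (\<lambda>x. G x - grad \<phi> x))\<^sup>2) < \<epsilon>"
      using that by (intro real_less_lsqrt) auto
    then show ?thesis using \<phi> by blast
  qed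
  ultimately show ?thesis unfolding H10_grad_def by blast
qed

section \<open>Exponential averages in time\<close>

lemma integrable_bounded_support:
  fixes g :: "'a::euclidean_space \<Rightarrow> 'b::{banach, second_countable_topology}"
  assumes [measurable]: "g \<in> borel_measurable borel"
    and "\<And>x. norm (g x) \<le> C" "bounded S" "S \<in> sets borel" "\<And>x. x \<notin> S \<Longrightarrow> g x = 0"
  shows "integrable lborel g"
proof (rule Bochner_Integration.integrable_bound)
  show "integrable lborel (\<lambda>x. C * indicat_real S x)"
    using assms(4) emeasure_bounded_finite[OF assms(3)]
    by (intro integrable_mult_right integrable_real_indicator) auto
  show "AE x in lborel. norm (g x) \<le> norm (C * indicat_real S x)"
    using assms(2,5) by (auto simp: indicator_def intro: order_trans[OF _ abs_ge_self])
qed simp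

lemma integrable_pair_bounded_support:
  fixes g :: "real \<times> real \<Rightarrow> real"
  assumes "g \<in> borel_measurable borel" "\<And>x y. \<bar>g (x, y)\<bar> \<le> C"
    "\<And>x y. x \<notin> {a..b} \<or> y \<notin> {c..d} \<Longrightarrow> g (x, y) = 0"
  shows "integrable (lborel \<Otimes>\<^sub>M lborel) g"
  unfolding lborel_prod
proof (rule integrable_bounded_support[of _ C "{a..b} \<times> {c..d}"])
  show "x \<notin> {a..b} \<times> {c..d} \<Longrightarrow> g x = 0" for x
    using assms(3)[of "fst x" "snd x"] by (cases x) auto
  show "norm (g x) \<le> C" for x
    using assms(2)[of "fst x" "snd x"] by simp
qed (use assms in \<open>auto intro!: bounded_Times borel_closed closed_Times\<close>)

text \<open>Bounds are required at every time, not almost everywhere, and the function vanishes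
  before time 0. On this class all exponential convolutions converge absolutely and start from
  zero.\<close>

definition causal :: "real \<Rightarrow> (real \<Rightarrow> real) \<Rightarrow> bool" where
  "causal B f \<longleftrightarrow> f \<in> borel_measurable borel \<and> (\<forall>t. \<bar>f t\<bar> \<le> B) \<and> (\<forall>t<0. f t = 0)"

text \<open>The solution operator of \<open>r' + a r = f\<close> with zero initial value, that is,
  the resolvent of the time derivative on the half-line.\<close>

definition expconv :: "real \<Rightarrow> (real \<Rightarrow> real) \<Rightarrow> real \<Rightarrow> real" where
  "expconv a f t = (\<integral>\<tau>. (if \<tau> < t then exp (- a * (t - \<tau>)) else 0) * f \<tau> \<partial>lborel)"

lemma causalD:
  assumes "causal B f"
  shows "f \<in> borel_measurable borel" "\<bar>f t\<bar> \<le> B" "t < 0 \<Longrightarrow> f t = 0" "B \<ge> 0"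
  using assms abs_ge_zero[of "f 0"] by (auto simp: causal_def intro: order_trans)

lemma expconv_measurable:
  assumes [measurable]: "f \<in> borel_measurable borel"
  shows "expconv a f \<in> borel_measurable borel"
  unfolding expconv_def[abs_def] by measurable

text \<open>Splitting the exponential turns the convolution into an indefinite integral with a fixed
  lower end, to which the fundamental theorem applies. Any lower end \<open>b \<le> 0\<close> will
  do because \<open>f\<close> vanishes before 0; a negative one gives continuity at 0.\<close>

lemma expconv_eq:
  assumes f: "causal B f" and "b \<le> 0"
  shows "(\<lambda>\<tau>. exp (a * \<tau>) * f \<tau>) integrable_on {b..t}"
    and "expconv a f t = exp (- a * t) * integral {b..t} (\<lambda>\<tau>. exp (a * \<tau>) * f \<tau>)"
proof -
  note [measurable] = causalD(1)[OF f]
  have "set_integrable lborel {b..t} (\<lambda>\<tau>. exp (a * \<tau>) * f \<tau>)"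
    unfolding set_integrable_def
  proof (rule integrable_bounded_support[of _ "exp (\<bar>a\<bar> * (\<bar>b\<bar> + \<bar>t\<bar>)) * B" "{b..t}"])
    fix \<tau>
    have "\<bar>exp (a * \<tau>) * f \<tau>\<bar> \<le> exp (\<bar>a\<bar> * (\<bar>b\<bar> + \<bar>t\<bar>)) * B" if "\<tau> \<in> {b..t}"
    proof -
      have "a * \<tau> \<le> \<bar>a\<bar> * \<bar>\<tau>\<bar>" by (metis abs_ge_self abs_mult)
      also have "\<dots> \<le> \<bar>a\<bar> * (\<bar>b\<bar> + \<bar>t\<bar>)" using that by (intro mult_left_mono) auto
      finally show ?thesis using causalD[OF f] by (auto simp: abs_mult intro!: mult_mono)
    qed
    then show "norm (indicat_real {b..t} \<tau> *\<^sub>R (exp (a * \<tau>) * f \<tau>)) \<le> exp (\<bar>a\<bar> * (\<bar>b\<bar> + \<bar>t\<bar>)) * B"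
      using causalD(4)[OF f] by (auto simp: indicator_def)
  qed auto
  note * = set_borel_integral_eq_integral[OF this]
  show "(\<lambda>\<tau>. exp (a * \<tau>) * f \<tau>) integrable_on {b..t}" by (rule *)
  have "expconv a f t = (\<integral>\<tau>. exp (- a * t) * (indicat_real {b..t} \<tau> * (exp (a * \<tau>) * f \<tau>)) \<partial>lborel)"
    unfolding expconv_def
  proof (rule integral_cong_AE)
    show "AE \<tau> in lborel. (if \<tau> < t then exp (- a * (t - \<tau>)) else 0) * f \<tau> =
        exp (- a * t) * (indicat_real {b..t} \<tau> * (exp (a * \<tau>) * f \<tau>))"
      using AE_lborel_singleton[of t]
    proof eventually_elim
      case (elim \<tau>)
      show ?case
        using causalD(3)[OF f, of \<tau>] \<open>b \<le> 0\<close> elim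
        by (cases "\<tau> < 0") (auto simp: indicator_def right_diff_distrib exp_diff exp_minus field_simps simp flip: exp_add)
    qed
  qed measurable
  then show "expconv a f t = exp (- a * t) * integral {b..t} (\<lambda>\<tau>. exp (a * \<tau>) * f \<tau>)"
    using *(2) by (simp add: set_lebesgue_integral_def)
qed

lemma expconv_nonpos: "causal B f \<Longrightarrow> t \<le> 0 \<Longrightarrow> expconv a f t = 0"
  unfolding expconv_def using causalD(3)[of B f]
  by (intro integral_eq_zero_AE AE_I2) auto

lemma isCont_expconv:
  assumes f: "causal B f"
  shows "isCont (expconv a f) t"
proof -
  define N where "N = \<bar>t\<bar> + 1"
  have "continuous_on {- N..N} (\<lambda>u. exp (- a * u) * integral {- N..u} (\<lambda>\<tau>. exp (a * \<tau>) * f \<tau>))"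
    by (intro continuous_intros indefinite_integral_continuous_1 expconv_eq(1)[OF f]) (simp add: N_def)
  then have "continuous_on {- N..N} (expconv a f)"
    by (rule continuous_on_eq) (rule expconv_eq(2)[OF f, symmetric], simp add: N_def)
  then show ?thesis
    by (rule continuous_on_interior) (auto simp: N_def)
qed

lemma expconv_has_derivative:
  assumes f: "causal B f" "continuous_on {0..T} f" "t \<in> {0..T}"
  shows "(expconv a f has_real_derivative f t - a * expconv a f t) (at t within {0..T})"
proof -
  let ?I = "\<lambda>u. integral {0..u} (\<lambda>\<tau>. exp (a * \<tau>) * f \<tau>)"
  have "(?I has_real_derivative exp (a * t) * f t) (at t within {0..T})"
    using f by (intro integral_has_real_derivative continuous_intros)
  then have "((\<lambda>u. exp (- a * u) * ?I u) has_real_derivative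
      exp (- a * t) * (exp (a * t) * f t) + (- a * exp (- a * t)) * ?I t) (at t within {0..T})"
    by (auto intro!: derivative_eq_intros)
  moreover have "exp (- a * t) * (exp (a * t) * f t) + (- a * exp (- a * t)) * ?I t
      = f t - a * expconv a f t"
  proof -
    have e: "exp (- a * t) * exp (a * t) = 1" by (simp flip: exp_add)
    show ?thesis
      unfolding expconv_eq(2)[OF f(1) order_refl] by (simp only: mult.assoc[symmetric] e) 
  qed
  ultimately have "((\<lambda>u. exp (- a * u) * ?I u) has_real_derivative f t - a * expconv a f t) (at t within {0..T})"
    by (simp only:)
  then show ?thesis
    by (rule has_field_derivative_transform_within[of _ _ _ _ 1])
       (use f(3) expconv_eq(2)[OF f(1), of 0] in auto)
qed

lemma integral_exp_lborel:
  fixes c :: real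
  assumes "c \<noteq> 0" "a \<le> b"
  shows "(\<integral>x. indicat_real {a..b} x * exp (c * x) \<partial>lborel) = (exp (c * b) - exp (c * a)) / c"
proof -
  have "(\<integral>x. indicat_real {a..b} x *\<^sub>R exp (c * x) \<partial>lborel) = exp (c * b) / c - exp (c * a) / c"
  proof (rule integral_FTC_atLeastAtMost[OF assms(2)])
    show "((\<lambda>x. exp (c * x) / c) has_vector_derivative exp (c * x)) (at x within {a..b})" for x
      unfolding has_real_derivative_iff_has_vector_derivative[symmetric]
      using assms(1) by (auto intro!: derivative_eq_intros)
  qed (intro continuous_intros)
  then show ?thesis by (simp add: diff_divide_distrib)
qed

lemma expconv_bound:
  assumes f: "causal B f" and "a > 0"
  shows "\<bar>expconv a f t\<bar> \<le> B / a"
proof (cases "t \<le> 0")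
  case True
  then show ?thesis using expconv_nonpos[OF f True, of a] causalD(4)[OF f] \<open>a > 0\<close> by simp
next
  case False
  note [measurable] = causalD(1)[OF f]
  have int: "integrable lborel (\<lambda>\<tau>. indicat_real {0..t} \<tau> * exp (a * \<tau>))"
    using borel_integrable_atLeastAtMost'[of 0 t "\<lambda>\<tau>. exp (a * \<tau>)"]
    by (simp add: set_integrable_def continuous_intros)
  have "\<bar>expconv a f t\<bar> \<le> (\<integral>\<tau>. B * exp (- a * t) * (indicat_real {0..t} \<tau> * exp (a * \<tau>)) \<partial>lborel)"
  proof -
    have "norm (expconv a f t) \<le> (\<integral>\<tau>. norm ((if \<tau> < t then exp (- a * (t - \<tau>)) else 0) * f \<tau>) \<partial>lborel)"
      unfolding expconv_def by (rule integral_norm_bound)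
    also have "\<dots> \<le> (\<integral>\<tau>. B * exp (- a * t) * (indicat_real {0..t} \<tau> * exp (a * \<tau>)) \<partial>lborel)"
    proof (rule integral_mono_AE')
      show "integrable lborel (\<lambda>\<tau>. B * exp (- a * t) * (indicat_real {0..t} \<tau> * exp (a * \<tau>)))"
        using int by simp
      show "AE \<tau> in lborel. norm ((if \<tau> < t then exp (- a * (t - \<tau>)) else 0) * f \<tau>)
          \<le> B * exp (- a * t) * (indicat_real {0..t} \<tau> * exp (a * \<tau>))"
      proof (rule AE_I2)
        fix \<tau>
        have "exp (- a * (t - \<tau>)) = exp (- a * t) * exp (a * \<tau>)" by (simp add: algebra_simps flip: exp_add)
        then show "norm ((if \<tau> < t then exp (- a * (t - \<tau>)) else 0) * f \<tau>)
          \<le> B * exp (- a * t) * (indicat_real {0..t} \<tau> * exp (a * \<tau>))"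
          using causalD[OF f] by (cases "\<tau> < 0") (auto simp: abs_mult indicator_def mult.commute intro: mult_left_mono)
      qed
    qed (use causalD(4)[OF f] in \<open>auto intro!: AE_I2 mult_nonneg_nonneg\<close>)
    finally show ?thesis by simp
  qed
  also have "\<dots> = B * exp (- a * t) * ((exp (a * t) - exp (a * 0)) / a)"
    using False \<open>a > 0\<close> by (simp add: integral_exp_lborel)
  also have "\<dots> = B * (1 - exp (- a * t)) / a"
    by (simp add: field_simps flip: exp_add)
  also have "\<dots> \<le> B * 1 / a"
    using causalD(4)[OF f] \<open>a > 0\<close> by (intro divide_right_mono mult_left_mono) auto
  finally show ?thesis by simp
qed

lemma causal_expconv:
  assumes "causal B f" "a > 0"
  shows "causal (B / a) (expconv a f)"
  unfolding causal_def
  using assms expconv_measurable[OF causalD(1)] expconv_bound expconv_nonpos by auto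

text \<open>The resolvent identity: by Fubini the inner kernel is the convolution of two
  exponentials, and partial fractions split it.\<close>

lemma expconv_expconv:
  assumes f: "causal B f" and ab: "a > 0" "b > 0" "a \<noteq> b"
  shows "expconv a (expconv b f) t = (expconv b f t - expconv a f t) / (a - b)"
proof -
  note [measurable] = causalD(1)[OF f]
  define F where "F \<sigma> \<tau> = (if \<tau> < \<sigma> \<and> \<sigma> < t then exp (- a * (t - \<sigma>)) * exp (- b * (\<sigma> - \<tau>)) else 0) * f \<tau>" for \<sigma> \<tau>
  have F: "integrable (lborel \<Otimes>\<^sub>M lborel) (case_prod F)"
  proof (rule integrable_pair_bounded_support[of _ "1 * B" 0 t 0 t])
    show "case_prod F \<in> borel_measurable borel"
      unfolding F_def[abs_def] borel_prod[symmetric] by measurable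
    fix \<sigma> \<tau>
    have "\<bar>if \<tau> < \<sigma> \<and> \<sigma> < t then exp (- a * (t - \<sigma>)) * exp (- b * (\<sigma> - \<tau>)) else 0\<bar> \<le> 1"
      using ab by (auto simp: mult_le_0_iff intro!: mult_le_one)
    then show "\<bar>case (\<sigma>, \<tau>) of (\<sigma>, \<tau>) \<Rightarrow> F \<sigma> \<tau>\<bar> \<le> 1 * B"
      unfolding F_def abs_mult prod.case using causalD[OF f] by (intro mult_mono) auto
    show "\<sigma> \<notin> {0..t} \<or> \<tau> \<notin> {0..t} \<Longrightarrow> (case (\<sigma>, \<tau>) of (\<sigma>, \<tau>) \<Rightarrow> F \<sigma> \<tau>) = 0"
      using causalD(3)[OF f, of \<tau>] by (auto simp: F_def)
  qed
  have "expconv a (expconv b f) t = (\<integral>\<sigma>. (\<integral>\<tau>. F \<sigma> \<tau> \<partial>lborel) \<partial>lborel)"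
    unfolding expconv_def
    by (intro Bochner_Integration.integral_cong refl)
       (auto simp: F_def mult.assoc simp flip: Bochner_Integration.integral_mult_right_zero intro!: Bochner_Integration.integral_cong)
  also have "\<dots> = (\<integral>\<tau>. (\<integral>\<sigma>. F \<sigma> \<tau> \<partial>lborel) \<partial>lborel)"
    using lborel_pair.Fubini_integral[OF F] by simp
  also have "\<dots> = (\<integral>\<tau>. ((if \<tau> < t then exp (- b * (t - \<tau>)) else 0) * f \<tau> -
      (if \<tau> < t then exp (- a * (t - \<tau>)) else 0) * f \<tau>) / (a - b) \<partial>lborel)"
  proof (rule Bochner_Integration.integral_cong[OF refl])
    fix \<tau>
    show "(\<integral>\<sigma>. F \<sigma> \<tau> \<partial>lborel) = ((if \<tau> < t then exp (- b * (t - \<tau>)) else 0) * f \<tau> -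
      (if \<tau> < t then exp (- a * (t - \<tau>)) else 0) * f \<tau>) / (a - b)"
    proof (cases "\<tau> < t")
      case True
      have "(\<integral>\<sigma>. F \<sigma> \<tau> \<partial>lborel) =
          (\<integral>\<sigma>. (exp (- a * t + b * \<tau>) * f \<tau>) * (indicat_real {\<tau>..t} \<sigma> * exp ((a - b) * \<sigma>)) \<partial>lborel)"
      proof (rule integral_cong_AE)
        show "AE \<sigma> in lborel. F \<sigma> \<tau> = (exp (- a * t + b * \<tau>) * f \<tau>) * (indicat_real {\<tau>..t} \<sigma> * exp ((a - b) * \<sigma>))"
          using AE_lborel_singleton[of t] AE_lborel_singleton[of \<tau>]
          by eventually_elim (auto simp: F_def indicator_def algebra_simps simp flip: exp_add)
      qed (unfold F_def, measurable)
      also have "\<dots> = (exp (- a * t + b * \<tau>) * f \<tau>) * ((exp ((a - b) * t) - exp ((a - b) * \<tau>)) / (a - b))"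
        using True ab(3) by (simp add: integral_exp_lborel)
      also have "\<dots> = (exp (- a * t + b * \<tau>) * exp ((a - b) * t) - exp (- a * t + b * \<tau>) * exp ((a - b) * \<tau>)) * f \<tau> / (a - b)"
        by (simp add: algebra_simps)
      also have "exp (- a * t + b * \<tau>) * exp ((a - b) * t) = exp (- b * (t - \<tau>))"
        by (simp add: algebra_simps flip: exp_add)
      also have "exp (- a * t + b * \<tau>) * exp ((a - b) * \<tau>) = exp (- a * (t - \<tau>))"
        by (simp add: algebra_simps flip: exp_add)
      finally show ?thesis using True by (simp add: left_diff_distrib)
    qed (auto simp: F_def intro!: integral_eq_zero_AE)
  qed
  also have "\<dots> = (expconv b f t - expconv a f t) / (a - b)"
  proof -
    have "integrable lborel (\<lambda>\<tau>. (if \<tau> < t then exp (- c * (t - \<tau>)) else 0) * f \<tau>)" if "c > 0" for c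
    proof (rule integrable_bounded_support[of _ "1 * B" "{0..t}"])
      fix \<tau>
      show "norm ((if \<tau> < t then exp (- c * (t - \<tau>)) else 0) * f \<tau>) \<le> 1 * B"
        unfolding norm_mult using causalD[OF f] that by (intro mult_mono) auto
    qed (use causalD(3)[OF f] in \<open>auto simp: not_le\<close>)
    then show ?thesis using ab by (simp add: expconv_def Bochner_Integration.integral_diff)
  qed
  finally show ?thesis .
qed

text \<open>For distinct rates the right-hand side of the resolvent identity is symmetric in
  \<open>a\<close> and \<open>b\<close>.\<close>

lemma expconv_commute:
  assumes "causal B f" "a > 0" "b > 0"
  shows "expconv a (expconv b f) t = expconv b (expconv a f) t"
proof (cases "a = b")
  case False
  then show ?thesis
    using expconv_expconv[OF assms False] expconv_expconv[OF assms(1,3,2), of t]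
      minus_divide_divide[of "expconv b f t - expconv a f t" "a - b"] by simp
qed simp

section \<open>The forward average and its adjoint\<close>

definition fwd :: "real \<Rightarrow> (real \<Rightarrow> real) \<Rightarrow> real \<Rightarrow> real" where
  "fwd h f t = expconv (1 / h) f t / h"

text \<open>While \<open>fwd h\<close> inverts \<open>1 + h d/dt\<close> with zero initial value,
  \<open>bwd h T\<close> inverts \<open>1 - h d/dt\<close> with zero value at \<open>T\<close>. They
  are adjoint to each other on \<open>(0,T)\<close>.\<close>

definition bwd :: "real \<Rightarrow> real \<Rightarrow> (real \<Rightarrow> real) \<Rightarrow> real \<Rightarrow> real" where
  "bwd h T g t = (\<integral>\<sigma>. (if t < \<sigma> \<and> \<sigma> < T then exp (- (1 / h) * (\<sigma> - t)) / h else 0) * g \<sigma> \<partial>lborel)"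

lemma causal_fwd:
  assumes "causal B f" "h > 0"
  shows "causal B (fwd h f)"
proof -
  have c: "causal (B / (1 / h)) (expconv (1 / h) f)" using assms by (intro causal_expconv) auto
  note [measurable] = causalD(1)[OF c]
  have "\<bar>fwd h f t\<bar> \<le> B" for t
    using causalD(2)[OF c, of t] assms(2) by (simp add: fwd_def abs_divide field_simps)
  then show ?thesis using causalD(3)[OF c] unfolding causal_def fwd_def[abs_def] by auto
qed

lemma isCont_fwd: "causal B f \<Longrightarrow> isCont (fwd h f) t"
  unfolding fwd_def[abs_def] divide_inverse by (intro continuous_intros isCont_expconv)

lemma fwd_nonpos: "causal B f \<Longrightarrow> t \<le> 0 \<Longrightarrow> fwd h f t = 0"
  by (simp add: fwd_def expconv_nonpos)

lemma fwd_has_derivative: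
  assumes "causal B f" "continuous_on {0..T} f" "t \<in> {0..T}"
  shows "(fwd h f has_real_derivative (f t - fwd h f t) / h) (at t within {0..T})"
  unfolding fwd_def[abs_def]
  by (rule DERIV_cong[OF DERIV_cdivide[OF expconv_has_derivative[OF assms]]]) simp

lemma bwd_eq:
  assumes g: "continuous_on {0..T} g" and t: "t \<in> {0..T}"
  shows "bwd h T g t = exp (t / h) / h *
     (integral {0..T} (\<lambda>\<sigma>. exp (- \<sigma> / h) * g \<sigma>) - integral {0..t} (\<lambda>\<sigma>. exp (- \<sigma> / h) * g \<sigma>))"
proof -
  let ?G = "\<lambda>\<sigma>. exp (- \<sigma> / h) * g \<sigma>"
  have cG: "continuous_on {0..T} ?G"
    unfolding divide_inverse by (intro continuous_intros g)
  then have si: "set_integrable lborel {t..T} ?G"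
    using t by (intro borel_integrable_atLeastAtMost' continuous_on_subset[OF cG]) auto
  have "bwd h T g t = (\<integral>\<sigma>. exp (t / h) / h * (indicat_real {t..T} \<sigma> *\<^sub>R ?G \<sigma>) \<partial>lborel)"
    unfolding bwd_def
  proof (rule integral_cong_AE)
    have "AE \<sigma> in lborel. (if t < \<sigma> \<and> \<sigma> < T then exp (- (1 / h) * (\<sigma> - t)) / h else 0) * g \<sigma> =
       exp (t / h) / h * (indicat_real {t..T} \<sigma> *\<^sub>R ?G \<sigma>)"
      using AE_lborel_singleton[of t] AE_lborel_singleton[of T]
      by eventually_elim (auto simp: indicator_def diff_divide_distrib simp flip: exp_add)
    then show "AE \<sigma> in lborel. (if t < \<sigma> \<and> \<sigma> < T then exp (- (1 / h) * (\<sigma> - t)) / h else 0) * g \<sigma> =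
       exp (t / h) / h * (indicat_real {t..T} \<sigma> *\<^sub>R ?G \<sigma>)" .
    show m: "(\<lambda>\<sigma>. exp (t / h) / h * (indicat_real {t..T} \<sigma> *\<^sub>R ?G \<sigma>)) \<in> borel_measurable lborel"
      using si unfolding set_integrable_def by (intro borel_measurable_times borel_measurable_integrable) auto
    have "continuous_on {t<..<T} (\<lambda>\<sigma>. exp (- (1 / h) * (\<sigma> - t)) / h * g \<sigma>)"
      unfolding divide_inverse using t by (intro continuous_intros continuous_on_subset[OF g]) auto
    then have "(\<lambda>\<sigma>. indicat_real {t<..<T} \<sigma> *\<^sub>R (exp (- (1 / h) * (\<sigma> - t)) / h * g \<sigma>)) \<in> borel_measurable borel"
      by (intro borel_measurable_continuous_on_indicator) auto
    moreover have "(\<lambda>\<sigma>. indicat_real {t<..<T} \<sigma> *\<^sub>R (exp (- (1 / h) * (\<sigma> - t)) / h * g \<sigma>)) =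
       (\<lambda>\<sigma>. (if t < \<sigma> \<and> \<sigma> < T then exp (- (1 / h) * (\<sigma> - t)) / h else 0) * g \<sigma>)"
      by (auto simp: indicator_def fun_eq_iff)
    ultimately show "(\<lambda>\<sigma>. (if t < \<sigma> \<and> \<sigma> < T then exp (- (1 / h) * (\<sigma> - t)) / h else 0) * g \<sigma>) \<in> borel_measurable lborel"
      by simp
  qed
  also have "\<dots> = exp (t / h) / h * integral {t..T} ?G"
    using set_borel_integral_eq_integral(2)[OF si] by (simp add: set_lebesgue_integral_def)
  also have "integral {t..T} ?G = integral {0..T} ?G - integral {0..t} ?G"
    using Henstock_Kurzweil_Integration.integral_combine[of 0 t T ?G] t integrable_continuous_real[OF cG] by simp
  finally show ?thesis .
qed

lemma bwd_has_derivative: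
  assumes g: "continuous_on {0..T} g" and t: "t \<in> {0..T}" and h: "h > 0"
  shows "(bwd h T g has_real_derivative (bwd h T g t - g t) / h) (at t within {0..T})"
proof -
  let ?G = "\<lambda>\<sigma>. exp (- \<sigma> / h) * g \<sigma>"
  have "((\<lambda>u. integral {0..u} ?G) has_real_derivative ?G t) (at t within {0..T})"
    using t h by (intro integral_has_real_derivative continuous_intros g) auto
  then have "((\<lambda>u. exp (u / h) / h * (integral {0..T} ?G - integral {0..u} ?G)) has_real_derivative
     exp (t / h) / h * (- ?G t) + (exp (t / h) / h / h) * (integral {0..T} ?G - integral {0..t} ?G)) (at t within {0..T})"
    using h by (auto intro!: derivative_eq_intros simp: field_simps)
  moreover have "exp (t / h) / h * (- ?G t) + (exp (t / h) / h / h) * (integral {0..T} ?G - integral {0..t} ?G)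
      = (bwd h T g t - g t) / h"
  proof -
    have e: "exp (t / h) * exp (- t / h) = 1" by (simp flip: exp_add)
    have "exp (t / h) / h * (- ?G t) = - (exp (t / h) * exp (- t / h)) * g t / h" by simp
    then show ?thesis unfolding bwd_eq[OF g t] e by (simp add: diff_divide_distrib)
  qed
  ultimately have "((\<lambda>u. exp (u / h) / h * (integral {0..T} ?G - integral {0..u} ?G)) has_real_derivative
     (bwd h T g t - g t) / h) (at t within {0..T})" by simp
  then show ?thesis
    by (rule has_field_derivative_transform_within[of _ _ _ _ 1]) (use t bwd_eq[OF g] in auto)
qed

lemma bwd_end: "bwd h T g T = 0"
  unfolding bwd_def by (intro integral_eq_zero_AE AE_I2) auto

text \<open>Fubini on the triangle \<open>0 < t < \<sigma> < T\<close>. Since \<open>r\<close>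
  vanishes at negative times, the inner integral over \<open>t\<close> is the full forward
  average.\<close>

lemma bwd_fwd_duality:
  assumes g: "causal B g" and r: "causal C r" and h: "h > 0"
  shows "(\<integral>t. indicat_real {0<..<T} t * (bwd h T g t * r t) \<partial>lborel) =
    (\<integral>t. indicat_real {0<..<T} t * (g t * fwd h r t) \<partial>lborel)"
proof -
  note [measurable] = causalD(1)[OF g] causalD(1)[OF r]
  define H where "H t \<sigma> = (indicat_real {0<..<T} t *
    (if t < \<sigma> \<and> \<sigma> < T then exp (- (1 / h) * (\<sigma> - t)) / h else 0)) * (g \<sigma> * r t)" for t \<sigma>
  have H: "integrable (lborel \<Otimes>\<^sub>M lborel) (case_prod H)"
  proof (rule integrable_pair_bounded_support[of _ "(1 * (1 / h)) * (B * C)" 0 T 0 T])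
    show "case_prod H \<in> borel_measurable borel"
      unfolding H_def[abs_def] borel_prod[symmetric] by measurable
    fix t \<sigma>
    have "\<bar>if t < \<sigma> \<and> \<sigma> < T then exp (- (1 / h) * (\<sigma> - t)) / h else 0\<bar> \<le> 1 / h"
      using h by (auto simp: divide_right_mono)
    then show "\<bar>case (t, \<sigma>) of (t, \<sigma>) \<Rightarrow> H t \<sigma>\<bar> \<le> 1 * (1 / h) * (B * C)"
      unfolding H_def abs_mult prod.case using causalD[OF g] causalD[OF r] h
      by (intro mult_mono) (auto simp: indicator_def)
    show "t \<notin> {0..T} \<or> \<sigma> \<notin> {0..T} \<Longrightarrow> (case (t, \<sigma>) of (t, \<sigma>) \<Rightarrow> H t \<sigma>) = 0"
      using causalD(3)[OF g, of \<sigma>] by (auto simp: H_def)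
  qed
  have "(\<integral>t. indicat_real {0<..<T} t * (bwd h T g t * r t) \<partial>lborel) = (\<integral>t. (\<integral>\<sigma>. H t \<sigma> \<partial>lborel) \<partial>lborel)"
  proof (rule Bochner_Integration.integral_cong[OF refl])
    fix t
    have "(\<integral>\<sigma>. H t \<sigma> \<partial>lborel) = (\<integral>\<sigma>. (indicat_real {0<..<T} t * r t) *
        ((if t < \<sigma> \<and> \<sigma> < T then exp (- (1 / h) * (\<sigma> - t)) / h else 0) * g \<sigma>) \<partial>lborel)"
      by (rule Bochner_Integration.integral_cong) (auto simp: H_def)
    then show "indicat_real {0<..<T} t * (bwd h T g t * r t) = (\<integral>\<sigma>. H t \<sigma> \<partial>lborel)"
      by (simp add: bwd_def)
  qed
  also have "\<dots> = (\<integral>\<sigma>. (\<integral>t. H t \<sigma> \<partial>lborel) \<partial>lborel)"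
    using lborel_pair.Fubini_integral[OF H] by simp
  also have "\<dots> = (\<integral>\<sigma>. indicat_real {0<..<T} \<sigma> * (g \<sigma> * fwd h r \<sigma>) \<partial>lborel)"
  proof (rule Bochner_Integration.integral_cong[OF refl])
    fix \<sigma>
    have "(\<integral>t. H t \<sigma> \<partial>lborel) = (\<integral>t. (indicat_real {0<..<T} \<sigma> * g \<sigma> / h) *
        ((if t < \<sigma> then exp (- (1 / h) * (\<sigma> - t)) else 0) * r t) \<partial>lborel)"
    proof (rule integral_cong_AE)
      show "AE t in lborel. H t \<sigma> = (indicat_real {0<..<T} \<sigma> * g \<sigma> / h) *
        ((if t < \<sigma> then exp (- (1 / h) * (\<sigma> - t)) else 0) * r t)"
        using AE_lborel_singleton[of 0]
      proof eventually_elim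
        case (elim t)
        then show ?case using causalD(3)[OF r, of t]
          by (cases "t < 0") (auto simp: H_def indicator_def)
      qed
    qed (unfold H_def, measurable)
    then show "(\<integral>t. H t \<sigma> \<partial>lborel) = indicat_real {0<..<T} \<sigma> * (g \<sigma> * fwd h r \<sigma>)"
      by (simp add: fwd_def expconv_def)
  qed
  finally show ?thesis .
qed

lemma integrable_indicator_causal:
  fixes f :: "real \<Rightarrow> real"
  assumes "f \<in> borel_measurable borel" "\<And>t. \<bar>f t\<bar> \<le> C"
  shows "integrable lborel (\<lambda>t. indicat_real {0<..<T} t * f t)"
proof (rule integrable_bounded_support[of _ C "{0<..<T}"])
  have "C \<ge> 0" using assms(2)[of 0] by simp
  then show "norm (indicat_real {0<..<T} t * f t) \<le> C" for t
    using assms(2)[of t] by (auto simp: indicator_def)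
  show "(\<lambda>t. indicat_real {0<..<T} t * f t) \<in> borel_measurable borel"
    by (intro borel_measurable_times borel_measurable_indicator assms) simp
  show "bounded {0<..<T}" by (rule bounded_subset[of "{0..T}"]) auto
qed auto

text \<open>
  With \<open>v = fwd h (expconv s w)\<close> one has \<open>v' + s v = z\<close>, and the left-hand side is \<open>\<integral> z v'\<close>.
  The lower bound is pointwise: \<open>z v' - c z\<^sup>2\<close> dominates the derivative of
  \<open>(T - t) v\<^sup>2 / (4 T\<^sup>2) + (1 - 2 c) s v\<^sup>2 / 2\<close>, which vanishes at \<open>0\<close> and is nonnegative at \<open>T\<close>.
\<close>

lemma exponential_coercive:
  fixes w :: "real \<Rightarrow> real"
  assumes w: "causal B w" and pos: "T > 0" "h > 0" "s > 0"
    and c: "0 \<le> c" "c \<le> 1 / 2" "c * s\<^sup>2 \<le> 1 / (8 * T\<^sup>2)"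
  defines "z \<equiv> fwd h w"
  shows "c * (\<integral>t. indicat_real {0<..<T} t * (z t)\<^sup>2 \<partial>lborel) \<le>
    (\<integral>t. indicat_real {0<..<T} t * ((z t - bwd h T z t) / h * expconv s w t) \<partial>lborel)"
proof -
  define r where "r = expconv s w"
  define v where "v = fwd h r"
  define p where "p t = z t - s * v t" for t
  define \<kappa> where "\<kappa> = 1 / (4 * T\<^sup>2)"
  let ?J = "indicat_real {0<..<T}"
  have cz: "causal B z" unfolding z_def by (rule causal_fwd[OF w pos(2)])
  have cr: "causal (B / s) r" unfolding r_def by (rule causal_expconv[OF w pos(3)])
  have cv: "causal (B / s) v" unfolding v_def by (rule causal_fwd[OF cr pos(2)])
  note [measurable] = causalD(1)[OF cz] causalD(1)[OF cr] causalD(1)[OF cv]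
  have cont_z: "continuous_on S z" and cont_r: "continuous_on S r" and cont_v: "continuous_on S v" for S
    unfolding z_def r_def v_def
    by (intro continuous_at_imp_continuous_on ballI isCont_fwd[OF w] isCont_expconv[OF w] isCont_fwd[OF cr[unfolded r_def]])+
  \<comment> \<open>Commuting the two convolutions exhibits \<open>v\<close> as the exponential
    convolution of \<open>z\<close>, which gives the equation \<open>v' = z - s v\<close> in
    addition to the one from the forward average.\<close>
  have v_alt: "v t = expconv s z t" for t
  proof -
    have "v t = expconv s (expconv (1 / h) w) t / h"
      unfolding v_def fwd_def r_def using expconv_commute[OF w, of "1 / h" s t] pos by simp
    also have "\<dots> = expconv s z t"
      unfolding z_def fwd_def[abs_def] expconv_def[of s] by (simp flip: Bochner_Integration.integral_divide_zero)
    finally show ?thesis .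
  qed
  have dv: "(v has_real_derivative p t) (at t within {0..T})" if "t \<in> {0..T}" for t
    using expconv_has_derivative[OF cz cont_z that, of s] v_alt unfolding p_def by (simp add: v_alt[abs_def])
  \<comment> \<open>Both differential equations describe the same derivative of \<open>v\<close>;
    equating them eliminates \<open>r\<close> and the factor \<open>1 / h\<close>.\<close>
  have rv: "(r t - v t) / h = p t" if "t \<in> {0<..<T}" for t
  proof -
    have "at t within {0..T} = at t" using that by (intro at_within_interior) auto
    then have "(v has_real_derivative (r t - v t) / h) (at t)" "(v has_real_derivative p t) (at t)"
      using fwd_has_derivative[OF cr cont_r, of t T h] dv[of t] that by (auto simp: v_def)
    then show ?thesis by (rule DERIV_unique)
  qed
  \<comment> \<open>The backward average is moved onto \<open>r\<close>, where it becomes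
    \<open>v\<close>. The left-hand side turns into \<open>\<integral> z (r - v) / h\<close>, which
    is \<open>\<integral> z v'\<close>.\<close>
  have dual: "(\<integral>t. ?J t * (bwd h T z t * r t) \<partial>lborel) = (\<integral>t. ?J t * (z t * v t) \<partial>lborel)"
    unfolding v_def by (rule bwd_fwd_duality[OF cz cr pos(2)])
  have i1: "integrable lborel (\<lambda>t. ?J t * (z t * r t))" and i2: "integrable lborel (\<lambda>t. ?J t * (z t * v t))"
    by (rule integrable_indicator_causal[where C = "B * (B / s)"], measurable,
        unfold abs_mult, intro mult_mono causalD[OF cz] causalD[OF cr] causalD[OF cv] abs_ge_zero)+
  have bz: "bwd h T z \<in> borel_measurable borel" unfolding bwd_def[abs_def] by measurable
  note [measurable] = bz
  have i3: "integrable lborel (\<lambda>t. ?J t * (bwd h T z t * r t))"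
  proof -
    have "continuous_on {0..T} (bwd h T z)"
      by (rule DERIV_continuous_on[OF bwd_has_derivative[OF cont_z _ pos(2)]])
    then have "continuous_on {0..T} (\<lambda>t. bwd h T z t * r t)" by (intro continuous_intros cont_r)
    then have "set_integrable lborel {0..T} (\<lambda>t. bwd h T z t * r t)"
      by (rule borel_integrable_atLeastAtMost')
    then have "set_integrable lborel {0<..<T} (\<lambda>t. bwd h T z t * r t)"
      by (rule set_integrable_subset) auto
    then show ?thesis by (simp add: set_integrable_def)
  qed
  have "(\<integral>t. ?J t * ((z t - bwd h T z t) / h * r t) \<partial>lborel) =
      (\<integral>t. (?J t * (z t * r t) - ?J t * (bwd h T z t * r t)) / h \<partial>lborel)"
    by (rule Bochner_Integration.integral_cong) (auto simp: algebra_simps diff_divide_distrib)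
  also have "\<dots> = ((\<integral>t. ?J t * (z t * r t) \<partial>lborel) - (\<integral>t. ?J t * (z t * v t) \<partial>lborel)) / h"
    using i1 i3 by (simp add: Bochner_Integration.integral_diff dual)
  also have "\<dots> = (\<integral>t. (?J t * (z t * r t) - ?J t * (z t * v t)) / h \<partial>lborel)"
    using i1 i2 by (simp add: Bochner_Integration.integral_diff)
  also have "\<dots> = (\<integral>t. ?J t * (z t * p t) \<partial>lborel)"
    by (rule Bochner_Integration.integral_cong)
       (auto simp: indicator_def rv[symmetric] right_diff_distrib)
  finally have lhs: "(\<integral>t. ?J t * ((z t - bwd h T z t) / h * r t) \<partial>lborel) = (\<integral>t. ?J t * (z t * p t) \<partial>lborel)" .
  \<comment> \<open>The weight \<open>T - t\<close> encodes a Poincare inequality for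
    \<open>v\<close>, which starts from 0: its derivative supplies the missing \<open>v^2\<close>
    term, at the cost of a cross term absorbed by \<open>p^2\<close>. The factor
    \<open>1 - 2 * c\<close> in the other summand is what remains of \<open>s v v'\<close> after
    subtracting \<open>c z^2\<close>, so these cross terms cancel.\<close>
  define G where "G t = \<kappa> * (T - t) * (v t)\<^sup>2 + (1 - 2 * c) * s * (v t)\<^sup>2 / 2" for t
  define G' where "G' t = - \<kappa> * (v t)\<^sup>2 + \<kappa> * (T - t) * (2 * v t * p t) + (1 - 2 * c) * s * v t * p t" for t
  have contG': "continuous_on {0..T} G'"
    unfolding G'_def p_def by (intro continuous_intros cont_z cont_v)
  have FTC: "(\<integral>t. indicat_real {0..T} t *\<^sub>R G' t \<partial>lborel) = G T - G 0"
  proof (rule integral_FTC_atLeastAtMost)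
    fix t assume t: "0 \<le> t" "t \<le> T"
    have "(G has_real_derivative G' t) (at t within {0..T})"
      unfolding G_def G'_def
      using dv[of t] t by (auto intro!: derivative_eq_intros simp: power2_eq_square field_simps)
    then show "(G has_vector_derivative G' t) (at t within {0..T})"
      by (simp add: has_real_derivative_iff_has_vector_derivative)
  qed (use pos contG' in auto)
  have v0: "v 0 = 0" unfolding v_def by (rule fwd_nonpos[OF cr]) simp
  have "0 \<le> G T - G 0" using c pos by (simp add: G_def v0)
  also have "G T - G 0 = (\<integral>t. ?J t * G' t \<partial>lborel)"
    unfolding FTC[symmetric]
  proof (rule integral_cong_AE)
    show "AE t in lborel. indicat_real {0..T} t *\<^sub>R G' t = ?J t * G' t"
      using AE_lborel_singleton[of 0] AE_lborel_singleton[of T]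
      by eventually_elim (auto simp: indicator_def)
  qed (unfold G'_def p_def, measurable)
  also have "\<dots> \<le> (\<integral>t. ?J t * (z t * p t) - c * (?J t * (z t)\<^sup>2) \<partial>lborel)"
  proof (rule integral_mono)
    have "set_integrable lborel {0<..<T} G'"
      by (rule set_integrable_subset[OF borel_integrable_atLeastAtMost'[OF contG']]) auto
    then show "integrable lborel (\<lambda>t. ?J t * G' t)" by (simp add: set_integrable_def)
    have "set_integrable lborel {0<..<T} (\<lambda>t. z t * p t - c * (z t)\<^sup>2)"
      by (rule set_integrable_subset[OF borel_integrable_atLeastAtMost'[of 0 T]])
         (auto simp: p_def intro!: continuous_intros cont_z cont_v)
    then show "integrable lborel (\<lambda>t. ?J t * (z t * p t) - c * (?J t * (z t)\<^sup>2))"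
      by (simp add: set_integrable_def algebra_simps)
    fix t
    show "?J t * G' t \<le> ?J t * (z t * p t) - c * (?J t * (z t)\<^sup>2)"
    proof (cases "t \<in> {0<..<T}")
      case True
      define \<theta> where "\<theta> = \<kappa> * (T - t)"
      have zt: "z t = p t + s * v t" by (simp add: p_def)
      have "\<kappa> > 0" using pos by (simp add: \<kappa>_def)
      have "(T - t)\<^sup>2 \<le> T\<^sup>2" using True by (intro power_mono) auto
      then have "\<theta>\<^sup>2 \<le> \<kappa>\<^sup>2 * T\<^sup>2" unfolding \<theta>_def power_mult_distrib by (intro mult_left_mono) auto
      also have "\<dots> = \<kappa> / 4" using pos by (simp add: \<kappa>_def power2_eq_square field_simps)
      finally have \<theta>: "\<theta>\<^sup>2 \<le> \<kappa> / 4" .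
      \<comment> \<open>Completing the square. The four coefficients are nonnegative because
        \<open>c \<le> 1 / 2\<close>, because \<open>c * s^2\<close> is at most
        \<open>\<kappa> / 2 = 1 / (8 T^2)\<close>, and by the bound on
        \<open>\<theta>\<close>.\<close>
      have "z t * p t - c * (z t)\<^sup>2 - G' t =
          (1/2 - c) * (p t)\<^sup>2 + (1/2) * (p t - 2 * \<theta> * v t)\<^sup>2 + (\<kappa> / 2 - c * s\<^sup>2) * (v t)\<^sup>2 + 2 * (\<kappa> / 4 - \<theta>\<^sup>2) * (v t)\<^sup>2"
        unfolding G'_def zt \<theta>_def[symmetric] by (simp add: power2_eq_square algebra_simps)
      also have "\<dots> \<ge> 0"
        using c \<theta> by (intro add_nonneg_nonneg mult_nonneg_nonneg) (auto simp: \<kappa>_def)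
      finally show ?thesis using True by simp
    qed simp
  qed
  also have "\<dots> = (\<integral>t. ?J t * (z t * p t) \<partial>lborel) - c * (\<integral>t. ?J t * (z t)\<^sup>2 \<partial>lborel)"
  proof (subst Bochner_Integration.integral_diff)
    have "set_integrable lborel {0<..<T} (\<lambda>t. z t * p t)" "set_integrable lborel {0<..<T} (\<lambda>t. c * (z t)\<^sup>2)"
      by (rule set_integrable_subset[OF borel_integrable_atLeastAtMost'[of 0 T]];
          auto simp: p_def intro!: continuous_intros cont_z cont_v)+
    then show "integrable lborel (\<lambda>t. ?J t * (z t * p t))" "integrable lborel (\<lambda>t. c * (?J t * (z t)\<^sup>2))"
      by (simp_all add: set_integrable_def mult.left_commute)
  qed simp
  finally show ?thesis unfolding r_def[symmetric] lhs by simp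
qed

section \<open>The symmetric average and approximation of the identity\<close>

text \<open>The Green function of \<open>1 - h^2 d^2/dt^2\<close> with value zero at
  \<open>T\<close>, obtained by reflecting the free kernel at \<open>T\<close>. Beyond
  \<open>T\<close> the reflected term may dominate, so the sign and the bounds hold only for times
  up to \<open>T\<close>.\<close>

definition sker :: "real \<Rightarrow> real \<Rightarrow> real \<Rightarrow> real \<Rightarrow> real" where
  "sker h T t \<tau> = (exp (- \<bar>t - \<tau>\<bar> / h) - exp (- (2 * T - t - \<tau>) / h)) / (2 * h)"

definition sym_avg :: "real \<Rightarrow> real \<Rightarrow> (real \<Rightarrow> real) \<Rightarrow> real \<Rightarrow> real" where
  "sym_avg h T f t = (\<integral>\<tau>. sker h T t \<tau> * f \<tau> \<partial>lborel)"

lemma sker_bounds: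
  assumes "h > 0" "t \<le> T" "\<tau> \<le> T"
  shows "0 \<le> sker h T t \<tau>" "sker h T t \<tau> \<le> exp (- \<bar>t - \<tau>\<bar> / h) / (2 * h)" "sker h T t \<tau> \<le> 1 / (2 * h)"
proof -
  have "- (2 * T - t - \<tau>) \<le> - \<bar>t - \<tau>\<bar>" using assms by (simp add: abs_if)
  then have "exp (- (2 * T - t - \<tau>) / h) \<le> exp (- \<bar>t - \<tau>\<bar> / h)"
    using assms(1) by (subst exp_le_cancel_iff) (intro divide_right_mono, auto)
  then show "0 \<le> sker h T t \<tau>" using assms(1) by (simp add: sker_def)
  show le: "sker h T t \<tau> \<le> exp (- \<bar>t - \<tau>\<bar> / h) / (2 * h)"
    using assms(1) by (simp add: sker_def divide_right_mono)
  have "exp (- \<bar>t - \<tau>\<bar> / h) / (2 * h) \<le> 1 / (2 * h)"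
    using assms(1) by (intro divide_right_mono) auto
  with le show "sker h T t \<tau> \<le> 1 / (2 * h)" by simp
qed

lemma sker_measurable [measurable]: "case_prod (sker h T) \<in> borel_measurable (borel \<Otimes>\<^sub>M borel)"
  unfolding sker_def[abs_def] by measurable

text \<open>The composition of the two averages has an explicit symmetric kernel. The kernel form
  also makes sense for functions that are merely square integrable, as the gradients are.\<close>

lemma bwd_fwd_eq_sym_avg:
  assumes f: "causal B f" "\<And>\<tau>. \<tau> \<ge> T \<Longrightarrow> f \<tau> = 0" and h: "h > 0" and t: "t \<le> T"
  shows "bwd h T (fwd h f) t = sym_avg h T f t"
proof -
  note [measurable] = causalD(1)[OF f(1)]
  define F where "F \<sigma> \<tau> = ((if t < \<sigma> \<and> \<sigma> < T then exp (- (1 / h) * (\<sigma> - t)) / h else 0) *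
     (if \<tau> < \<sigma> then exp (- (1 / h) * (\<sigma> - \<tau>)) / h else 0)) * f \<tau>" for \<sigma> \<tau>
  have F: "integrable (lborel \<Otimes>\<^sub>M lborel) (case_prod F)"
  proof (rule integrable_pair_bounded_support[of _ "((1 / h) * (1 / h)) * B" t T 0 T])
    show "case_prod F \<in> borel_measurable borel"
      unfolding F_def[abs_def] borel_prod[symmetric] by measurable
    fix \<sigma> \<tau>
    have "\<bar>if t < \<sigma> \<and> \<sigma> < T then exp (- (1 / h) * (\<sigma> - t)) / h else 0\<bar> \<le> 1 / h"
      "\<bar>if \<tau> < \<sigma> then exp (- (1 / h) * (\<sigma> - \<tau>)) / h else 0\<bar> \<le> 1 / h"
      using h by (auto simp: divide_right_mono)
    then show "\<bar>case (\<sigma>, \<tau>) of (\<sigma>, \<tau>) \<Rightarrow> F \<sigma> \<tau>\<bar> \<le> ((1 / h) * (1 / h)) * B"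
      unfolding F_def abs_mult prod.case using causalD[OF f(1)] h
      by (intro mult_mono) auto
    show "\<sigma> \<notin> {t..T} \<or> \<tau> \<notin> {0..T} \<Longrightarrow> (case (\<sigma>, \<tau>) of (\<sigma>, \<tau>) \<Rightarrow> F \<sigma> \<tau>) = 0"
      using causalD(3)[OF f(1), of \<tau>] f(2)[of \<tau>] by (auto simp: F_def)
  qed
  have "bwd h T (fwd h f) t = (\<integral>\<sigma>. (\<integral>\<tau>. F \<sigma> \<tau> \<partial>lborel) \<partial>lborel)"
    unfolding bwd_def
  proof (rule Bochner_Integration.integral_cong[OF refl])
    fix \<sigma>
    have "(\<integral>\<tau>. F \<sigma> \<tau> \<partial>lborel) = (\<integral>\<tau>. (if t < \<sigma> \<and> \<sigma> < T then exp (- (1 / h) * (\<sigma> - t)) / h else 0) / h *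
       ((if \<tau> < \<sigma> then exp (- (1 / h) * (\<sigma> - \<tau>)) else 0) * f \<tau>) \<partial>lborel)"
      by (rule Bochner_Integration.integral_cong) (auto simp: F_def)
    then show "(if t < \<sigma> \<and> \<sigma> < T then exp (- (1 / h) * (\<sigma> - t)) / h else 0) * fwd h f \<sigma> = (\<integral>\<tau>. F \<sigma> \<tau> \<partial>lborel)"
      by (simp add: fwd_def expconv_def)
  qed
  also have "\<dots> = (\<integral>\<tau>. (\<integral>\<sigma>. F \<sigma> \<tau> \<partial>lborel) \<partial>lborel)"
    using lborel_pair.Fubini_integral[OF F] by simp
  also have "\<dots> = sym_avg h T f t"
    unfolding sym_avg_def
  proof (rule Bochner_Integration.integral_cong[OF refl])
    fix \<tau>
    show "(\<integral>\<sigma>. F \<sigma> \<tau> \<partial>lborel) = sker h T t \<tau> * f \<tau>"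
    proof (cases "\<tau> < T")
      case True
      \<comment> \<open>The intermediate time \<open>\<sigma>\<close> lies after both
        \<open>t\<close> and \<open>\<tau>\<close>. The lower limit of its range produces the term
        with \<open>\<bar>t - \<tau>\<bar>\<close>, the upper limit \<open>T\<close> the reflected
        term.\<close>
      define m where "m = max t \<tau>"
      have m: "m \<le> T" using True t by (simp add: m_def)
      have "(\<integral>\<sigma>. F \<sigma> \<tau> \<partial>lborel) = (\<integral>\<sigma>. (exp ((t + \<tau>) / h) / h\<^sup>2 * f \<tau>) * (indicat_real {m..T} \<sigma> * exp ((- 2 / h) * \<sigma>)) \<partial>lborel)"
      proof (rule integral_cong_AE)
        show "AE \<sigma> in lborel. F \<sigma> \<tau> = (exp ((t + \<tau>) / h) / h\<^sup>2 * f \<tau>) * (indicat_real {m..T} \<sigma> * exp ((- 2 / h) * \<sigma>))"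
          using AE_lborel_singleton[of m] AE_lborel_singleton[of T]
        proof eventually_elim
          case (elim \<sigma>)
          have "exp (- (1 / h) * (\<sigma> - t)) * exp (- (1 / h) * (\<sigma> - \<tau>)) = exp ((t + \<tau>) / h) * exp ((- 2 / h) * \<sigma>)"
            by (simp add: diff_divide_distrib add_divide_distrib algebra_simps flip: exp_add)
          then show ?case
            using elim by (auto simp: F_def indicator_def m_def power2_eq_square)
        qed
      qed (unfold F_def, measurable)
      also have "\<dots> = (exp ((t + \<tau>) / h) / h\<^sup>2 * f \<tau>) * ((exp ((- 2 / h) * T) - exp ((- 2 / h) * m)) / (- 2 / h))"
        using integral_exp_lborel[of "- 2 / h" m T] h m by simp
      also have "\<dots> = (exp ((t + \<tau>) / h) * exp ((- 2 / h) * m) - exp ((t + \<tau>) / h) * exp ((- 2 / h) * T)) / (2 * h) * f \<tau>"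
        using h by (simp add: field_simps power2_eq_square)
      also have "exp ((t + \<tau>) / h) * exp ((- 2 / h) * m) = exp (- \<bar>t - \<tau>\<bar> / h)"
        by (simp add: m_def max_def abs_if diff_divide_distrib add_divide_distrib flip: exp_add)
      also have "exp ((t + \<tau>) / h) * exp ((- 2 / h) * T) = exp (- (2 * T - t - \<tau>) / h)"
        by (simp add: diff_divide_distrib add_divide_distrib flip: exp_add)
      finally show ?thesis by (simp add: sker_def)
    next
      case False
      then show ?thesis by (simp add: f(2) F_def)
    qed
  qed
  finally show ?thesis .
qed

section \<open>The two-sided exponential density and convergence of the averages\<close>

lemma has_bochner_integral_of_has_integral:
  fixes f :: "real \<Rightarrow> real"
  assumes "(f has_integral I) S" "\<And>x. x \<in> S \<Longrightarrow> 0 \<le> f x"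
    "(\<lambda>x. indicat_real S x * f x) \<in> borel_measurable borel"
  shows "has_bochner_integral lborel (\<lambda>x. indicat_real S x * f x) I"
proof (rule has_bochner_integral_nn_integral)
  show "0 \<le> I" using has_integral_nonneg[OF assms(1,2)] .
  have "(\<integral>\<^sup>+x. ennreal (indicat_real S x * f x) \<partial>lborel) = (\<integral>\<^sup>+x. indicator S x * ennreal (f x) \<partial>lborel)"
    by (intro nn_integral_cong) (auto simp: indicator_def)
  then show "(\<integral>\<^sup>+x. ennreal (indicat_real S x * f x) \<partial>lborel) = ennreal I"
    using nn_integral_has_integral_lebesgue[OF assms(2,1)] by simp
qed (use assms in \<open>auto simp: indicator_def\<close>)

lemma has_bochner_integral_exp_abs: "has_bochner_integral lborel (\<lambda>x::real. exp (- \<bar>x\<bar>) / 2) 1"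
proof -
  let ?f = "\<lambda>x::real. indicat_real {0..} x * exp (- x)"
  have "((\<lambda>x::real. exp (- x)) has_integral 1) {0..}"
    using has_integral_exp_minus_to_infinity[of 1 0] by simp
  then have 0: "has_bochner_integral lborel ?f 1"
    by (rule has_bochner_integral_of_has_integral) auto
  have "integrable lborel (\<lambda>x. ?f (0 + (-1) * x))"
    by (rule lborel_integrable_real_affine) (use 0 in \<open>auto simp: has_bochner_integral_iff\<close>)
  moreover have "(\<integral>x. ?f (0 + (-1) * x) \<partial>lborel) = 1"
    using lborel_integral_real_affine[of "-1" ?f 0] 0 by (simp add: has_bochner_integral_iff)
  ultimately have 1: "has_bochner_integral lborel (\<lambda>x. ?f (- x)) 1"
    by (simp add: has_bochner_integral_iff)
  have 2: "has_bochner_integral lborel (\<lambda>x. (?f x + ?f (- x)) / 2) ((1 + 1) / 2)"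
    by (intro has_bochner_integral_divide_zero has_bochner_integral_add 0 1)
  show ?thesis
  proof (rule has_bochner_integral_cong_AE[THEN iffD1, OF _ _ _ 2[simplified]])
    show "AE x in lborel. (indicat_real {0..} x * exp (- x) + indicat_real {0..} (- x) * exp x) / 2 = exp (- \<bar>x\<bar>) / 2"
      using AE_lborel_singleton[of 0] by eventually_elim (auto simp: indicator_def abs_if)
  qed simp_all
qed

lemma integral_exp_abs:
  fixes h t :: real
  assumes "h > 0"
  shows "integrable lborel (\<lambda>\<tau>. exp (- \<bar>t - \<tau>\<bar> / h) / (2 * h))"
    and "(\<integral>\<tau>. exp (- \<bar>t - \<tau>\<bar> / h) / (2 * h) \<partial>lborel) = 1"
proof -
  let ?E = "\<lambda>x::real. exp (- \<bar>x\<bar>) / 2"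
  note E = has_bochner_integral_exp_abs[unfolded has_bochner_integral_iff]
  have eq: "(\<lambda>\<tau>. exp (- \<bar>t - \<tau>\<bar> / h) / (2 * h)) = (\<lambda>\<tau>. ?E (- t / h + (1 / h) * \<tau>) / h)"
  proof
    fix \<tau> :: real
    have "- t / h + (1 / h) * \<tau> = - ((t - \<tau>) / h)" by (simp add: diff_divide_distrib)
    then have "\<bar>- t / h + (1 / h) * \<tau>\<bar> = \<bar>t - \<tau>\<bar> / h" using assms by (simp add: abs_divide)
    then show "exp (- \<bar>t - \<tau>\<bar> / h) / (2 * h) = ?E (- t / h + (1 / h) * \<tau>) / h" by simp
  qed
  show "integrable lborel (\<lambda>\<tau>. exp (- \<bar>t - \<tau>\<bar> / h) / (2 * h))"
    unfolding eq by (rule integrable_divide_zero, rule lborel_integrable_real_affine) (use E assms in auto)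
  have "1 = \<bar>1 / h\<bar> *\<^sub>R (\<integral>\<tau>. ?E (- t / h + (1 / h) * \<tau>) \<partial>lborel)"
    using lborel_integral_real_affine[of "1 / h" ?E "- t / h"] E assms by simp
  then show "(\<integral>\<tau>. exp (- \<bar>t - \<tau>\<bar> / h) / (2 * h) \<partial>lborel) = 1"
    unfolding eq using assms by simp
qed

text \<open>The density has mass 1 in either variable. Both placements of \<open>q\<close> occur,
  because the two factors of a pairing are evaluated at different times.\<close>

lemma integrable_exp_abs_product:
  fixes q :: "real \<Rightarrow> real"
  assumes h: "h > 0" and q: "integrable lborel q" "\<And>t. q t \<ge> 0"
  defines "K \<equiv> \<lambda>(t, \<tau>). exp (- \<bar>t - \<tau>\<bar> / h) / (2 * h) * q t"
  shows "integrable (lborel \<Otimes>\<^sub>M lborel) K" "integral\<^sup>L (lborel \<Otimes>\<^sub>M lborel) K = (\<integral>t. q t \<partial>lborel)"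
    "integrable (lborel \<Otimes>\<^sub>M lborel) (\<lambda>(t, \<tau>). K (\<tau>, t))"
    "integral\<^sup>L (lborel \<Otimes>\<^sub>M lborel) (\<lambda>(t, \<tau>). K (\<tau>, t)) = (\<integral>t. q t \<partial>lborel)"
proof -
  note [measurable] = borel_measurable_integrable[OF q(1)]
  have inner: "integrable lborel (\<lambda>\<tau>. K (t, \<tau>))" "(\<integral>\<tau>. K (t, \<tau>) \<partial>lborel) = q t" for t
    unfolding K_def prod.case
    by (intro integrable_mult_left integral_exp_abs(1)[OF h])
       (simp only: Bochner_Integration.integral_mult_left_zero integral_exp_abs(2)[OF h] mult_1_left)
  have nn: "norm (K p) = K p" for p
    using q(2) h by (cases p) (simp add: K_def)
  show 1: "integrable (lborel \<Otimes>\<^sub>M lborel) K"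
  proof (rule lborel_pair.Fubini_integrable)
    show "K \<in> borel_measurable (lborel \<Otimes>\<^sub>M lborel)" unfolding K_def by measurable
  qed (simp_all only: nn inner q(1) AE_I2)
  have "integral\<^sup>L (lborel \<Otimes>\<^sub>M lborel) K = (\<integral>t. (\<integral>\<tau>. K (t, \<tau>) \<partial>lborel) \<partial>lborel)"
    using lborel_pair.integral_fst'[OF 1] by simp
  then show 2: "integral\<^sup>L (lborel \<Otimes>\<^sub>M lborel) K = (\<integral>t. q t \<partial>lborel)" by (simp only: inner)
  show "integrable (lborel \<Otimes>\<^sub>M lborel) (\<lambda>(t, \<tau>). K (\<tau>, t))"
    using 1 by (rule lborel_pair.integrable_product_swap)
  show "integral\<^sup>L (lborel \<Otimes>\<^sub>M lborel) (\<lambda>(t, \<tau>). K (\<tau>, t)) = (\<integral>t. q t \<partial>lborel)"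
    using lborel_pair.integral_product_swap[of K] 1 2 by (simp add: borel_measurable_integrable)
qed

lemma young_abs: "\<mu> > 0 \<Longrightarrow> \<bar>a * b\<bar> \<le> (\<mu> * a\<^sup>2 + b\<^sup>2 / \<mu>) / 2" for a b \<mu> :: real
proof -
  assume l: "\<mu> > 0"
  have "0 \<le> (\<mu> * \<bar>a\<bar> - \<bar>b\<bar>)\<^sup>2 / \<mu>" using l by simp
  also have "\<dots> = \<mu> * a\<^sup>2 - 2 * \<bar>a * b\<bar> + b\<^sup>2 / \<mu>"
    using l by (simp add: power2_diff power_mult_distrib abs_mult field_simps power2_eq_square)
  finally show ?thesis by simp
qed

text \<open>A Schur test: inside \<open>(0,T)\<close> the kernel lies between 0 and a density with
  unit marginals, so Young's inequality applied to \<open>f t * g \<tau>\<close> integrates to the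
  stated bound. It is uniform in \<open>h\<close>, and the free parameter \<open>\<mu>\<close> takes
  the place of the Cauchy-Schwarz inequality.\<close>

lemma sym_avg_pairing:
  fixes f g :: "real \<Rightarrow> real"
  assumes f[measurable]: "f \<in> borel_measurable borel" and g[measurable]: "g \<in> borel_measurable borel"
    and f2: "integrable lborel (\<lambda>t. (f t)\<^sup>2)" and g2: "integrable lborel (\<lambda>t. (g t)\<^sup>2)"
    and supp: "\<And>t. t \<notin> {0<..<T} \<Longrightarrow> f t = 0" "\<And>t. t \<notin> {0<..<T} \<Longrightarrow> g t = 0"
    and h: "h > 0"
  shows "integrable lborel (\<lambda>t. f t * sym_avg h T g t)"
    and "\<mu> > 0 \<Longrightarrow> \<bar>\<integral>t. f t * sym_avg h T g t \<partial>lborel\<bar> \<le> (\<mu> * (\<integral>t. (f t)\<^sup>2 \<partial>lborel) + (\<integral>t. (g t)\<^sup>2 \<partial>lborel) / \<mu>) / 2"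
proof -
  define F where "F = (\<lambda>(t, \<tau>). f t * (sker h T t \<tau> * g \<tau>))"
  have mF: "F \<in> borel_measurable (lborel \<Otimes>\<^sub>M lborel)" unfolding F_def by measurable
  have main: "integrable (lborel \<Otimes>\<^sub>M lborel) F \<and>
    \<bar>integral\<^sup>L (lborel \<Otimes>\<^sub>M lborel) F\<bar> \<le> (\<mu> * (\<integral>t. (f t)\<^sup>2 \<partial>lborel) + (\<integral>t. (g t)\<^sup>2 \<partial>lborel) / \<mu>) / 2" if l: "\<mu> > 0" for \<mu>
  proof -
    define K1 where "K1 = (\<lambda>(t, \<tau>). exp (- \<bar>t - \<tau>\<bar> / h) / (2 * h) * (f t)\<^sup>2)"
    define K2 where "K2 = (\<lambda>(t, \<tau>). exp (- \<bar>t - \<tau>\<bar> / h) / (2 * h) * (g t)\<^sup>2)"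
    define D where "D p = (\<mu> * K1 p + (case p of (t, \<tau>) \<Rightarrow> K2 (\<tau>, t)) / \<mu>) / 2" for p
    have i1: "integrable (lborel \<Otimes>\<^sub>M lborel) K1" "integral\<^sup>L (lborel \<Otimes>\<^sub>M lborel) K1 = (\<integral>t. (f t)\<^sup>2 \<partial>lborel)"
      unfolding K1_def using integrable_exp_abs_product[OF h f2] by auto
    have i2: "integrable (lborel \<Otimes>\<^sub>M lborel) (\<lambda>(t, \<tau>). K2 (\<tau>, t))"
      "integral\<^sup>L (lborel \<Otimes>\<^sub>M lborel) (\<lambda>(t, \<tau>). K2 (\<tau>, t)) = (\<integral>t. (g t)\<^sup>2 \<partial>lborel)"
      unfolding K2_def using integrable_exp_abs_product(3,4)[OF h g2] by auto
    have iD: "integrable (lborel \<Otimes>\<^sub>M lborel) D" unfolding D_def using i1 i2 by auto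
    have bound: "norm (F p) \<le> D p" for p
    proof (cases p)
      case (Pair t \<tau>)
      show ?thesis
      proof (cases "t \<in> {0<..<T} \<and> \<tau> \<in> {0<..<T}")
        case True
        have "\<bar>F p\<bar> = sker h T t \<tau> * \<bar>f t * g \<tau>\<bar>"
          using sker_bounds(1)[OF h, of t T \<tau>] True by (simp add: F_def Pair abs_mult)
        also have "\<dots> \<le> exp (- \<bar>t - \<tau>\<bar> / h) / (2 * h) * ((\<mu> * (f t)\<^sup>2 + (g \<tau>)\<^sup>2 / \<mu>) / 2)"
          by (intro mult_mono young_abs l sker_bounds) (use True h in auto)
        also have "\<dots> = D p"
          by (simp add: D_def K1_def K2_def Pair abs_minus_commute algebra_simps add_divide_distrib)
        finally show ?thesis by simp
      next
        case False
        then have "F p = 0" using supp by (auto simp: F_def Pair)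
        moreover have "D p \<ge> 0" using l h by (simp add: D_def K1_def K2_def Pair)
        ultimately show ?thesis by simp
      qed
    qed
    have iF: "integrable (lborel \<Otimes>\<^sub>M lborel) F"
      by (rule Bochner_Integration.integrable_bound[OF iD mF]) (use bound in \<open>auto intro!: AE_I2 order_trans[OF _ abs_ge_self]\<close>)
    have "norm (integral\<^sup>L (lborel \<Otimes>\<^sub>M lborel) F) \<le> integral\<^sup>L (lborel \<Otimes>\<^sub>M lborel) D"
      by (rule Bochner_Integration.integral_norm_bound_integral[OF iF iD bound])
    also have "\<dots> = (\<mu> * (\<integral>t. (f t)\<^sup>2 \<partial>lborel) + (\<integral>t. (g t)\<^sup>2 \<partial>lborel) / \<mu>) / 2"
      unfolding D_def using i1 i2 by (simp add: Bochner_Integration.integral_add)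
    finally show ?thesis using iF by simp
  qed
  have iF: "integrable (lborel \<Otimes>\<^sub>M lborel) F" using main[of 1] by simp
  have inner: "(\<integral>\<tau>. F (t, \<tau>) \<partial>lborel) = f t * sym_avg h T g t" for t
    by (simp add: F_def sym_avg_def)
  show "integrable lborel (\<lambda>t. f t * sym_avg h T g t)"
    using lborel_pair.integrable_fst'[OF iF] by (simp only: inner)
  have "(\<integral>t. f t * sym_avg h T g t \<partial>lborel) = integral\<^sup>L (lborel \<Otimes>\<^sub>M lborel) F"
    using lborel_pair.integral_fst'[OF iF] by (simp only: inner)
  then show "\<mu> > 0 \<Longrightarrow> \<bar>\<integral>t. f t * sym_avg h T g t \<partial>lborel\<bar> \<le> (\<mu> * (\<integral>t. (f t)\<^sup>2 \<partial>lborel) + (\<integral>t. (g t)\<^sup>2 \<partial>lborel) / \<mu>) / 2"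
    using main by simp
qed

lemma sym_avg_measurable:
  assumes [measurable]: "g \<in> borel_measurable borel"
  shows "sym_avg h T g \<in> borel_measurable borel"
  unfolding sym_avg_def[abs_def] by measurable

lemma sym_avg_bound:
  assumes [measurable]: "g \<in> borel_measurable borel"
    and "\<And>\<tau>. \<bar>g \<tau>\<bar> \<le> C" "\<And>\<tau>. \<tau> \<ge> T \<Longrightarrow> g \<tau> = 0" "h > 0" "t \<le> T"
  shows "\<bar>sym_avg h T g t\<bar> \<le> C"
proof -
  have b: "norm (sker h T t \<tau> * g \<tau>) \<le> C * (exp (- \<bar>t - \<tau>\<bar> / h) / (2 * h))" for \<tau>
  proof (cases "\<tau> < T")
    case True
    then have "\<bar>sker h T t \<tau>\<bar> * \<bar>g \<tau>\<bar> \<le> (exp (- \<bar>t - \<tau>\<bar> / h) / (2 * h)) * C"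
      using sker_bounds[OF assms(4,5), of \<tau>] assms by (intro mult_mono) auto
    then show ?thesis by (simp add: abs_mult mult.commute)
  next
    case False
    have "C \<ge> 0" using assms(2)[of 0] by simp
    then show ?thesis using False assms by simp
  qed
  have i: "integrable lborel (\<lambda>\<tau>. C * (exp (- \<bar>t - \<tau>\<bar> / h) / (2 * h)))"
    using integral_exp_abs(1)[OF assms(4)] by (rule integrable_mult_right)
  have "integrable lborel (\<lambda>\<tau>. sker h T t \<tau> * g \<tau>)"
    by (rule Bochner_Integration.integrable_bound[OF i _ AE_I2])
       (measurable, rule order_trans[OF b], simp only: real_norm_def abs_ge_self)
  then have "norm (sym_avg h T g t) \<le> (\<integral>\<tau>. C * (exp (- \<bar>t - \<tau>\<bar> / h) / (2 * h)) \<partial>lborel)"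
    unfolding sym_avg_def using i b by (rule Bochner_Integration.integral_norm_bound_integral)
  also have "\<dots> = C * 1"
    using integral_exp_abs(2)[OF assms(4), of t] by (simp only: Bochner_Integration.integral_mult_right_zero)
  finally show ?thesis by simp
qed

text \<open>Rescaling by \<open>\<tau> = t + h \<sigma>\<close> turns the main part of the kernel
  into a fixed density. The reflected part disappears because \<open>t\<close> lies strictly below
  \<open>T\<close>.\<close>

lemma sym_avg_tendsto:
  assumes c: "continuous_on UNIV c" "\<And>\<tau>. \<bar>c \<tau>\<bar> \<le> C" and t: "t \<in> {0<..<T}"
  shows "(\<lambda>n. sym_avg (1 / real (Suc n)) T (\<lambda>\<tau>. indicat_real {0<..<T} \<tau> * c \<tau>) t) \<longlonglongrightarrow> c t"
proof -
  let ?J = "indicat_real {0<..<T}"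
  note [measurable] = borel_measurable_continuous_onI[OF c(1)]
  define h where "h n = 1 / real (Suc n)" for n
  have h: "h n > 0" for n by (simp add: h_def)
  have h0: "h \<longlonglongrightarrow> 0" unfolding h_def[abs_def] by (rule LIMSEQ_Suc[OF lim_1_over_n])
  have sub: "sym_avg (h n) T (\<lambda>\<tau>. ?J \<tau> * c \<tau>) t =
     (\<integral>\<sigma>. h n * (sker (h n) T t (t + h n * \<sigma>) * (?J (t + h n * \<sigma>) * c (t + h n * \<sigma>))) \<partial>lborel)" for n
    unfolding sym_avg_def using h[of n]
    by (subst lborel_integral_real_affine[where c = "h n" and t = t]) auto
  have hs: "h n * sker (h n) T t (t + h n * \<sigma>) = (exp (- \<bar>\<sigma>\<bar>) - exp (- 2 * (T - t) / h n + \<sigma>)) / 2" for n \<sigma>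
  proof -
    have "- \<bar>t - (t + h n * \<sigma>)\<bar> / h n = - \<bar>\<sigma>\<bar>" using h[of n] by (simp add: abs_mult)
    moreover have "- (2 * T - t - (t + h n * \<sigma>)) / h n = - 2 * (T - t) / h n + \<sigma>"
      using h[of n] by (simp add: field_simps)
    ultimately show ?thesis using h[of n] by (simp add: sker_def)
  qed
  have "(\<lambda>n. \<integral>\<sigma>. h n * (sker (h n) T t (t + h n * \<sigma>) * (?J (t + h n * \<sigma>) * c (t + h n * \<sigma>))) \<partial>lborel)
     \<longlonglongrightarrow> (\<integral>\<sigma>. exp (- \<bar>\<sigma>\<bar>) / 2 * c t \<partial>lborel)"
  proof (rule integral_dominated_convergence)
    show "integrable lborel (\<lambda>\<sigma>::real. exp (- \<bar>\<sigma>\<bar>) / 2 * C)"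
      using has_bochner_integral_exp_abs by (intro integrable_mult_left) (simp add: has_bochner_integral_iff)
    show "AE \<sigma> in lborel. (\<lambda>n. h n * (sker (h n) T t (t + h n * \<sigma>) * (?J (t + h n * \<sigma>) * c (t + h n * \<sigma>)))) \<longlonglongrightarrow> exp (- \<bar>\<sigma>\<bar>) / 2 * c t"
    proof (rule AE_I2)
      fix \<sigma>
      have lim: "(\<lambda>n. t + h n * \<sigma>) \<longlonglongrightarrow> t + 0 * \<sigma>" by (intro tendsto_intros h0)
      then have lim: "(\<lambda>n. t + h n * \<sigma>) \<longlonglongrightarrow> t" by simp
      have "isCont c t" using c(1) by (simp add: continuous_on_eq_continuous_at)
      then have cl: "(\<lambda>n. c (t + h n * \<sigma>)) \<longlonglongrightarrow> c t" using lim by (rule isCont_tendsto_compose)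
      have "\<forall>\<^sub>F n in sequentially. t + h n * \<sigma> \<in> {0<..<T}"
        using t topological_tendstoD[OF lim, of "{0<..<T}"] by auto
      then have Jl: "(\<lambda>n. ?J (t + h n * \<sigma>)) \<longlonglongrightarrow> 1"
        by (intro tendsto_eventually) (auto elim: eventually_mono)
      \<comment> \<open>As \<open>1 / h n\<close> is the integer \<open>n + 1\<close>, the reflected
        term is a geometric sequence up to the factor \<open>exp \<sigma>\<close>.\<close>
      have "(\<lambda>n. exp (- 2 * (T - t)) ^ Suc n) \<longlonglongrightarrow> 0"
        using t by (intro LIMSEQ_Suc LIMSEQ_power_zero) auto
      then have "(\<lambda>n. exp (- 2 * (T - t)) ^ Suc n * exp \<sigma>) \<longlonglongrightarrow> 0" by (rule tendsto_mult_left_zero)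
      moreover have "exp (- 2 * (T - t)) ^ Suc n * exp \<sigma> = exp (- 2 * (T - t) / h n + \<sigma>)" for n
        unfolding exp_of_nat_mult[symmetric] exp_add h_def by (simp add: mult.commute)
      ultimately have "(\<lambda>n. exp (- 2 * (T - t) / h n + \<sigma>)) \<longlonglongrightarrow> 0" by (simp only:)
      then have "(\<lambda>n. (exp (- \<bar>\<sigma>\<bar>) - exp (- 2 * (T - t) / h n + \<sigma>)) / 2) \<longlonglongrightarrow> (exp (- \<bar>\<sigma>\<bar>) - 0) / 2"
        by (intro tendsto_intros) auto
      then have "(\<lambda>n. (exp (- \<bar>\<sigma>\<bar>) - exp (- 2 * (T - t) / h n + \<sigma>)) / 2 * (?J (t + h n * \<sigma>) * c (t + h n * \<sigma>)))
          \<longlonglongrightarrow> (exp (- \<bar>\<sigma>\<bar>) - 0) / 2 * (1 * c t)"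
        by (intro tendsto_mult Jl cl)
      then show "(\<lambda>n. h n * (sker (h n) T t (t + h n * \<sigma>) * (?J (t + h n * \<sigma>) * c (t + h n * \<sigma>)))) \<longlonglongrightarrow> exp (- \<bar>\<sigma>\<bar>) / 2 * c t"
        by (simp add: mult.assoc[symmetric] hs)
    qed
    show "AE \<sigma> in lborel. norm (h n * (sker (h n) T t (t + h n * \<sigma>) * (?J (t + h n * \<sigma>) * c (t + h n * \<sigma>)))) \<le> exp (- \<bar>\<sigma>\<bar>) / 2 * C" for n
    proof (rule AE_I2)
      fix \<sigma>
      show "norm (h n * (sker (h n) T t (t + h n * \<sigma>) * (?J (t + h n * \<sigma>) * c (t + h n * \<sigma>)))) \<le> exp (- \<bar>\<sigma>\<bar>) / 2 * C"
      proof (cases "t + h n * \<sigma> \<in> {0<..<T}")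
        case True
        have "0 \<le> h n * sker (h n) T t (t + h n * \<sigma>)"
          using sker_bounds(1)[OF h, of t T "t + h n * \<sigma>" n] h[of n] True t by auto
        moreover have "h n * sker (h n) T t (t + h n * \<sigma>) \<le> exp (- \<bar>\<sigma>\<bar>) / 2" unfolding hs by simp
        ultimately have "\<bar>h n * sker (h n) T t (t + h n * \<sigma>)\<bar> * \<bar>c (t + h n * \<sigma>)\<bar> \<le> exp (- \<bar>\<sigma>\<bar>) / 2 * C"
          using c(2) by (intro mult_mono) auto
        then show ?thesis using True by (simp add: abs_mult mult.assoc)
      next
        case False
        then show ?thesis using order_trans[OF abs_ge_zero c(2)[of 0]] by simp
      qed
    qed
  qed measurable
  also have "(\<integral>\<sigma>. exp (- \<bar>\<sigma>\<bar>) / 2 * c t \<partial>lborel) = 1 * c t"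
    using has_bochner_integral_exp_abs unfolding has_bochner_integral_iff
    by (simp only: Bochner_Integration.integral_mult_left_zero)
  finally show ?thesis unfolding sub[symmetric] by (simp add: h_def)
qed

text \<open>Density argument: replace \<open>g\<close> by a cut-off continuous function, for which
  pointwise convergence and domination are available; the bound uniform in \<open>h\<close> controls
  the error.\<close>

lemma sym_avg_pairing_tendsto:
  fixes f g :: "real \<Rightarrow> real"
  assumes f[measurable]: "f \<in> borel_measurable borel" and g[measurable]: "g \<in> borel_measurable borel"
    and f2: "integrable lborel (\<lambda>t. (f t)\<^sup>2)" and g2: "integrable lborel (\<lambda>t. (g t)\<^sup>2)"
    and supp: "\<And>t. t \<notin> {0<..<T} \<Longrightarrow> f t = 0" "\<And>t. t \<notin> {0<..<T} \<Longrightarrow> g t = 0"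
  shows "(\<lambda>n. \<integral>t. f t * sym_avg (1 / real (Suc n)) T g t \<partial>lborel) \<longlonglongrightarrow> (\<integral>t. f t * g t \<partial>lborel)"
proof (rule LIMSEQ_I)
  fix \<epsilon> :: real assume "0 < \<epsilon>"
  let ?J = "indicat_real {0<..<T}"
  define P where "P n g = (\<integral>t. f t * sym_avg (1 / real (Suc n)) T g t \<partial>lborel)" for n g
  define A where "A = (\<integral>t. (f t)\<^sup>2 \<partial>lborel)"
  have "A \<ge> 0" by (simp add: A_def)
  \<comment> \<open>The parameter is fixed first so that the share of \<open>f\<close> is at most
    \<open>\<epsilon> / 3\<close>; the approximation of \<open>g\<close> is then chosen so close
    that its squared error divided by \<open>\<mu>\<close> is at most \<open>\<epsilon> / 3\<close>
    as well.\<close>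
  define \<mu> where "\<mu> = \<epsilon> / (3 * (A + 1))"
  have l: "\<mu> > 0" "\<mu> * A \<le> \<epsilon> / 3"
    using \<open>0 < \<epsilon>\<close> \<open>A \<ge> 0\<close> by (auto simp: \<mu>_def field_simps)
  have supp': "\<bar>t\<bar> > T \<Longrightarrow> g t = 0" "\<bar>t\<bar> > T \<Longrightarrow> f t = 0" for t
    by (rule supp, simp, linarith)+
  obtain c where c: "continuous_on UNIV c" "\<And>x. norm x > T + 1 \<Longrightarrow> c x = 0"
    "(\<integral>t. (g t - c t)\<^sup>2 \<partial>lborel) < \<mu> * \<epsilon> / 3"
    using square_integrable_approx_continuous[OF g g2, of T "\<mu> * \<epsilon> / 3"] supp' l(1) \<open>0 < \<epsilon>\<close> by auto
  obtain C where C: "\<And>t. \<bar>c t\<bar> \<le> C"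
  proof -
    have "bounded (c ` {- (T + 1)..T + 1})"
      by (intro compact_imp_bounded compact_continuous_image continuous_on_subset[OF c(1)]) auto
    then obtain C where C: "C > 0" "\<forall>t\<in>{- (T + 1)..T + 1}. \<bar>c t\<bar> \<le> C" unfolding bounded_pos by auto
    have "\<bar>c t\<bar> \<le> C" for t
      using C c(2)[of t] by (cases "\<bar>t\<bar> \<le> T + 1") (auto simp: abs_le_iff)
    then show ?thesis using that by blast
  qed
  note [measurable] = borel_measurable_continuous_onI[OF c(1)]
  \<comment> \<open>The continuous approximant is restricted to \<open>(0,T)\<close>, outside of
    which the kernel is not controlled. Restriction can only reduce the distance to
    \<open>g\<close>, which vanishes there.\<close>
  define g' where "g' t = ?J t * c t" for t
  have [measurable]: "g' \<in> borel_measurable borel" unfolding g'_def[abs_def] by measurable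
  have c2: "integrable lborel (\<lambda>t. (c t)\<^sup>2)" by (rule integrable_square_continuous_bounded_support[OF c(1,2)])
  have g'2: "integrable lborel (\<lambda>t. (g' t)\<^sup>2)"
    by (rule Bochner_Integration.integrable_bound[OF c2]) (auto simp: g'_def indicator_def)
  have d2: "integrable lborel (\<lambda>t. (g t - g' t)\<^sup>2)" by (rule integrable_square_add) (use g2 g'2 in auto)
  have gc2: "integrable lborel (\<lambda>t. (g t - c t)\<^sup>2)" by (rule integrable_square_add) (use g2 c2 in auto)
  have "(\<integral>t. (g t - g' t)\<^sup>2 \<partial>lborel) \<le> (\<integral>t. (g t - c t)\<^sup>2 \<partial>lborel)"
    by (rule integral_mono[OF d2 gc2]) (use supp(2) in \<open>auto simp: g'_def indicator_def\<close>)
  then have D: "(\<integral>t. (g t - g' t)\<^sup>2 \<partial>lborel) / \<mu> \<le> \<epsilon> / 3"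
    using c(3) l(1) by (simp add: field_simps)
  have supp_g': "t \<notin> {0<..<T} \<Longrightarrow> g' t = 0" for t by (simp add: g'_def)
  have supp_d: "t \<notin> {0<..<T} \<Longrightarrow> g t - g' t = 0" for t using supp(2)[of t] supp_g'[of t] by simp
  have lin: "P n g = P n (\<lambda>t. g t - g' t) + P n g'" for n
  proof -
    have hn: "1 / real (Suc n) > 0" by simp
    have i: "integrable lborel (\<lambda>\<tau>. sker h T t \<tau> * q \<tau>)"
      if q: "integrable lborel (\<lambda>t. (q t)\<^sup>2)" "q \<in> borel_measurable borel" "\<And>t. t \<notin> {0<..<T} \<Longrightarrow> q t = 0" and "t \<le> T" "h > 0" for q t h
    proof -
      note [measurable] = q(2)
      have qi: "integrable lborel q"
        by (rule integrable_of_square_integrable[OF q(2,1), of T]) (rule q(3), simp, linarith)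
      show ?thesis
      proof (rule Bochner_Integration.integrable_bound[OF integrable_mult_right[OF qi, of "1 / (2 * h)"]])
        show "AE \<tau> in lborel. norm (sker h T t \<tau> * q \<tau>) \<le> norm (1 / (2 * h) * q \<tau>)"
        proof (rule AE_I2)
          fix \<tau>
          show "norm (sker h T t \<tau> * q \<tau>) \<le> norm (1 / (2 * h) * q \<tau>)"
          proof (cases "\<tau> \<in> {0<..<T}")
            case True
            then show ?thesis
              using sker_bounds[OF \<open>h > 0\<close> \<open>t \<le> T\<close>, of \<tau>] \<open>h > 0\<close>
              unfolding norm_mult by (intro mult_right_mono) auto
          qed (simp add: q(3))
        qed
      qed measurable
    qed
    have "f t * sym_avg (1 / real (Suc n)) T g t =
        f t * sym_avg (1 / real (Suc n)) T (\<lambda>t. g t - g' t) t + f t * sym_avg (1 / real (Suc n)) T g' t" for t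
    proof (cases "t \<le> T")
      case True
      have "integrable lborel (\<lambda>\<tau>. sker (1 / real (Suc n)) T t \<tau> * (g \<tau> - g' \<tau>))"
        by (rule i) (use d2 supp_d True hn in auto)
      moreover have "integrable lborel (\<lambda>\<tau>. sker (1 / real (Suc n)) T t \<tau> * g' \<tau>)"
        by (rule i) (use g'2 supp_g' True hn in auto)
      ultimately have "sym_avg (1 / real (Suc n)) T g t =
          sym_avg (1 / real (Suc n)) T (\<lambda>t. g t - g' t) t + sym_avg (1 / real (Suc n)) T g' t"
        unfolding sym_avg_def by (subst Bochner_Integration.integral_add[symmetric]) (auto simp: algebra_simps)
      then show ?thesis by (simp add: distrib_left)
    qed (simp add: supp(1))
    moreover have "integrable lborel (\<lambda>t. f t * sym_avg (1 / real (Suc n)) T (\<lambda>t. g t - g' t) t)"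
      by (rule sym_avg_pairing(1)[OF f _ f2 d2 supp(1) supp_d hn]) auto
    moreover have "integrable lborel (\<lambda>t. f t * sym_avg (1 / real (Suc n)) T g' t)"
      by (rule sym_avg_pairing(1)[OF f _ f2 g'2 supp(1) supp_g' hn]) auto
    ultimately show ?thesis unfolding P_def by (simp only: Bochner_Integration.integral_add)
  qed
  have avg: "(a + b) / 2 \<le> \<epsilon> / 3" if "a \<le> \<epsilon> / 3" "b \<le> \<epsilon> / 3" for a b :: real
    using that by simp
  have Pd: "\<bar>P n (\<lambda>t. g t - g' t)\<bar> \<le> \<epsilon> / 3" for n
  proof -
    have "\<bar>P n (\<lambda>t. g t - g' t)\<bar> \<le> (\<mu> * A + (\<integral>t. (g t - g' t)\<^sup>2 \<partial>lborel) / \<mu>) / 2"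
      unfolding P_def A_def by (rule sym_avg_pairing(2)[OF f _ f2 d2 supp(1) supp_d _ l(1)]) auto
    then show ?thesis by (rule order_trans[OF _ avg[OF l(2) D]])
  qed
  have fd: "\<bar>\<integral>t. f t * (g t - g' t) \<partial>lborel\<bar> \<le> \<epsilon> / 3"
  proof -
    have i: "integrable lborel (\<lambda>t. f t * (g t - g' t))"
      by (rule integrable_square_integrable_product) (use f2 d2 in auto)
    have "norm (\<integral>t. f t * (g t - g' t) \<partial>lborel) \<le> (\<integral>t. (\<mu> * (f t)\<^sup>2 + (g t - g' t)\<^sup>2 / \<mu>) / 2 \<partial>lborel)"
      by (rule Bochner_Integration.integral_norm_bound_integral[OF i])
         (use f2 d2 young_abs[OF l(1)] in auto)
    also have "\<dots> = (\<mu> * A + (\<integral>t. (g t - g' t)\<^sup>2 \<partial>lborel) / \<mu>) / 2"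
      unfolding A_def using f2 d2 by (simp add: Bochner_Integration.integral_add)
    finally show ?thesis unfolding real_norm_def by (rule order_trans[OF _ avg[OF l(2) D]])
  qed
  have fint: "integrable lborel f" by (rule integrable_of_square_integrable[OF f f2, of T]) (use supp' in auto)
  have "(\<lambda>n. P n g') \<longlonglongrightarrow> (\<integral>t. f t * g' t \<partial>lborel)"
    unfolding P_def
  proof (rule integral_dominated_convergence)
    show "integrable lborel (\<lambda>t. C * \<bar>f t\<bar>)" using fint by auto
    show "(\<lambda>t. f t * sym_avg (1 / real (Suc n)) T g' t) \<in> borel_measurable lborel" for n
      using sym_avg_measurable[of g'] by simp
    show "AE t in lborel. (\<lambda>n. f t * sym_avg (1 / real (Suc n)) T g' t) \<longlonglongrightarrow> f t * g' t"
    proof (rule AE_I2)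
      fix t
      show "(\<lambda>n. f t * sym_avg (1 / real (Suc n)) T g' t) \<longlonglongrightarrow> f t * g' t"
      proof (cases "t \<in> {0<..<T}")
        case True
        then show ?thesis
          using sym_avg_tendsto[OF c(1) C True] by (auto simp: g'_def[abs_def] intro!: tendsto_mult)
      qed (simp add: supp)
    qed
    show "AE t in lborel. norm (f t * sym_avg (1 / real (Suc n)) T g' t) \<le> C * \<bar>f t\<bar>" for n
    proof (rule AE_I2)
      fix t
      show "norm (f t * sym_avg (1 / real (Suc n)) T g' t) \<le> C * \<bar>f t\<bar>"
      proof (cases "t \<in> {0<..<T}")
        case True
        have "C \<ge> 0" using C[of 0] by simp
        then have "\<bar>g' \<tau>\<bar> \<le> C" for \<tau> using C[of \<tau>] by (simp add: g'_def indicator_def)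
        then have "\<bar>sym_avg (1 / real (Suc n)) T g' t\<bar> \<le> C"
          using True supp_g' by (intro sym_avg_bound) auto
        then show ?thesis by (simp add: abs_mult mult.commute[of C] mult_left_mono)
      qed (simp add: supp)
    qed
  qed measurable
  from LIMSEQ_D[OF this, of "\<epsilon> / 3"] \<open>0 < \<epsilon>\<close>
  obtain N where N: "\<And>n. n \<ge> N \<Longrightarrow> \<bar>P n g' - (\<integral>t. f t * g' t \<partial>lborel)\<bar> < \<epsilon> / 3"
    by (auto simp: real_norm_def)
  have "(\<integral>t. f t * g t \<partial>lborel) = (\<integral>t. f t * (g t - g' t) \<partial>lborel) + (\<integral>t. f t * g' t \<partial>lborel)"
  proof -
    have "integrable lborel (\<lambda>t. f t * (g t - g' t))" "integrable lborel (\<lambda>t. f t * g' t)"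
      using f2 d2 g'2 by (auto intro!: integrable_square_integrable_product)
    then show ?thesis by (subst Bochner_Integration.integral_add[symmetric]) (auto simp: algebra_simps)
  qed
  then have "\<bar>P n g - (\<integral>t. f t * g t \<partial>lborel)\<bar> < \<epsilon>" if "n \<ge> N" for n
    using N[OF that] Pd[of n] fd lin[of n] by linarith
  then show "\<exists>no. \<forall>n\<ge>no. norm ((\<integral>t. f t * sym_avg (1 / real (Suc n)) T g t \<partial>lborel) - (\<integral>t. f t * g t \<partial>lborel)) < \<epsilon>"
    unfolding P_def[symmetric] by (auto simp: real_norm_def)
qed

section \<open>Coercivity of the fractional derivative\<close>

text \<open>The Gamma integral for \<open>\<alpha>\<close> with the variable rescaled by
  \<open>x\<close>: it expresses \<open>x\<close> to the power \<open>-\<alpha>\<close> as an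
  integral of \<open>exp (- s * x)\<close> with positive weight.\<close>

lemma gker_superposition:
  assumes \<alpha>: "0 < \<alpha>" "\<alpha> < 1" and x: "x > 0"
  shows "has_bochner_integral lborel
    (\<lambda>s. indicat_real {0..} s * (s powr (\<alpha> - 1) * exp (- s * x)) / (Gamma \<alpha> * Gamma (1 - \<alpha>))) (gker (1 - \<alpha>) x)"
proof -
  let ?f = "\<lambda>t::real. indicat_real {0..} t * (t powr (\<alpha> - 1) / exp t)"
  have f: "has_bochner_integral lborel ?f (Gamma \<alpha>)"
    by (rule has_bochner_integral_of_has_integral[OF Gamma_integral_real[OF \<alpha>(1)]]) auto
  have G: "Gamma \<alpha> > 0" "Gamma (1 - \<alpha>) > 0" using \<alpha> by (auto intro: Gamma_real_pos)
  have eq: "?f (0 + x * s) = x powr (\<alpha> - 1) * (indicat_real {0..} s * (s powr (\<alpha> - 1) * exp (- s * x)))" for s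
    using x by (auto simp: indicator_def powr_mult exp_minus divide_inverse mult.commute zero_le_mult_iff)
  have "integrable lborel (\<lambda>s. ?f (0 + x * s))"
    by (rule lborel_integrable_real_affine) (use f x in \<open>auto simp: has_bochner_integral_iff\<close>)
  moreover have "(\<integral>s. ?f (0 + x * s) \<partial>lborel) = Gamma \<alpha> / x"
    using lborel_integral_real_affine[of x ?f 0] f x by (simp add: has_bochner_integral_iff field_simps)
  ultimately have 1: "has_bochner_integral lborel (\<lambda>s. x powr (\<alpha> - 1) * (indicat_real {0..} s * (s powr (\<alpha> - 1) * exp (- s * x)))) (Gamma \<alpha> / x)"
    unfolding eq by (simp add: has_bochner_integral_iff)
  have "has_bochner_integral lborel (\<lambda>s. (x powr (\<alpha> - 1) * (indicat_real {0..} s * (s powr (\<alpha> - 1) * exp (- s * x)))) *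
     (1 / (x powr (\<alpha> - 1) * (Gamma \<alpha> * Gamma (1 - \<alpha>))))) (Gamma \<alpha> / x * (1 / (x powr (\<alpha> - 1) * (Gamma \<alpha> * Gamma (1 - \<alpha>)))))"
    by (rule has_bochner_integral_mult_left[OF 1]) 
  moreover have "Gamma \<alpha> / x * (1 / (x powr (\<alpha> - 1) * (Gamma \<alpha> * Gamma (1 - \<alpha>)))) = gker (1 - \<alpha>) x"
    using G x by (simp add: gker_def powr_diff powr_minus field_simps)
  moreover have "(\<lambda>s. (x powr (\<alpha> - 1) * (indicat_real {0..} s * (s powr (\<alpha> - 1) * exp (- s * x)))) *
     (1 / (x powr (\<alpha> - 1) * (Gamma \<alpha> * Gamma (1 - \<alpha>))))) =
     (\<lambda>s. indicat_real {0..} s * (s powr (\<alpha> - 1) * exp (- s * x)) / (Gamma \<alpha> * Gamma (1 - \<alpha>)))"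
    using x by (auto simp: fun_eq_iff)
  ultimately show ?thesis by simp
qed

lemma gker_nonneg: "0 < \<beta> \<Longrightarrow> gker \<beta> x \<ge> 0"
  using Gamma_real_pos[of \<beta>] by (simp add: gker_def)

lemma gker_measurable [measurable]: "gker \<beta> \<in> borel_measurable borel"
  unfolding gker_def[abs_def] by measurable

lemma integrable_gker:
  assumes "0 < \<beta>" "T \<ge> 0"
  shows "integrable lborel (\<lambda>x. indicat_real {0..T} x * gker \<beta> x)"
proof -
  have "has_bochner_integral lborel (\<lambda>x. indicat_real {0..T} x * x powr (\<beta> - 1)) (T powr (\<beta> - 1 + 1) / (\<beta> - 1 + 1))"
    by (rule has_bochner_integral_of_has_integral[OF has_integral_powr_from_0]) (use assms in auto)
  then have "integrable lborel (\<lambda>x. indicat_real {0..T} x * x powr (\<beta> - 1) / Gamma \<beta>)"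
    by (auto simp: has_bochner_integral_iff)
  then show ?thesis by (simp add: gker_def)
qed

text \<open>The kernel is singular on the diagonal, so boundedness arguments fail. Each section is
  dominated by a translate of the kernel truncated to \<open>{0..T}\<close>, whose integral does not
  depend on \<open>t\<close>.\<close>

lemma integrable_gker_conv:
  assumes \<beta>: "0 < \<beta>" and T: "T \<ge> 0"
  shows "integrable (lborel \<Otimes>\<^sub>M lborel)
    (\<lambda>(t, \<tau>). (if \<tau> < t then gker \<beta> (t - \<tau>) else 0) * (indicat_real {0<..<T} t * indicat_real {0..T} \<tau>))" (is "integrable _ ?F")
    and "integrable lborel (\<lambda>\<tau>. (if \<tau> < t then gker \<beta> (t - \<tau>) else 0) * (indicat_real {0<..<T} t * indicat_real {0..T} \<tau>))"
proof -
  let ?m = "\<lambda>x. indicat_real {0..T} x * gker \<beta> x"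
  have m: "integrable lborel ?m" by (rule integrable_gker[OF assms])
  have mt: "integrable lborel (\<lambda>\<tau>. ?m (t - \<tau>))" "(\<integral>\<tau>. ?m (t - \<tau>) \<partial>lborel) = (\<integral>x. ?m x \<partial>lborel)" for t
    using integrable_shift_minus[of ?m t] integral_shift_minus[of ?m t] m by auto
  have nn: "norm (?F p) = ?F p" for p using gker_nonneg[OF \<beta>] by (cases p) auto
  have le: "?F (t, \<tau>) \<le> ?m (t - \<tau>)" for t \<tau>
    using gker_nonneg[OF \<beta>, of "t - \<tau>"] by (auto simp: indicator_def)
  have i: "integrable lborel (\<lambda>\<tau>. ?F (t, \<tau>))" for t
  proof (rule Bochner_Integration.integrable_bound[OF mt(1)[of t] _ AE_I2])
    show "(\<lambda>\<tau>. ?F (t, \<tau>)) \<in> borel_measurable lborel" unfolding prod.case by measurable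
    show "norm (?F (t, \<tau>)) \<le> norm (?m (t - \<tau>))" for \<tau>
      unfolding nn by (rule order_trans[OF le]) (simp only: real_norm_def abs_ge_self)
  qed
  then show "integrable lborel (\<lambda>\<tau>. (if \<tau> < t then gker \<beta> (t - \<tau>) else 0) * (indicat_real {0<..<T} t * indicat_real {0..T} \<tau>))"
    by simp
  show "integrable (lborel \<Otimes>\<^sub>M lborel) ?F"
  proof (rule lborel_pair.Fubini_integrable)
    show mF: "?F \<in> borel_measurable (lborel \<Otimes>\<^sub>M lborel)" by measurable
    have "integrable lborel (\<lambda>t. (\<integral>x. ?m x \<partial>lborel) * indicat_real {0<..<T} t)"
      using T by (intro integrable_mult_right integrable_real_indicator) auto
    then show "integrable lborel (\<lambda>t. \<integral>\<tau>. norm (?F (t, \<tau>)) \<partial>lborel)"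
    proof (rule Bochner_Integration.integrable_bound[OF _ _ AE_I2])
      fix t
      have 0: "(\<integral>\<tau>. norm (?F (t, \<tau>)) \<partial>lborel) \<ge> 0" by simp
      have "(\<integral>\<tau>. norm (?F (t, \<tau>)) \<partial>lborel) \<le> (\<integral>x. ?m x \<partial>lborel) * indicat_real {0<..<T} t"
      proof (cases "t \<in> {0<..<T}")
        case True
        have "(\<integral>\<tau>. norm (?F (t, \<tau>)) \<partial>lborel) \<le> (\<integral>\<tau>. ?m (t - \<tau>) \<partial>lborel)"
          unfolding nn by (rule integral_mono[OF i mt(1) le])
        then show ?thesis using True mt(2) by simp
      qed simp
      with 0 show "norm (\<integral>\<tau>. norm (?F (t, \<tau>)) \<partial>lborel) \<le> norm ((\<integral>x. ?m x \<partial>lborel) * indicat_real {0<..<T} t)"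
        by simp
    qed measurable
    show "AE t in lborel. integrable lborel (\<lambda>\<tau>. ?F (t, \<tau>))" using i by (intro AE_I2)
  qed
qed

text \<open>Fubini makes the exponential rate \<open>s\<close> the outermost variable, so that a
  lower bound for each single exponential can be integrated against the positive weight.\<close>

lemma gker_conv_superposition:
  fixes g w :: "real \<Rightarrow> real"
  assumes \<alpha>: "0 < \<alpha>" "\<alpha> < 1" and T: "T > 0"
    and w: "causal B w" "\<And>t. t \<ge> T \<Longrightarrow> w t = 0"
    and g[measurable]: "g \<in> borel_measurable borel" and gB: "\<And>t. t \<in> {0<..<T} \<Longrightarrow> \<bar>g t\<bar> \<le> C"
  defines "\<Phi> \<equiv> \<lambda>s. indicat_real {0..} s * (s powr (\<alpha> - 1) / (Gamma \<alpha> * Gamma (1 - \<alpha>)) *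
      (\<integral>t. indicat_real {0<..<T} t * (g t * expconv s w t) \<partial>lborel))"
  shows "integrable lborel \<Phi>"
    and "(\<integral>t. indicat_real {0<..<T} t * (g t * (\<integral>\<tau>. (if \<tau> < t then gker (1 - \<alpha>) (t - \<tau>) else 0) * w \<tau> \<partial>lborel)) \<partial>lborel)
      = (\<integral>s. \<Phi> s \<partial>lborel)"
proof -
  let ?J = "indicat_real {0<..<T}"
  note [measurable] = causalD(1)[OF w(1)]
  define G where "G = Gamma \<alpha> * Gamma (1 - \<alpha>)"
  define a where "a p = ?J (fst p) * (g (fst p) * w (snd p))" for p :: "real \<times> real"
  define k where "k p = (if snd p < fst p then gker (1 - \<alpha>) (fst p - snd p) else 0)" for p :: "real \<times> real"
  define F where "F p s = (if snd p < fst p then indicat_real {0..} s * (s powr (\<alpha> - 1) * exp (- s * (fst p - snd p))) / G else 0) * a p" for p s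
  have [measurable]: "a \<in> borel_measurable borel" "k \<in> borel_measurable borel"
    unfolding a_def[abs_def] k_def[abs_def] borel_prod[symmetric] by measurable
  have Gpos: "G > 0" using \<alpha> by (auto simp: G_def intro!: mult_pos_pos Gamma_real_pos)
  have k0: "k p \<ge> 0" for p using gker_nonneg[of "1 - \<alpha>"] \<alpha> by (simp add: k_def)
  have C0: "C \<ge> 0" using gB[of "T / 2"] T by (auto intro: order_trans[OF abs_ge_zero])
  have wz: "w \<tau> = w \<tau> * indicat_real {0..T} \<tau>" for \<tau>
    using causalD(3)[OF w(1), of \<tau>] w(2)[of \<tau>]
    by (cases "\<tau> < 0"; cases "\<tau> \<ge> T") (auto simp: indicator_def)
  have aB: "\<bar>a p\<bar> \<le> C * B * (?J (fst p) * indicat_real {0..T} (snd p))" for p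
  proof (cases "fst p \<in> {0<..<T}")
    case True
    have "\<bar>g (fst p)\<bar> * \<bar>w (snd p)\<bar> \<le> C * (B * indicat_real {0..T} (snd p))"
      using gB[OF True] causalD(2)[OF w(1), of "snd p"] C0 wz[of "snd p"]
      by (intro mult_mono) (auto simp: indicator_def)
    then show ?thesis using True by (simp add: a_def abs_mult)
  qed (simp add: a_def)
  have inner_s: "has_bochner_integral lborel (F p) (k p * a p)" for p
  proof (cases "snd p < fst p")
    case True
    have "has_bochner_integral lborel (\<lambda>s. indicat_real {0..} s * (s powr (\<alpha> - 1) * exp (- s * (fst p - snd p))) / (Gamma \<alpha> * Gamma (1 - \<alpha>)) * a p) (gker (1 - \<alpha>) (fst p - snd p) * a p)"
      by (rule has_bochner_integral_mult_left[OF gker_superposition[OF \<alpha>]]) (use True in auto)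
    then show ?thesis using True by (simp add: F_def[abs_def] k_def G_def)
  qed (simp add: F_def[abs_def] k_def has_bochner_integral_zero)
  have nF: "norm (F p s) = (if snd p < fst p then indicat_real {0..} s * (s powr (\<alpha> - 1) * exp (- s * (fst p - snd p))) / G else 0) * \<bar>a p\<bar>" for p s
    using Gpos by (auto simp: F_def abs_mult)
  \<comment> \<open>The exponential weights are nonnegative, so integrating the absolute value over
    \<open>s\<close> reproduces the kernel times \<open>\<bar>a p\<bar>\<close>; joint integrability
    reduces to that of the singular kernel.\<close>
  have inner_n: "(\<integral>s. norm (F p s) \<partial>lborel) = k p * \<bar>a p\<bar>" for p
  proof (cases "snd p < fst p")
    case True
    then have "has_bochner_integral lborel (\<lambda>s. indicat_real {0..} s * (s powr (\<alpha> - 1) * exp (- s * (fst p - snd p))) / (Gamma \<alpha> * Gamma (1 - \<alpha>)) * \<bar>a p\<bar>)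
        (gker (1 - \<alpha>) (fst p - snd p) * \<bar>a p\<bar>)"
      by (intro has_bochner_integral_mult_left[OF gker_superposition[OF \<alpha>]]) simp
    from has_bochner_integral_integral_eq[OF this] show ?thesis
      unfolding nF k_def G_def if_P[OF True] .
  next
    case False
    then show ?thesis unfolding nF by (simp add: k_def)
  qed
  have kint: "integrable lborel (\<lambda>p. k p * (?J (fst p) * indicat_real {0..T} (snd p)))"
    using integrable_gker_conv(1)[of "1 - \<alpha>" T] \<alpha> T
    by (simp add: k_def[abs_def] case_prod_beta' lborel_prod)
  have kaint: "integrable lborel (\<lambda>p. k p * \<bar>a p\<bar>)"
  proof (rule Bochner_Integration.integrable_bound[OF integrable_mult_right[OF kint, of "C * B"] _ AE_I2])
    fix p
    have "k p * \<bar>a p\<bar> \<le> k p * (C * B * (?J (fst p) * indicat_real {0..T} (snd p)))"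
      by (intro mult_left_mono aB k0)
    then show "norm (k p * \<bar>a p\<bar>) \<le> norm (C * B * (k p * (?J (fst p) * indicat_real {0..T} (snd p))))"
      using k0[of p] C0 causalD(4)[OF w(1)] by (simp add: abs_mult mult_ac)
  qed measurable
  have iF: "integrable (lborel \<Otimes>\<^sub>M lborel) (case_prod F)"
  proof (rule lborel_pair.Fubini_integrable)
    show "case_prod F \<in> borel_measurable (lborel \<Otimes>\<^sub>M lborel)"
      unfolding F_def[abs_def] a_def borel_prod[symmetric] lborel_prod[symmetric] by measurable
    show "integrable lborel (\<lambda>p. \<integral>s. norm (case (p, s) of (p, s) \<Rightarrow> F p s) \<partial>lborel)"
      unfolding prod.case inner_n by (rule kaint)
    show "AE p in lborel. integrable lborel (\<lambda>s. case (p, s) of (p, s) \<Rightarrow> F p s)"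
      using inner_s by (auto simp: has_bochner_integral_iff)
  qed
  have inner_p: "(\<integral>p. F p s \<partial>lborel) = \<Phi> s" for s
  proof (cases "s \<ge> 0")
    case True
    define H where "H = (\<lambda>(t, \<tau>). ?J t * (g t * ((if \<tau> < t then exp (- s * (t - \<tau>)) else 0) * w \<tau>)))"
    have H: "integrable (lborel \<Otimes>\<^sub>M lborel) H"
    proof (rule integrable_pair_bounded_support[of _ "C * (1 * B)" 0 T 0 T])
      show "H \<in> borel_measurable borel" unfolding H_def borel_prod[symmetric] by measurable
      fix t \<tau>
      show "\<bar>H (t, \<tau>)\<bar> \<le> C * (1 * B)"
      proof (cases "t \<in> {0<..<T}")
        case t: True
        have "\<bar>if \<tau> < t then exp (- s * (t - \<tau>)) else 0\<bar> \<le> 1" using True by auto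
        then have "\<bar>g t\<bar> * (\<bar>if \<tau> < t then exp (- s * (t - \<tau>)) else 0\<bar> * \<bar>w \<tau>\<bar>) \<le> C * (1 * B)"
          using gB[OF t] causalD(2)[OF w(1)] C0 by (intro mult_mono) auto
        then show ?thesis using t by (simp add: H_def abs_mult)
      qed (use C0 causalD(4)[OF w(1)] in \<open>simp add: H_def\<close>)
      show "t \<notin> {0..T} \<or> \<tau> \<notin> {0..T} \<Longrightarrow> H (t, \<tau>) = 0"
        using wz[of \<tau>] by (auto simp: H_def indicator_def)
    qed
    have "(\<integral>p. F p s \<partial>lborel) = (\<integral>p. (s powr (\<alpha> - 1) / G) * H p \<partial>(lborel \<Otimes>\<^sub>M lborel))"
      unfolding lborel_prod by (rule Bochner_Integration.integral_cong) (use True in \<open>auto simp: F_def H_def a_def\<close>)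
    also have "\<dots> = (s powr (\<alpha> - 1) / G) * (\<integral>t. (\<integral>\<tau>. H (t, \<tau>) \<partial>lborel) \<partial>lborel)"
      using lborel_pair.integral_fst'[OF H] by simp
    also have "(\<lambda>t. \<integral>\<tau>. H (t, \<tau>) \<partial>lborel) = (\<lambda>t. ?J t * (g t * expconv s w t))"
      by (simp add: H_def expconv_def fun_eq_iff)
    finally show ?thesis using True by (simp add: \<Phi>_def G_def)
  next
    case False
    then have "F p s = 0" for p by (simp add: F_def)
    then show ?thesis using False by (simp add: \<Phi>_def)
  qed
  show "integrable lborel \<Phi>"
    using lborel_pair.integrable_snd[OF iF] by (simp only: inner_p)
  have ka: "integrable (lborel \<Otimes>\<^sub>M lborel) (\<lambda>p. k p * a p)"
  proof -
    have "integrable lborel (\<lambda>p. \<integral>s. F p s \<partial>lborel)" by (rule lborel_pair.integrable_fst[OF iF])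
    moreover have "(\<lambda>p. \<integral>s. F p s \<partial>lborel) = (\<lambda>p. k p * a p)"
      using inner_s by (auto simp: has_bochner_integral_iff)
    ultimately show ?thesis by (simp add: lborel_prod)
  qed
  have "(\<integral>s. \<Phi> s \<partial>lborel) = (\<integral>s. (\<integral>p. F p s \<partial>lborel) \<partial>lborel)" by (simp only: inner_p)
  also have "\<dots> = (\<integral>p. (\<integral>s. F p s \<partial>lborel) \<partial>lborel)" by (rule lborel_pair.Fubini_integral[OF iF])
  also have "\<dots> = (\<integral>p. k p * a p \<partial>(lborel \<Otimes>\<^sub>M lborel))"
    unfolding lborel_prod using inner_s by (simp add: has_bochner_integral_iff)
  also have "\<dots> = (\<integral>t. (\<integral>\<tau>. k (t, \<tau>) * a (t, \<tau>) \<partial>lborel) \<partial>lborel)"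
    using lborel_pair.integral_fst'[OF ka] by simp
  also have "\<dots> = (\<integral>t. ?J t * (g t * (\<integral>\<tau>. (if \<tau> < t then gker (1 - \<alpha>) (t - \<tau>) else 0) * w \<tau> \<partial>lborel)) \<partial>lborel)"
  proof (rule Bochner_Integration.integral_cong[OF refl])
    fix t
    have "(\<integral>\<tau>. k (t, \<tau>) * a (t, \<tau>) \<partial>lborel) = (\<integral>\<tau>. (?J t * g t) * ((if \<tau> < t then gker (1 - \<alpha>) (t - \<tau>) else 0) * w \<tau>) \<partial>lborel)"
      by (rule Bochner_Integration.integral_cong) (auto simp: k_def a_def)
    then show "(\<integral>\<tau>. k (t, \<tau>) * a (t, \<tau>) \<partial>lborel) = ?J t * (g t * (\<integral>\<tau>. (if \<tau> < t then gker (1 - \<alpha>) (t - \<tau>) else 0) * w \<tau> \<partial>lborel))"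
      by simp
  qed
  finally show "(\<integral>t. ?J t * (g t * (\<integral>\<tau>. (if \<tau> < t then gker (1 - \<alpha>) (t - \<tau>) else 0) * w \<tau> \<partial>lborel)) \<partial>lborel)
      = (\<integral>s. \<Phi> s \<partial>lborel)" by simp
qed

text \<open>The coercivity of single exponentials is integrated over their rates. Small rates
  contribute a definite amount, large rates are merely nonnegative. The constant depends on
  \<open>\<alpha>\<close> and \<open>T\<close> only, which permits the limit in \<open>h\<close> and
  the change of radius.\<close>

lemma fractional_coercive:
  assumes \<alpha>: "0 < \<alpha>" "\<alpha> < 1" and T: "T > 0"
  obtains C where "C > 0"
    "\<And>h w B. h > 0 \<Longrightarrow> causal B w \<Longrightarrow> (\<And>t. t \<notin> {0<..<T} \<Longrightarrow> w t = 0) \<Longrightarrow>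
      C * (\<integral>t. w t * sym_avg h T w t \<partial>lborel) \<le>
      (\<integral>t. indicat_real {0<..<T} t * ((fwd h w t - sym_avg h T w t) / h *
        (\<integral>\<tau>. (if \<tau> < t then gker (1 - \<alpha>) (t - \<tau>) else 0) * w \<tau> \<partial>lborel)) \<partial>lborel)"
proof -
  \<comment> \<open>With this choice the smallness condition
    \<open>c * s^2 \<le> 1 / (8 T^2)\<close> holds for all rates \<open>s \<le> 1\<close>. The
    factor \<open>1 / \<alpha>\<close> in \<open>C\<close> below is the integral of the weight over
    \<open>(0,1]\<close>.\<close>
  define c where "c = min (1 / 2) (1 / (8 * T\<^sup>2))"
  have c: "0 < c" "c \<le> 1 / 2" "c \<le> 1 / (8 * T\<^sup>2)" using T by (auto simp: c_def)
  define G where "G = Gamma \<alpha> * Gamma (1 - \<alpha>)"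
  have G: "G > 0" using \<alpha> by (auto simp: G_def intro!: mult_pos_pos Gamma_real_pos)
  define C where "C = c / (\<alpha> * G)"
  have "C > 0" using c G \<alpha> by (simp add: C_def)
  moreover have "C * (\<integral>t. w t * sym_avg h T w t \<partial>lborel) \<le>
      (\<integral>t. indicat_real {0<..<T} t * ((fwd h w t - sym_avg h T w t) / h *
        (\<integral>\<tau>. (if \<tau> < t then gker (1 - \<alpha>) (t - \<tau>) else 0) * w \<tau> \<partial>lborel)) \<partial>lborel)"
    if h: "h > 0" and w: "causal B w" and w0: "\<And>t. t \<notin> {0<..<T} \<Longrightarrow> w t = 0" for h w B
  proof -
    let ?J = "indicat_real {0<..<T}"
    note [measurable] = causalD(1)[OF w]
    have wT: "t \<ge> T \<Longrightarrow> w t = 0" for t using w0 by simp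
    have cz: "causal B (fwd h w)" by (rule causal_fwd[OF w h])
    note [measurable] = causalD(1)[OF cz] sym_avg_measurable[OF causalD(1)[OF w]]
    define g where "g t = (fwd h w t - sym_avg h T w t) / h" for t
    have [measurable]: "g \<in> borel_measurable borel" unfolding g_def[abs_def] by measurable
    have gB: "\<bar>g t\<bar> \<le> 2 * B / h" if "t \<in> {0<..<T}" for t
    proof -
      have "\<bar>sym_avg h T w t\<bar> \<le> B"
        by (rule sym_avg_bound) (use causalD[OF w] wT h that in auto)
      then have "\<bar>fwd h w t - sym_avg h T w t\<bar> \<le> 2 * B" using causalD(2)[OF cz, of t] by linarith
      then show ?thesis using h by (simp add: g_def divide_right_mono)
    qed
    define Z where "Z = (\<integral>t. ?J t * (fwd h w t)\<^sup>2 \<partial>lborel)"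
    have Z: "Z \<ge> 0" by (simp add: Z_def)
    have bwd: "bwd h T (fwd h w) t = sym_avg h T w t" if "t \<in> {0<..<T}" for t
      by (rule bwd_fwd_eq_sym_avg[OF w wT h]) (use that in auto)
    \<comment> \<open>On \<open>(0,T)\<close> the symmetric average is the adjoint applied to the
      forward average, so the pairing is the squared norm of the latter.\<close>
    have ZP: "(\<integral>t. w t * sym_avg h T w t \<partial>lborel) = Z"
    proof -
      have "(\<integral>t. w t * sym_avg h T w t \<partial>lborel) = (\<integral>t. ?J t * (bwd h T (fwd h w) t * w t) \<partial>lborel)"
        by (rule Bochner_Integration.integral_cong) (use bwd w0 in \<open>auto simp: indicator_def\<close>)
      also have "\<dots> = Z" unfolding bwd_fwd_duality[OF cz w h] Z_def by (simp add: power2_eq_square)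
      finally show ?thesis .
    qed
    define \<Phi> where "\<Phi> s = indicat_real {0..} s * (s powr (\<alpha> - 1) / (Gamma \<alpha> * Gamma (1 - \<alpha>)) *
      (\<integral>t. ?J t * (g t * expconv s w t) \<partial>lborel))" for s
    note sup = gker_conv_superposition[OF \<alpha> T w wT \<open>g \<in> borel_measurable borel\<close> gB, folded \<Phi>_def]
    have lower: "(c * Z / G) * (indicat_real {0..1} s * s powr (\<alpha> - 1)) \<le> \<Phi> s" for s
    proof -
      consider "s \<le> 0" | "0 < s" "s \<le> 1" | "s > 1" by linarith
      then show ?thesis
      proof cases
        case 1
        \<comment> \<open>For \<open>s = 0\<close> both sides vanish because
          \<open>0 powr x = 0\<close>.\<close>
        then show ?thesis by (cases "s = 0") (auto simp: \<Phi>_def)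
      next
        case 2
        have "c * s\<^sup>2 \<le> c * 1" using 2 c by (intro mult_left_mono) (auto simp: power_le_one)
        then have cs: "c * s\<^sup>2 \<le> 1 / (8 * T\<^sup>2)" using c(3) by linarith
        have "c * Z \<le> (\<integral>t. ?J t * ((fwd h w t - bwd h T (fwd h w) t) / h * expconv s w t) \<partial>lborel)"
          unfolding Z_def by (rule exponential_coercive[OF w T h 2(1) less_imp_le[OF c(1)] c(2) cs])
        also have "\<dots> = (\<integral>t. ?J t * (g t * expconv s w t) \<partial>lborel)"
          by (rule Bochner_Integration.integral_cong) (auto simp: g_def bwd indicator_def)
        finally have "s powr (\<alpha> - 1) / G * (c * Z) \<le> s powr (\<alpha> - 1) / G * (\<integral>t. ?J t * (g t * expconv s w t) \<partial>lborel)"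
          using G by (intro mult_left_mono) auto
        then show ?thesis using 2 by (simp add: \<Phi>_def G_def mult_ac)
      next
        case 3
        \<comment> \<open>For rates above 1 the coercive lemma is used with the constant 0, for
          which its smallness condition is trivial.\<close>
        have "0 * Z \<le> (\<integral>t. ?J t * ((fwd h w t - bwd h T (fwd h w) t) / h * expconv s w t) \<partial>lborel)"
          unfolding Z_def using 3 by (intro exponential_coercive[OF w T h]) auto
        also have "\<dots> = (\<integral>t. ?J t * (g t * expconv s w t) \<partial>lborel)"
          by (rule Bochner_Integration.integral_cong) (auto simp: g_def bwd indicator_def)
        finally have "0 \<le> s powr (\<alpha> - 1) / G * (\<integral>t. ?J t * (g t * expconv s w t) \<partial>lborel)"
          using G by (intro mult_nonneg_nonneg) auto
        then show ?thesis using 3 by (simp add: \<Phi>_def G_def)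
      qed
    qed
    have hb: "has_bochner_integral lborel (\<lambda>s. indicat_real {0..1} s * s powr (\<alpha> - 1)) (1 powr (\<alpha> - 1 + 1) / (\<alpha> - 1 + 1))"
      by (rule has_bochner_integral_of_has_integral[OF has_integral_powr_from_0]) (use \<alpha> in auto)
    then have hb': "integrable lborel (\<lambda>s. indicat_real {0..1} s * s powr (\<alpha> - 1))"
      "(\<integral>s. indicat_real {0..1} s * s powr (\<alpha> - 1) \<partial>lborel) = 1 / \<alpha>"
      by (auto simp: has_bochner_integral_iff)
    have "C * Z = (c * Z / G) * (\<integral>s. indicat_real {0..1} s * s powr (\<alpha> - 1) \<partial>lborel)"
      unfolding hb' C_def by simp
    also have "\<dots> = (\<integral>s. (c * Z / G) * (indicat_real {0..1} s * s powr (\<alpha> - 1)) \<partial>lborel)"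
      by (rule Bochner_Integration.integral_mult_right_zero[symmetric])
    also have "\<dots> \<le> (\<integral>s. \<Phi> s \<partial>lborel)"
      by (rule integral_mono[OF integrable_mult_right[OF hb'(1)] sup(1) lower])
    also have "\<dots> = (\<integral>t. ?J t * (g t * (\<integral>\<tau>. (if \<tau> < t then gker (1 - \<alpha>) (t - \<tau>) else 0) * w \<tau> \<partial>lborel)) \<partial>lborel)"
      by (rule sup(2)[symmetric])
    finally show ?thesis unfolding ZP g_def .
  qed
  ultimately show ?thesis by (rule that)
qed

section \<open>Averages of functions of time and space\<close>

text \<open>Shows that constants have weak gradient zero, as the auxiliary test function built from
  \<open>M\<close> requires. The integral is the derivative of a mollification that is constant near
  the origin.\<close>

lemma integral_grad_eq_0:
  fixes \<theta> :: "'a::euclidean_space \<Rightarrow> real"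
  assumes \<theta>: "\<theta> \<in> Cinf0 UNIV"
  shows "(\<integral>x. grad \<theta> x \<partial>lborel) = 0"
proof -
  obtain R where R: "R > 0" "\<And>x. norm x > R \<Longrightarrow> x \<notin> closure {x. \<theta> x \<noteq> 0}"
    using compact_imp_bounded[OF Cinf0_D(2)[OF \<theta>]] unfolding bounded_pos by (metis linorder_not_le)
  have z: "norm x > R \<Longrightarrow> \<theta> x = 0" "norm x > R \<Longrightarrow> grad \<theta> x = 0" for x
    using R(2) not_in_closure_support[of x \<theta>] grad_eq_0_outside[of x \<theta>] by blast+
  note [measurable] = Cinf0_borel_measurable[OF \<theta>] Cinf0_grad_borel_measurable[OF \<theta>]
  \<comment> \<open>For \<open>norm x < 1\<close> the support of the translated reflection of
    \<open>\<theta>\<close> stays in this ball, so the mollification equals the full integral of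
    \<open>\<theta>\<close>.\<close>
  define f where "f = indicat_real (cball (0::'a) (R + 1))"
  have f: "integrable lborel f"
    unfolding f_def by (intro integrable_real_indicator) (auto simp: emeasure_bounded_finite[OF bounded_cball, simplified])
  have const: "mollify \<theta> f x = (\<integral>y. \<theta> y \<partial>lborel)" if "norm x < 1" for x
  proof -
    have "mollify \<theta> f x = (\<integral>y. \<theta> (x - y) \<partial>lborel)"
      unfolding mollify_def
    proof (rule Bochner_Integration.integral_cong[OF refl])
      fix y
      show "\<theta> (x - y) * f y = \<theta> (x - y)"
      proof (cases "norm y \<le> R + 1")
        case False
        then have "norm (x - y) > R" using that norm_triangle_ineq2[of y x] norm_minus_commute[of x y] by linarith
        then show ?thesis using z(1) by simp
      qed (simp add: f_def)
    qed
    then show ?thesis by (simp add: integral_shift_minus)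
  qed
  have "((\<lambda>x. \<integral>y. \<theta> y \<partial>lborel) has_derivative (\<lambda>v. 0 \<bullet> v)) (at (0::'a))" by simp
  then have "(mollify \<theta> f has_derivative (\<lambda>v. 0 \<bullet> v)) (at 0)"
    by (rule has_derivative_transform_within_open[of _ _ _ _ "ball 0 1"]) (auto simp: const)
  then have "grad (mollify \<theta> f) 0 = 0" by (rule grad_eqI)
  then have "(\<integral>y. f y *\<^sub>R grad \<theta> (0 - y) \<partial>lborel) = 0"
    by (simp add: grad_mollify[OF \<theta> f])
  moreover have "(\<integral>y. f y *\<^sub>R grad \<theta> (0 - y) \<partial>lborel) = (\<integral>y. grad \<theta> (0 - y) \<partial>lborel)"
  proof (rule Bochner_Integration.integral_cong[OF refl])
    fix y
    show "f y *\<^sub>R grad \<theta> (0 - y) = grad \<theta> (0 - y)"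
      using z(2)[of "- y"] by (cases "norm y \<le> R + 1") (auto simp: f_def)
  qed
  moreover have "(\<integral>y. grad \<theta> (0 - y) \<partial>lborel) = (\<integral>y. grad \<theta> y \<partial>lborel)"
    by (rule integral_shift_minus) measurable
  ultimately show ?thesis by simp
qed

text \<open>Cauchy-Schwarz on an interval of length \<open>T\<close>, obtained by subtracting the
  mean \<open>m\<close> and expanding the nonnegative square.\<close>

lemma square_integral_le:
  fixes f :: "real \<Rightarrow> real"
  assumes f[measurable]: "f \<in> borel_measurable borel" and f2: "integrable lborel (\<lambda>t. (f t)\<^sup>2)"
    and supp: "\<And>t. t \<notin> {0<..<T} \<Longrightarrow> f t = 0" and T: "T > 0"
  shows "(\<integral>t. f t \<partial>lborel)\<^sup>2 \<le> T * (\<integral>t. (f t)\<^sup>2 \<partial>lborel)"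
proof -
  let ?J = "indicat_real {0<..<T}"
  define m where "m = (\<integral>t. f t \<partial>lborel) / T"
  have fi: "integrable lborel f"
    by (rule integrable_of_square_integrable[OF f f2, of T]) (rule supp, simp, linarith)
  have J: "integrable lborel ?J" "(\<integral>t. ?J t \<partial>lborel) = T"
    using T by (auto intro!: integrable_real_indicator)
  have "0 \<le> (\<integral>t. (f t - m * ?J t)\<^sup>2 \<partial>lborel)" by simp
  also have "\<dots> = (\<integral>t. (f t)\<^sup>2 - 2 * m * f t + m\<^sup>2 * ?J t \<partial>lborel)"
  proof (rule Bochner_Integration.integral_cong[OF refl])
    fix t
    show "(f t - m * ?J t)\<^sup>2 = (f t)\<^sup>2 - 2 * m * f t + m\<^sup>2 * ?J t"
      using supp[of t] by (cases "t \<in> {0<..<T}") (auto simp: power2_eq_square algebra_simps)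
  qed
  also have "\<dots> = (\<integral>t. (f t)\<^sup>2 \<partial>lborel) - 2 * m * (\<integral>t. f t \<partial>lborel) + m\<^sup>2 * T"
    using f2 fi J by (simp add: Bochner_Integration.integral_add Bochner_Integration.integral_diff)
  also have "\<dots> = (\<integral>t. (f t)\<^sup>2 \<partial>lborel) - (\<integral>t. f t \<partial>lborel)\<^sup>2 / T"
    using T by (simp add: m_def power2_eq_square field_simps)
  finally show ?thesis using T by (simp add: field_simps)
qed

lemma sym_avg_nonneg:
  assumes "\<And>\<tau>. g \<tau> \<ge> 0" "\<And>\<tau>. \<tau> \<ge> T \<Longrightarrow> g \<tau> = 0" "h > 0" "t \<le> T"
  shows "sym_avg h T g t \<ge> 0"
  unfolding sym_avg_def
proof (intro integral_nonneg_AE AE_I2)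
  fix \<tau>
  show "0 \<le> sker h T t \<tau> * g \<tau>"
    using sker_bounds(1)[OF assms(3,4), of \<tau>] assms(1,2)[of \<tau>] by (cases "\<tau> \<ge> T") auto
qed

lemma sym_avg_has_derivative:
  assumes w: "causal B w" "\<And>t. t \<ge> T \<Longrightarrow> w t = 0" and h: "h > 0" and t: "t \<in> {0..T}"
  shows "(sym_avg h T w has_real_derivative (sym_avg h T w t - fwd h w t) / h) (at t within {0..T})"
proof -
  have "continuous_on {0..T} (fwd h w)"
    by (intro continuous_at_imp_continuous_on ballI isCont_fwd[OF w(1)])
  from bwd_has_derivative[OF this t h]
  have D: "(bwd h T (fwd h w) has_real_derivative (sym_avg h T w t - fwd h w t) / h) (at t within {0..T})"
    using bwd_fwd_eq_sym_avg[OF w h] t by simp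
  show ?thesis
    by (rule has_field_derivative_transform_within[OF D, of 1]) (use t bwd_fwd_eq_sym_avg[OF w h] in auto)
qed

lemma sym_avg_end:
  assumes "causal B w" "\<And>t. t \<ge> T \<Longrightarrow> w t = 0" "h > 0"
  shows "sym_avg h T w T = 0"
  using bwd_fwd_eq_sym_avg[OF assms order_refl] bwd_end by simp

text \<open>The derivative is the difference of two averages, each bounded by \<open>B\<close>,
  divided by \<open>h\<close>. Uniformity over the space variable gives continuity of the test
  function with values in \<open>L_2\<close>.\<close>

lemma sym_avg_lipschitz:
  assumes w: "causal B w" "\<And>t. t \<ge> T \<Longrightarrow> w t = 0" and h: "h > 0" and st: "s \<in> {0..T}" "t \<in> {0..T}"
  shows "\<bar>sym_avg h T w s - sym_avg h T w t\<bar> \<le> 2 * B / h * \<bar>s - t\<bar>"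
proof -
  have "norm (sym_avg h T w s - sym_avg h T w t) \<le> 2 * B / h * norm (s - t)"
  proof (rule field_differentiable_bound[OF convex_real_interval(5)])
    fix x assume x: "x \<in> {0..T}"
    show "(sym_avg h T w has_real_derivative (sym_avg h T w x - fwd h w x) / h) (at x within {0..T})"
      by (rule sym_avg_has_derivative[OF w h x])
    have "\<bar>sym_avg h T w x\<bar> \<le> B"
      by (rule sym_avg_bound) (use causalD[OF w(1)] w(2) h x in auto)
    then have "\<bar>sym_avg h T w x - fwd h w x\<bar> \<le> 2 * B"
      using causalD(2)[OF causal_fwd[OF w(1) h], of x] by linarith
    then show "norm ((sym_avg h T w x - fwd h w x) / h) \<le> 2 * B / h"
      using h by (simp add: divide_right_mono)
  qed (use st in auto)
  then show ?thesis by simp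
qed

lemma Cinf0_deriv:
  assumes "\<theta> \<in> Cinf0 \<Omega>"
  shows "deriv \<theta> \<in> Cinf0 \<Omega>"
proof -
  have "frechet_derivative \<theta> (at t) 1 = deriv \<theta> t" for t
  proof -
    have "(\<theta> has_real_derivative deriv \<theta> t) (at t)"
      using Cinf0_differentiable[OF assms, of t] DERIV_deriv_iff_real_differentiable by blast
    then have "(\<theta> has_derivative times (deriv \<theta> t)) (at t)" by (simp add: has_field_derivative_def)
    then have "frechet_derivative \<theta> (at t) = times (deriv \<theta> t)" using frechet_derivative_at by metis
    then show ?thesis by simp
  qed
  then show ?thesis using Cinf0_derivative[OF assms, of 1] by simp
qed

lemma sym_avg_integration_by_parts:
  assumes w: "causal B w" "\<And>t. t \<ge> T \<Longrightarrow> w t = 0" and h: "h > 0" and T: "T > 0"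
    and \<theta>: "\<theta> \<in> Cinf0 {0<..<T}"
  shows "(\<integral>t. indicat_real {0<..<T} t * (deriv \<theta> t * sym_avg h T w t) \<partial>lborel) =
    - (\<integral>t. indicat_real {0<..<T} t * (\<theta> t * ((sym_avg h T w t - fwd h w t) / h)) \<partial>lborel)"
proof -
  let ?S = "sym_avg h T w" and ?S' = "\<lambda>t. (sym_avg h T w t - fwd h w t) / h"
  have d\<theta>: "(\<theta> has_real_derivative deriv \<theta> t) (at t)" for t
    using Cinf0_differentiable[OF \<theta>, of t] DERIV_deriv_iff_real_differentiable by blast
  note cd = Cinf0_D(5)[OF Cinf0_deriv[OF \<theta>], of "{0..T}"]
  have cS: "continuous_on {0..T} ?S"
    by (rule DERIV_continuous_on[OF sym_avg_has_derivative[OF w h]])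
  have cS': "continuous_on {0..T} ?S'"
    unfolding divide_inverse
    by (intro continuous_intros cS continuous_at_imp_continuous_on ballI isCont_fwd[OF w(1)])
  note c\<theta> = Cinf0_D(5)[OF \<theta>, of "{0..T}"]
  have cc: "continuous_on {0..T} (\<lambda>t. deriv \<theta> t * ?S t + \<theta> t * ?S' t)"
    by (intro continuous_on_add continuous_on_mult c\<theta> cd cS cS')
  have "(\<integral>t. indicat_real {0..T} t *\<^sub>R (deriv \<theta> t * ?S t + \<theta> t * ?S' t) \<partial>lborel) = \<theta> T * ?S T - \<theta> 0 * ?S 0"
  proof (rule integral_FTC_atLeastAtMost)
    fix t assume "0 \<le> t" "t \<le> T"
    then have "((\<lambda>t. \<theta> t * ?S t) has_real_derivative (deriv \<theta> t * ?S t + ?S' t * \<theta> t)) (at t within {0..T})"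
      by (intro DERIV_mult has_field_derivative_at_within[OF d\<theta>] sym_avg_has_derivative[OF w h]) auto
    then show "((\<lambda>t. \<theta> t * ?S t) has_vector_derivative (deriv \<theta> t * ?S t + \<theta> t * ?S' t)) (at t within {0..T})"
      by (simp add: has_real_derivative_iff_has_vector_derivative mult.commute)
  qed (use T cc in auto)
  moreover have "\<theta> T = 0" "\<theta> 0 = 0" using Cinf0_D(4)[OF \<theta>] by auto
  ultimately have 0: "(\<integral>t. indicat_real {0..T} t *\<^sub>R (deriv \<theta> t * ?S t + \<theta> t * ?S' t) \<partial>lborel) = 0" by simp
  have i: "integrable lborel (\<lambda>t. indicat_real {0<..<T} t * f t)" if "continuous_on {0..T} f" for f :: "real \<Rightarrow> real"
  proof -
    have "set_integrable lborel {0<..<T} f"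
      by (rule set_integrable_subset[OF borel_integrable_atLeastAtMost'[OF that]]) auto
    then show ?thesis by (simp add: set_integrable_def)
  qed
  have i1: "integrable lborel (\<lambda>t. indicat_real {0<..<T} t * (deriv \<theta> t * ?S t))"
    and i2: "integrable lborel (\<lambda>t. indicat_real {0<..<T} t * (\<theta> t * ?S' t))"
    by (intro i continuous_on_mult c\<theta> cd cS cS')+
  have "(\<integral>t. indicat_real {0<..<T} t * (deriv \<theta> t * ?S t) \<partial>lborel) + (\<integral>t. indicat_real {0<..<T} t * (\<theta> t * ?S' t) \<partial>lborel)
      = (\<integral>t. indicat_real {0<..<T} t * (deriv \<theta> t * ?S t) + indicat_real {0<..<T} t * (\<theta> t * ?S' t) \<partial>lborel)"
    using i1 i2 by (rule Bochner_Integration.integral_add[symmetric])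
  also have "\<dots> = (\<integral>t. indicat_real {0..T} t *\<^sub>R (deriv \<theta> t * ?S t + \<theta> t * ?S' t) \<partial>lborel)"
  proof (rule integral_cong_AE)
    show "AE t in lborel. indicat_real {0<..<T} t * (deriv \<theta> t * ?S t) + indicat_real {0<..<T} t * (\<theta> t * ?S' t) =
        indicat_real {0..T} t *\<^sub>R (deriv \<theta> t * ?S t + \<theta> t * ?S' t)"
      using AE_lborel_singleton[of 0] AE_lborel_singleton[of T]
      by eventually_elim (auto simp: indicator_def)
    show "(\<lambda>t. indicat_real {0..T} t *\<^sub>R (deriv \<theta> t * ?S t + \<theta> t * ?S' t)) \<in> borel_measurable lborel"
      using borel_integrable_atLeastAtMost'[OF cc] unfolding set_integrable_def by (rule borel_measurable_integrable)
  qed (use i1 i2 in auto)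
  finally show ?thesis using 0 by simp
qed

text \<open>\<open>U\<close> is a function on the cylinder \<open>(0,T) \<times> B(0,r)\<close> and \<open>V\<close> its spatial gradient.\<close>

locale cylinder_function =
  fixes T r M :: real and U :: "real \<times> 'a::euclidean_space \<Rightarrow> real" and V :: "real \<times> 'a \<Rightarrow> 'a"
  assumes T: "T > 0" and r: "r > 0"
    and U_measurable [measurable]: "U \<in> borel_measurable (borel \<Otimes>\<^sub>M borel)" and U_bound: "\<And>p. \<bar>U p\<bar> \<le> M"
    and V_measurable [measurable]: "V \<in> borel_measurable (borel \<Otimes>\<^sub>M borel)" and V_square: "integrable lborel (\<lambda>p. (norm (V p))\<^sup>2)"
    and U_support: "\<And>t x. t \<notin> {0<..<T} \<or> norm x \<ge> r \<Longrightarrow> U (t, x) = 0"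
    and V_support: "\<And>t x. t \<notin> {0<..<T} \<or> norm x \<ge> r \<Longrightarrow> V (t, x) = 0"
    and weak_gradient: "AE t in lborel. t \<in> {0<..<T} \<longrightarrow> (\<forall>\<theta>\<in>Cinf0 (ball 0 r).
      (\<integral>x. U (t, x) *\<^sub>R grad \<theta> x \<partial>lborel) = - (\<integral>x. \<theta> x *\<^sub>R V (t, x) \<partial>lborel))"
begin

abbreviation SU :: "real \<Rightarrow> real \<Rightarrow> 'a \<Rightarrow> real" where
  "SU h t x \<equiv> sym_avg h T (\<lambda>\<tau>. U (\<tau>, x)) t"

text \<open>The average of the gradient as a vector-valued Bochner integral. At exceptional points
  \<open>x\<close>, where it does not converge, its value is 0 by convention; for
  \<open>t \<le> T\<close> and \<open>h > 0\<close> these form a null set.\<close>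

definition SV :: "real \<Rightarrow> real \<Rightarrow> 'a \<Rightarrow> 'a" where
  "SV h t x = (\<integral>\<tau>. sker h T t \<tau> *\<^sub>R V (\<tau>, x) \<partial>lborel)"

definition N :: "'a \<Rightarrow> real" where
  "N x = (\<integral>\<tau>. (norm (V (\<tau>, x)))\<^sup>2 \<partial>lborel)"

lemma M_nonneg: "M \<ge> 0"
  using U_bound[of undefined] by simp

lemma causal_U: "causal M (\<lambda>\<tau>. U (\<tau>, x))"
  using U_bound U_support by (auto simp: causal_def)

lemma U_end: "t \<ge> T \<Longrightarrow> U (t, x) = 0"
  using U_support by auto

lemma SU_measurable [measurable]: "(\<lambda>p. SU h (fst p) (snd p)) \<in> borel_measurable (borel \<Otimes>\<^sub>M borel)"
  unfolding sym_avg_def sker_def by measurable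

lemma fwd_U_measurable [measurable]: "(\<lambda>p. fwd h (\<lambda>\<tau>. U (\<tau>, snd p)) (fst p)) \<in> borel_measurable (borel \<Otimes>\<^sub>M borel)"
  unfolding fwd_def expconv_def by measurable

lemma SV_measurable [measurable]: "(\<lambda>p. SV h (fst p) (snd p)) \<in> borel_measurable (borel \<Otimes>\<^sub>M borel)"
  unfolding SV_def sker_def by measurable

lemma SU_bound: "h > 0 \<Longrightarrow> t \<le> T \<Longrightarrow> \<bar>SU h t x\<bar> \<le> M"
  by (rule sym_avg_bound) (use U_bound U_end in auto)

lemma SV_support: "norm x \<ge> r \<Longrightarrow> SV h t x = 0"
  using V_support by (simp add: SV_def)

lemma V_square_pair: "integrable (lborel \<Otimes>\<^sub>M lborel) (\<lambda>(t, x). (norm (V (t, x)))\<^sup>2)"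
  using V_square by (simp add: lborel_prod case_prod_beta')

lemma N_integrable: "integrable lborel N" and N_nonneg: "N x \<ge> 0"
  and AE_V_square: "AE x in lborel. integrable lborel (\<lambda>t. (norm (V (t, x)))\<^sup>2)"
  using lborel_pair.integrable_snd[OF V_square_pair] lborel_pair.AE_integrable_snd[OF V_square_pair]
  by (auto simp: N_def[abs_def])

text \<open>A crude estimate with a factor \<open>h^-2\<close>. It only serves to place the test
  function in the right spaces for fixed \<open>h\<close>; estimates uniform in \<open>h\<close>
  come from the pairings.\<close>

lemma SV_bound:
  assumes x: "integrable lborel (\<lambda>t. (norm (V (t, x)))\<^sup>2)" and h: "h > 0" and t: "t \<le> T"
  shows "integrable lborel (\<lambda>\<tau>. sker h T t \<tau> *\<^sub>R V (\<tau>, x))"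
    and "(norm (SV h t x))\<^sup>2 \<le> T / (4 * h\<^sup>2) * N x"
proof -
  let ?f = "\<lambda>\<tau>. norm (V (\<tau>, x))"
  have fi: "integrable lborel ?f"
    by (rule integrable_of_square_integrable[OF _ x, of T]) (auto intro!: V_support)
  have le: "norm (sker h T t \<tau> *\<^sub>R V (\<tau>, x)) \<le> 1 / (2 * h) * ?f \<tau>" for \<tau>
  proof (cases "\<tau> \<in> {0<..<T}")
    case True
    then show ?thesis
      using sker_bounds(1)[OF h t, of \<tau>] mult_right_mono[OF sker_bounds(3)[OF h t, of \<tau>] norm_ge_zero[of "V (\<tau>, x)"]]
      by simp
  qed (simp add: V_support)
  show i: "integrable lborel (\<lambda>\<tau>. sker h T t \<tau> *\<^sub>R V (\<tau>, x))"
    by (rule Bochner_Integration.integrable_bound[OF integrable_mult_right[OF fi, of "1 / (2 * h)"]])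
       (measurable, rule AE_I2, rule order_trans[OF le], simp only: real_norm_def abs_ge_self)
  have "norm (SV h t x) \<le> (\<integral>\<tau>. 1 / (2 * h) * ?f \<tau> \<partial>lborel)"
    unfolding SV_def by (rule Bochner_Integration.integral_norm_bound_integral[OF i integrable_mult_right[OF fi] le])
  then have "(norm (SV h t x))\<^sup>2 \<le> (1 / (2 * h) * (\<integral>\<tau>. ?f \<tau> \<partial>lborel))\<^sup>2"
    by (intro power_mono) auto
  also have "\<dots> = 1 / (4 * h\<^sup>2) * (\<integral>\<tau>. ?f \<tau> \<partial>lborel)\<^sup>2"
    by (simp add: power_mult_distrib power_divide)
  also have "\<dots> \<le> 1 / (4 * h\<^sup>2) * (T * N x)"
    unfolding N_def by (intro mult_left_mono square_integral_le[OF _ x]) (use T V_support in auto)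
  finally show "(norm (SV h t x))\<^sup>2 \<le> T / (4 * h\<^sup>2) * N x" by simp
qed

lemma SV_square:
  assumes "h > 0" "t \<le> T"
  shows "integrable lborel (\<lambda>x. (norm (SV h t x))\<^sup>2)"
proof (rule Bochner_Integration.integrable_bound[OF integrable_mult_right[OF N_integrable, of "T / (4 * h\<^sup>2)"]])
  show "AE x in lborel. norm ((norm (SV h t x))\<^sup>2) \<le> norm (T / (4 * h\<^sup>2) * N x)"
    using AE_V_square
  proof eventually_elim
    case (elim x)
    show ?case using order_trans[OF SV_bound(2)[OF elim assms] abs_ge_self]
      by (simp only: real_norm_def abs_of_nonneg[OF zero_le_power2])
  qed
  show "(\<lambda>x. (norm (SV h t x))\<^sup>2) \<in> borel_measurable lborel"
    unfolding SV_def sker_def by measurable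
qed

lemma SV_square_pair:
  assumes h: "h > 0"
  shows "integrable lborel (\<lambda>p. indicat_real {0<..<T} (fst p) * (norm (SV h (fst p) (snd p)))\<^sup>2)"
proof -
  have "integrable (lborel \<Otimes>\<^sub>M lborel) (\<lambda>(t, x). indicat_real {0<..<T} t * (T / (4 * h\<^sup>2) * N x))"
  proof (rule lborel_pair.Fubini_integrable)
    have [measurable]: "N \<in> borel_measurable borel" using borel_measurable_integrable[OF N_integrable] by simp
    show "(\<lambda>(t, x). indicat_real {0<..<T} t * (T / (4 * h\<^sup>2) * N x)) \<in> borel_measurable (lborel \<Otimes>\<^sub>M lborel)"
      by measurable
    have eq: "(\<lambda>t. \<integral>x. norm (case (t, x) of (t, x) \<Rightarrow> indicat_real {0<..<T} t * (T / (4 * h\<^sup>2) * N x)) \<partial>lborel)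
        = (\<lambda>t. indicat_real {0<..<T} t * (T / (4 * h\<^sup>2) * (\<integral>x. N x \<partial>lborel)))"
      using T N_nonneg by (simp add: abs_mult fun_eq_iff)
    show "integrable lborel (\<lambda>t. \<integral>x. norm (case (t, x) of (t, x) \<Rightarrow> indicat_real {0<..<T} t * (T / (4 * h\<^sup>2) * N x)) \<partial>lborel)"
      unfolding eq using T by (intro integrable_mult_left integrable_real_indicator) auto
    show "AE t in lborel. integrable lborel (\<lambda>x. case (t, x) of (t, x) \<Rightarrow> indicat_real {0<..<T} t * (T / (4 * h\<^sup>2) * N x))"
      using N_integrable by simp
  qed
  then show ?thesis
    unfolding lborel_prod
  proof (rule Bochner_Integration.integrable_bound)
    \<comment> \<open>The condition concerns \<open>x\<close> alone, so its exceptional set is a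
      null set of points times the whole time axis.\<close>
    have "AE p in lborel \<Otimes>\<^sub>M lborel. integrable lborel (\<lambda>t. (norm (V (t, snd p)))\<^sup>2)"
    proof (rule lborel_pair.AE_pair_measure)
      show "{p \<in> space (lborel \<Otimes>\<^sub>M lborel). integrable lborel (\<lambda>t. (norm (V (t, snd p)))\<^sup>2)} \<in> sets (lborel \<Otimes>\<^sub>M lborel)"
        by measurable
      show "AE t in lborel. AE x in lborel. integrable lborel (\<lambda>s. (norm (V (s, snd (t, x))))\<^sup>2)"
        using AE_V_square by simp
    qed
    then have "AE p in (lborel :: (real \<times> 'a) measure). integrable lborel (\<lambda>t. (norm (V (t, snd p)))\<^sup>2)"
      unfolding lborel_prod .
    then show "AE p in lborel. norm (indicat_real {0<..<T} (fst p) * (norm (SV h (fst p) (snd p)))\<^sup>2)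
        \<le> norm (case p of (t, x) \<Rightarrow> indicat_real {0<..<T} t * (T / (4 * h\<^sup>2) * N x))"
    proof eventually_elim
      case (elim p)
      have "\<bar>(norm (SV h (fst p) (snd p)))\<^sup>2\<bar> \<le> \<bar>T / (4 * h\<^sup>2) * N (snd p)\<bar>" if "fst p \<in> {0<..<T}"
      proof -
        have "fst p \<le> T" using that by simp
        from order_trans[OF SV_bound(2)[OF elim h this] abs_ge_self] show ?thesis
          by (simp only: abs_of_nonneg[OF zero_le_power2])
      qed
      then show ?case by (cases "fst p \<in> {0<..<T}") (auto simp: case_prod_beta')
    qed
    show "(\<lambda>p. indicat_real {0<..<T} (fst p) * (norm (SV h (fst p) (snd p)))\<^sup>2) \<in> borel_measurable lborel"
      unfolding lborel_prod[symmetric] by measurable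
  qed
qed

lemma V_integrable: "integrable lborel V"
proof (rule Bochner_Integration.integrable_bound)
  let ?S = "{0<..<T} \<times> ball (0::'a) r"
  have b: "bounded ?S" by (intro bounded_Times bounded_ball) (rule bounded_subset[of "{0..T}"], auto)
  have "?S \<in> sets (borel :: (real \<times> 'a) measure)" by (intro borel_open open_Times) auto
  then have "integrable lborel (indicat_real ?S)"
    using emeasure_bounded_finite[OF b] by (intro integrable_real_indicator) auto
  with V_square show "integrable lborel (\<lambda>p. (norm (V p))\<^sup>2 + indicat_real ?S p)" by simp
  have "a \<le> a\<^sup>2 + 1" for a :: real using sum_squares_bound[of a 1] zero_le_power2[of a] by (simp, linarith?)
  then have *: "norm (V p) \<le> (norm (V p))\<^sup>2 + indicat_real ?S p" for p
    using V_support[of "fst p" "snd p"] by (cases "p \<in> ?S") (auto simp: mem_Times_iff)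
  show "AE p in lborel. norm (V p) \<le> norm ((norm (V p))\<^sup>2 + indicat_real ?S p)"
    by (rule AE_I2, rule order_trans[OF *], simp only: real_norm_def abs_ge_self)
qed (simp add: borel_prod[symmetric])

text \<open>Averaging in time commutes with the weak spatial gradient: Fubini brings the space
  integral inside, and the weak identity is applied at almost every time
  \<open>\<tau>\<close>.\<close>

lemma SU_weak_gradient:
  assumes h: "h > 0" and t: "t \<le> T" and \<theta>: "\<theta> \<in> Cinf0 (ball 0 r)"
  shows "(\<integral>x. SU h t x *\<^sub>R grad \<theta> x \<partial>lborel) = - (\<integral>x. \<theta> x *\<^sub>R SV h t x \<partial>lborel)"
proof -
  note [measurable] = Cinf0_borel_measurable[OF \<theta>] Cinf0_grad_borel_measurable[OF \<theta>]
  obtain B where B: "B > 0" "\<And>x. \<bar>\<theta> x\<bar> \<le> B" using Cinf0_bounded[OF \<theta>] by blast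
  obtain B' where B': "B' > 0" "\<And>x. norm (grad \<theta> x) \<le> B'" using Cinf0_grad_bounded[OF \<theta>] by blast
  define F where "F \<tau> x = (sker h T t \<tau> * U (\<tau>, x)) *\<^sub>R grad \<theta> x" for \<tau> x
  define G where "G \<tau> x = (sker h T t \<tau> * \<theta> x) *\<^sub>R V (\<tau>, x)" for \<tau> x
  have sk: "\<bar>sker h T t \<tau>\<bar> \<le> 1 / (2 * h)" if "\<tau> \<in> {0<..<T}" for \<tau>
    using sker_bounds[OF h t, of \<tau>] that by auto
  have F: "integrable (lborel \<Otimes>\<^sub>M lborel) (case_prod F)"
    unfolding lborel_prod
  proof (rule integrable_bounded_support[of _ "(1 / (2 * h) * M) * B'" "{0<..<T} \<times> ball 0 r"])
    show "case_prod F \<in> borel_measurable borel"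
      unfolding F_def sker_def case_prod_beta' borel_prod[symmetric] by measurable
    show "norm (case p of (\<tau>, x) \<Rightarrow> F \<tau> x) \<le> (1 / (2 * h) * M) * B'" for p
    proof (cases "fst p \<in> {0<..<T}")
      case True
      have "\<bar>sker h T t (fst p)\<bar> * \<bar>U p\<bar> * norm (grad \<theta> (snd p)) \<le> (1 / (2 * h) * M) * B'"
        using h M_nonneg by (intro mult_mono sk[OF True] U_bound B') auto
      then show ?thesis by (simp add: F_def case_prod_beta' abs_mult)
    next
      case False
      then show ?thesis using h M_nonneg B'(1) U_support[of "fst p" "snd p"] by (simp add: F_def case_prod_beta')
    qed
    show "bounded ({0<..<T} \<times> ball (0::'a) r)"
      by (intro bounded_Times bounded_ball) (rule bounded_subset[of "{0..T}"], auto)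
    show "{0<..<T} \<times> ball (0::'a) r \<in> sets borel" by (intro borel_open open_Times) auto
    show "(case p of (\<tau>, x) \<Rightarrow> F \<tau> x) = 0" if "p \<notin> {0<..<T} \<times> ball 0 r" for p
      using that U_support[of "fst p" "snd p"] by (cases p) (auto simp: F_def)
  qed
  have G: "integrable (lborel \<Otimes>\<^sub>M lborel) (case_prod G)"
    unfolding lborel_prod
  proof (rule Bochner_Integration.integrable_bound[OF integrable_scaleR_right[OF V_integrable, of "1 / (2 * h) * B"] _ AE_I2])
    show "case_prod G \<in> borel_measurable lborel" unfolding G_def sker_def case_prod_beta' lborel_prod[symmetric] by measurable
    fix p :: "real \<times> 'a"
    show "norm (case p of (\<tau>, x) \<Rightarrow> G \<tau> x) \<le> norm ((1 / (2 * h) * B) *\<^sub>R V p)"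
    proof (cases "fst p \<in> {0<..<T}")
      case True
      have "\<bar>sker h T t (fst p)\<bar> * \<bar>\<theta> (snd p)\<bar> * norm (V p) \<le> (1 / (2 * h) * B) * norm (V p)"
        using h by (intro mult_right_mono mult_mono sk[OF True] B) auto
      then show ?thesis using h B(1) by (simp add: G_def case_prod_beta' abs_mult)
    qed (use V_support[of "fst p" "snd p"] in \<open>simp add: G_def case_prod_beta'\<close>)
  qed
  have "(\<integral>x. SU h t x *\<^sub>R grad \<theta> x \<partial>lborel) = (\<integral>x. (\<integral>\<tau>. F \<tau> x \<partial>lborel) \<partial>lborel)"
  proof (rule Bochner_Integration.integral_cong[OF refl])
    fix x
    have "integrable lborel (\<lambda>\<tau>. sker h T t \<tau> * U (\<tau>, x))"
    proof (rule integrable_bounded_support[of _ "1 / (2 * h) * M" "{0<..<T}"])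
      show "norm (sker h T t \<tau> * U (\<tau>, x)) \<le> 1 / (2 * h) * M" for \<tau>
      proof (cases "\<tau> \<in> {0<..<T}")
        case True
        then show ?thesis unfolding real_norm_def abs_mult using h M_nonneg by (intro mult_mono sk U_bound) auto
      qed (use U_support[of \<tau> x] h M_nonneg in simp)
      show "bounded {0<..<T}" by (rule bounded_subset[of "{0..T}"]) auto
    qed (use U_support in auto)
    then show "SU h t x *\<^sub>R grad \<theta> x = (\<integral>\<tau>. F \<tau> x \<partial>lborel)"
      unfolding sym_avg_def F_def by (rule integral_scaleR_left[symmetric])
  qed
  also have "\<dots> = (\<integral>\<tau>. (\<integral>x. F \<tau> x \<partial>lborel) \<partial>lborel)" by (rule lborel_pair.Fubini_integral[OF F])
  also have "\<dots> = (\<integral>\<tau>. - (\<integral>x. G \<tau> x \<partial>lborel) \<partial>lborel)"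
  proof (rule integral_cong_AE)
    show "AE \<tau> in lborel. (\<integral>x. F \<tau> x \<partial>lborel) = - (\<integral>x. G \<tau> x \<partial>lborel)"
      using weak_gradient
    proof eventually_elim
      case (elim \<tau>)
      show ?case
      proof (cases "\<tau> \<in> {0<..<T}")
        case True
        have "(\<integral>x. F \<tau> x \<partial>lborel) = sker h T t \<tau> *\<^sub>R (\<integral>x. U (\<tau>, x) *\<^sub>R grad \<theta> x \<partial>lborel)"
          by (simp add: F_def flip: integral_scaleR_right)
        also have "\<dots> = - (sker h T t \<tau> *\<^sub>R (\<integral>x. \<theta> x *\<^sub>R V (\<tau>, x) \<partial>lborel))"
          using elim True \<theta> by simp
        also have "\<dots> = - (\<integral>x. G \<tau> x \<partial>lborel)"
          by (simp add: G_def flip: integral_scaleR_right)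
        finally show ?thesis .
      qed (use U_support V_support in \<open>simp add: F_def G_def\<close>)
    qed
  qed (use lborel_pair.integrable_fst[OF F] lborel_pair.integrable_fst[OF G] in \<open>auto intro: borel_measurable_integrable\<close>)
  also have "\<dots> = - (\<integral>x. (\<integral>\<tau>. G \<tau> x \<partial>lborel) \<partial>lborel)"
    using lborel_pair.Fubini_integral[OF G] by simp
  also have "(\<integral>x. (\<integral>\<tau>. G \<tau> x \<partial>lborel) \<partial>lborel) = (\<integral>x. \<theta> x *\<^sub>R SV h t x \<partial>lborel)"
  proof (rule Bochner_Integration.integral_cong[OF refl])
    fix x
    have "(\<integral>\<tau>. G \<tau> x \<partial>lborel) = (\<integral>\<tau>. \<theta> x *\<^sub>R (sker h T t \<tau> *\<^sub>R V (\<tau>, x)) \<partial>lborel)"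
      by (rule Bochner_Integration.integral_cong) (auto simp: G_def)
    then show "(\<integral>\<tau>. G \<tau> x \<partial>lborel) = \<theta> x *\<^sub>R SV h t x" by (simp only: SV_def integral_scaleR_right)
  qed
  finally show ?thesis .
qed

lemma SV_integrable:
  assumes "h > 0" "t \<le> T"
  shows "integrable lborel (SV h t)"
proof (rule Bochner_Integration.integrable_bound)
  have "integrable lborel (indicat_real (cball (0::'a) r))"
    by (intro integrable_real_indicator) (auto simp: emeasure_bounded_finite[OF bounded_cball, simplified])
  with SV_square[OF assms] show "integrable lborel (\<lambda>x. (norm (SV h t x))\<^sup>2 + indicat_real (cball 0 r) x)" by simp
  have "a \<le> a\<^sup>2 + 1" for a :: real using sum_squares_bound[of a 1] zero_le_power2[of a] by (simp, linarith?)
  then have *: "norm (SV h t x) \<le> (norm (SV h t x))\<^sup>2 + indicat_real (cball 0 r) x" for x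
    using SV_support[of x h t] by (cases "norm x \<le> r") auto
  show "AE x in lborel. norm (SV h t x) \<le> norm ((norm (SV h t x))\<^sup>2 + indicat_real (cball 0 r) x)"
    by (rule AE_I2, rule order_trans[OF *], simp only: real_norm_def abs_ge_self)
  show "SV h t \<in> borel_measurable lborel" unfolding SV_def[abs_def] sker_def by measurable
qed

text \<open>The square of the cutoff leaves one factor \<open>bump R\<close> in the term with its
  gradient, to be absorbed by ellipticity. The indicator removes times beyond \<open>T\<close>,
  where the averaging kernel is not controlled.\<close>

definition tst :: "real \<Rightarrow> real \<Rightarrow> real \<Rightarrow> 'a \<Rightarrow> real" where
  "tst h R t x = indicat_real {0<..<T} t * ((bump R x)\<^sup>2 * SU h t x)"

text \<open>The time derivative, read off from the backward differential equation: the symmetric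
  average minus the forward average, divided by \<open>h\<close>.\<close>

definition tst' :: "real \<Rightarrow> real \<Rightarrow> real \<Rightarrow> 'a \<Rightarrow> real" where
  "tst' h R t x = indicat_real {0<..<T} t * ((bump R x)\<^sup>2 * ((SU h t x - fwd h (\<lambda>\<tau>. U (\<tau>, x)) t) / h))"

definition Dtst :: "real \<Rightarrow> real \<Rightarrow> real \<Rightarrow> 'a \<Rightarrow> 'a" where
  "Dtst h R t x = indicat_real {0<..<T} t *\<^sub>R ((bump R x)\<^sup>2 *\<^sub>R SV h t x + (2 * bump R x * SU h t x) *\<^sub>R grad (bump R) x)"

section \<open>Admissibility of the test function\<close>

lemma bump_measurable [measurable]: "R > 0 \<Longrightarrow> (bump R :: 'a \<Rightarrow> real) \<in> borel_measurable borel"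
  using Cinf0_borel_measurable[OF bump_in_Cinf0[OF _ subset_UNIV]] .

lemma grad_bump_measurable [measurable]: "R > 0 \<Longrightarrow> grad (bump R :: 'a \<Rightarrow> real) \<in> borel_measurable borel"
  using Cinf0_grad_borel_measurable[OF bump_in_Cinf0[OF _ subset_UNIV]] .

lemma tst_measurable [measurable]:
  assumes [simp]: "R > 0"
  shows "(\<lambda>p. tst h R (fst p) (snd p)) \<in> borel_measurable (borel \<Otimes>\<^sub>M borel)"
    and "(\<lambda>p. tst' h R (fst p) (snd p)) \<in> borel_measurable (borel \<Otimes>\<^sub>M borel)"
    and "(\<lambda>p. Dtst h R (fst p) (snd p)) \<in> borel_measurable (borel \<Otimes>\<^sub>M borel)"
  unfolding tst_def tst'_def Dtst_def by measurable

lemma cylinder: "bounded ({0<..<T} \<times> ball (0::'a) r)" "{0<..<T} \<times> ball (0::'a) r \<in> sets borel"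
  by (intro bounded_Times bounded_ball, rule bounded_subset[of "{0..T}"], auto)
     (intro borel_open open_Times, auto)

lemma grad_bump_outside:
  assumes "R > 0" "norm x > R"
  shows "grad (bump R) (x :: 'a) = 0"
proof (rule grad_eq_0_outside)
  show "x \<notin> closure {x. bump R x \<noteq> 0}"
    using Cinf0_D(3)[OF bump_in_Cinf0[OF assms(1) order_refl]] assms(2) by auto
qed

text \<open>The product rule in weak form: the weak gradient identity of the average is tested with
  the square of the cutoff times an arbitrary \<open>\<theta>\<close>. The support lies in the ball
  of radius \<open>R < r\<close>, so zero boundary values follow.\<close>

lemma test_function_H10:
  assumes h: "h > 0" and R: "R > 0" "R < r" and t: "t \<in> {0<..<T}"
  shows "H10_grad (ball 0 r) (tst h R t) (Dtst h R t)"
proof (rule H10_gradI[OF _ _ _ _ _ _ _ R(2)])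
  have b: "bump R \<in> Cinf0 (ball (0::'a) r)" using R by (intro bump_in_Cinf0) auto
  note bm [measurable] = bump_measurable[OF R(1)] grad_bump_measurable[OF R(1)]
  have sm [measurable]: "SV h t \<in> borel_measurable borel" "SU h t \<in> borel_measurable borel"
    unfolding SV_def[abs_def] sker_def sym_avg_def[abs_def] by measurable
  obtain B where B: "B > 0" "\<And>x. norm (grad (bump R) (x::'a)) \<le> B" using Cinf0_grad_bounded[OF b] by blast
  have J: "indicat_real {0<..<T} t = 1" using t by simp
  have tT: "t \<le> T" using t by simp
  have bb: "\<bar>(bump R (x::'a))\<^sup>2\<bar> \<le> 1" for x using bump_nonneg[of R x] bump_le_1[of R x] by (simp add: power_le_one)
  show m1: "tst h R t \<in> borel_measurable borel" unfolding tst_def[abs_def] by measurable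
  show m2: "Dtst h R t \<in> borel_measurable borel" unfolding Dtst_def[abs_def] by measurable
  show s1: "tst h R t x = 0" if "norm x > R" for x using that bump_eq_0[of R x] R by (simp add: tst_def)
  show s2: "Dtst h R t x = 0" if "norm x > R" for x using that bump_eq_0[of R x] R by (simp add: Dtst_def)
  have tb: "\<bar>tst h R t x\<bar> \<le> 1 * M" for x
  proof -
    have "\<bar>(bump R x)\<^sup>2\<bar> * \<bar>SU h t x\<bar> \<le> 1 * M"
      using SU_bound[OF h tT, of x] bb by (intro mult_mono) auto
    then show ?thesis by (simp add: tst_def J abs_mult)
  qed
  have "\<bar>(tst h R t x)\<^sup>2\<bar> \<le> (1 * M)\<^sup>2" for x
    using power_mono[OF tb, of x 2] by simp
  then show "integrable lborel (\<lambda>x. (tst h R t x)\<^sup>2)"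
    by (intro integrable_bounded_support[of _ "(1 * M)\<^sup>2" "cball 0 R"]) (use m1 s1 in auto)
  define K where "K = 2 * M * B"
  have gb: "norm ((2 * bump R x * SU h t x) *\<^sub>R grad (bump R) x) \<le> K * indicat_real (cball 0 r) x" for x
  proof (cases "norm x \<le> r")
    case True
    have "2 * bump R x * \<bar>SU h t x\<bar> * norm (grad (bump R) x) \<le> 2 * 1 * M * B"
      using bump_nonneg[of R x] bump_le_1[of R x] SU_bound[OF h tT, of x] B M_nonneg by (intro mult_mono) auto
    then show ?thesis using True bump_nonneg[of R x] by (simp add: K_def abs_mult)
  qed (use bump_eq_0[of R x] R in simp)
  show i2: "integrable lborel (\<lambda>x. (norm (Dtst h R t x))\<^sup>2)"
  proof (rule Bochner_Integration.integrable_bound)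
    have "integrable lborel (indicat_real (cball (0::'a) r))"
      by (intro integrable_real_indicator) (auto simp: emeasure_bounded_finite[OF bounded_cball, simplified])
    then show "integrable lborel (\<lambda>x. 2 * (norm (SV h t x))\<^sup>2 + 2 * K\<^sup>2 * indicat_real (cball 0 r) x)"
      using SV_square[OF h tT] by simp
    have "(norm (Dtst h R t x))\<^sup>2 \<le> 2 * (norm (SV h t x))\<^sup>2 + 2 * K\<^sup>2 * indicat_real (cball 0 r) x" for x
    proof -
      have "norm (Dtst h R t x) \<le> norm ((bump R x)\<^sup>2 *\<^sub>R SV h t x) + norm ((2 * bump R x * SU h t x) *\<^sub>R grad (bump R) x)"
        unfolding Dtst_def J scaleR_one by (rule norm_triangle_ineq)
      also have "\<dots> \<le> norm (SV h t x) + K * indicat_real (cball 0 r) x"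
        using mult_right_mono[OF bb[of x] norm_ge_zero[of "SV h t x"]] by (intro add_mono gb) simp
      finally have "(norm (Dtst h R t x))\<^sup>2 \<le> (norm (SV h t x) + K * indicat_real (cball 0 r) x)\<^sup>2"
        by (intro power_mono) auto
      also have "\<dots> \<le> 2 * (norm (SV h t x))\<^sup>2 + 2 * (K * indicat_real (cball 0 r) x)\<^sup>2"
        using sum_squares_bound[of "norm (SV h t x)" "K * indicat_real (cball 0 r) x"]
        by (simp add: power2_sum)
      finally show ?thesis by (cases "norm x \<le> r") (simp_all add: power_mult_distrib)
    qed
    then show "AE x in lborel. norm ((norm (Dtst h R t x))\<^sup>2) \<le> norm (2 * (norm (SV h t x))\<^sup>2 + 2 * K\<^sup>2 * indicat_real (cball 0 r) x)"
      by (auto intro!: AE_I2 order_trans[OF _ abs_ge_self])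
  qed (use m2 in measurable)
  fix \<theta> :: "'a \<Rightarrow> real" assume \<theta>: "\<theta> \<in> Cinf0 UNIV"
  note [measurable] = Cinf0_borel_measurable[OF \<theta>] Cinf0_grad_borel_measurable[OF \<theta>]
  \<comment> \<open>This test function moves the cutoff from the average onto
    \<open>\<theta>\<close>. The extra term of its gradient becomes the cutoff-gradient part of
    \<open>Dtst\<close>.\<close>
  define \<psi> where "\<psi> x = bump R x * (bump R x * \<theta> x)" for x
  have b\<theta>: "(\<lambda>x. bump R x * \<theta> x) \<in> Cinf0 (ball 0 r)" by (rule Cinf0_mult[OF b Cinf0_D(1)[OF \<theta>]])
  have \<psi>: "\<psi> \<in> Cinf0 (ball 0 r)"
    unfolding \<psi>_def[abs_def] by (rule Cinf0_mult[OF b Cinf0_D(1)[OF b\<theta>]])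
  have g\<psi>: "grad \<psi> x = (bump R x)\<^sup>2 *\<^sub>R grad \<theta> x + (2 * bump R x * \<theta> x) *\<^sub>R grad (bump R) x" for x
    unfolding \<psi>_def[abs_def]
    by (simp add: grad_mult Cinf0_differentiable[OF b] Cinf0_differentiable[OF b\<theta>] Cinf0_differentiable[OF \<theta>]
        power2_eq_square algebra_simps scaleR_add_left[symmetric] flip: scaleR_2)
  obtain B1 where B1: "B1 > 0" "\<And>x. \<bar>\<theta> x\<bar> \<le> B1" using Cinf0_bounded[OF \<theta>] by blast
  obtain B2 where B2: "B2 > 0" "\<And>x. norm (grad \<theta> x) \<le> B2" using Cinf0_grad_bounded[OF \<theta>] by blast
  have j1: "integrable lborel (\<lambda>x. (SU h t x * (bump R x)\<^sup>2) *\<^sub>R grad \<theta> x)"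
  proof (rule integrable_bounded_support[of _ "M * 1 * B2" "cball 0 R"])
    show "norm ((SU h t x * (bump R x)\<^sup>2) *\<^sub>R grad \<theta> x) \<le> M * 1 * B2" for x
      unfolding norm_scaleR abs_mult using SU_bound[OF h tT, of x] bb[of x] B2 M_nonneg by (intro mult_mono) auto
    show "(SU h t x * (bump R x)\<^sup>2) *\<^sub>R grad \<theta> x = 0" if "x \<notin> cball 0 R" for x
      using that bump_eq_0[of R x] R by simp
  qed auto
  have j2: "integrable lborel (\<lambda>x. \<theta> x *\<^sub>R ((2 * bump R x * SU h t x) *\<^sub>R grad (bump R) x))"
  proof (rule integrable_bounded_support[of _ "B1 * K" "cball 0 R"])
    show "norm (\<theta> x *\<^sub>R ((2 * bump R x * SU h t x) *\<^sub>R grad (bump R) x)) \<le> B1 * K" for x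
    proof -
      have "K \<ge> 0" using B M_nonneg by (simp add: K_def)
      then have "K * indicat_real (cball 0 r) x \<le> K * 1" by (intro mult_left_mono) (auto simp: indicator_def)
      then have "norm ((2 * bump R x * SU h t x) *\<^sub>R grad (bump R) x) \<le> K"
        using order_trans[OF gb[of x]] by simp
      then show ?thesis unfolding norm_scaleR[of "\<theta> x"] using B1 by (intro mult_mono) auto
    qed
    show "\<theta> x *\<^sub>R ((2 * bump R x * SU h t x) *\<^sub>R grad (bump R) x) = 0" if "x \<notin> cball 0 R" for x
      using that bump_eq_0[of R x] R by simp
  qed auto
  have j3: "integrable lborel (\<lambda>x. \<theta> x *\<^sub>R ((bump R x)\<^sup>2 *\<^sub>R SV h t x))"
  proof (rule Bochner_Integration.integrable_bound[OF integrable_scaleR_right[OF SV_integrable[OF h tT], of B1] _ AE_I2])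
    fix x
    have "\<bar>\<theta> x\<bar> * (\<bar>(bump R x)\<^sup>2\<bar> * norm (SV h t x)) \<le> B1 * (1 * norm (SV h t x))"
      using B1 bb by (intro mult_mono) auto
    then show "norm (\<theta> x *\<^sub>R ((bump R x)\<^sup>2 *\<^sub>R SV h t x)) \<le> norm (B1 *\<^sub>R SV h t x)"
      using B1(1) by (simp add: abs_mult mult.assoc)
  qed measurable
  have "(\<integral>x. SU h t x *\<^sub>R grad \<psi> x \<partial>lborel) = - (\<integral>x. \<psi> x *\<^sub>R SV h t x \<partial>lborel)"
    by (rule SU_weak_gradient[OF h tT \<psi>])
  moreover have "(\<integral>x. SU h t x *\<^sub>R grad \<psi> x \<partial>lborel) =
      (\<integral>x. (SU h t x * (bump R x)\<^sup>2) *\<^sub>R grad \<theta> x + \<theta> x *\<^sub>R ((2 * bump R x * SU h t x) *\<^sub>R grad (bump R) x) \<partial>lborel)"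
    by (rule Bochner_Integration.integral_cong) (auto simp: g\<psi> scaleR_add_right mult_ac)
  moreover have "(\<integral>x. \<psi> x *\<^sub>R SV h t x \<partial>lborel) = (\<integral>x. \<theta> x *\<^sub>R ((bump R x)\<^sup>2 *\<^sub>R SV h t x) \<partial>lborel)"
    by (rule Bochner_Integration.integral_cong) (auto simp: \<psi>_def power2_eq_square mult_ac)
  ultimately have e1: "(\<integral>x. (SU h t x * (bump R x)\<^sup>2) *\<^sub>R grad \<theta> x \<partial>lborel) =
      - ((\<integral>x. \<theta> x *\<^sub>R ((bump R x)\<^sup>2 *\<^sub>R SV h t x) \<partial>lborel) + (\<integral>x. \<theta> x *\<^sub>R ((2 * bump R x * SU h t x) *\<^sub>R grad (bump R) x) \<partial>lborel))"
    using j1 j2 by (simp add: Bochner_Integration.integral_add eq_neg_iff_add_eq_0 algebra_simps)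
  have "(\<integral>x. tst h R t x *\<^sub>R grad \<theta> x \<partial>lborel) = (\<integral>x. (SU h t x * (bump R x)\<^sup>2) *\<^sub>R grad \<theta> x \<partial>lborel)"
    by (simp add: tst_def J mult.commute)
  also note e1
  also have "(\<integral>x. \<theta> x *\<^sub>R ((bump R x)\<^sup>2 *\<^sub>R SV h t x) \<partial>lborel) + (\<integral>x. \<theta> x *\<^sub>R ((2 * bump R x * SU h t x) *\<^sub>R grad (bump R) x) \<partial>lborel)
      = (\<integral>x. \<theta> x *\<^sub>R ((bump R x)\<^sup>2 *\<^sub>R SV h t x) + \<theta> x *\<^sub>R ((2 * bump R x * SU h t x) *\<^sub>R grad (bump R) x) \<partial>lborel)"
    by (rule Bochner_Integration.integral_add[OF j3 j2, symmetric])
  also have "\<dots> = (\<integral>x. \<theta> x *\<^sub>R Dtst h R t x \<partial>lborel)"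
    by (simp only: Dtst_def J scaleR_one scaleR_add_right)
  finally show "(\<integral>x. tst h R t x *\<^sub>R grad \<theta> x \<partial>lborel) = - (\<integral>x. \<theta> x *\<^sub>R Dtst h R t x \<partial>lborel)" .
qed

lemma L2_L2_cylinder:
  fixes f :: "real \<Rightarrow> 'a \<Rightarrow> 'c::euclidean_space"
  assumes "(\<lambda>p. f (fst p) (snd p)) \<in> borel_measurable (borel \<Otimes>\<^sub>M borel)"
    and "\<And>t x. t \<notin> {0<..<T} \<or> norm x \<ge> r \<Longrightarrow> f t x = 0"
    and "integrable lborel (\<lambda>p. (norm (f (fst p) (snd p)))\<^sup>2)"
  shows "L2_L2 T (ball 0 r) f"
  unfolding L2_L2_def case_prod_beta'
proof (rule L2_borelI(1)[OF cylinder(2)])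
  show "f (fst p) (snd p) = 0" if "p \<notin> {0<..<T} \<times> ball 0 r" for p
    using that assms(2)[of "fst p" "snd p"] by (cases p) auto
qed (use assms in \<open>auto simp: borel_prod\<close>)

lemma bounded_square_cylinder:
  fixes f :: "real \<Rightarrow> 'a \<Rightarrow> real"
  assumes m: "(\<lambda>p. f (fst p) (snd p)) \<in> borel_measurable (borel \<Otimes>\<^sub>M borel)"
    and z: "\<And>t x. t \<notin> {0<..<T} \<or> norm x \<ge> r \<Longrightarrow> f t x = 0"
    and b: "\<And>t x. \<bar>f t x\<bar> \<le> C"
  shows "integrable lborel (\<lambda>p. (norm (f (fst p) (snd p)))\<^sup>2)"
proof (rule integrable_bounded_support[of _ "C\<^sup>2" "{0<..<T} \<times> ball (0::'a) r"])
  note [measurable] = m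
  show "(\<lambda>p. (norm (f (fst p) (snd p)))\<^sup>2) \<in> borel_measurable borel"
    unfolding borel_prod[symmetric] by measurable
  show "norm ((norm (f (fst p) (snd p)))\<^sup>2) \<le> C\<^sup>2" for p
    using power_mono[OF b[of "fst p" "snd p"], of 2] by simp
  show "(norm (f (fst p) (snd p)))\<^sup>2 = 0" if "p \<notin> {0<..<T} \<times> ball 0 r" for p
    using that z[of "fst p" "snd p"] by (cases p) auto
qed (use cylinder in auto)

lemma bump_square_le: "\<bar>(bump R (x::'a))\<^sup>2\<bar> \<le> 1"
  using bump_nonneg[of R x] bump_le_1[of R x] by (simp add: power_le_one)

lemma tst_support:
  assumes "R > 0" "R < r" "t \<notin> {0<..<T} \<or> norm x \<ge> r"
  shows "tst h R t x = 0" "tst' h R t x = 0" "Dtst h R t x = 0"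
  using assms bump_eq_0[of R x] by (auto simp: tst_def tst'_def Dtst_def)

lemma tst_bound:
  assumes "h > 0"
  shows "\<bar>tst h R t x\<bar> \<le> M" "\<bar>tst' h R t x\<bar> \<le> 2 * M / h"
proof -
  have "\<bar>tst h R t x\<bar> \<le> M \<and> \<bar>tst' h R t x\<bar> \<le> 2 * M / h"
  proof (cases "t \<in> {0<..<T}")
    case True
    have S: "\<bar>SU h t x\<bar> \<le> M" by (rule SU_bound[OF assms]) (use True in simp)
    have "\<bar>fwd h (\<lambda>\<tau>. U (\<tau>, x)) t\<bar> \<le> M" by (rule causalD(2)[OF causal_fwd[OF causal_U assms]])
    then have "\<bar>SU h t x - fwd h (\<lambda>\<tau>. U (\<tau>, x)) t\<bar> / h \<le> 2 * M / h"
      using S assms by (intro divide_right_mono) auto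
    then have S': "\<bar>(SU h t x - fwd h (\<lambda>\<tau>. U (\<tau>, x)) t) / h\<bar> \<le> 2 * M / h" using assms by simp
    have "\<bar>(bump R x)\<^sup>2\<bar> * \<bar>SU h t x\<bar> \<le> 1 * M"
      "\<bar>(bump R x)\<^sup>2\<bar> * \<bar>(SU h t x - fwd h (\<lambda>\<tau>. U (\<tau>, x)) t) / h\<bar> \<le> 1 * (2 * M / h)"
      using S S' bump_square_le[of R x] by (intro mult_mono; simp)+
    then show ?thesis using True by (simp add: tst_def tst'_def abs_mult)
  next
    case False
    then show ?thesis using M_nonneg assms by (simp add: tst_def tst'_def)
  qed
  then show "\<bar>tst h R t x\<bar> \<le> M" "\<bar>tst' h R t x\<bar> \<le> 2 * M / h" by auto
qed

lemma tst_square: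
  assumes h: "h > 0" and R: "R > 0" "R < r"
  shows "integrable lborel (\<lambda>p. (norm (tst h R (fst p) (snd p)))\<^sup>2)"
    and "integrable lborel (\<lambda>p. (norm (tst' h R (fst p) (snd p)))\<^sup>2)"
    and "integrable lborel (\<lambda>p. (norm (Dtst h R (fst p) (snd p)))\<^sup>2)"
proof -
  show "integrable lborel (\<lambda>p. (norm (tst h R (fst p) (snd p)))\<^sup>2)"
    by (rule bounded_square_cylinder[OF tst_measurable(1)[OF R(1)] tst_support(1)[OF R] tst_bound(1)[OF h]])
  show "integrable lborel (\<lambda>p. (norm (tst' h R (fst p) (snd p)))\<^sup>2)"
    by (rule bounded_square_cylinder[OF tst_measurable(2)[OF R(1)] tst_support(2)[OF R] tst_bound(2)[OF h]])
  have b: "bump R \<in> Cinf0 (ball (0::'a) r)" using R by (intro bump_in_Cinf0) auto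
  obtain B where B: "B > 0" "\<And>x. norm (grad (bump R) (x::'a)) \<le> B" using Cinf0_grad_bounded[OF b] by blast
  define K where "K = 2 * M * B"
  let ?S = "{0<..<T} \<times> ball (0::'a) r"
  show "integrable lborel (\<lambda>p. (norm (Dtst h R (fst p) (snd p)))\<^sup>2)"
  proof (rule Bochner_Integration.integrable_bound)
    have "integrable lborel (indicat_real ?S)"
      using emeasure_bounded_finite[OF cylinder(1)] cylinder(2) by (intro integrable_real_indicator) auto
    then show "integrable lborel (\<lambda>p. 2 * (indicat_real {0<..<T} (fst p) * (norm (SV h (fst p) (snd p)))\<^sup>2) + 2 * K\<^sup>2 * indicat_real ?S p)"
      using SV_square_pair[OF h] by simp
    have ptw: "(norm (Dtst h R t x))\<^sup>2 \<le> 2 * (indicat_real {0<..<T} t * (norm (SV h t x))\<^sup>2) + 2 * K\<^sup>2 * indicat_real ?S (t, x)" for t x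
    proof (cases "t \<in> {0<..<T} \<and> norm x < r")
      case True
      then have J: "indicat_real {0<..<T} t = 1" "t \<le> T" by auto
      have g: "norm ((2 * bump R x * SU h t x) *\<^sub>R grad (bump R) x) \<le> K"
      proof -
        have "2 * bump R x * \<bar>SU h t x\<bar> * norm (grad (bump R) x) \<le> 2 * 1 * M * B"
          using bump_nonneg[of R x] bump_le_1[of R x] SU_bound[OF h J(2), of x] B M_nonneg by (intro mult_mono) auto
        then show ?thesis using bump_nonneg[of R x] by (simp add: K_def abs_mult)
      qed
      have "norm (Dtst h R t x) \<le> norm ((bump R x)\<^sup>2 *\<^sub>R SV h t x) + norm ((2 * bump R x * SU h t x) *\<^sub>R grad (bump R) x)"
        unfolding Dtst_def J scaleR_one by (rule norm_triangle_ineq)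
      also have "\<dots> \<le> norm (SV h t x) + K"
        using mult_right_mono[OF bump_square_le[of R x] norm_ge_zero[of "SV h t x"]] by (intro add_mono g) simp
      finally have "(norm (Dtst h R t x))\<^sup>2 \<le> (norm (SV h t x) + K)\<^sup>2"
        by (intro power_mono) auto
      also have "\<dots> \<le> 2 * (norm (SV h t x))\<^sup>2 + 2 * K\<^sup>2"
        using sum_squares_bound[of "norm (SV h t x)" K] by (simp add: power2_sum)
      finally show ?thesis using True by simp
    next
      case False
      then have "Dtst h R t x = 0" by (intro tst_support(3)[OF R]) auto
      then show ?thesis by simp
    qed
    show "AE p in lborel. norm ((norm (Dtst h R (fst p) (snd p)))\<^sup>2) \<le>
        norm (2 * (indicat_real {0<..<T} (fst p) * (norm (SV h (fst p) (snd p)))\<^sup>2) + 2 * K\<^sup>2 * indicat_real ?S p)"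
    proof (rule AE_I2)
      fix p
      from order_trans[OF ptw[of "fst p" "snd p"] abs_ge_self]
      show "norm ((norm (Dtst h R (fst p) (snd p)))\<^sup>2) \<le>
        norm (2 * (indicat_real {0<..<T} (fst p) * (norm (SV h (fst p) (snd p)))\<^sup>2) + 2 * K\<^sup>2 * indicat_real ?S p)"
        by (simp only: real_norm_def abs_of_nonneg[OF zero_le_power2] prod.collapse)
    qed
    note [measurable] = tst_measurable(3)[OF R(1)]
    show "(\<lambda>p. (norm (Dtst h R (fst p) (snd p)))\<^sup>2) \<in> borel_measurable lborel"
      unfolding lborel_prod[symmetric] by measurable
  qed
qed

lemma test_function:
  assumes h: "h > 0" and R: "R > 0" "R < r"
  shows "H1_L2 T (ball 0 r) (tst h R) (tst' h R)" (is ?H1)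
    and "L2_H10 T (ball 0 r) (tst h R) (Dtst h R)" (is ?H10)
    and "C_L2_vanishing T (ball 0 r) T (tst h R)" (is ?C)
proof -
  note L = L2_L2_cylinder[OF tst_measurable(1)[OF R(1)] tst_support(1)[OF R] tst_square(1)[OF h R]]
    L2_L2_cylinder[OF tst_measurable(2)[OF R(1)] tst_support(2)[OF R] tst_square(2)[OF h R]]
    L2_L2_cylinder[OF tst_measurable(3)[OF R(1)] tst_support(3)[OF R] tst_square(3)[OF h R]]
  show ?H10
    unfolding L2_H10_def using L(1,3) test_function_H10[OF h R] by (auto intro!: AE_I2)
  show ?H1
    unfolding H1_L2_def
  proof (intro conjI L(1,2) ballI AE_I2)
    fix \<theta> :: "real \<Rightarrow> real" and x :: 'a
    assume \<theta>: "\<theta> \<in> Cinf0 {0<..<T}"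
    let ?w = "\<lambda>\<tau>. U (\<tau>, x)"
    note [measurable] = sym_avg_measurable[OF causalD(1)[OF causal_U[of x]]]
      causalD(1)[OF causal_fwd[OF causal_U[of x] h]] Cinf0_borel_measurable[OF \<theta>]
    note [measurable] = Cinf0_borel_measurable[OF Cinf0_deriv[OF \<theta>]]
    have m1: "(\<lambda>t. deriv \<theta> t * tst h R t x) \<in> borel_measurable borel"
      unfolding tst_def by measurable
    have m2: "(\<lambda>t. \<theta> t * tst' h R t x) \<in> borel_measurable borel"
      unfolding tst'_def by measurable
    have "(LINT t|lebesgue_on {0<..<T}. deriv \<theta> t * tst h R t x) = (\<integral>t. deriv \<theta> t * tst h R t x \<partial>lborel)"
      by (rule integral_lebesgue_on_borel(1)[OF _ m1]) (auto simp: tst_def)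
    also have "\<dots> = (\<integral>t. (bump R x)\<^sup>2 * (indicat_real {0<..<T} t * (deriv \<theta> t * sym_avg h T ?w t)) \<partial>lborel)"
      by (rule Bochner_Integration.integral_cong) (auto simp: tst_def)
    also have "\<dots> = (bump R x)\<^sup>2 * - (\<integral>t. indicat_real {0<..<T} t * (\<theta> t * ((sym_avg h T ?w t - fwd h ?w t) / h)) \<partial>lborel)"
      unfolding Bochner_Integration.integral_mult_right_zero
      by (subst sym_avg_integration_by_parts[OF causal_U _ h T \<theta>]) (rule U_end, assumption, rule refl)
    also have "\<dots> = - (\<integral>t. (bump R x)\<^sup>2 * (indicat_real {0<..<T} t * (\<theta> t * ((sym_avg h T ?w t - fwd h ?w t) / h))) \<partial>lborel)"
      unfolding Bochner_Integration.integral_mult_right_zero by (rule mult_minus_right)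
    also have "(\<integral>t. (bump R x)\<^sup>2 * (indicat_real {0<..<T} t * (\<theta> t * ((sym_avg h T ?w t - fwd h ?w t) / h))) \<partial>lborel)
        = (\<integral>t. \<theta> t * tst' h R t x \<partial>lborel)"
      by (rule Bochner_Integration.integral_cong) (auto simp: tst'_def)
    also have "\<dots> = (LINT t|lebesgue_on {0<..<T}. \<theta> t * tst' h R t x)"
      by (rule integral_lebesgue_on_borel(1)[OF _ m2, symmetric]) (auto simp: tst'_def)
    finally show "(LINT t|lebesgue_on {0<..<T}. deriv \<theta> t * tst h R t x) = - (LINT t|lebesgue_on {0<..<T}. \<theta> t * tst' h R t x)" .
  qed
  \<comment> \<open>The representative without the time indicator. The test function is set to 0 at
    time 0, where the average is in general nonzero, and so is not itself continuous up to the
    boundary.\<close>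
  define w where "w t x = (bump R x)\<^sup>2 * SU h t x" for t and x :: 'a
  note [measurable] = bump_measurable[OF R(1)]
  have wm [measurable]: "w t \<in> borel_measurable borel" for t
    unfolding w_def[abs_def] sym_avg_def sker_def by measurable
  have w0: "x \<notin> ball 0 r \<Longrightarrow> w t x = 0" for t x using bump_eq_0[of R x] R by (auto simp: w_def)
  have bnd: "bounded (ball (0::'a) r)" "ball (0::'a) r \<in> sets borel" by auto
  have wL: "w t \<in> L2 (ball 0 r)" if "t \<in> {0..T}" for t
  proof (rule L2_borelI(1)[OF bnd(2) wm w0])
    have "\<bar>w t x\<bar> \<le> 1 * M" for x
      unfolding w_def abs_mult using SU_bound[OF h, of t x] bump_square_le[of R x] that M_nonneg by (intro mult_mono) auto
    from power_mono[OF this, of _ 2] show "integrable lborel (\<lambda>x. (norm (w t x))\<^sup>2)"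
      by (intro integrable_bounded_support[of _ "(1 * M)\<^sup>2" "ball 0 r"]) (use w0 in auto)
  qed
  define K where "K = 2 * M / h * sqrt (measure lborel (ball (0::'a) r))"
  have wlip: "L2_norm (ball 0 r) (\<lambda>x. w s x - w t x) \<le> K * \<bar>s - t\<bar>" if st: "s \<in> {0..T}" "t \<in> {0..T}" for s t
  proof -
    define c where "c = 2 * M / h * \<bar>s - t\<bar>"
    have "\<bar>w s x - w t x\<bar> \<le> 1 * c" for x
    proof -
      have "\<bar>w s x - w t x\<bar> = \<bar>(bump R x)\<^sup>2\<bar> * \<bar>SU h s x - SU h t x\<bar>"
        by (simp add: w_def abs_mult flip: right_diff_distrib)
      also have "\<dots> \<le> 1 * c" unfolding c_def
        using sym_avg_lipschitz[OF causal_U U_end h st] bump_square_le[of R x] by (intro mult_mono) auto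
      finally show ?thesis .
    qed
    then have sq: "(norm (w s x - w t x))\<^sup>2 \<le> c\<^sup>2 * indicat_real (ball 0 r) x" for x
      using power_mono[of "\<bar>w s x - w t x\<bar>" c 2] w0[of x s] w0[of x t] by (cases "x \<in> ball 0 r") auto
    have ib: "integrable lborel (\<lambda>x. c\<^sup>2 * indicat_real (ball (0::'a) r) x)"
      using emeasure_bounded_finite[OF bnd(1)] bnd(2) by (intro integrable_mult_right integrable_real_indicator) auto
    have isq: "integrable lborel (\<lambda>x. (norm (w s x - w t x))\<^sup>2)"
    proof (rule Bochner_Integration.integrable_bound[OF ib _ AE_I2])
      fix x
      from order_trans[OF sq abs_ge_self, of x]
      show "norm ((norm (w s x - w t x))\<^sup>2) \<le> norm (c\<^sup>2 * indicat_real (ball 0 r) x)"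
        by (simp only: real_norm_def abs_of_nonneg[OF zero_le_power2])
    qed measurable
    have "(L2_norm (ball 0 r) (\<lambda>x. w s x - w t x))\<^sup>2 = (\<integral>x. (norm (w s x - w t x))\<^sup>2 \<partial>lborel)"
      by (rule L2_borelI(2)[OF bnd(2) _ _ isq]) (use w0 in auto)
    also have "\<dots> \<le> (\<integral>x. c\<^sup>2 * indicat_real (ball (0::'a) r) x \<partial>lborel)" by (rule integral_mono[OF isq ib sq])
    also have "\<dots> = (K * \<bar>s - t\<bar>)\<^sup>2"
      by (simp add: K_def c_def power_mult_distrib power_divide)
    finally show ?thesis
      by (rule power2_le_imp_le) (use M_nonneg h in \<open>simp add: K_def\<close>)
  qed
  have wC: "C_L2 T (ball 0 r) w"
    unfolding C_L2_def
  proof (intro ballI conjI wL)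
    fix t assume t: "t \<in> {0..T}"
    have "((\<lambda>s. K * \<bar>s - t\<bar>) \<longlongrightarrow> K * \<bar>t - t\<bar>) (at t within {0..T})"
      by (intro tendsto_intros)
    then have lim0: "((\<lambda>s. K * \<bar>s - t\<bar>) \<longlongrightarrow> 0) (at t within {0..T})" by simp
    show "((\<lambda>s. L2_norm (ball 0 r) (\<lambda>x. w s x - w t x)) \<longlongrightarrow> 0) (at t within {0..T})"
    proof (rule tendsto_sandwich[OF _ _ tendsto_const lim0])
      show "\<forall>\<^sub>F s in at t within {0..T}. 0 \<le> L2_norm (ball 0 r) (\<lambda>x. w s x - w t x)"
        by (simp add: L2_norm_def)
      show "\<forall>\<^sub>F s in at t within {0..T}. L2_norm (ball 0 r) (\<lambda>x. w s x - w t x) \<le> K * \<bar>s - t\<bar>"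
        unfolding eventually_at_filter by (rule always_eventually) (use wlip t in auto)
    qed
  qed
  show ?C
    unfolding C_L2_vanishing_def
  proof (intro exI[of _ w] conjI wC AE_I2)
    fix t x assume "t \<in> space (lebesgue_on {0<..<T})"
    then show "w t x = tst h R t x" by (simp add: w_def tst_def)
  next
    fix x show "w T x = 0" unfolding w_def using sym_avg_end[OF causal_U U_end h] by simp
  qed
qed

lemma tst_nonneg:
  assumes "h > 0" "\<And>p. U p \<ge> 0"
  shows "tst h R t x \<ge> 0"
  using sym_avg_nonneg[of "\<lambda>\<tau>. U (\<tau>, x)" T h t] assms U_end by (cases "t \<in> {0<..<T}") (auto simp: tst_def)

end

section \<open>The energy inequality\<close>

lemma space_time_sections:
  fixes F :: "real \<times> 'a::euclidean_space \<Rightarrow> real"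
  assumes F: "integrable lborel (\<lambda>p. (F p)\<^sup>2)"
  shows "AE x in lborel. integrable lborel (\<lambda>t. (F (t, x))\<^sup>2)"
    and "integrable lborel (\<lambda>x. \<integral>t. (F (t, x))\<^sup>2 \<partial>lborel)"
proof -
  have "integrable (lborel \<Otimes>\<^sub>M lborel) (\<lambda>(t, x). (F (t, x))\<^sup>2)"
    using F by (simp add: lborel_prod case_prod_beta')
  from lborel_pair.AE_integrable_snd[OF this] lborel_pair.integrable_snd[OF this]
  show "AE x in lborel. integrable lborel (\<lambda>t. (F (t, x))\<^sup>2)"
    "integrable lborel (\<lambda>x. \<integral>t. (F (t, x))\<^sup>2 \<partial>lborel)" by auto
qed

lemma integral_space_time:
  fixes F :: "real \<times> 'a::euclidean_space \<Rightarrow> real"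
  assumes F: "integrable lborel F"
  shows "(\<integral>p. F p \<partial>lborel) = (\<integral>x. (\<integral>t. F (t, x) \<partial>lborel) \<partial>lborel)"
    and "integrable lborel (\<lambda>x. \<integral>t. F (t, x) \<partial>lborel)"
    and "(\<integral>p. F p \<partial>lborel) = (\<integral>t. (\<integral>x. F (t, x) \<partial>lborel) \<partial>lborel)"
proof -
  have i: "integrable (lborel \<Otimes>\<^sub>M lborel) (\<lambda>(t, x). F (t, x))"
    using F by (simp add: lborel_prod)
  show "(\<integral>p. F p \<partial>lborel) = (\<integral>x. (\<integral>t. F (t, x) \<partial>lborel) \<partial>lborel)"
    using lborel_pair.integral_snd[OF i] by (simp add: lborel_prod)
  show "integrable lborel (\<lambda>x. \<integral>t. F (t, x) \<partial>lborel)"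
    using lborel_pair.integrable_snd[OF i] by simp
  show "(\<integral>p. F p \<partial>lborel) = (\<integral>t. (\<integral>x. F (t, x) \<partial>lborel) \<partial>lborel)"
    using lborel_pair.integral_fst[OF i] by (simp add: lborel_prod)
qed

lemma sym_avg_abs:
  assumes [measurable]: "g \<in> borel_measurable borel" and "h > 0" "t \<le> T" "\<And>\<tau>. \<tau> \<ge> T \<Longrightarrow> g \<tau> = 0"
  shows "\<bar>sym_avg h T g t\<bar> \<le> sym_avg h T (\<lambda>\<tau>. \<bar>g \<tau>\<bar>) t"
proof -
  have "norm (sym_avg h T g t) \<le> (\<integral>\<tau>. norm (sker h T t \<tau> * g \<tau>) \<partial>lborel)"
    unfolding sym_avg_def by (rule integral_norm_bound)
  also have "\<dots> = sym_avg h T (\<lambda>\<tau>. \<bar>g \<tau>\<bar>) t"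
    unfolding sym_avg_def
  proof (rule Bochner_Integration.integral_cong[OF refl])
    fix \<tau>
    show "norm (sker h T t \<tau> * g \<tau>) = sker h T t \<tau> * \<bar>g \<tau>\<bar>"
      using sker_bounds(1)[OF assms(2,3), of \<tau>] assms(4)[of \<tau>] by (cases "\<tau> \<ge> T") (auto simp: abs_mult)
  qed
  finally show ?thesis by simp
qed

text \<open>The one-dimensional pairing results hold for almost every \<open>x\<close>. Their bound
  with \<open>\<mu> = 1\<close> is the integrable function \<open>W\<close>, uniform in
  \<open>h\<close>, which provides both joint integrability and domination in the limit.\<close>

lemma space_time_pairing:
  fixes F G :: "real \<times> 'a::euclidean_space \<Rightarrow> real"
  assumes F[measurable]: "F \<in> borel_measurable (borel \<Otimes>\<^sub>M borel)" and G[measurable]: "G \<in> borel_measurable (borel \<Otimes>\<^sub>M borel)"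
    and F2: "integrable lborel (\<lambda>p. (F p)\<^sup>2)" and G2: "integrable lborel (\<lambda>p. (G p)\<^sup>2)"
    and F0: "\<And>t x. t \<notin> {0<..<T} \<Longrightarrow> F (t, x) = 0" and G0: "\<And>t x. t \<notin> {0<..<T} \<Longrightarrow> G (t, x) = 0"
  defines "P \<equiv> \<lambda>h p. F p * sym_avg h T (\<lambda>\<tau>. G (\<tau>, snd p)) (fst p)"
  shows "h > 0 \<Longrightarrow> integrable lborel (P h)"
    and "(\<lambda>n. \<integral>p. P (1 / real (Suc n)) p \<partial>lborel) \<longlonglongrightarrow> (\<integral>p. F p * G p \<partial>lborel)"
proof -
  define W where "W x = ((\<integral>t. (F (t, x))\<^sup>2 \<partial>lborel) + (\<integral>t. (G (t, x))\<^sup>2 \<partial>lborel)) / 2" for x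
  have W: "integrable lborel W"
    unfolding W_def using space_time_sections(2)[OF F2] space_time_sections(2)[OF G2] by auto
  have W0: "W x \<ge> 0" for x by (simp add: W_def)
  have Pm: "P h \<in> borel_measurable (borel \<Otimes>\<^sub>M borel)" for h
    unfolding P_def sym_avg_def sker_def by measurable
  note [measurable] = Pm
  have mF: "(\<lambda>t. F (t, x)) \<in> borel_measurable borel" and mG: "(\<lambda>t. G (t, x)) \<in> borel_measurable borel" for x
    by measurable
  show iP: "integrable lborel (P h)" if h: "h > 0" for h
  proof -
    \<comment> \<open>The average acts in time only, so Fubini is run with \<open>x\<close> as the
      outer variable and the variables are swapped afterwards.\<close>
    have "integrable (lborel \<Otimes>\<^sub>M lborel) (\<lambda>(x, t). P h (t, x))"
    proof (rule lborel_pair.Fubini_integrable)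
      show "(\<lambda>(x, t). P h (t, x)) \<in> borel_measurable (lborel \<Otimes>\<^sub>M lborel)" by measurable
      show "AE x in lborel. integrable lborel (\<lambda>t. case (x, t) of (x, t) \<Rightarrow> P h (t, x))"
        using space_time_sections(1)[OF F2] space_time_sections(1)[OF G2]
      proof eventually_elim
        case (elim x)
        show ?case unfolding P_def prod.case fst_conv snd_conv
          by (rule sym_avg_pairing(1)[OF mF mG elim F0 G0 h])
      qed
      show "integrable lborel (\<lambda>x. \<integral>t. norm (case (x, t) of (x, t) \<Rightarrow> P h (t, x)) \<partial>lborel)"
      proof (rule Bochner_Integration.integrable_bound[OF W])
        show "AE x in lborel. norm (\<integral>t. norm (case (x, t) of (x, t) \<Rightarrow> P h (t, x)) \<partial>lborel) \<le> norm (W x)"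
          using space_time_sections(1)[OF F2] space_time_sections(1)[OF G2]
        proof eventually_elim
          case (elim x)
          let ?f = "\<lambda>t. \<bar>F (t, x)\<bar>" and ?g = "\<lambda>t. \<bar>G (t, x)\<bar>"
          have s: "integrable lborel (\<lambda>t. (?f t)\<^sup>2)" "integrable lborel (\<lambda>t. (?g t)\<^sup>2)" using elim by simp_all
          have z: "t \<notin> {0<..<T} \<Longrightarrow> ?f t = 0" "t \<notin> {0<..<T} \<Longrightarrow> ?g t = 0" for t using F0 G0 by simp_all
          have m: "?f \<in> borel_measurable borel" "?g \<in> borel_measurable borel" by measurable
          have "(\<integral>t. norm (P h (t, x)) \<partial>lborel) \<le> (\<integral>t. ?f t * sym_avg h T ?g t \<partial>lborel)"
          proof (rule integral_mono')
            show "integrable lborel (\<lambda>t. ?f t * sym_avg h T ?g t)"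
              by (rule sym_avg_pairing(1)[OF m s z h, where T = T])
            fix t
            show "norm (P h (t, x)) \<le> ?f t * sym_avg h T ?g t"
            proof (cases "t \<in> {0<..<T}")
              case True
              then show ?thesis unfolding P_def real_norm_def abs_mult fst_conv snd_conv
                by (intro mult_left_mono sym_avg_abs[OF mG h]) (use G0 in auto)
            qed (simp add: P_def F0)
            show "0 \<le> ?f t * sym_avg h T ?g t"
            proof (cases "t \<in> {0<..<T}")
              case True
              then show ?thesis by (intro mult_nonneg_nonneg sym_avg_nonneg h) (use G0 in auto)
            qed (simp add: F0)
          qed
          also have "\<dots> \<le> W x"
            using sym_avg_pairing(2)[OF m s z h, where \<mu> = 1 and T = T] by (simp add: W_def)
          finally show ?case using W0[of x] by simp
        qed
      qed measurable
    qed
    from lborel_pair.integrable_product_swap[OF this] show ?thesis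
      by (simp add: lborel_prod case_prod_beta')
  qed
  have lim: "(\<lambda>n. \<integral>x. (\<integral>t. P (1 / real (Suc n)) (t, x) \<partial>lborel) \<partial>lborel) \<longlonglongrightarrow> (\<integral>x. (\<integral>t. F (t, x) * G (t, x) \<partial>lborel) \<partial>lborel)"
  proof (rule integral_dominated_convergence[OF _ _ W])
    show "AE x in lborel. (\<lambda>n. \<integral>t. P (1 / real (Suc n)) (t, x) \<partial>lborel) \<longlonglongrightarrow> (\<integral>t. F (t, x) * G (t, x) \<partial>lborel)"
      using space_time_sections(1)[OF F2] space_time_sections(1)[OF G2]
    proof eventually_elim
      case (elim x)
      show ?case unfolding P_def fst_conv snd_conv by (rule sym_avg_pairing_tendsto[OF mF mG elim F0 G0])
    qed
    show "AE x in lborel. norm (\<integral>t. P (1 / real (Suc n)) (t, x) \<partial>lborel) \<le> W x" for n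
      using space_time_sections(1)[OF F2] space_time_sections(1)[OF G2]
    proof eventually_elim
      case (elim x)
      have "1 / real (Suc n) > 0" by simp
      from sym_avg_pairing(2)[OF mF mG elim F0 G0 this, where \<mu> = 1 and T = T] show ?case
        by (simp add: W_def P_def)
    qed
  qed measurable
  have FG: "integrable lborel (\<lambda>p. F p * G p)"
    by (rule integrable_square_integrable_product[OF _ _ F2 G2]) (simp_all add: borel_prod[symmetric] lborel_prod[symmetric])
  have "(\<lambda>n. \<integral>p. P (1 / real (Suc n)) p \<partial>lborel) = (\<lambda>n. \<integral>x. (\<integral>t. P (1 / real (Suc n)) (t, x) \<partial>lborel) \<partial>lborel)"
    by (rule ext, rule integral_space_time(1), rule iP) simp
  then show "(\<lambda>n. \<integral>p. P (1 / real (Suc n)) p \<partial>lborel) \<longlonglongrightarrow> (\<integral>p. F p * G p \<partial>lborel)"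
    using lim integral_space_time(1)[OF FG] by simp
qed

text \<open>\<open>W\<close> stands for the flux \<open>A Du\<close> and \<open>Q\<close> for
  \<open>g\<close> with index \<open>1-\<alpha>\<close> convolved with \<open>u\<close>; only growth
  and ellipticity of the flux are kept. Integrability belongs to the equation because the integral
  of a nonintegrable function is 0, and the identity could otherwise not be split into its two
  parts.\<close>

locale parabolic_cylinder = cylinder_function T r M U V
  for T r M :: real and U :: "real \<times> 'a::euclidean_space \<Rightarrow> real" and V :: "real \<times> 'a \<Rightarrow> 'a" +
  fixes \<alpha> \<nu> K :: real and W :: "real \<times> 'a \<Rightarrow> 'a" and Q :: "real \<Rightarrow> 'a \<Rightarrow> real"
  assumes \<alpha>: "0 < \<alpha>" "\<alpha> < 1" and \<nu>: "\<nu> > 0" and K: "K \<ge> 0"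
    and W_measurable [measurable]: "W \<in> borel_measurable (borel \<Otimes>\<^sub>M borel)"
    and W_bound: "\<And>p. norm (W p) \<le> K * norm (V p)"
    and elliptic: "AE p in lborel. W p \<bullet> V p \<ge> \<nu> * (norm (V p))\<^sup>2"
  defines "Q \<equiv> \<lambda>t x. \<integral>\<tau>. (if \<tau> < t then gker (1 - \<alpha>) (t - \<tau>) else 0) * U (\<tau>, x) \<partial>lborel"
  assumes weak_equation: "\<And>h R. h > 0 \<Longrightarrow> R > 0 \<Longrightarrow> R < r \<Longrightarrow>
      integrable lborel (\<lambda>p. - tst' h R (fst p) (snd p) * Q (fst p) (snd p) + W p \<bullet> Dtst h R (fst p) (snd p)) \<and>
      integrable lborel (\<lambda>p. tst' h R (fst p) (snd p) * Q (fst p) (snd p)) \<and>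
      (\<integral>p. - tst' h R (fst p) (snd p) * Q (fst p) (snd p) + W p \<bullet> Dtst h R (fst p) (snd p) \<partial>lborel) = 0"
begin

lemma W_support: "t \<notin> {0<..<T} \<or> norm x \<ge> r \<Longrightarrow> W (t, x) = 0"
  using W_bound[of "(t, x)"] V_support[of t x] by auto

text \<open>The memory constant \<open>C\<close> enters as a parameter and is thereby common to all
  radii. The gradient energy is spent completely on the cutoff term, so only integrals of
  \<open>U^2\<close> remain.\<close>

lemma energy:
  assumes R: "R > 0" "R < r"
    and C: "\<And>h w B. h > 0 \<Longrightarrow> causal B w \<Longrightarrow> (\<And>t. t \<notin> {0<..<T} \<Longrightarrow> w t = 0) \<Longrightarrow>
      C * (\<integral>t. w t * sym_avg h T w t \<partial>lborel) \<le>
      (\<integral>t. indicat_real {0<..<T} t * ((fwd h w t - sym_avg h T w t) / h *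
        (\<integral>\<tau>. (if \<tau> < t then gker (1 - \<alpha>) (t - \<tau>) else 0) * w \<tau> \<partial>lborel)) \<partial>lborel)"
  shows "C * (\<integral>p. (bump R (snd p))\<^sup>2 * (U p)\<^sup>2 \<partial>lborel) \<le>
    K\<^sup>2 / \<nu> * (\<integral>p. (U p)\<^sup>2 * (norm (grad (bump R) (snd p)))\<^sup>2 \<partial>lborel)"
proof -
  let ?J = "indicat_real {0<..<T}"
  note bm [measurable] = bump_measurable[OF R(1)] grad_bump_measurable[OF R(1)]
  have b: "bump R \<in> Cinf0 (ball (0::'a) r)" using R by (intro bump_in_Cinf0) auto
  obtain B where B: "B > 0" "\<And>x. norm (grad (bump R) (x::'a)) \<le> B" using Cinf0_grad_bounded[OF b] by blast
  have bump1: "bump R (x::'a) \<le> 1" "bump R x \<ge> 0" for x by (rule bump_le_1 bump_nonneg)+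
  define F1 where "F1 p = (bump R (snd p))\<^sup>2 * U p" for p :: "real \<times> 'a"
  define F2 where "F2 b p = (bump R (snd p))\<^sup>2 * (W p \<bullet> b)" for b and p :: "real \<times> 'a"
  define F3 where "F3 p = 2 * bump R (snd p) * (W p \<bullet> grad (bump R) (snd p))" for p :: "real \<times> 'a"
  \<comment> \<open>Averages and pairings are available for scalar functions, so the diffusion term
    is decomposed along the basis.\<close>
  define Vb where "Vb b p = V p \<bullet> b" for b and p :: "real \<times> 'a"
  have m [measurable]: "F1 \<in> borel_measurable (borel \<Otimes>\<^sub>M borel)" "F2 b \<in> borel_measurable (borel \<Otimes>\<^sub>M borel)"
    "F3 \<in> borel_measurable (borel \<Otimes>\<^sub>M borel)" "Vb b \<in> borel_measurable (borel \<Otimes>\<^sub>M borel)" for b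
    unfolding F1_def[abs_def] F2_def[abs_def] F3_def[abs_def] Vb_def[abs_def] by measurable
  have z: "t \<notin> {0<..<T} \<Longrightarrow> F1 (t, x) = 0" "t \<notin> {0<..<T} \<Longrightarrow> F2 b (t, x) = 0" "t \<notin> {0<..<T} \<Longrightarrow> F3 (t, x) = 0"
    "t \<notin> {0<..<T} \<Longrightarrow> Vb b (t, x) = 0" "t \<notin> {0<..<T} \<Longrightarrow> U (t, x) = 0" for t x b
    using U_support W_support V_support by (simp_all add: F1_def F2_def F3_def Vb_def)
  have U2: "integrable lborel (\<lambda>p. (U p)\<^sup>2)"
  proof (rule integrable_bounded_support[of _ "M\<^sup>2" "{0<..<T} \<times> ball (0::'a) r"])
    show "(\<lambda>p. (U p)\<^sup>2) \<in> borel_measurable borel" unfolding borel_prod[symmetric] by measurable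
    show "norm ((U p)\<^sup>2) \<le> M\<^sup>2" for p using power_mono[OF U_bound[of p], of 2] by simp
    show "(U p)\<^sup>2 = 0" if "p \<notin> {0<..<T} \<times> ball 0 r" for p
      using that U_support[of "fst p" "snd p"] by (cases p) auto
  qed (use cylinder in auto)
  have dom: "integrable lborel (\<lambda>p. (f p)\<^sup>2)"
    if f: "f \<in> borel_measurable (borel \<Otimes>\<^sub>M borel)" "\<And>p. \<bar>f p\<bar> \<le> c * norm (V p)" for f :: "real \<times> 'a \<Rightarrow> real" and c
  proof (rule Bochner_Integration.integrable_bound[OF integrable_mult_right[OF V_square, of "c\<^sup>2"] _ AE_I2])
    note [measurable] = f(1)
    show "(\<lambda>p. (f p)\<^sup>2) \<in> borel_measurable lborel" unfolding lborel_prod[symmetric] by measurable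
    fix p
    show "norm ((f p)\<^sup>2) \<le> norm (c\<^sup>2 * (norm (V p))\<^sup>2)"
      using power_mono[OF f(2)[of p], of 2] by (simp add: power_mult_distrib)
  qed
  have s1: "integrable lborel (\<lambda>p. (F1 p)\<^sup>2)"
  proof (rule Bochner_Integration.integrable_bound[OF U2 _ AE_I2])
    show "(\<lambda>p. (F1 p)\<^sup>2) \<in> borel_measurable lborel" unfolding lborel_prod[symmetric] by measurable
    fix p
    have "\<bar>(bump R (snd p))\<^sup>2\<bar> * \<bar>U p\<bar> \<le> 1 * \<bar>U p\<bar>" by (intro mult_right_mono bump_square_le) simp
    then have "\<bar>F1 p\<bar> \<le> \<bar>U p\<bar>" by (simp add: F1_def abs_mult)
    then show "norm ((F1 p)\<^sup>2) \<le> norm ((U p)\<^sup>2)" by (simp add: abs_le_square_iff)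
  qed
  have s2: "integrable lborel (\<lambda>p. (F2 b p)\<^sup>2)" if "b \<in> Basis" for b
  proof (rule dom[OF m(2)])
    fix p
    have "\<bar>(bump R (snd p))\<^sup>2\<bar> * \<bar>W p \<bullet> b\<bar> \<le> 1 * (K * norm (V p))"
      using bump_square_le[of R "snd p"] order_trans[OF Basis_le_norm[OF that] W_bound[of p]] by (intro mult_mono) auto
    then show "\<bar>F2 b p\<bar> \<le> K * norm (V p)" by (simp add: F2_def abs_mult)
  qed
  have s3: "integrable lborel (\<lambda>p. (F3 p)\<^sup>2)"
  proof (rule dom[OF m(3)])
    fix p
    have "\<bar>W p \<bullet> grad (bump R) (snd p)\<bar> \<le> norm (W p) * norm (grad (bump R) (snd p))" by (rule Cauchy_Schwarz_ineq2)
    also have "\<dots> \<le> (K * norm (V p)) * B" using K by (intro mult_mono W_bound B) auto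
    finally have "(2 * bump R (snd p)) * \<bar>W p \<bullet> grad (bump R) (snd p)\<bar> \<le> (2 * 1) * ((K * norm (V p)) * B)"
      using bump1[of "snd p"] by (intro mult_mono) auto
    then show "\<bar>F3 p\<bar> \<le> 2 * K * B * norm (V p)" using bump1(2)[of "snd p"] by (simp add: F3_def abs_mult mult_ac)
  qed
  have sV: "integrable lborel (\<lambda>p. (Vb b p)\<^sup>2)" if "b \<in> Basis" for b
    by (rule dom[OF m(4), of _ 1]) (use Basis_le_norm[OF that] in \<open>simp add: Vb_def\<close>)
  define L1 where "L1 h p = F1 p * sym_avg h T (\<lambda>\<tau>. U (\<tau>, snd p)) (fst p)" for h p
  define L2 where "L2 b h p = F2 b p * sym_avg h T (\<lambda>\<tau>. Vb b (\<tau>, snd p)) (fst p)" for b h p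
  define L3 where "L3 h p = F3 p * sym_avg h T (\<lambda>\<tau>. U (\<tau>, snd p)) (fst p)" for h p
  have p1: "integrable lborel (L1 h)" if "h > 0" for h
    unfolding L1_def[abs_def] by (rule space_time_pairing(1)[OF m(1) U_measurable s1 U2]) (use z that in auto)
  have p2: "integrable lborel (L2 b h)" if "b \<in> Basis" "h > 0" for b h
    unfolding L2_def[abs_def] by (rule space_time_pairing(1)[OF m(2) m(4) s2 sV]) (use z that in auto)
  have p3: "integrable lborel (L3 h)" if "h > 0" for h
    unfolding L3_def[abs_def] by (rule space_time_pairing(1)[OF m(3) U_measurable s3 U2]) (use z that in auto)
  have l1: "(\<lambda>n. \<integral>p. L1 (1 / real (Suc n)) p \<partial>lborel) \<longlonglongrightarrow> (\<integral>p. F1 p * U p \<partial>lborel)"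
    unfolding L1_def by (rule space_time_pairing(2)[OF m(1) U_measurable s1 U2]) (use z in auto)
  have l2: "(\<lambda>n. \<integral>p. L2 b (1 / real (Suc n)) p \<partial>lborel) \<longlonglongrightarrow> (\<integral>p. F2 b p * Vb b p \<partial>lborel)" if "b \<in> Basis" for b
    unfolding L2_def by (rule space_time_pairing(2)[OF m(2) m(4) s2 sV]) (use z that in auto)
  have l3: "(\<lambda>n. \<integral>p. L3 (1 / real (Suc n)) p \<partial>lborel) \<longlonglongrightarrow> (\<integral>p. F3 p * U p \<partial>lborel)"
    unfolding L3_def by (rule space_time_pairing(2)[OF m(3) U_measurable s3 U2]) (use z in auto)
  \<comment> \<open>At fixed \<open>h\<close> only the memory term is estimated. The diffusion terms
    have no sign yet and are kept as exact integrals until the limit.\<close>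
  have ineq: "C * (\<integral>p. L1 h p \<partial>lborel) + (\<Sum>b\<in>Basis. \<integral>p. L2 b h p \<partial>lborel) + (\<integral>p. L3 h p \<partial>lborel) \<le> 0"
    if h: "h > 0" for h
  proof -
    define q where "q p = - tst' h R (fst p) (snd p) * Q (fst p) (snd p)" for p :: "real \<times> 'a"
    have iq: "integrable lborel q" using weak_equation[OF h R] by (simp add: q_def[abs_def])
    \<comment> \<open>The inner product may be taken inside the vector-valued average only where
      that integral converges, hence at almost every point.\<close>
    have D: "AE p in lborel. W p \<bullet> Dtst h R (fst p) (snd p) = (\<Sum>b\<in>Basis. L2 b h p) + L3 h p"
    proof -
      have "AE p in lborel \<Otimes>\<^sub>M lborel. integrable lborel (\<lambda>t. (norm (V (t, snd p)))\<^sup>2)"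
      proof (rule lborel_pair.AE_pair_measure)
        show "{p \<in> space (lborel \<Otimes>\<^sub>M lborel). integrable lborel (\<lambda>t. (norm (V (t, snd p)))\<^sup>2)} \<in> sets (lborel \<Otimes>\<^sub>M lborel)"
          by measurable
        show "AE t in lborel. AE x in lborel. integrable lborel (\<lambda>s. (norm (V (s, snd (t, x))))\<^sup>2)"
          using AE_V_square by simp
      qed
      then have "AE p in (lborel :: (real \<times> 'a) measure). integrable lborel (\<lambda>t. (norm (V (t, snd p)))\<^sup>2)"
        unfolding lborel_prod .
      then show ?thesis
      proof eventually_elim
        case (elim p)
        obtain t x where p: "p = (t, x)" by (cases p)
        show ?case
        proof (cases "t \<in> {0<..<T}")
          case True
          then have J: "?J t = 1" "t \<le> T" by auto
          have i: "integrable lborel (\<lambda>\<tau>. sker h T t \<tau> *\<^sub>R V (\<tau>, x))"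
            using SV_bound(1)[OF _ h J(2), of x] elim by (simp add: p)
          have SVb: "SV h t x \<bullet> b = sym_avg h T (\<lambda>\<tau>. Vb b (\<tau>, x)) t" for b
            unfolding SV_def sym_avg_def Vb_def using integral_inner_left[OF i, of b] by simp
          have "W p \<bullet> SV h t x = (\<Sum>b\<in>Basis. (W p \<bullet> b) * sym_avg h T (\<lambda>\<tau>. Vb b (\<tau>, x)) t)"
            unfolding euclidean_inner[of "W p" "SV h t x"] by (simp only: SVb)
          then show ?thesis
            by (simp add: p Dtst_def J(1) inner_add_right L2_def L3_def F2_def F3_def sum_distrib_left mult_ac)
        next
          case False
          then show ?thesis using z by (simp add: p Dtst_def L2_def L3_def)
        qed
      qed
    qed
    have iL: "integrable lborel (\<lambda>p. (\<Sum>b\<in>Basis. L2 b h p) + L3 h p)"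
      using p2[OF _ h] p3[OF h] by auto
    have WD: "(\<integral>p. W p \<bullet> Dtst h R (fst p) (snd p) \<partial>lborel) = (\<Sum>b\<in>Basis. \<integral>p. L2 b h p \<partial>lborel) + (\<integral>p. L3 h p \<partial>lborel)"
      and iWD: "integrable lborel (\<lambda>p. W p \<bullet> Dtst h R (fst p) (snd p))"
    proof -
      have mW: "(\<lambda>p. W p \<bullet> Dtst h R (fst p) (snd p)) \<in> borel_measurable lborel"
        using tst_measurable(3)[OF R(1), of h] unfolding lborel_prod[symmetric] by measurable
      have "(\<integral>p. W p \<bullet> Dtst h R (fst p) (snd p) \<partial>lborel) = (\<integral>p. (\<Sum>b\<in>Basis. L2 b h p) + L3 h p \<partial>lborel)"
        by (rule integral_cong_AE[OF mW _ D]) (use iL in auto)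
      then show "(\<integral>p. W p \<bullet> Dtst h R (fst p) (snd p) \<partial>lborel) = (\<Sum>b\<in>Basis. \<integral>p. L2 b h p \<partial>lborel) + (\<integral>p. L3 h p \<partial>lborel)"
        using p2[OF _ h] p3[OF h] by (simp add: Bochner_Integration.integral_add Bochner_Integration.integral_sum)
      show "integrable lborel (\<lambda>p. W p \<bullet> Dtst h R (fst p) (snd p))"
        by (rule integrable_cong_AE_imp[OF iL mW]) (use D in \<open>auto elim: eventually_mono\<close>)
    qed
    have "0 = (\<integral>p. q p + W p \<bullet> Dtst h R (fst p) (snd p) \<partial>lborel)"
      using weak_equation[OF h R] by (simp add: q_def)
    also have "\<dots> = (\<integral>p. q p \<partial>lborel) + (\<integral>p. W p \<bullet> Dtst h R (fst p) (snd p) \<partial>lborel)"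
      by (rule Bochner_Integration.integral_add[OF iq iWD])
    finally have 0: "(\<integral>p. q p \<partial>lborel) + ((\<Sum>b\<in>Basis. \<integral>p. L2 b h p \<partial>lborel) + (\<integral>p. L3 h p \<partial>lborel)) = 0"
      unfolding WD by simp
    \<comment> \<open>The coercivity of the memory term is applied on each time fibre to
      \<open>U (\<tau>, x)\<close> as a function of \<open>\<tau>\<close>, multiplied by the squared
      cutoff and integrated over \<open>x\<close>.\<close>
    have "C * (\<integral>p. L1 h p \<partial>lborel) = (\<integral>x. C * (\<integral>t. L1 h (t, x) \<partial>lborel) \<partial>lborel)"
      using integral_space_time(1)[OF p1[OF h]] by simp
    also have "\<dots> \<le> (\<integral>x. (\<integral>t. q (t, x) \<partial>lborel) \<partial>lborel)"
    proof (rule integral_mono)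
      show "integrable lborel (\<lambda>x. C * (\<integral>t. L1 h (t, x) \<partial>lborel))"
        using integral_space_time(2)[OF p1[OF h]] by simp
      show "integrable lborel (\<lambda>x. \<integral>t. q (t, x) \<partial>lborel)" by (rule integral_space_time(2)[OF iq])
      fix x
      let ?w = "\<lambda>\<tau>. U (\<tau>, x)"
      have "(\<integral>t. L1 h (t, x) \<partial>lborel) = (\<integral>t. (bump R x)\<^sup>2 * (?w t * sym_avg h T ?w t) \<partial>lborel)"
        by (rule Bochner_Integration.integral_cong) (auto simp: L1_def F1_def)
      then have 1: "C * (\<integral>t. L1 h (t, x) \<partial>lborel) = (bump R x)\<^sup>2 * (C * (\<integral>t. ?w t * sym_avg h T ?w t \<partial>lborel))"
        by simp
      have "(\<integral>t. q (t, x) \<partial>lborel) = (\<integral>t. (bump R x)\<^sup>2 * (?J t * ((fwd h ?w t - sym_avg h T ?w t) / h * Q t x)) \<partial>lborel)"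
      proof (rule Bochner_Integration.integral_cong[OF refl])
        fix t
        have "- ((sym_avg h T ?w t - fwd h ?w t) / h) = (fwd h ?w t - sym_avg h T ?w t) / h"
          by (simp add: minus_divide_left)
        then show "q (t, x) = (bump R x)\<^sup>2 * (?J t * ((fwd h ?w t - sym_avg h T ?w t) / h * Q t x))"
          using h by (simp add: q_def tst'_def field_simps)
      qed
      then have 2: "(\<integral>t. q (t, x) \<partial>lborel) = (bump R x)\<^sup>2 * (\<integral>t. ?J t * ((fwd h ?w t - sym_avg h T ?w t) / h * Q t x) \<partial>lborel)"
        by simp
      show "C * (\<integral>t. L1 h (t, x) \<partial>lborel) \<le> (\<integral>t. q (t, x) \<partial>lborel)"
        unfolding 1 2 Q_def using z(5) by (intro mult_left_mono C[OF h causal_U]) auto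
    qed
    also have "\<dots> = (\<integral>p. q p \<partial>lborel)" by (rule integral_space_time(1)[OF iq, symmetric])
    finally show ?thesis using 0 by linarith
  qed
  \<comment> \<open>In the limit the averages disappear, and flux and gradient meet at the same
    time, so that ellipticity can be used.\<close>
  have "(\<lambda>n. C * (\<integral>p. L1 (1 / real (Suc n)) p \<partial>lborel) + (\<Sum>b\<in>Basis. \<integral>p. L2 b (1 / real (Suc n)) p \<partial>lborel) + (\<integral>p. L3 (1 / real (Suc n)) p \<partial>lborel))
    \<longlonglongrightarrow> C * (\<integral>p. F1 p * U p \<partial>lborel) + (\<Sum>b\<in>Basis. \<integral>p. F2 b p * Vb b p \<partial>lborel) + (\<integral>p. F3 p * U p \<partial>lborel)"
    by (intro tendsto_intros l1 l2 l3)
  then have le0: "C * (\<integral>p. F1 p * U p \<partial>lborel) + (\<Sum>b\<in>Basis. \<integral>p. F2 b p * Vb b p \<partial>lborel) + (\<integral>p. F3 p * U p \<partial>lborel) \<le> 0"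
    by (rule LIMSEQ_le_const2) (use ineq in auto)
  have mm: "F1 \<in> borel_measurable lborel" "F2 b \<in> borel_measurable lborel" "F3 \<in> borel_measurable lborel"
    "Vb b \<in> borel_measurable lborel" "U \<in> borel_measurable lborel" for b
    unfolding lborel_prod[symmetric] by measurable
  have i2: "integrable lborel (\<lambda>p. F2 b p * Vb b p)" if "b \<in> Basis" for b
    by (rule integrable_square_integrable_product[OF mm(2,4) s2[OF that] sV[OF that]])
  have i3: "integrable lborel (\<lambda>p. F3 p * U p)"
    by (rule integrable_square_integrable_product[OF mm(3,5) s3 U2])
  have i4: "integrable lborel (\<lambda>p. (U p)\<^sup>2 * (norm (grad (bump R) (snd p)))\<^sup>2)"
  proof (rule Bochner_Integration.integrable_bound[OF integrable_mult_right[OF U2, of "B\<^sup>2"] _ AE_I2])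
    show "(\<lambda>p. (U p)\<^sup>2 * (norm (grad (bump R) (snd p)))\<^sup>2) \<in> borel_measurable lborel"
      unfolding lborel_prod[symmetric] by measurable
    fix p :: "real \<times> 'a"
    show "norm ((U p)\<^sup>2 * (norm (grad (bump R) (snd p)))\<^sup>2) \<le> norm (B\<^sup>2 * (U p)\<^sup>2)"
      using mult_left_mono[OF power_mono[OF B(2)[of "snd p"], of 2], of "(U p)\<^sup>2"] by (simp add: mult.commute)
  qed
  have "- (K\<^sup>2 / \<nu> * (\<integral>p. (U p)\<^sup>2 * (norm (grad (bump R) (snd p)))\<^sup>2 \<partial>lborel))
      = (\<integral>p. - (K\<^sup>2 / \<nu>) * ((U p)\<^sup>2 * (norm (grad (bump R) (snd p)))\<^sup>2) \<partial>lborel)"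
    by simp
  also have "\<dots> \<le> (\<integral>p. (\<Sum>b\<in>Basis. F2 b p * Vb b p) + F3 p * U p \<partial>lborel)"
  proof (rule integral_mono_AE)
    show "AE p in lborel. - (K\<^sup>2 / \<nu>) * ((U p)\<^sup>2 * (norm (grad (bump R) (snd p)))\<^sup>2) \<le> (\<Sum>b\<in>Basis. F2 b p * Vb b p) + F3 p * U p"
      using elliptic
    proof eventually_elim
      case (elim p)
      \<comment> \<open>With these quantities the integrand is at least
        \<open>\<nu> a^2 - 2 K a d\<close>. Completing the square bounds it below by
        \<open>- (K^2 / \<nu>) d^2\<close>, free of the gradient of \<open>U\<close>.\<close>
      define a where "a = bump R (snd p) * norm (V p)"
      define d where "d = \<bar>U p\<bar> * norm (grad (bump R) (snd p))"
      have e1: "(\<Sum>b\<in>Basis. F2 b p * Vb b p) = (bump R (snd p))\<^sup>2 * (W p \<bullet> V p)"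
        unfolding euclidean_inner[of "W p" "V p"] by (simp add: F2_def Vb_def sum_distrib_left mult_ac)
      have e2: "\<nu> * a\<^sup>2 \<le> (bump R (snd p))\<^sup>2 * (W p \<bullet> V p)"
        using mult_left_mono[OF elim, of "(bump R (snd p))\<^sup>2"] by (simp add: a_def power_mult_distrib mult_ac)
      have "\<bar>F3 p * U p\<bar> = 2 * bump R (snd p) * \<bar>W p \<bullet> grad (bump R) (snd p)\<bar> * \<bar>U p\<bar>"
        using bump1(2)[of "snd p"] by (simp add: F3_def abs_mult)
      also have "\<dots> \<le> 2 * bump R (snd p) * ((K * norm (V p)) * norm (grad (bump R) (snd p))) * \<bar>U p\<bar>"
        using bump1(2)[of "snd p"]
        by (intro mult_right_mono mult_left_mono order_trans[OF Cauchy_Schwarz_ineq2] W_bound) auto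
      also have "\<dots> = 2 * K * a * d" by (simp add: a_def d_def mult_ac)
      finally have e3: "- (2 * K * a * d) \<le> F3 p * U p" by linarith
      have "0 \<le> (\<nu> * a - K * d)\<^sup>2 / \<nu>" using \<nu> by simp
      also have "\<dots> = \<nu> * a\<^sup>2 - 2 * K * a * d + K\<^sup>2 / \<nu> * d\<^sup>2"
        using \<nu> by (simp add: power2_eq_square field_simps)
      finally have "- (K\<^sup>2 / \<nu>) * d\<^sup>2 \<le> (\<Sum>b\<in>Basis. F2 b p * Vb b p) + F3 p * U p"
        using e1 e2 e3 by linarith
      then show ?case by (simp add: d_def power_mult_distrib)
    qed
  qed (use i2 i3 i4 in auto)
  also have "\<dots> = (\<Sum>b\<in>Basis. \<integral>p. F2 b p * Vb b p \<partial>lborel) + (\<integral>p. F3 p * U p \<partial>lborel)"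
    using i2 i3 by (simp add: Bochner_Integration.integral_add Bochner_Integration.integral_sum)
  finally have "C * (\<integral>p. F1 p * U p \<partial>lborel) \<le> K\<^sup>2 / \<nu> * (\<integral>p. (U p)\<^sup>2 * (norm (grad (bump R) (snd p)))\<^sup>2 \<partial>lborel)"
    using le0 by linarith
  then show ?thesis by (simp add: F1_def power2_eq_square mult_ac)
qed

end

section \<open>Borel representatives\<close>

text \<open>Sections and product measures call for Borel functions, while the given data are
  Lebesgue measurable. The modification on a null set is done componentwise, and the function is
  extended by zero.\<close>

lemma ex_borel_version:
  fixes f :: "'a::euclidean_space \<Rightarrow> 'b::euclidean_space"
  assumes f: "f \<in> borel_measurable (lebesgue_on S)" and S: "S \<in> sets borel"
  obtains g where "g \<in> borel_measurable borel" "\<And>x. x \<notin> S \<Longrightarrow> g x = 0"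
    "AE x in lborel. x \<in> S \<longrightarrow> f x = g x"
proof -
  have S': "S \<inter> space lebesgue \<in> sets lebesgue" using S by auto
  have m: "(\<lambda>x. indicat_real S x *\<^sub>R f x) \<in> borel_measurable lebesgue"
    using f borel_measurable_restrict_space_iff[OF S'] by blast
  have "\<exists>g\<in>borel_measurable lborel. AE x in lborel. (indicat_real S x *\<^sub>R f x) \<bullet> b = g x" for b
    by (rule completion_ex_borel_measurable_real) (use m in measurable)
  then obtain g where g: "\<And>b. g b \<in> borel_measurable lborel"
    "\<And>b. AE x in lborel. (indicat_real S x *\<^sub>R f x) \<bullet> b = g b x" by metis
  define G where "G x = indicat_real S x *\<^sub>R (\<Sum>b\<in>Basis. g b x *\<^sub>R b)" for x
  have "(\<lambda>x. indicat_real S x) \<in> borel_measurable borel" using S by simp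
  moreover have "g b \<in> borel_measurable borel" for b using g(1)[of b] by simp
  ultimately have "G \<in> borel_measurable borel" unfolding G_def[abs_def] by measurable
  moreover have "AE x in lborel. \<forall>b\<in>Basis. (indicat_real S x *\<^sub>R f x) \<bullet> b = g b x"
    by (rule AE_finite_allI) (use g(2) in auto)
  then have "AE x in lborel. x \<in> S \<longrightarrow> f x = G x"
  proof eventually_elim
    case (elim x)
    show ?case
    proof
      assume "x \<in> S"
      then have "G x = (\<Sum>b\<in>Basis. (f x \<bullet> b) *\<^sub>R b)" using elim by (simp add: G_def)
      then show "f x = G x" by (simp add: euclidean_representation)
    qed
  qed
  ultimately show ?thesis using that[of G] by (simp add: G_def)
qed

text \<open>Completeness of the Lebesgue measure transfers measurability from \<open>g\<close> to
  \<open>f\<close>, so a section of \<open>u\<close> may be replaced by a Borel section as soon as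
  they agree almost everywhere.\<close>

lemma integral_lebesgue_on_AE:
  fixes f g :: "'a::euclidean_space \<Rightarrow> 'b::euclidean_space"
  assumes S: "S \<in> sets borel" and g: "g \<in> borel_measurable borel" "\<And>x. x \<notin> S \<Longrightarrow> g x = 0"
    and ae: "AE x in lborel. x \<in> S \<longrightarrow> f x = g x"
  shows "(LINT x|lebesgue_on S. f x) = (\<integral>x. g x \<partial>lborel)"
    and "integrable (lebesgue_on S) f \<longleftrightarrow> integrable lborel g"
proof -
  have S': "S \<inter> space lebesgue \<in> sets lebesgue" using S by auto
  have gl: "g \<in> borel_measurable lebesgue" using g(1) by (simp add: measurable_completion)
  have ae': "AE x in lebesgue. g x = indicat_real S x *\<^sub>R f x"
    unfolding AE_completion_iff using ae by eventually_elim (use g(2) in \<open>auto simp: indicator_def\<close>)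
  have fl: "(\<lambda>x. indicat_real S x *\<^sub>R f x) \<in> borel_measurable lebesgue"
    by (rule borel_measurable_AE[OF gl ae'])
  have "(\<integral>x. indicat_real S x *\<^sub>R f x \<partial>lebesgue) = (\<integral>x. g x \<partial>lebesgue)"
    by (rule integral_cong_AE[OF fl gl]) (use ae' in \<open>auto elim: eventually_mono\<close>)
  then show "(LINT x|lebesgue_on S. f x) = (\<integral>x. g x \<partial>lborel)"
    unfolding integral_restrict_space[OF S'] using g(1) by (simp add: integral_completion)
  have "integrable lebesgue (\<lambda>x. indicat_real S x *\<^sub>R f x) \<longleftrightarrow> integrable lebesgue g"
    by (rule integrable_cong_AE[OF fl gl]) (use ae' in \<open>auto elim: eventually_mono\<close>)
  then show "integrable (lebesgue_on S) f \<longleftrightarrow> integrable lborel g"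
    unfolding integrable_restrict_space[OF S'] using g(1) by (simp add: integrable_completion)
qed

lemma AE_lborel_sections:
  fixes P :: "real \<times> 'a::euclidean_space \<Rightarrow> bool"
  assumes "AE p in lborel. P p"
  shows "AE t in lborel. AE x in lborel. P (t, x)" "AE x in lborel. AE t in lborel. P (t, x)"
proof -
  have ae: "AE p in lborel \<Otimes>\<^sub>M lborel. P p" unfolding lborel_prod by (rule assms)
  then show "AE t in lborel. AE x in lborel. P (t, x)" by (rule lborel_pair.AE_pair)
  \<comment> \<open>Exchanging the two quantifiers requires a measurable exceptional set, so the
    possibly nonmeasurable one is enlarged to a measurable null set.\<close>
  obtain N where N: "{p \<in> space (lborel \<Otimes>\<^sub>M lborel). \<not> P p} \<subseteq> N" "N \<in> null_sets (lborel \<Otimes>\<^sub>M lborel)"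
    using ae unfolding eventually_ae_filter by auto
  have "AE p in lborel \<Otimes>\<^sub>M lborel. p \<notin> N" using N(2) by (rule AE_not_in)
  then have "AE t in lborel. AE x in lborel. (t, x) \<notin> N" by (rule lborel_pair.AE_pair)
  moreover have "{p \<in> space (lborel \<Otimes>\<^sub>M lborel). (fst p, snd p) \<notin> N} \<in> sets (lborel \<Otimes>\<^sub>M lborel)"
  proof -
    have "{p \<in> space (lborel \<Otimes>\<^sub>M lborel). (fst p, snd p) \<notin> N} = space (lborel \<Otimes>\<^sub>M lborel) - N" by auto
    then show ?thesis using sets.compl_sets[OF null_setsD2[OF N(2)]] by (simp only:)
  qed
  ultimately have "AE x in lborel. AE t in lborel. (t, x) \<notin> N"
    by (subst lborel_pair.AE_commute[symmetric]) auto
  then show "AE x in lborel. AE t in lborel. P (t, x)"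
    by (elim eventually_mono) (use N(1) in \<open>auto simp: space_pair_measure\<close>)
qed

lemma norm_matrix_vector_mult_le:
  fixes A :: "real^'n^'n" and x :: "real^'n"
  shows "norm (A *v x) \<le> real CARD('n) * norm A * norm x"
proof -
  have "norm (A *v x) \<le> (\<Sum>i\<in>UNIV. \<bar>(A *v x) $ i\<bar>)" by (rule norm_le_l1_cart)
  also have "\<dots> \<le> (\<Sum>i\<in>(UNIV::'n set). norm A * norm x)"
  proof (rule sum_mono)
    fix i
    have "\<bar>(A *v x) $ i\<bar> = \<bar>A $ i \<bullet> x\<bar>" by (simp add: matrix_vector_mul_component)
    also have "\<dots> \<le> norm (A $ i) * norm x" by (rule Cauchy_Schwarz_ineq2)
    also have "\<dots> \<le> norm A * norm x" by (intro mult_right_mono Finite_Cartesian_Product.norm_nth_le) auto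
    finally show "\<bar>(A *v x) $ i\<bar> \<le> norm A * norm x" .
  qed
  finally show ?thesis by simp
qed

lemma matrix_vector_mult_measurable:
  fixes A :: "'b \<Rightarrow> real^'n^'n" and v :: "'b \<Rightarrow> real^'n"
  assumes "A \<in> borel_measurable M" "v \<in> borel_measurable M"
  shows "(\<lambda>p. A p *v v p) \<in> borel_measurable M"
proof -
  have "continuous_on UNIV (\<lambda>q::(real^'n^'n) \<times> (real^'n). fst q *v snd q)"
    unfolding matrix_vector_mult_def by (intro continuous_intros)
  then show ?thesis
    using borel_measurable_continuous_Pair[OF assms, of "\<lambda>A v. A *v v"] by (simp add: case_prod_beta')
qed

lemma expconv_add:
  assumes f: "causal B f" and g: "causal C g" and a: "a > 0"
  shows "expconv a (\<lambda>\<tau>. f \<tau> + g \<tau>) t = expconv a f t + expconv a g t"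
proof -
  have "integrable lborel (\<lambda>\<tau>. (if \<tau> < t then exp (- a * (t - \<tau>)) else 0) * q \<tau>)" if q: "causal D q" for D q
  proof (rule integrable_bounded_support[of _ "1 * D" "{0..t}"])
    note [measurable] = causalD(1)[OF q]
    show "(\<lambda>\<tau>. (if \<tau> < t then exp (- a * (t - \<tau>)) else 0) * q \<tau>) \<in> borel_measurable borel" by measurable
    fix \<tau>
    show "norm ((if \<tau> < t then exp (- a * (t - \<tau>)) else 0) * q \<tau>) \<le> 1 * D"
      unfolding norm_mult using causalD[OF q] a by (intro mult_mono) auto
  qed (use causalD(3)[OF q] in \<open>auto simp: not_le\<close>)
  from this[OF f] this[OF g] show ?thesis
    unfolding expconv_def by (subst Bochner_Integration.integral_add[symmetric]) (auto simp: algebra_simps)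
qed

lemma sym_avg_add:
  assumes f: "causal B f" "\<And>\<tau>. \<tau> \<ge> T \<Longrightarrow> f \<tau> = 0" and g: "causal C g" "\<And>\<tau>. \<tau> \<ge> T \<Longrightarrow> g \<tau> = 0"
    and h: "h > 0" and t: "t \<le> T"
  shows "sym_avg h T (\<lambda>\<tau>. f \<tau> + g \<tau>) t = sym_avg h T f t + sym_avg h T g t"
proof -
  have "integrable lborel (\<lambda>\<tau>. sker h T t \<tau> * q \<tau>)" if q: "causal D q" "\<And>\<tau>. \<tau> \<ge> T \<Longrightarrow> q \<tau> = 0" for D q
  proof (rule integrable_bounded_support[of _ "1 / (2 * h) * D" "{0..T}"])
    note [measurable] = causalD(1)[OF q(1)]
    show "(\<lambda>\<tau>. sker h T t \<tau> * q \<tau>) \<in> borel_measurable borel" by measurable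
    fix \<tau>
    show "norm (sker h T t \<tau> * q \<tau>) \<le> 1 / (2 * h) * D"
    proof (cases "\<tau> \<ge> T")
      case False
      then show ?thesis unfolding norm_mult
        using causalD[OF q(1)] sker_bounds[OF h t, of \<tau>] h by (intro mult_mono) auto
    qed (use q(2) h causalD(4)[OF q(1)] in simp)
    show "sker h T t \<tau> * q \<tau> = 0" if "\<tau> \<notin> {0..T}"
      using that causalD(3)[OF q(1), of \<tau>] q(2)[of \<tau>] by (cases "\<tau> < 0") auto
  qed auto
  from this[OF f] this[OF g] show ?thesis
    unfolding sym_avg_def by (subst Bochner_Integration.integral_add[symmetric]) (auto simp: algebra_simps)
qed

lemma gker_conv_bound:
  assumes \<beta>: "0 < \<beta>" and w: "w \<in> borel_measurable borel" "\<And>\<tau>. \<bar>w \<tau>\<bar> \<le> M" "\<And>\<tau>. \<tau> \<notin> {0<..<T} \<Longrightarrow> w \<tau> = 0"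
    and t: "t \<in> {0<..<T}"
  shows "\<bar>\<integral>\<tau>. (if \<tau> < t then gker \<beta> (t - \<tau>) else 0) * w \<tau> \<partial>lborel\<bar> \<le> M * (\<integral>x. indicat_real {0..T} x * gker \<beta> x \<partial>lborel)"
proof -
  let ?m = "\<lambda>x. indicat_real {0..T} x * gker \<beta> x"
  note [measurable] = w(1)
  have m: "integrable lborel ?m" by (rule integrable_gker) (use \<beta> t in auto)
  have mt: "integrable lborel (\<lambda>\<tau>. M * ?m (t - \<tau>))" "(\<integral>\<tau>. M * ?m (t - \<tau>) \<partial>lborel) = M * (\<integral>x. ?m x \<partial>lborel)"
    using integrable_shift_minus[of ?m t] integral_shift_minus[of ?m t] m by auto
  have M0: "M \<ge> 0" using w(2)[of 0] by simp
  have le: "norm ((if \<tau> < t then gker \<beta> (t - \<tau>) else 0) * w \<tau>) \<le> M * ?m (t - \<tau>)" for \<tau>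
  proof (cases "\<tau> \<in> {0<..<T} \<and> \<tau> < t")
    case True
    then have "t - \<tau> \<in> {0..T}" using t by auto
    then show ?thesis using True gker_nonneg[OF \<beta>, of "t - \<tau>"] w(2)[of \<tau>]
      by (simp add: abs_mult mult.commute[of M] mult_left_mono)
  next
    case False
    then have 0: "(if \<tau> < t then gker \<beta> (t - \<tau>) else 0) * w \<tau> = 0" using w(3)[of \<tau>] by auto
    show ?thesis unfolding 0 using M0 gker_nonneg[OF \<beta>] by simp
  qed
  have i: "integrable lborel (\<lambda>\<tau>. (if \<tau> < t then gker \<beta> (t - \<tau>) else 0) * w \<tau>)"
    by (rule Bochner_Integration.integrable_bound[OF mt(1) _ AE_I2])
       (measurable, rule order_trans[OF le], simp only: real_norm_def abs_ge_self)
  have "norm (\<integral>\<tau>. (if \<tau> < t then gker \<beta> (t - \<tau>) else 0) * w \<tau> \<partial>lborel) \<le> (\<integral>\<tau>. M * ?m (t - \<tau>) \<partial>lborel)"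
    by (rule Bochner_Integration.integral_norm_bound_integral[OF i mt(1) le])
  then show ?thesis unfolding mt(2) real_norm_def .
qed

text \<open>Passes from the definition to Borel functions on the whole space and removes the sign
  restriction on test functions. The equation for \<open>u\<close> is the difference of those
  obtained for \<open>u + M\<close> and for \<open>M\<close>.\<close>

lemma weak_solution_parabolic_cylinder:
  fixes A :: "real \<Rightarrow> real^'n \<Rightarrow> real^'n^'n" and u :: "real \<Rightarrow> real^'n \<Rightarrow> real"
    and A0 :: "real \<times> (real^'n) \<Rightarrow> real^'n^'n" and U0 :: "real \<times> (real^'n) \<Rightarrow> real"
  assumes sol: "weak_solution \<alpha> A T (ball 0 r) u"
    and \<alpha>: "0 < \<alpha>" "\<alpha> < 1" and T: "T > 0" and r: "r > 0" and \<nu>: "\<nu> > 0"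
    and U0: "U0 \<in> borel_measurable borel" "\<And>p. \<bar>U0 p\<bar> \<le> M" "AE p in lborel. fst p > 0 \<longrightarrow> u (fst p) (snd p) = U0 p"
    and A0: "A0 \<in> borel_measurable borel" "\<And>p. norm (A0 p) \<le> a" "AE p in lborel. fst p > 0 \<longrightarrow> A (fst p) (snd p) = A0 p"
    and ell: "AE p in lborel. fst p > 0 \<longrightarrow> (\<forall>\<xi>. (A0 p *v \<xi>) \<bullet> \<xi> \<ge> \<nu> * (norm \<xi>)\<^sup>2)"
  obtains V W where "parabolic_cylinder T r M (\<lambda>p. indicat_real ({0<..<T} \<times> ball 0 r) p * U0 p) V \<alpha> \<nu> (real CARD('n) * a) W"
proof -
  let ?\<Omega> = "ball (0 :: real^'n) r"
  let ?S = "{0<..<T} \<times> ?\<Omega>"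
  define U where "U p = indicat_real ?S p * U0 p" for p
  obtain Du where Du: "L2_H1 T ?\<Omega> u Du" and wf: "\<And>\<zeta> \<zeta>' D\<zeta>.
      H1_L2 T ?\<Omega> \<zeta> \<zeta>' \<Longrightarrow> L2_H10 T ?\<Omega> \<zeta> D\<zeta> \<Longrightarrow> C_L2_vanishing T ?\<Omega> T \<zeta> \<Longrightarrow>
      (AE (t, x) in lebesgue_on ?S. \<zeta> t x \<ge> 0) \<Longrightarrow>
      (LINT t|lebesgue_on {0<..<T}. LINT x|lebesgue_on ?\<Omega>.
             - \<zeta>' t x * tconv (gker (1 - \<alpha>)) u t x + (A t x *v Du t x) \<bullet> D\<zeta> t x) = 0"
    using sol unfolding weak_solution_def by blast
  have S: "?S \<in> sets borel" by (intro borel_open open_Times) auto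
  have Sb: "bounded ?S" by (intro bounded_Times bounded_ball) (rule bounded_subset[of "{0..T}"], auto)
  have L2Du: "(\<lambda>(t, x). Du t x) \<in> L2 ?S" using Du by (simp add: L2_H1_def L2_L2_def)
  then have "(\<lambda>(t, x). Du t x) \<in> borel_measurable (lebesgue_on ?S)" by (simp add: L2_def)
  then obtain V where V: "V \<in> borel_measurable borel" "\<And>p. p \<notin> ?S \<Longrightarrow> V p = 0"
    "AE p in lborel. p \<in> ?S \<longrightarrow> (case p of (t, x) \<Rightarrow> Du t x) = V p"
    using ex_borel_version[OF _ S] by blast
  have V2: "integrable lborel (\<lambda>p. (norm (V p))\<^sup>2)"
  proof -
    have i: "integrable (lebesgue_on ?S) (\<lambda>p. (norm (case p of (t, x) \<Rightarrow> Du t x))\<^sup>2)"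
      using L2Du by (simp add: L2_def)
    have "AE p in lborel. p \<in> ?S \<longrightarrow> (norm (case p of (t, x) \<Rightarrow> Du t x))\<^sup>2 = (norm (V p))\<^sup>2"
      using V(3) by eventually_elim auto
    from integral_lebesgue_on_AE(2)[OF S _ _ this] i V(1,2) show ?thesis by auto
  qed
  have [measurable]: "V \<in> borel_measurable (borel \<Otimes>\<^sub>M borel)" "A0 \<in> borel_measurable (borel \<Otimes>\<^sub>M borel)"
    "U0 \<in> borel_measurable (borel \<Otimes>\<^sub>M borel)" "indicat_real ?S \<in> borel_measurable (borel \<Otimes>\<^sub>M borel)"
    unfolding borel_prod using V(1) A0(1) U0(1) S by auto
  have Um [measurable]: "U \<in> borel_measurable (borel \<Otimes>\<^sub>M borel)" unfolding U_def[abs_def] by measurable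
  have M0: "M \<ge> 0" using U0(2)[of undefined] by simp
  have a0: "a \<ge> 0" using order_trans[OF norm_ge_zero A0(2)[of undefined]] .
  have UB: "\<bar>U p\<bar> \<le> M" for p using U0(2)[of p] M0 by (auto simp: U_def indicator_def)
  have Us: "U (t, x) = 0" if "t \<notin> {0<..<T} \<or> norm x \<ge> r" for t x using that by (auto simp: U_def)
  have Vs: "V (t, x) = 0" if "t \<notin> {0<..<T} \<or> norm x \<ge> r" for t x using that V(2)[of "(t, x)"] by auto
  have uU: "AE p in lborel. p \<in> ?S \<longrightarrow> u (fst p) (snd p) = U p"
    using U0(3) by eventually_elim (auto simp: U_def)
  have H1: "AE t in lborel. t \<in> {0<..<T} \<longrightarrow> H1_grad ?\<Omega> (u t) (Du t)"
    using Du by (simp add: L2_H1_def AE_restrict_space_iff AE_completion_iff)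
  have wg: "AE t in lborel. t \<in> {0<..<T} \<longrightarrow> (\<forall>\<theta>\<in>Cinf0 ?\<Omega>.
      (\<integral>x. U (t, x) *\<^sub>R grad \<theta> x \<partial>lborel) = - (\<integral>x. \<theta> x *\<^sub>R V (t, x) \<partial>lborel))"
    using H1 AE_lborel_sections(1)[OF uU] AE_lborel_sections(1)[OF V(3)]
  proof eventually_elim
    case (elim t)
    show ?case
    proof (intro impI ballI)
      fix \<theta> assume t: "t \<in> {0<..<T}" and \<theta>: "\<theta> \<in> Cinf0 ?\<Omega>"
      note [measurable] = Cinf0_borel_measurable[OF \<theta>] Cinf0_grad_borel_measurable[OF \<theta>]
      have "(LINT x|lebesgue_on ?\<Omega>. u t x *\<^sub>R grad \<theta> x) = (\<integral>x. U (t, x) *\<^sub>R grad \<theta> x \<partial>lborel)"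
      proof (rule integral_lebesgue_on_AE(1))
        show "AE x in lborel. x \<in> ?\<Omega> \<longrightarrow> u t x *\<^sub>R grad \<theta> x = U (t, x) *\<^sub>R grad \<theta> x"
          using elim(2) by eventually_elim (use t in auto)
      qed (use Us in auto)
      moreover have "(LINT x|lebesgue_on ?\<Omega>. \<theta> x *\<^sub>R Du t x) = (\<integral>x. \<theta> x *\<^sub>R V (t, x) \<partial>lborel)"
      proof (rule integral_lebesgue_on_AE(1))
        show "AE x in lborel. x \<in> ?\<Omega> \<longrightarrow> \<theta> x *\<^sub>R Du t x = \<theta> x *\<^sub>R V (t, x)"
          using elim(3) by eventually_elim (use t in auto)
      qed (use Vs in auto)
      ultimately show "(\<integral>x. U (t, x) *\<^sub>R grad \<theta> x \<partial>lborel) = - (\<integral>x. \<theta> x *\<^sub>R V (t, x) \<partial>lborel)"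
        using elim(1) t \<theta> by (auto simp: H1_grad_def)
    qed
  qed
  interpret c0: cylinder_function T r M U V
    by unfold_locales (use T r UB V2 Us Vs wg in auto)
  define W where "W p = A0 p *v V p" for p
  have Wm [measurable]: "W \<in> borel_measurable (borel \<Otimes>\<^sub>M borel)"
    unfolding W_def[abs_def] by (rule matrix_vector_mult_measurable) measurable
  define K where "K = real CARD('n) * a"
  have WB: "norm (W p) \<le> K * norm (V p)" for p
  proof -
    have "norm (W p) \<le> real CARD('n) * norm (A0 p) * norm (V p)"
      unfolding W_def by (rule norm_matrix_vector_mult_le)
    also have "\<dots> \<le> K * norm (V p)" unfolding K_def using A0(2)[of p] by (intro mult_right_mono mult_left_mono) auto
    finally show ?thesis .
  qed
  have Well: "AE p in lborel. W p \<bullet> V p \<ge> \<nu> * (norm (V p))\<^sup>2"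
    using ell
  proof eventually_elim
    case (elim p)
    show ?case
    proof (cases "p \<in> ?S")
      case True
      then show ?thesis using elim by (auto simp: W_def)
    qed (simp add: V(2))
  qed
  define Q where "Q t x = (\<integral>\<tau>. (if \<tau> < t then gker (1 - \<alpha>) (t - \<tau>) else 0) * U (\<tau>, x) \<partial>lborel)" for t x
  have Qm [measurable]: "(\<lambda>p. Q (fst p) (snd p)) \<in> borel_measurable (borel \<Otimes>\<^sub>M borel)"
    unfolding Q_def by measurable
  define CQ where "CQ = M * (\<integral>x. indicat_real {0..T} x * gker (1 - \<alpha>) x \<partial>lborel)"
  have QB: "\<bar>Q t x\<bar> \<le> CQ" if "t \<in> {0<..<T}" for t x
    unfolding Q_def CQ_def by (rule gker_conv_bound) (use \<alpha> UB Us that in auto)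
  \<comment> \<open>For almost every \<open>x\<close> the function and its Borel version agree at
    almost all past times, so the convolutions agree for every \<open>t\<close> at once; the
    exceptional set of \<open>x\<close> does not depend on \<open>t\<close>.\<close>
  have tQ: "AE x in lborel. \<forall>t\<in>{0<..<T}. x \<in> ?\<Omega> \<longrightarrow> tconv (gker (1 - \<alpha>)) u t x = Q t x"
    using AE_lborel_sections(2)[OF uU]
  proof eventually_elim
    case (elim x)
    show ?case
    proof (intro ballI impI)
      fix t assume t: "t \<in> {0<..<T}" and x: "x \<in> ?\<Omega>"
      show "tconv (gker (1 - \<alpha>)) u t x = Q t x"
        unfolding tconv_def Q_def
      proof (rule integral_lebesgue_on_AE(1))
        show "AE \<tau> in lborel. \<tau> \<in> {0<..<t} \<longrightarrow> gker (1 - \<alpha>) (t - \<tau>) * u \<tau> x = (if \<tau> < t then gker (1 - \<alpha>) (t - \<tau>) else 0) * U (\<tau>, x)"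
          using elim by eventually_elim (use t x in auto)
      qed (use Us in auto)
    qed
  qed
  \<comment> \<open>Only the test function varies with \<open>U1\<close> and \<open>V1\<close>;
    \<open>Q\<close> and \<open>W\<close> always belong to the solution. For the solution itself,
    which may change sign, just the integrability is extracted; the identity is available for
    nonnegative \<open>U1\<close>.\<close>
  have key: "integrable lborel (\<lambda>p. cylinder_function.tst' T U1 h R (fst p) (snd p) * Q (fst p) (snd p)) \<and>
      integrable lborel (\<lambda>p. W p \<bullet> cylinder_function.Dtst T U1 V1 h R (fst p) (snd p)) \<and>
      ((\<forall>p. U1 p \<ge> 0) \<longrightarrow> (\<integral>p. - cylinder_function.tst' T U1 h R (fst p) (snd p) * Q (fst p) (snd p) + W p \<bullet> cylinder_function.Dtst T U1 V1 h R (fst p) (snd p) \<partial>lborel) = 0)"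
    if c1: "cylinder_function T r M1 U1 V1" and h: "h > 0" and R: "R > 0" "R < r" for M1 U1 V1 h R
  proof -
    interpret c: cylinder_function T r M1 U1 V1 by (rule c1)
    note [measurable] = c.tst_measurable[OF R(1)]
    have i1: "integrable lborel (\<lambda>p. c.tst' h R (fst p) (snd p) * Q (fst p) (snd p))"
    proof (rule integrable_bounded_support[of _ "2 * M1 / h * CQ" ?S])
      show "(\<lambda>p. c.tst' h R (fst p) (snd p) * Q (fst p) (snd p)) \<in> borel_measurable borel"
        unfolding borel_prod[symmetric] by measurable
      have CQ0: "CQ \<ge> 0" using order_trans[OF abs_ge_zero QB[of "T / 2"]] T by simp
      show "norm (c.tst' h R (fst p) (snd p) * Q (fst p) (snd p)) \<le> 2 * M1 / h * CQ" for p
      proof (cases "fst p \<in> {0<..<T}")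
        case True
        have M1: "2 * M1 / h \<ge> 0" using c.M_nonneg h by simp
        show ?thesis unfolding real_norm_def abs_mult
          by (intro mult_mono c.tst_bound(2)[OF h] QB[OF True] M1) simp
      next
        case False
        then have "c.tst' h R (fst p) (snd p) = 0" by (intro c.tst_support(2)[OF R]) simp
        then show ?thesis using c.M_nonneg h CQ0 by simp
      qed
      show "c.tst' h R (fst p) (snd p) * Q (fst p) (snd p) = 0" if "p \<notin> ?S" for p
      proof -
        have "c.tst' h R (fst p) (snd p) = 0" using that by (intro c.tst_support(2)[OF R]) (cases p, auto)
        then show ?thesis by simp
      qed
    qed (use S Sb in auto)
    have i2: "integrable lborel (\<lambda>p. W p \<bullet> c.Dtst h R (fst p) (snd p))"
    proof (rule Bochner_Integration.integrable_bound[OF _ _ AE_I2])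
      show "integrable lborel (\<lambda>p. K\<^sup>2 * (norm (V p))\<^sup>2 + (norm (c.Dtst h R (fst p) (snd p)))\<^sup>2)"
        using V2 c.tst_square(3)[OF h R] by simp
      show "(\<lambda>p. W p \<bullet> c.Dtst h R (fst p) (snd p)) \<in> borel_measurable lborel"
        unfolding lborel_prod[symmetric] by measurable
      fix p
      let ?D = "c.Dtst h R (fst p) (snd p)"
      have sq: "x * y \<le> x\<^sup>2 + y\<^sup>2" for x y :: real
        using sum_squares_bound[of x y] sum_power2_ge_zero[of x y] by linarith
      have "\<bar>W p \<bullet> ?D\<bar> \<le> norm (W p) * norm ?D" by (rule Cauchy_Schwarz_ineq2)
      also have "\<dots> \<le> (K * norm (V p)) * norm ?D" by (intro mult_right_mono WB) simp
      also have "\<dots> \<le> (K * norm (V p))\<^sup>2 + (norm ?D)\<^sup>2"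
        using sq[of "K * norm (V p)" "norm ?D"] .
      finally show "norm (W p \<bullet> ?D) \<le> norm (K\<^sup>2 * (norm (V p))\<^sup>2 + (norm ?D)\<^sup>2)"
        by (simp add: power_mult_distrib)
    qed
    have "(\<integral>p. - c.tst' h R (fst p) (snd p) * Q (fst p) (snd p) + W p \<bullet> c.Dtst h R (fst p) (snd p) \<partial>lborel) = 0"
      if pos: "\<forall>p. U1 p \<ge> 0"
    proof -
      define q where "q p = - c.tst' h R (fst p) (snd p) * Q (fst p) (snd p) + W p \<bullet> c.Dtst h R (fst p) (snd p)" for p
      have qm [measurable]: "q \<in> borel_measurable (borel \<Otimes>\<^sub>M borel)" unfolding q_def[abs_def] by measurable
      have qi: "integrable lborel q" unfolding q_def[abs_def] using i1 i2 by simp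
      have q0: "q (t, x) = 0" if "t \<notin> {0<..<T} \<or> norm x \<ge> r" for t x
        using c.tst_support[OF R that] by (simp add: q_def)
      have "AE t in lborel. t \<in> {0<..<T} \<longrightarrow> (LINT x|lebesgue_on ?\<Omega>.
             - c.tst' h R t x * tconv (gker (1 - \<alpha>)) u t x + (A t x *v Du t x) \<bullet> c.Dtst h R t x) = (\<integral>x. q (t, x) \<partial>lborel)"
        using AE_lborel_sections(1)[OF V(3)] AE_lborel_sections(1)[OF A0(3)]
      proof eventually_elim
        case (elim t)
        show ?case
        proof
          assume t: "t \<in> {0<..<T}"
          show "(LINT x|lebesgue_on ?\<Omega>. - c.tst' h R t x * tconv (gker (1 - \<alpha>)) u t x + (A t x *v Du t x) \<bullet> c.Dtst h R t x)
              = (\<integral>x. q (t, x) \<partial>lborel)"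
          proof (rule integral_lebesgue_on_AE(1))
            show "AE x in lborel. x \<in> ?\<Omega> \<longrightarrow> - c.tst' h R t x * tconv (gker (1 - \<alpha>)) u t x + (A t x *v Du t x) \<bullet> c.Dtst h R t x = q (t, x)"
              using elim tQ by eventually_elim (use t in \<open>auto simp: q_def W_def\<close>)
          qed (use q0 in auto)
        qed
      qed
      then have "(LINT t|lebesgue_on {0<..<T}. LINT x|lebesgue_on ?\<Omega>.
             - c.tst' h R t x * tconv (gker (1 - \<alpha>)) u t x + (A t x *v Du t x) \<bullet> c.Dtst h R t x) = (\<integral>t. (\<integral>x. q (t, x) \<partial>lborel) \<partial>lborel)"
        by (rule integral_lebesgue_on_AE(1)[rotated 3]) (use q0 in auto)
      moreover have "(LINT t|lebesgue_on {0<..<T}. LINT x|lebesgue_on ?\<Omega>.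
             - c.tst' h R t x * tconv (gker (1 - \<alpha>)) u t x + (A t x *v Du t x) \<bullet> c.Dtst h R t x) = 0"
        by (rule wf[OF c.test_function[OF h R]]) (use c.tst_nonneg[OF h] pos in auto)
      ultimately show ?thesis using integral_space_time(3)[OF qi] by (simp add: q_def)
    qed
    with i1 i2 show ?thesis by blast
  qed
  \<comment> \<open>The constant \<open>M\<close> restricted to the cylinder. Its weak gradient is
    zero, so adding it makes the function nonnegative without changing \<open>V\<close>.\<close>
  define U2 where "U2 p = indicat_real ?S p * M" for p :: "real \<times> (real^'n)"
  define U1 where "U1 p = U p + U2 p" for p
  have [measurable]: "U2 \<in> borel_measurable (borel \<Otimes>\<^sub>M borel)" unfolding U2_def[abs_def] by measurable
  have [measurable]: "U1 \<in> borel_measurable (borel \<Otimes>\<^sub>M borel)" unfolding U1_def[abs_def] by measurable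
  have U2s: "U2 (t, x) = 0" if "t \<notin> {0<..<T} \<or> norm x \<ge> r" for t x using that by (auto simp: U2_def)
  have U2B: "\<bar>U2 p\<bar> \<le> M" for p using M0 by (auto simp: U2_def indicator_def)
  have U1B: "\<bar>U1 p\<bar> \<le> 2 * M" for p using UB[of p] U2B[of p] by (auto simp: U1_def)
  have U2nn: "\<forall>p. U2 p \<ge> 0" using M0 by (auto simp: U2_def)
  have U1nn: "\<forall>p. U1 p \<ge> 0"
  proof
    fix p show "U1 p \<ge> 0" using U0(2)[of p] by (auto simp: U1_def U2_def U_def indicator_def)
  qed
  have g2: "(\<integral>x. U2 (t, x) *\<^sub>R grad \<theta> x \<partial>lborel) = 0" if "t \<in> {0<..<T}" "\<theta> \<in> Cinf0 ?\<Omega>" for t \<theta>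
  proof -
    have \<theta>: "\<theta> \<in> Cinf0 UNIV" using that(2) by (auto simp: Cinf0_def)
    \<comment> \<open>The jump at the boundary of the ball is invisible, since gradients of
      admissible \<open>\<theta>\<close> vanish outside the ball.\<close>
    have e: "U2 (t, x) *\<^sub>R grad \<theta> x = M *\<^sub>R grad \<theta> x" for x
    proof (cases "x \<in> ?\<Omega>")
      case False
      then have "x \<notin> closure {x. \<theta> x \<noteq> 0}" using Cinf0_D(3)[OF that(2)] by blast
      from grad_eq_0_outside[OF this] show ?thesis by simp
    qed (use that(1) in \<open>simp add: U2_def\<close>)
    show ?thesis unfolding e using integral_grad_eq_0[OF \<theta>] by simp
  qed
  interpret c2: cylinder_function T r M U2 "\<lambda>_. 0"
    by unfold_locales (use T r U2B U2s g2 in \<open>auto intro!: AE_I2\<close>)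
  have wg1: "AE t in lborel. t \<in> {0<..<T} \<longrightarrow> (\<forall>\<theta>\<in>Cinf0 ?\<Omega>.
      (\<integral>x. U1 (t, x) *\<^sub>R grad \<theta> x \<partial>lborel) = - (\<integral>x. \<theta> x *\<^sub>R V (t, x) \<partial>lborel))"
    using wg
  proof eventually_elim
    case (elim t)
    show ?case
    proof (intro impI ballI)
      fix \<theta> assume t: "t \<in> {0<..<T}" and \<theta>: "\<theta> \<in> Cinf0 ?\<Omega>"
      note [measurable] = Cinf0_borel_measurable[OF \<theta>] Cinf0_grad_borel_measurable[OF \<theta>]
      obtain B where B: "B > 0" "\<And>x. norm (grad \<theta> x) \<le> B" using Cinf0_grad_bounded[OF \<theta>] by blast
      have i: "integrable lborel (\<lambda>x. w (t, x) *\<^sub>R grad \<theta> x)"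
        if "w \<in> borel_measurable (borel \<Otimes>\<^sub>M borel)" "\<And>p. \<bar>w p\<bar> \<le> M" "\<And>x. norm x \<ge> r \<Longrightarrow> w (t, x) = 0" for w
      proof (rule integrable_bounded_support[of _ "M * B" ?\<Omega>])
        note [measurable] = that(1)
        show "(\<lambda>x. w (t, x) *\<^sub>R grad \<theta> x) \<in> borel_measurable borel" by measurable
        show "norm (w (t, x) *\<^sub>R grad \<theta> x) \<le> M * B" for x
          unfolding norm_scaleR using M0 by (intro mult_mono that(2) B(2)) auto
      qed (use that(3) in auto)
      have "(\<integral>x. U1 (t, x) *\<^sub>R grad \<theta> x \<partial>lborel) = (\<integral>x. U (t, x) *\<^sub>R grad \<theta> x + U2 (t, x) *\<^sub>R grad \<theta> x \<partial>lborel)"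
        by (simp add: U1_def scaleR_add_left)
      also have "\<dots> = (\<integral>x. U (t, x) *\<^sub>R grad \<theta> x \<partial>lborel) + (\<integral>x. U2 (t, x) *\<^sub>R grad \<theta> x \<partial>lborel)"
        by (rule Bochner_Integration.integral_add; rule i) (use UB U2B Us U2s in auto)
      finally show "(\<integral>x. U1 (t, x) *\<^sub>R grad \<theta> x \<partial>lborel) = - (\<integral>x. \<theta> x *\<^sub>R V (t, x) \<partial>lborel)"
        using elim t \<theta> g2[OF t \<theta>] by simp
    qed
  qed
  interpret c1: cylinder_function T r "2 * M" U1 V
    by unfold_locales (use T r U1B V2 Us U2s Vs wg1 in \<open>auto simp: U1_def\<close>)
  have SU1: "sym_avg h T (\<lambda>\<tau>. U1 (\<tau>, x)) t = sym_avg h T (\<lambda>\<tau>. U (\<tau>, x)) t + sym_avg h T (\<lambda>\<tau>. U2 (\<tau>, x)) t"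
    if "h > 0" "t \<le> T" for h t x
    unfolding U1_def by (rule sym_avg_add[OF c0.causal_U _ c2.causal_U _ that]) (use Us U2s in auto)
  have fU1: "fwd h (\<lambda>\<tau>. U1 (\<tau>, x)) t = fwd h (\<lambda>\<tau>. U (\<tau>, x)) t + fwd h (\<lambda>\<tau>. U2 (\<tau>, x)) t" if "h > 0" for h t x
    unfolding fwd_def U1_def using expconv_add[OF c0.causal_U c2.causal_U, of "1 / h" x x t] that
    by (simp add: add_divide_distrib)
  have lin: "c1.tst' h R t x = c0.tst' h R t x + c2.tst' h R t x" "c1.Dtst h R t x = c0.Dtst h R t x + c2.Dtst h R t x"
    if h: "h > 0" for h R t x
  proof -
    have "c1.tst' h R t x = c0.tst' h R t x + c2.tst' h R t x \<and> c1.Dtst h R t x = c0.Dtst h R t x + c2.Dtst h R t x"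
    proof (cases "t \<in> {0<..<T}")
      case True
      then have "t \<le> T" by simp
      have "c2.SV h t x = 0" by (simp add: c2.SV_def)
      moreover have "c1.SV h t x = c0.SV h t x" by (simp add: c1.SV_def)
      ultimately show ?thesis
        unfolding c0.tst'_def c1.tst'_def c2.tst'_def c0.Dtst_def c1.Dtst_def c2.Dtst_def
          SU1[OF h \<open>t \<le> T\<close>] fU1[OF h] using True
        by (simp add: algebra_simps add_divide_distrib diff_divide_distrib)
    qed (simp add: c0.tst'_def c1.tst'_def c2.tst'_def c0.Dtst_def c1.Dtst_def c2.Dtst_def)
    then show "c1.tst' h R t x = c0.tst' h R t x + c2.tst' h R t x" "c1.Dtst h R t x = c0.Dtst h R t x + c2.Dtst h R t x"
      by auto
  qed
  have eq: "integrable lborel (\<lambda>p. - c0.tst' h R (fst p) (snd p) * Q (fst p) (snd p) + W p \<bullet> c0.Dtst h R (fst p) (snd p)) \<and>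
      integrable lborel (\<lambda>p. c0.tst' h R (fst p) (snd p) * Q (fst p) (snd p)) \<and>
      (\<integral>p. - c0.tst' h R (fst p) (snd p) * Q (fst p) (snd p) + W p \<bullet> c0.Dtst h R (fst p) (snd p) \<partial>lborel) = 0"
    if h: "h > 0" and R: "R > 0" "R < r" for h R
  proof -
    note k0 = key[OF c0.cylinder_function_axioms h R]
    note k1 = key[OF c1.cylinder_function_axioms h R]
    note k2 = key[OF c2.cylinder_function_axioms h R]
    define q0 where "q0 p = - c0.tst' h R (fst p) (snd p) * Q (fst p) (snd p) + W p \<bullet> c0.Dtst h R (fst p) (snd p)" for p
    define q1 where "q1 p = - c1.tst' h R (fst p) (snd p) * Q (fst p) (snd p) + W p \<bullet> c1.Dtst h R (fst p) (snd p)" for p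
    define q2 where "q2 p = - c2.tst' h R (fst p) (snd p) * Q (fst p) (snd p) + W p \<bullet> c2.Dtst h R (fst p) (snd p)" for p
    have i: "integrable lborel q0" "integrable lborel q1" "integrable lborel q2"
      unfolding q0_def[abs_def] q1_def[abs_def] q2_def[abs_def] using k0 k1 k2 by simp_all
    \<comment> \<open>The integrand is linear in the test function. Integrability of each part
      allows the two identities for nonnegative functions to be subtracted.\<close>
    have "q0 p = q1 p - q2 p" for p
      unfolding q0_def q1_def q2_def lin[OF h] by (simp add: algebra_simps inner_add_right)
    then have "(\<integral>p. q0 p \<partial>lborel) = (\<integral>p. q1 p \<partial>lborel) - (\<integral>p. q2 p \<partial>lborel)"
      using i by (simp add: Bochner_Integration.integral_diff)
    also have "\<dots> = 0" using k1 k2 U1nn U2nn by (simp add: q1_def q2_def)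
    finally show ?thesis using i(1) k0 by (simp add: q0_def[abs_def])
  qed
  have "parabolic_cylinder T r M U V \<alpha> \<nu> K W"
    by unfold_locales (use \<alpha> \<nu> a0 WB Well eq in \<open>auto simp: K_def Q_def\<close>)
  then show ?thesis using that unfolding U_def[abs_def] K_def by blast
qed

section \<open>Decay of the energy\<close>

text \<open>Each application of the step at the doubled radius gains a factor \<open>R^-2\<close>,
  so finitely many beat the polynomial growth. Monotonicity then bounds \<open>E R\<close> by values
  at arbitrarily large radii, which tend to 0.\<close>

lemma scaling_decay:
  fixes E :: "real \<Rightarrow> real"
  assumes mono: "\<And>R R'. 0 < R \<Longrightarrow> R \<le> R' \<Longrightarrow> E R \<le> E R'" and nonneg: "\<And>R. E R \<ge> 0"
    and growth: "\<And>R. R > 0 \<Longrightarrow> E R \<le> D * R ^ N" and D: "D \<ge> 0"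
    and step: "\<And>R. R > 0 \<Longrightarrow> E (R / 2) \<le> c / R\<^sup>2 * E R" and c: "c \<ge> 0" and R: "R > 0"
  shows "E R = 0"
proof -
  have "\<exists>Dk\<ge>0. \<forall>R>0. E R \<le> Dk * (R ^ N / R ^ (2 * k))" for k
  proof (induction k)
    case 0
    then show ?case using growth D by auto
  next
    case (Suc k)
    then obtain Dk where Dk: "Dk \<ge> 0" "\<And>R. R > 0 \<Longrightarrow> E R \<le> Dk * (R ^ N / R ^ (2 * k))" by blast
    \<comment> \<open>The powers of 2 stem from evaluating the previous bound at
      \<open>2 * R\<close>; the factor 1/4 from \<open>c / (2 * R)^2\<close>.\<close>
    define D' where "D' = c / 4 * (Dk * (2 ^ N / 2 ^ (2 * k)))"
    have "E R \<le> D' * (R ^ N / R ^ (2 * Suc k))" if "R > 0" for R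
    proof -
      have "E R \<le> c / (2 * R)\<^sup>2 * E (2 * R)" using step[of "2 * R"] that by simp
      also have "\<dots> \<le> c / (2 * R)\<^sup>2 * (Dk * ((2 * R) ^ N / (2 * R) ^ (2 * k)))"
        using that c by (intro mult_left_mono Dk(2)) auto
      also have "\<dots> = D' * (R ^ N / R ^ (2 * Suc k))"
        using that by (simp add: D'_def power_mult_distrib power2_eq_square field_simps)
      finally show ?thesis .
    qed
    moreover have "D' \<ge> 0" using c Dk by (simp add: D'_def)
    ultimately show ?case by blast
  qed
  \<comment> \<open>After \<open>N + 1\<close> steps the exponent is \<open>N - 2 * (N + 1)\<close>,
    which is negative.\<close>
  then obtain B where B: "B \<ge> 0" "\<And>R. R > 0 \<Longrightarrow> E R \<le> B * (R ^ N / R ^ (2 * Suc N))" by blast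
  have le: "E R \<le> B / real (Suc n)" if "real (Suc n) \<ge> R" for n
  proof -
    define x where "x = real (Suc n)"
    have x: "x \<ge> 1" "x \<ge> R" using that by (auto simp: x_def)
    have "E R \<le> E x" by (rule mono) (use R x in auto)
    also have "\<dots> \<le> B * (x ^ N / x ^ (2 * Suc N))" by (rule B(2)) (use x in auto)
    also have "x ^ (2 * Suc N) = x ^ N * (x * x ^ Suc N)" by (simp add: power_add mult_2)
    also have "x ^ N / (x ^ N * (x * x ^ Suc N)) = 1 / (x * x ^ Suc N)" using x by simp
    also have "1 / (x * x ^ Suc N) \<le> 1 / (x * 1)"
      using x by (intro divide_left_mono mult_left_mono one_le_power mult_pos_pos) auto
    finally show ?thesis using B(1) by (simp add: x_def mult_left_mono)
  qed
  have "(\<lambda>n. B / real (Suc n)) \<longlonglongrightarrow> 0"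
    using LIMSEQ_Suc[OF lim_const_over_n[of B]] by simp
  moreover have "\<forall>\<^sub>F n in sequentially. E R \<le> B / real (Suc n)"
    using eventually_ge_at_top[of "nat \<lceil>R\<rceil>"] by eventually_elim (rule le, linarith)
  ultimately have "E R \<le> 0" by (intro tendsto_lowerbound) auto
  then show ?thesis using nonneg[of R] by simp
qed

theorem corollary5p1:
  fixes \<alpha> \<nu> :: real
    and A :: "real \<Rightarrow> real^'n \<Rightarrow> real^'n^'n"
    and u :: "real \<Rightarrow> real^'n \<Rightarrow> real"
  assumes "0 < \<alpha>" and "\<alpha> < 1"
    and "(\<lambda>(t, x). A t x) \<in> Linf ({0<..} \<times> UNIV)"
    and "\<nu> > 0"
    and "AE (t, x) in lebesgue_on ({0<..} \<times> UNIV). \<forall>\<xi>. (A t x *v \<xi>) \<bullet> \<xi> \<ge> \<nu> * (norm \<xi>)\<^sup>2"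
    and "global_weak_solution \<alpha> A u"
    and "(\<lambda>(t, x). u t x) \<in> Linf ({0<..} \<times> UNIV)"
  shows "AE (t, x) in lebesgue_on ({0<..} \<times> UNIV). u t x = 0"
proof -
  let ?H = "{0<..} \<times> UNIV :: (real \<times> (real^'n)) set"
  have H: "?H \<in> sets borel" by (intro borel_open open_Times) auto
  have AE_H: "(AE p in lebesgue_on ?H. P p) \<longleftrightarrow> (AE p in lborel. fst p > 0 \<longrightarrow> P p)" for P
    using H by (subst AE_restrict_space_iff) (auto simp: AE_completion_iff mem_Times_iff)
  obtain U1 where U1: "U1 \<in> borel_measurable borel" "AE p in lborel. p \<in> ?H \<longrightarrow> (case p of (t, x) \<Rightarrow> u t x) = U1 p"
    using ex_borel_version[OF _ H, of "\<lambda>(t, x). u t x"] assms(7) unfolding Linf_def by blast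
  obtain M' where M': "AE p in lborel. fst p > 0 \<longrightarrow> norm (case p of (t, x) \<Rightarrow> u t x) \<le> M'"
    using assms(7) unfolding Linf_def AE_H by blast
  define M where "M = max M' 0"
  \<comment> \<open>Clipping turns the essential bound into a bound at every point, as
    \<open>causal\<close> demands, and changes the values only on a null set of positive
    times.\<close>
  define U0 where "U0 p = max (- M) (min M (U1 p))" for p
  have U0: "U0 \<in> borel_measurable borel" "\<bar>U0 p\<bar> \<le> M" for p
    unfolding U0_def[abs_def] using U1(1) by (measurable, auto simp: M_def)
  have uU0: "AE p in lborel. fst p > 0 \<longrightarrow> u (fst p) (snd p) = U0 p"
    using U1(2) M' by eventually_elim (auto simp: U0_def M_def)
  obtain A1 where A1: "A1 \<in> borel_measurable borel" "AE p in lborel. p \<in> ?H \<longrightarrow> (case p of (t, x) \<Rightarrow> A t x) = A1 p"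
    using ex_borel_version[OF _ H, of "\<lambda>(t, x). A t x"] assms(3) unfolding Linf_def by blast
  obtain a' where a': "AE p in lborel. fst p > 0 \<longrightarrow> norm (case p of (t, x) \<Rightarrow> A t x) \<le> a'"
    using assms(3) unfolding Linf_def AE_H by blast
  define a where "a = max a' 0"
  \<comment> \<open>Likewise for the coefficients: the value 0 is taken only on a null set of
    positive times, so ellipticity persists almost everywhere.\<close>
  define A0 where "A0 p = (if norm (A1 p) \<le> a then A1 p else 0)" for p
  have A0: "A0 \<in> borel_measurable borel" "norm (A0 p) \<le> a" for p
    unfolding A0_def[abs_def] using A1(1) by (measurable, auto simp: a_def)
  have AA0: "AE p in lborel. fst p > 0 \<longrightarrow> A (fst p) (snd p) = A0 p"
    using A1(2) a' by eventually_elim (auto simp: A0_def a_def)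
  have "AE p in lborel. fst p > 0 \<longrightarrow> (case p of (t, x) \<Rightarrow> \<forall>\<xi>. (A t x *v \<xi>) \<bullet> \<xi> \<ge> \<nu> * (norm \<xi>)\<^sup>2)"
    using assms(5) unfolding AE_H .
  then have ell: "AE p in lborel. fst p > 0 \<longrightarrow> (\<forall>\<xi>. (A0 p *v \<xi>) \<bullet> \<xi> \<ge> \<nu> * (norm \<xi>)\<^sup>2)"
    using AA0 by eventually_elim (auto simp: case_prod_beta')
  obtain C1 where C1: "C1 > 0" "\<And>R x. R > 0 \<Longrightarrow> norm (grad (bump R) (x :: real^'n)) \<le> C1 / R"
    using bump_grad_bound by blast
  define K where "K = real CARD('n) * a"
  have zero: "AE p in lborel. p \<in> {0<..<T} \<times> cball 0 R \<longrightarrow> U0 p = 0" if T: "T > 0" and R: "R > 0" for T R :: real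
  proof -
    \<comment> \<open>The constant is fixed from \<open>T\<close> before any radius is considered,
      so the same factor serves in every iteration step.\<close>
    obtain C where C: "C > 0" "\<And>h w B. h > 0 \<Longrightarrow> causal B w \<Longrightarrow> (\<And>t. t \<notin> {0<..<T} \<Longrightarrow> w t = 0) \<Longrightarrow>
      C * (\<integral>t. w t * sym_avg h T w t \<partial>lborel) \<le>
      (\<integral>t. indicat_real {0<..<T} t * ((fwd h w t - sym_avg h T w t) / h *
        (\<integral>\<tau>. (if \<tau> < t then gker (1 - \<alpha>) (t - \<tau>) else 0) * w \<tau> \<partial>lborel)) \<partial>lborel)"
      using fractional_coercive[OF assms(1,2) T] by blast
    define Z where "Z R = {0<..<T} \<times> cball (0 :: real^'n) R" for R
    have Zs: "Z R \<in> sets borel" for R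
      unfolding Z_def borel_prod[symmetric] by (intro pair_measureI) auto
    have Zb: "bounded (Z R)" for R
      unfolding Z_def by (intro bounded_Times bounded_cball) (rule bounded_subset[of "{0..T}"], auto)
    define E where "E R = (\<integral>p. indicat_real (Z R) p * (U0 p)\<^sup>2 \<partial>lborel)" for R
    have sq: "(U0 p)\<^sup>2 \<le> M\<^sup>2" for p using power_mono[OF U0(2)[of p], of 2] by simp
    have Ei: "integrable lborel (\<lambda>p. indicat_real (Z R) p * (U0 p)\<^sup>2)" for R
    proof (rule integrable_bounded_support[of _ "M\<^sup>2" "Z R"])
      show "(\<lambda>p. indicat_real (Z R) p * (U0 p)\<^sup>2) \<in> borel_measurable borel"
        using U0(1) Zs[of R] by (intro borel_measurable_times borel_measurable_power borel_measurable_indicator) auto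
      show "norm (indicat_real (Z R) p * (U0 p)\<^sup>2) \<le> M\<^sup>2" for p using sq[of p] by (simp add: indicator_def)
    qed (use Zs Zb in auto)
    have E_nonneg: "E R \<ge> 0" for R by (simp add: E_def)
    have E_mono: "E R \<le> E R'" if "R \<le> R'" for R R'
      unfolding E_def using that by (intro integral_mono Ei) (auto simp: Z_def indicator_def)
    define V1 where "V1 = unit_ball_vol (real DIM(real^'n))"
    have growth: "E R \<le> (M\<^sup>2 * T * V1) * R ^ DIM(real^'n)" if "R > 0" for R
    proof -
      have i: "integrable lborel (\<lambda>p. indicat_real (Z R) p * M\<^sup>2)"
        using Zs[of R] emeasure_bounded_finite[OF Zb] by (intro integrable_mult_left integrable_real_indicator) auto
      have "E R \<le> (\<integral>p. indicat_real (Z R) p * M\<^sup>2 \<partial>lborel)"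
        unfolding E_def by (intro integral_mono Ei i mult_left_mono sq) auto
      also have "\<dots> = (\<integral>x. (\<integral>t. indicat_real (Z R) (t, x) * M\<^sup>2 \<partial>lborel) \<partial>lborel)"
        by (rule integral_space_time(1)[OF i])
      also have "\<dots> = (\<integral>x. indicat_real (cball 0 R) x * (T * M\<^sup>2) \<partial>(lborel :: (real^'n) measure))"
      proof (rule Bochner_Integration.integral_cong[OF refl])
        fix x :: "real^'n"
        have "(\<integral>t. indicat_real (Z R) (t, x) * M\<^sup>2 \<partial>lborel) = (\<integral>t. (indicat_real (cball 0 R) x * M\<^sup>2) * indicat_real {0<..<T} t \<partial>lborel)"
          by (rule Bochner_Integration.integral_cong) (auto simp: Z_def indicator_def)
        then show "(\<integral>t. indicat_real (Z R) (t, x) * M\<^sup>2 \<partial>lborel) = indicat_real (cball 0 R) x * (T * M\<^sup>2)"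
          using T by simp
      qed
      also have "\<dots> = (M\<^sup>2 * T * V1) * R ^ DIM(real^'n)"
        using content_cball[of R "0 :: real^'n"] that by (simp add: V1_def)
      finally show ?thesis .
    qed
    \<comment> \<open>\<open>C1\<close> comes from the cutoff gradient, \<open>exp (-4/3)\<close>
      from the lower bound of the cutoff on the half ball, and \<open>K^2 / \<nu>\<close> and
      \<open>C\<close> from the energy inequality.\<close>
    define c where "c = K\<^sup>2 / \<nu> * C1\<^sup>2 / (C * (exp (-4/3))\<^sup>2)"
    have c: "c \<ge> 0" using assms(4) C(1) by (simp add: c_def)
    have step: "E (R / 2) \<le> c / R\<^sup>2 * E R" if R: "R > 0" for R
    proof -
      \<comment> \<open>The cylinder has radius \<open>2 * R\<close> because the cutoff radius must
        be strictly smaller than that of the cylinder; on the support of the cutoff the restriction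
        is harmless.\<close>
      let ?U = "\<lambda>p. indicat_real ({0<..<T} \<times> ball 0 (2 * R)) p * U0 p"
      have "weak_solution \<alpha> A T (ball 0 (2 * R)) u"
        using assms(6) T R by (simp add: global_weak_solution_def)
      from weak_solution_parabolic_cylinder[OF this assms(1,2) T _ assms(4) U0 uU0 A0 AA0 ell] R
      obtain V W where pc: "parabolic_cylinder T (2 * R) M ?U V \<alpha> \<nu> K W"
        unfolding K_def by auto
      interpret parabolic_cylinder T "2 * R" M ?U V \<alpha> \<nu> K W
        "\<lambda>t x. \<integral>\<tau>. (if \<tau> < t then gker (1 - \<alpha>) (t - \<tau>) else 0) * ?U (\<tau>, x) \<partial>lborel"
        by (rule pc) (rule reflexive)
      have en: "C * (\<integral>p. (bump R (snd p))\<^sup>2 * (?U p)\<^sup>2 \<partial>lborel) \<le>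
          K\<^sup>2 / \<nu> * (\<integral>p. (?U p)\<^sup>2 * (norm (grad (bump R) (snd p)))\<^sup>2 \<partial>lborel)"
        by (rule energy[OF _ _ C(2)]) (use R in auto)
      have Um: "?U \<in> borel_measurable lborel"
        unfolding lborel_prod[symmetric] by measurable
      note [measurable] = bump_measurable[OF R] grad_bump_measurable[OF R]
      have gz: "grad (bump R) x = 0" if "norm x > R" for x :: "real^'n"
        by (rule grad_bump_outside[OF R that])
      have U_Z: "(?U p)\<^sup>2 = indicat_real (Z R) p * (U0 p)\<^sup>2" if "norm (snd p) \<le> R" for p
        using that R by (cases p) (auto simp: Z_def indicator_def)
      have i1: "integrable lborel (\<lambda>p. (bump R (snd p))\<^sup>2 * (?U p)\<^sup>2)"
      proof (rule Bochner_Integration.integrable_bound[OF Ei[of R] _ AE_I2])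
        show "(\<lambda>p. (bump R (snd p))\<^sup>2 * (?U p)\<^sup>2) \<in> borel_measurable lborel"
          using Um unfolding lborel_prod[symmetric] by measurable
        fix p :: "real \<times> (real^'n)"
        show "norm ((bump R (snd p))\<^sup>2 * (?U p)\<^sup>2) \<le> norm (indicat_real (Z R) p * (U0 p)\<^sup>2)"
        proof (cases "norm (snd p) \<le> R")
          case True
          then show ?thesis unfolding U_Z[OF True] norm_mult
            using mult_right_mono[OF bump_square_le[of R "snd p"], of "\<bar>indicat_real (Z R) p\<bar> * \<bar>(U0 p)\<^sup>2\<bar>"] by simp
        qed (use bump_eq_0[OF R, of "snd p"] in simp)
      qed
      have "C * ((exp (-4/3))\<^sup>2 * E (R / 2)) \<le> C * (\<integral>p. (bump R (snd p))\<^sup>2 * (?U p)\<^sup>2 \<partial>lborel)"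
      proof (rule mult_left_mono)
        have "(exp (-4/3))\<^sup>2 * E (R / 2) = (\<integral>p. (exp (-4/3))\<^sup>2 * (indicat_real (Z (R / 2)) p * (U0 p)\<^sup>2) \<partial>lborel)"
          by (simp add: E_def)
        also have "\<dots> \<le> (\<integral>p. (bump R (snd p))\<^sup>2 * (?U p)\<^sup>2 \<partial>lborel)"
        proof (rule integral_mono[OF integrable_mult_right[OF Ei] i1])
          fix p :: "real \<times> (real^'n)"
          show "(exp (-4/3))\<^sup>2 * (indicat_real (Z (R / 2)) p * (U0 p)\<^sup>2) \<le> (bump R (snd p))\<^sup>2 * (?U p)\<^sup>2"
          proof (cases "p \<in> Z (R / 2)")
            case True
            then have n: "norm (snd p) \<le> R / 2" by (auto simp: Z_def)
            then have "norm (snd p) \<le> R" "p \<in> Z R" using R True by (auto simp: Z_def)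
            then have "(?U p)\<^sup>2 = (U0 p)\<^sup>2" using U_Z[of p] by simp
            moreover have "(exp (-4/3))\<^sup>2 \<le> (bump R (snd p))\<^sup>2"
              by (rule power_mono[OF bump_ge[OF R n]]) simp
            ultimately show ?thesis using True by (simp add: mult_right_mono)
          qed simp
        qed
        finally show "(exp (-4/3))\<^sup>2 * E (R / 2) \<le> (\<integral>p. (bump R (snd p))\<^sup>2 * (?U p)\<^sup>2 \<partial>lborel)" .
      qed (use C(1) in simp)
      also note en
      also have "K\<^sup>2 / \<nu> * (\<integral>p. (?U p)\<^sup>2 * (norm (grad (bump R) (snd p)))\<^sup>2 \<partial>lborel) \<le> K\<^sup>2 / \<nu> * ((C1 / R)\<^sup>2 * E R)"
      proof (rule mult_left_mono)
        have "(\<integral>p. (?U p)\<^sup>2 * (norm (grad (bump R) (snd p)))\<^sup>2 \<partial>lborel) \<le> (\<integral>p. (C1 / R)\<^sup>2 * (indicat_real (Z R) p * (U0 p)\<^sup>2) \<partial>lborel)"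
        proof (rule integral_mono')
          show "integrable lborel (\<lambda>p. (C1 / R)\<^sup>2 * (indicat_real (Z R) p * (U0 p)\<^sup>2))"
            by (rule integrable_mult_right[OF Ei])
          fix p :: "real \<times> (real^'n)"
          show "(?U p)\<^sup>2 * (norm (grad (bump R) (snd p)))\<^sup>2 \<le> (C1 / R)\<^sup>2 * (indicat_real (Z R) p * (U0 p)\<^sup>2)"
          proof (cases "norm (snd p) \<le> R")
            case True
            have "(norm (grad (bump R) (snd p)))\<^sup>2 \<le> (C1 / R)\<^sup>2"
              by (rule power_mono[OF C1(2)[OF R]]) simp
            then show ?thesis unfolding U_Z[OF True] by (subst mult.commute) (intro mult_right_mono, auto)
          qed (use gz[of "snd p"] in simp)
        qed simp
        then show "(\<integral>p. (?U p)\<^sup>2 * (norm (grad (bump R) (snd p)))\<^sup>2 \<partial>lborel) \<le> (C1 / R)\<^sup>2 * E R"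
          by (simp add: E_def)
      qed (use assms(4) in simp)
      finally have "C * ((exp (-4/3))\<^sup>2 * E (R / 2)) \<le> K\<^sup>2 / \<nu> * ((C1 / R)\<^sup>2 * E R)" .
      then have "E (R / 2) \<le> K\<^sup>2 / \<nu> * ((C1 / R)\<^sup>2 * E R) / (C * (exp (-4/3))\<^sup>2)"
        by (subst pos_le_divide_eq) (use C(1) in \<open>auto simp: mult_ac\<close>)
      also have "\<dots> = c / R\<^sup>2 * E R" by (simp add: c_def power_divide mult_ac)
      finally show ?thesis .
    qed
    have "E R = 0"
    proof (rule scaling_decay[where E = E and N = "DIM(real^'n)"])
      show "0 \<le> M\<^sup>2 * T * V1" using T unit_ball_vol_pos[of "real DIM(real^'n)"] by (simp add: V1_def)
    qed (use E_mono E_nonneg growth step c R in auto)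
    then have "AE p in lborel. indicat_real (Z R) p * (U0 p)\<^sup>2 = 0"
      unfolding E_def using integral_nonneg_eq_0_iff_AE[OF Ei] by (simp add: AE_I2)
    then show ?thesis by eventually_elim (auto simp: Z_def indicator_def)
  qed
  \<comment> \<open>Countably many cylinders exhaust the half-space, so the union of their
    exceptional sets is still a null set.\<close>
  have "AE p in lborel. \<forall>n. p \<in> {0<..<real (Suc n)} \<times> cball 0 (real (Suc n)) \<longrightarrow> U0 p = 0"
    unfolding AE_all_countable using zero by simp
  then have "AE p in lborel. fst p > 0 \<longrightarrow> (case p of (t, x) \<Rightarrow> u t x = 0)"
    using uU0
  proof eventually_elim
    case (elim p)
    obtain n where n: "max (fst p) (norm (snd p)) < real n" using reals_Archimedean2 by blast
    then have "fst p > 0 \<Longrightarrow> p \<in> {0<..<real (Suc n)} \<times> cball 0 (real (Suc n))"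
      by (auto simp: mem_Times_iff)
    then show ?case using elim by (auto simp: case_prod_beta')
  qed
  then show ?thesis unfolding AE_H .
qed

end
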